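(* Let $(X,\chi)$ be an $n$-dimensional compact Hermitian manifold, let $f: X\to\mathbf{R}$ be a smooth function, let $F:(0,\infty)\to\mathbf{R}$ be a strictly increasing smooth function with $F'>0$ on $(0,\infty)$, and let $u_0: X\to\mathbf{R}$ be a smooth function satisfying $\chi+i\partial\bar\partial u_0>0$. There exists a constant $C>0$ depending only on $X,\chi,f,F,u_0$ such that the following holds. Suppose $0<T\le\infty$ and $u$ is a smooth solution of $$\partial_t u=F(e^{-f}\det h),\qquad h^j{}_\ell=\delta^j{}_\ell+\chi^{j\bar k}u_{\bar k\ell},$$ on $X\times[0,T]$ with $u(0)=u_0$. Then $$\operatorname{Tr} h\le C e^{C(\varphi-\inf\varphi)}\quad\text{on } X\times[0,T],$$ where $\varphi=u-\frac1V\int_X u\,\chi^n$ and $\inf\varphi=\inf_{X\times[0,T]}\varphi$.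
   Context: The Hermitian metric is identified with its positive real $(1,1)$-form; in local holomorphic coordinates $\chi=i\chi_{\bar kj}\,dz^j\wedge d\bar z^k$, and $\chi^{j\bar k}$ denotes the inverse matrix, $\chi^{j\bar k}\chi_{\bar k\ell}=\delta^j{}_\ell$. The metric $\chi$ is not assumed Kähler. Subscripts on $u$ denote partial derivatives, $u_{\bar kj}=\partial_j\partial_{\bar k}u$, so $i\partial\bar\partial u=i u_{\bar kj}\,dz^j\wedge d\bar z^k$. Repeated indices are summed. $h$ is regarded as an endomorphism of $T^{1,0}X$, with determinant $\det h$ and trace $\operatorname{Tr} h=n+\chi^{j\bar k}u_{\bar kj}$. $V=\int_X\chi^n$. For $T=\infty$ the interval $[0,T]$ is understood as $[0,\infty)$. *)

theory Defs
  imports "HOL-Analysis.Analysis"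
begin

section \<open>Smooth functions\<close>

text \<open>
  For open \<open>S\<close>, \<open>Ck_on k f S\<close> says that all partial derivatives of \<open>f\<close> of order at most \<open>k\<close>
  exist and are continuous on \<open>S\<close>.
\<close>

primrec Ck_on ::
  "nat \<Rightarrow> ('a::euclidean_space \<Rightarrow> 'b::real_normed_vector) \<Rightarrow> 'a set \<Rightarrow> bool" where
  "Ck_on 0 f S \<longleftrightarrow> continuous_on S f"
| "Ck_on (Suc k) f S \<longleftrightarrow>
     (\<forall>x\<in>S. f differentiable (at x)) \<and>
     (\<forall>v. Ck_on k (\<lambda>x. frechet_derivative f (at x) v) S)"

text \<open>
  Smoothness on an arbitrary set means local extendability to a smooth function on an open
  set. For open sets this is ordinary smoothness; for sets such as \<open>[0,T] \<times> U\<close> it is smoothness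
  up to the boundary.
\<close>

definition smooth_on ::
  "('a::euclidean_space \<Rightarrow> 'b::real_normed_vector) \<Rightarrow> 'a set \<Rightarrow> bool" where
  "smooth_on f S \<longleftrightarrow>
     (\<forall>x\<in>S. \<exists>U g. open U \<and> x \<in> U \<and> (\<forall>k. Ck_on k g U) \<and> (\<forall>y\<in>S \<inter> U. g y = f y))"


section \<open>Wirtinger derivatives\<close>

definition wirtinger :: "'n::finite \<Rightarrow> (complex^'n \<Rightarrow> complex) \<Rightarrow> complex^'n \<Rightarrow> complex" where
  "wirtinger j g x =
     (frechet_derivative g (at x) (axis j 1) - \<i> * frechet_derivative g (at x) (axis j \<i>)) / 2"

definition wirtinger_bar :: "'n::finite \<Rightarrow> (complex^'n \<Rightarrow> complex) \<Rightarrow> complex^'n \<Rightarrow> complex" where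
  "wirtinger_bar k g x =
     (frechet_derivative g (at x) (axis k 1) + \<i> * frechet_derivative g (at x) (axis k \<i>)) / 2"


section \<open>Complex manifolds\<close>

text \<open>A chart is a pair of its domain and its coordinate map.\<close>

type_synonym ('a, 'n) chart = "'a set \<times> ('a \<Rightarrow> complex^'n)"

definition chart_inv :: "('a, 'n::finite) chart \<Rightarrow> complex^'n \<Rightarrow> 'a" where
  "chart_inv c = inv_into (fst c) (snd c)"

definition chart_image :: "('a, 'n::finite) chart \<Rightarrow> (complex^'n) set" where
  "chart_image c = snd c ` fst c"

definition holomorphic_map_on ::
  "(complex^'n::finite \<Rightarrow> complex^'m::finite) \<Rightarrow> (complex^'n) set \<Rightarrow> bool" where
  "holomorphic_map_on g S \<longleftrightarrow>
     (\<forall>x\<in>S. \<exists>D. (g has_derivative D) (at x) \<and> (\<forall>a v. D (a *s v) = a *s D v))"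

definition complex_atlas ::
  "('a::{t2_space,second_countable_topology}, 'n::finite) chart set \<Rightarrow> bool" where
  "complex_atlas A \<longleftrightarrow>
     (\<Union>c\<in>A. fst c) = UNIV \<and>
     (\<forall>c\<in>A. open (fst c) \<and> open (chart_image c) \<and>
        homeomorphism (fst c) (chart_image c) (snd c) (chart_inv c)) \<and>
     (\<forall>c\<in>A. \<forall>d\<in>A. holomorphic_map_on (snd d \<circ> chart_inv c) (snd c ` (fst c \<inter> fst d)))"

definition smooth_fun :: "('a, 'n::finite) chart set \<Rightarrow> ('a \<Rightarrow> real) \<Rightarrow> bool" where
  "smooth_fun A f \<longleftrightarrow> (\<forall>c\<in>A. smooth_on (f \<circ> chart_inv c) (chart_image c))"

definition smooth_fun_time ::
  "('a, 'n::finite) chart set \<Rightarrow> real set \<Rightarrow> (real \<Rightarrow> 'a \<Rightarrow> real) \<Rightarrow> bool" where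
  "smooth_fun_time A I u \<longleftrightarrow>
     (\<forall>c\<in>A. smooth_on (\<lambda>(t, x). u t (chart_inv c x)) (I \<times> chart_image c))"


section \<open>Hermitian metrics\<close>

text \<open>
  Matrices of (1,1)-forms carry the barred index first: \<open>M $ k $ j\<close> is the coefficient
  of \<open>i dz\<^sup>j \<and> d(cnj z\<^sup>k)\<close>.
\<close>

definition hermitian_posdef :: "complex^'n::finite^'n \<Rightarrow> bool" where
  "hermitian_posdef M \<longleftrightarrow>
     (\<forall>j k. M $ k $ j = cnj (M $ j $ k)) \<and>
     (\<forall>v. v \<noteq> 0 \<longrightarrow> Re (\<Sum>j\<in>UNIV. \<Sum>k\<in>UNIV. M $ k $ j * v $ j * cnj (v $ k)) > 0)"

text \<open>
  A metric is written \<open>\<omega>\<close> and given by its coefficient matrices in the charts of the atlas,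
  related by the transformation law of (1,1)-forms. The values \<open>\<omega> c p\<close> with \<open>p\<close> outside the
  domain of \<open>c\<close> are irrelevant.
\<close>

definition hermitian_metric ::
  "('a, 'n::finite) chart set \<Rightarrow> (('a, 'n) chart \<Rightarrow> 'a \<Rightarrow> complex^'n^'n) \<Rightarrow> bool" where
  "hermitian_metric A \<omega> \<longleftrightarrow>
     (\<forall>c\<in>A. smooth_on (\<omega> c \<circ> chart_inv c) (chart_image c) \<and>
        (\<forall>p\<in>fst c. hermitian_posdef (\<omega> c p))) \<and>
     (\<forall>c\<in>A. \<forall>d\<in>A. \<forall>p\<in>fst c \<inter> fst d. \<forall>j k.
        \<omega> c p $ k $ j =
          (\<Sum>a\<in>UNIV. \<Sum>b\<in>UNIV.
             \<omega> d p $ b $ a *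
             wirtinger j (\<lambda>x. snd d (chart_inv c x) $ a) (snd c p) *
             cnj (wirtinger k (\<lambda>x. snd d (chart_inv c x) $ b) (snd c p))))"

definition ddbar :: "('a, 'n::finite) chart \<Rightarrow> ('a \<Rightarrow> real) \<Rightarrow> 'a \<Rightarrow> complex^'n^'n" where
  "ddbar c u p =
     (\<chi> k j. wirtinger j (wirtinger_bar k (\<lambda>x. complex_of_real (u (chart_inv c x)))) (snd c p))"

text \<open>
  The rows of \<open>matrix_inv (\<omega> c p)\<close> are indexed by \<open>j\<close> and its columns by the barred \<open>k\<close>, so that
  \<open>endo \<omega> c u p $ j $ l\<close> is \<open>h\<^sup>j\<^sub>l\<close>. Its determinant and trace are real and do not depend
  on the chart.
\<close>

definition endo ::
  "(('a, 'n::finite) chart \<Rightarrow> 'a \<Rightarrow> complex^'n^'n) \<Rightarrow> ('a, 'n) chart \<Rightarrow> ('a \<Rightarrow> real) \<Rightarrow>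
   'a \<Rightarrow> complex^'n^'n" where
  "endo \<omega> c u p = mat 1 + matrix_inv (\<omega> c p) ** ddbar c u p"

text \<open>
  \<open>\<mu>\<close> is the Borel measure of integration against \<open>\<omega>\<^sup>n\<close>. In local coordinates
  \<open>\<omega>\<^sup>n = n! det \<omega> \<cdot> (i dz\<^sup>1 \<and> d(cnj z\<^sup>1)) \<and> \<dots> \<and> (i dz\<^sup>n \<and> d(cnj z\<^sup>n))\<close>, and
  \<open>i dz \<and> d(cnj z) = 2 dx \<and> dy\<close>. These conditions determine \<open>\<mu>\<close> uniquely, since countably
  many chart domains cover the manifold.
\<close>

definition volume_measure ::
  "('a::{t2_space,second_countable_topology}, 'n::finite) chart set \<Rightarrow>
   (('a, 'n) chart \<Rightarrow> 'a \<Rightarrow> complex^'n^'n) \<Rightarrow> 'a measure \<Rightarrow> bool" where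
  "volume_measure A \<omega> \<mu> \<longleftrightarrow>
     sets \<mu> = sets borel \<and>
     (\<forall>c\<in>A. \<forall>B\<in>sets borel. B \<subseteq> fst c \<longrightarrow>
        emeasure \<mu> B =
          (\<integral>\<^sup>+x\<in>snd c ` B.
             ennreal (fact CARD('n) * 2 ^ CARD('n) * Re (det (\<omega> c (chart_inv c x)))) \<partial>lborel))"


section \<open>The flow\<close>

text \<open>The interval \<open>[0,T]\<close>, which is \<open>[0,\<infinity>)\<close> for \<open>T = \<infinity>\<close>.\<close>

definition time_interval :: "ereal \<Rightarrow> real set" where
  "time_interval T = {t. 0 \<le> t \<and> ereal t \<le> T}"

text \<open>
  As \<open>F\<close> is only given on \<open>(0,\<infinity>)\<close>, being a solution includes positivity of \<open>det h\<close>. Time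
  derivatives at the end points of the interval are one-sided.
\<close>

definition flow_solution ::
  "('a, 'n::finite) chart set \<Rightarrow> (('a, 'n) chart \<Rightarrow> 'a \<Rightarrow> complex^'n^'n) \<Rightarrow> ('a \<Rightarrow> real) \<Rightarrow>
   (real \<Rightarrow> real) \<Rightarrow> ('a \<Rightarrow> real) \<Rightarrow> ereal \<Rightarrow> (real \<Rightarrow> 'a \<Rightarrow> real) \<Rightarrow> bool" where
  "flow_solution A \<omega> f F u0 T u \<longleftrightarrow>
     smooth_fun_time A (time_interval T) u \<and>
     u 0 = u0 \<and>
     (\<forall>t\<in>time_interval T. \<forall>c\<in>A. \<forall>p\<in>fst c.
        Re (det (endo \<omega> c (u t) p)) > 0 \<and>
        ((\<lambda>s. u s p) has_real_derivative F (exp (- f p) * Re (det (endo \<omega> c (u t) p))))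
          (at t within time_interval T))"

definition normalized :: "'a measure \<Rightarrow> (real \<Rightarrow> 'a \<Rightarrow> real) \<Rightarrow> real \<Rightarrow> 'a \<Rightarrow> real" where
  "normalized \<mu> u t p = u t p - (1 / measure \<mu> UNIV) * (\<integral>q. u t q \<partial>\<mu>)"

text \<open>
  The infimum of the normalized solution may be \<open>-\<infinity>\<close> when \<open>T = \<infinity>\<close>, hence an infimum in
  \<^typ>\<open>ereal\<close> and an exponential with \<open>exp \<infinity> = \<infinity>\<close>.
\<close>

fun ereal_exp :: "ereal \<Rightarrow> ereal" where
  "ereal_exp (ereal r) = ereal (exp r)"
| "ereal_exp PInfty = \<infinity>"
| "ereal_exp MInfty = 0"

end

theory Submission
  imports Defs "HOL-Complex_Analysis.Cauchy_Integral_Formula"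
begin

text \<open>
  The maximum principle, applied to \<open>\<partial>\<^sub>t u\<close>, keeps \<open>e\<^sup>-\<^sup>f det h\<close> between two positive constants for
  all time. Hence \<open>w = \<partial>\<^sub>t u\<close> is bounded and \<open>\<Phi> = F \<circ> exp\<close> is only used on a fixed compact interval,
  where \<open>\<Phi>' \<ge> m\<^sub>1 > 0\<close>. Consider, with \<open>y = \<phi> - inf \<phi>\<close>, the test function
  \<open>ln (Tr h) + B w\<^sup>2 - A y + 1 / (y + 1)\<close>.
  Differentiating the equation twice gives \<open>\<partial>\<^sub>t Tr h\<close> in terms of the Laplacian of \<open>Tr h\<close> with respect to
  \<open>g = \<chi> + i\<partial>\<partial>-bar u\<close>, plus a term \<open>\<Phi>''\<bar>\<partial>w\<bar>\<^sup>2\<close>, which is not signed because \<open>F\<close> is not assumed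
  concave; the good gradient term produced by \<open>B w\<^sup>2\<close> absorbs it. The torsion of the non-Kaehler metric
  \<open>\<chi>\<close> enters through a vector \<open>E\<close> in \<open>\<bar>\<partial> Tr h - E\<bar>\<^sup>2\<close>, and its cross term with \<open>\<partial> Tr h\<close> is absorbed
  by the convexity of \<open>1 / (y + 1)\<close>. At an interior maximum therefore either \<open>(Tr h)\<^sup>2 \<le> C (y + 1)\<^sup>3\<close>,
  which is harmless against \<open>A y\<close>, or the trace of \<open>\<chi>\<close> with respect to \<open>g\<close> is bounded, and then so is
  \<open>Tr h\<close> because \<open>det h\<close> is.
\<close>

section \<open>Calculus of smooth functions\<close>

text \<open>Frames are frozen: at the maximum point constant vectors \<open>e\<close> and
  \<open>f\<close> are chosen, orthonormal at that one point, so neither a connection nor normal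
  coordinates appear. The price is paid in first derivatives of the background metric and of its
  inverse, collected in \<open>Y\<close>, \<open>T\<close> and \<open>E\<close>. The good terms have
  to be shared out. The squared gradient of \<open>w\<close> comes with the factor
  \<open>2 * B\<close>; one \<open>B\<close> pays for the second derivative of \<Phi>, the other for
  the part of the torsion cross term that contains the gradient of \<open>w\<close>. The part with
  the gradient of \<open>u\<close> is charged to the convexity of \<open>1 / (y + 1)\<close>, and
  everything quadratic in \<open>f\<close> to the trace of \<chi> with respect to \<open>g\<close>,
  which the Laplacian of \<open>- A y\<close> supplies with factor \<open>A\<close>. Time is a
  second obstacle. The mean of \<open>u\<close> is controlled only as a Lipschitz function, so at
  the maximum it is replaced by a linear comparison function; and since time intervals are closed,
  derivatives at their ends are carried by local smooth extensions. Finally, a solution provides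
  only det h > 0; positivity of \<open>g\<close> follows from the initial one because the time
  interval is connected.\<close>

definition Cinf :: "'a::euclidean_space set \<Rightarrow> ('a \<Rightarrow> 'b::real_normed_vector) \<Rightarrow> bool" where
  "Cinf S f \<longleftrightarrow> (\<forall>k. Ck_on k f S)"

lemma Ck_on_cong:
  assumes "open S" "\<And>x. x \<in> S \<Longrightarrow> f x = g x" "Ck_on k f S"
  shows "Ck_on k g S"
  using assms
proof (induction k arbitrary: f g)
  case 0
  then show ?case using continuous_on_cong by fastforce
next
  case (Suc k)
  have d: "g differentiable (at x)" if "x \<in> S" for x
    using Suc.prems that
    by (metis Ck_on.simps(2) differentiable_def has_derivative_transform_within_open)
  have e: "frechet_derivative f (at x) = frechet_derivative g (at x)" if "x \<in> S" for x
    using Suc.prems that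
    by (intro frechet_derivative_transform_within_open[of _ _ S]) auto
  show ?case
    using d Suc.IH[OF Suc.prems(1), of "\<lambda>x. frechet_derivative f (at x) v" for v] e Suc.prems(3)
    by auto
qed

lemma Ck_on_subset: "Ck_on k f S \<Longrightarrow> T \<subseteq> S \<Longrightarrow> Ck_on k f T"
  by (induction k arbitrary: f) (auto intro: continuous_on_subset)

lemma Ck_on_Suc_imp: "Ck_on (Suc k) f S \<Longrightarrow> Ck_on k f S"
proof (induction k arbitrary: f)
  case 0
  then show ?case
    by (auto intro!: continuous_at_imp_continuous_on differentiable_imp_continuous_within)
next
  case (Suc k)
  then show ?case by (metis Ck_on.simps(2))
qed

text \<open>Derivatives are local, so the neighbourhood may vary with the point. This turns the
  pointwise extensions in \<open>smooth_on\<close> into one statement \<open>Cinf\<close> on an open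
  set.\<close>

lemma Ck_on_local:
  assumes "\<And>x. x \<in> S \<Longrightarrow> \<exists>U. open U \<and> x \<in> U \<and> Ck_on k f U"
  shows "Ck_on k f S"
  using assms
proof (induction k arbitrary: f)
  case 0
  show ?case
    unfolding Ck_on.simps
  proof (rule continuous_at_imp_continuous_on, rule ballI)
    fix x assume "x \<in> S"
    then obtain U where "open U" "x \<in> U" "continuous_on U f" using 0 by auto
    then show "isCont f x" by (simp add: continuous_on_eq_continuous_at)
  qed
next
  case (Suc k)
  have "f differentiable at x" if "x \<in> S" for x using Suc.prems[OF that] by auto
  moreover have "Ck_on k (\<lambda>x. frechet_derivative f (at x) v) S" for v
    by (rule Suc.IH) (use Suc.prems in fastforce)
  ultimately show ?case by simp
qed

lemma Cinf_smooth_on: "smooth_on f S \<Longrightarrow> open S \<Longrightarrow> Cinf S f"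
  unfolding Cinf_def
proof (intro allI Ck_on_local)
  fix k x assume *: "smooth_on f S" "open S" "x \<in> S"
  then obtain U g where U: "open U" "x \<in> U" "Ck_on k g U" "\<forall>y\<in>S \<inter> U. g y = f y"
    unfolding smooth_on_def by blast
  have "Ck_on k f (S \<inter> U)"
    by (rule Ck_on_cong[of _ g]) (use U * in \<open>auto intro: Ck_on_subset\<close>)
  then show "\<exists>U. open U \<and> x \<in> U \<and> Ck_on k f U" using * U by blast
qed

lemma Cinf_cong: "open S \<Longrightarrow> (\<And>x. x \<in> S \<Longrightarrow> f x = g x) \<Longrightarrow> Cinf S f \<Longrightarrow> Cinf S g"
  unfolding Cinf_def using Ck_on_cong by blast

lemma Cinf_subset: "Cinf S f \<Longrightarrow> T \<subseteq> S \<Longrightarrow> Cinf T f"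
  unfolding Cinf_def using Ck_on_subset by blast

lemma Cinf_differentiable: "Cinf S f \<Longrightarrow> x \<in> S \<Longrightarrow> f differentiable (at x)"
  unfolding Cinf_def by (metis Ck_on.simps(2))

lemma Cinf_has_derivative:
  "Cinf S f \<Longrightarrow> x \<in> S \<Longrightarrow> (f has_derivative frechet_derivative f (at x)) (at x)"
  using Cinf_differentiable frechet_derivative_works by blast

lemma Cinf_continuous_on: "Cinf S f \<Longrightarrow> continuous_on S f"
  unfolding Cinf_def by (metis Ck_on.simps(1))

lemma Cinf_frechet: "Cinf S f \<Longrightarrow> Cinf S (\<lambda>x. frechet_derivative f (at x) v)"
  unfolding Cinf_def by (metis Ck_on.simps(2))

lemma Ck_on_SucI:
  assumes "open S" "\<And>x. x \<in> S \<Longrightarrow> (f has_derivative f' x) (at x)"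
    "\<And>v. Ck_on k (\<lambda>x. f' x v) S"
  shows "Ck_on (Suc k) f S"
proof -
  have eq: "f' x v = frechet_derivative f (at x) v" if "x \<in> S" for x v
    using frechet_derivative_at[OF assms(2)[OF that]] by metis
  have "Ck_on k (\<lambda>x. frechet_derivative f (at x) v) S" for v
    by (rule Ck_on_cong[OF assms(1) eq assms(3)])
  then show ?thesis using assms(2) by (auto simp: differentiable_def)
qed

lemma Ck_on_const: "Ck_on k (\<lambda>x. c) S"
  by (induction k arbitrary: c) auto

lemma Ck_on_add:
  assumes "open S" "Ck_on k f S" "Ck_on k g S"
  shows "Ck_on k (\<lambda>x. f x + g x) S"
  using assms
proof (induction k arbitrary: f g)
  case 0
  then show ?case by (simp add: continuous_on_add)
next
  case (Suc k)
  show ?case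
  proof (rule Ck_on_SucI[OF Suc.prems(1)])
    show "((\<lambda>x. f x + g x) has_derivative
        (\<lambda>v. frechet_derivative f (at x) v + frechet_derivative g (at x) v)) (at x)" if "x \<in> S" for x
      using Suc.prems that by (intro has_derivative_add) (simp_all add: frechet_derivative_works)
    show "Ck_on k (\<lambda>x. frechet_derivative f (at x) v + frechet_derivative g (at x) v) S" for v
      using Suc.prems by (intro Suc.IH) simp_all
  qed
qed

lemma (in bounded_bilinear) Ck_on_bilinear:
  assumes "open S" "Ck_on k f S" "Ck_on k g S"
  shows "Ck_on k (\<lambda>x. prod (f x) (g x)) S"
  using assms
proof (induction k arbitrary: f g)
  case 0
  then show ?case by (simp add: continuous_on)
next
  case (Suc k)
  show ?case
  proof (rule Ck_on_SucI[OF Suc.prems(1)])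
    show "((\<lambda>x. prod (f x) (g x)) has_derivative
        (\<lambda>v. prod (f x) (frechet_derivative g (at x) v) + prod (frechet_derivative f (at x) v) (g x))) (at x)"
      if "x \<in> S" for x
      using Suc.prems that by (intro FDERIV) (simp_all add: frechet_derivative_works)
    have "Ck_on k f S" "Ck_on k g S" using Suc.prems Ck_on_Suc_imp by blast+
    then show "Ck_on k (\<lambda>x. prod (f x) (frechet_derivative g (at x) v) + prod (frechet_derivative f (at x) v) (g x)) S" for v
      using Suc.prems by (intro Ck_on_add Suc.IH) simp_all
  qed
qed

lemma (in bounded_linear) Ck_on_linear:
  assumes "open S" "Ck_on k g S"
  shows "Ck_on k (\<lambda>x. f (g x)) S"
  using assms
proof (induction k arbitrary: g)
  case 0
  then show ?case by (simp add: continuous_on)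
next
  case (Suc k)
  show ?case
  proof (rule Ck_on_SucI[OF Suc.prems(1)])
    show "((\<lambda>x. f (g x)) has_derivative (\<lambda>v. f (frechet_derivative g (at x) v))) (at x)"
      if "x \<in> S" for x
      using Suc.prems that by (intro has_derivative) (simp_all add: frechet_derivative_works)
    show "Ck_on k (\<lambda>x. f (frechet_derivative g (at x) v)) S" for v
      using Suc.prems by (intro Suc.IH) simp_all
  qed
qed

text \<open>The outer function has one real variable, so the derivative is the product of the
  derivative of \<open>r\<close> with \<phi>' after \<open>r\<close>, and the induction closes under
  the bilinear rule. This form suffices for \<open>inverse\<close> and \<open>ln\<close> of positive
  real functions; \<open>Ck_on_affine\<close> covers restriction to slices.\<close>

lemma Ck_on_compose_real:
  fixes r :: "'a::euclidean_space \<Rightarrow> real" and \<phi> :: "real \<Rightarrow> real"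
  assumes "open S" "Ck_on k r S" "Ck_on k \<phi> T" "r ` S \<subseteq> T"
  shows "Ck_on k (\<lambda>x. \<phi> (r x)) S"
  using assms
proof (induction k arbitrary: \<phi>)
  case 0
  then show ?case by (simp add: continuous_on_compose2)
next
  case (Suc k)
  have d\<phi>: "(\<phi> has_derivative frechet_derivative \<phi> (at (r x))) (at (r x))" if "x \<in> S" for x
    using Suc.prems(3,4) that by (auto simp: frechet_derivative_works)
  show ?case
  proof (rule Ck_on_SucI[OF Suc.prems(1)])
    show "((\<lambda>x. \<phi> (r x)) has_derivative
      (\<lambda>v. frechet_derivative r (at x) v * frechet_derivative \<phi> (at (r x)) 1)) (at x)"
      if "x \<in> S" for x
    proof -
      have "(\<phi> has_derivative (\<lambda>v. v * frechet_derivative \<phi> (at (r x)) 1)) (at (r x))"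
      proof -
        define k where "k = frechet_derivative \<phi> (at (r x)) 1"
        have "frechet_derivative \<phi> (at (r x)) = (\<lambda>v. v * k)"
          using linear_cmul[OF has_derivative_linear[OF d\<phi>[OF that]], of _ 1]
          unfolding k_def[symmetric] by auto
        then show ?thesis using d\<phi>[OF that] by (simp add: k_def)
      qed
      moreover have "(r has_derivative frechet_derivative r (at x)) (at x)"
        using Suc.prems(2) that by (simp add: frechet_derivative_works)
      ultimately show ?thesis using has_derivative_compose by blast
    qed
    have r: "Ck_on k r S" using Suc.prems(2) by (rule Ck_on_Suc_imp)
    show "Ck_on k (\<lambda>x. frechet_derivative r (at x) v * frechet_derivative \<phi> (at (r x)) 1) S" for v
    proof (rule bounded_bilinear.Ck_on_bilinear[OF bounded_bilinear_mult Suc.prems(1)])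
      show "Ck_on k (\<lambda>x. frechet_derivative r (at x) v) S" using Suc.prems(2) by simp
      have "Ck_on k (\<lambda>y. frechet_derivative \<phi> (at y) 1) T" using Suc.prems(3) by simp
      then show "Ck_on k (\<lambda>x. frechet_derivative \<phi> (at (r x)) 1) S"
        by (rule Suc.IH[OF Suc.prems(1) r _ Suc.prems(4)])
    qed
  qed
qed

lemma Ck_on_affine:
  fixes L :: "'a::euclidean_space \<Rightarrow> 'c::euclidean_space"
  assumes "open S" "Ck_on k h T" "bounded_linear L" "(\<lambda>x. p + L x) ` S \<subseteq> T"
  shows "Ck_on k (\<lambda>x. h (p + L x)) S"
  using assms
proof (induction k arbitrary: h)
  case 0
  have "continuous_on S (\<lambda>x. p + L x)"
    using 0 by (intro continuous_on_add continuous_on_const linear_continuous_on)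
  then show ?case using 0 continuous_on_compose2[of T h S "\<lambda>x. p + L x"] by simp
next
  case (Suc k)
  show ?case
  proof (rule Ck_on_SucI[OF Suc.prems(1)])
    show "((\<lambda>x. h (p + L x)) has_derivative
        (\<lambda>v. frechet_derivative h (at (p + L x)) (L v))) (at x)" if "x \<in> S" for x
    proof -
      have "((\<lambda>x. p + L x) has_derivative L) (at x)"
        using has_derivative_add[OF has_derivative_const bounded_linear_imp_has_derivative[OF Suc.prems(3)]]
        by simp
      moreover have "(h has_derivative frechet_derivative h (at (p + L x))) (at (p + L x))"
        using Suc.prems that by (auto simp: frechet_derivative_works)
      ultimately show ?thesis using has_derivative_compose by blast
    qed
    show "Ck_on k (\<lambda>x. frechet_derivative h (at (p + L x)) (L v)) S" for v
      using Suc.prems by (intro Suc.IH[of "\<lambda>y. frechet_derivative h (at y) (L v)"]) simp_all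
  qed
qed

lemma Cinf_const: "Cinf S (\<lambda>x. c)"
  by (simp add: Cinf_def Ck_on_const)

lemma Cinf_add: "open S \<Longrightarrow> Cinf S f \<Longrightarrow> Cinf S g \<Longrightarrow> Cinf S (\<lambda>x. f x + g x)"
  by (simp add: Cinf_def Ck_on_add)

lemma Cinf_mult:
  fixes f g :: "'a::euclidean_space \<Rightarrow> 'b::real_normed_algebra"
  shows "open S \<Longrightarrow> Cinf S f \<Longrightarrow> Cinf S g \<Longrightarrow> Cinf S (\<lambda>x. f x * g x)"
  by (simp add: Cinf_def bounded_bilinear.Ck_on_bilinear[OF bounded_bilinear_mult])

lemma Cinf_linear: "bounded_linear L \<Longrightarrow> open S \<Longrightarrow> Cinf S f \<Longrightarrow> Cinf S (\<lambda>x. L (f x))"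
  by (simp add: Cinf_def bounded_linear.Ck_on_linear)

lemmas Cinf_of_real = Cinf_linear[OF bounded_linear_of_real]
  and Cinf_Re = Cinf_linear[OF bounded_linear_Re]
  and Cinf_cnj = Cinf_linear[OF bounded_linear_cnj]
  and Cinf_nth = Cinf_linear[OF bounded_linear_vec_nth]
  and Cinf_minus = Cinf_linear[OF bounded_linear_minus[OF bounded_linear_ident]]

lemma Cinf_diff: "open S \<Longrightarrow> Cinf S f \<Longrightarrow> Cinf S g \<Longrightarrow> Cinf S (\<lambda>x. f x - g x)"
  using Cinf_add[of S f "\<lambda>x. - g x"] Cinf_minus[of S g] by simp

lemma Cinf_sum: "open S \<Longrightarrow> (\<And>i. i \<in> I \<Longrightarrow> Cinf S (f i)) \<Longrightarrow> Cinf S (\<lambda>x. \<Sum>i\<in>I. f i x)"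
  by (induction I rule: infinite_finite_induct) (auto intro: Cinf_const Cinf_add)

lemma Cinf_prod:
  fixes f :: "'i \<Rightarrow> 'a::euclidean_space \<Rightarrow> 'b::{comm_monoid_mult,real_normed_algebra}"
  shows "open S \<Longrightarrow> (\<And>i. i \<in> I \<Longrightarrow> Cinf S (f i)) \<Longrightarrow> Cinf S (\<lambda>x. \<Prod>i\<in>I. f i x)"
  by (induction I rule: infinite_finite_induct) (auto intro: Cinf_const Cinf_mult)

lemma Cinf_compose_real:
  fixes r :: "'a::euclidean_space \<Rightarrow> real" and \<phi> :: "real \<Rightarrow> real"
  assumes "Cinf T \<phi>" "open S" "Cinf S r" "r ` S \<subseteq> T"
  shows "Cinf S (\<lambda>x. \<phi> (r x))"
  using assms Ck_on_compose_real unfolding Cinf_def by blast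

lemma Cinf_affine:
  fixes L :: "'a::euclidean_space \<Rightarrow> 'c::euclidean_space"
  assumes "open S" "Cinf T h" "bounded_linear L" "(\<lambda>x. p + L x) ` S \<subseteq> T"
  shows "Cinf S (\<lambda>x. h (p + L x))"
  using assms Ck_on_affine unfolding Cinf_def by blast

text \<open>The derivative of the reciprocal is minus a product of two reciprocals, so each order
  follows from the previous one by the product rule. \<open>Cinf_ln\<close> then needs a single
  differentiation.\<close>

lemma Cinf_inverse: "Cinf {0<..} (inverse :: real \<Rightarrow> real)"
proof -
  have "Ck_on k (inverse :: real \<Rightarrow> real) {0<..}" for k
  proof (induction k)
    case 0 then show ?case by (auto intro!: continuous_intros)
  next
    case (Suc k)
    show ?case
    proof (rule Ck_on_SucI)
      show "(inverse has_derivative (\<lambda>v. (inverse x * inverse x) * (- v))) (at x)"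
        if "x \<in> {0<..}" for x :: real
        using that has_derivative_inverse'[of x UNIV] by (simp add: algebra_simps)
      show "Ck_on k (\<lambda>x::real. (inverse x * inverse x) * (- v)) {0<..}" for v
        using Suc by (intro bounded_bilinear.Ck_on_bilinear[OF bounded_bilinear_mult] Ck_on_const) simp_all
    qed simp
  qed
  then show ?thesis by (simp add: Cinf_def)
qed

lemma Cinf_ln: "Cinf {0<..} (ln :: real \<Rightarrow> real)"
  unfolding Cinf_def
proof (intro allI)
  fix k show "Ck_on k (ln :: real \<Rightarrow> real) {0<..}"
  proof (cases k)
    case 0 then show ?thesis by (auto intro!: continuous_intros)
  next
    case (Suc m)
    have "Ck_on (Suc m) (ln :: real \<Rightarrow> real) {0<..}"
    proof (rule Ck_on_SucI)
      show "(ln has_derivative (\<lambda>v. inverse x * v)) (at x)" if "x \<in> {0<..}" for x :: real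
        using that DERIV_ln[of x] by (simp add: has_field_derivative_def)
      show "Ck_on m (\<lambda>x::real. inverse x * v) {0<..}" for v
        using Cinf_inverse unfolding Cinf_def
        by (intro bounded_bilinear.Ck_on_bilinear[OF bounded_bilinear_mult] Ck_on_const) simp_all
    qed simp
    then show ?thesis using Suc by simp
  qed
qed

section \<open>Symmetry of second derivatives\<close>

lemma real_second_difference_mvt:
  fixes h :: "'a::euclidean_space \<Rightarrow> real"
  assumes "Cinf (ball x r) h" "s > 0" "s * (norm a + norm b) < r"
  obtains \<xi> \<eta> where "0 < \<xi>" "\<xi> < s" "0 < \<eta>" "\<eta> < s"
    "h (x + s *\<^sub>R a + s *\<^sub>R b) - h (x + s *\<^sub>R a) - h (x + s *\<^sub>R b) + h x
      = s * s * frechet_derivative (\<lambda>y. frechet_derivative h (at y) a) (at (x + \<xi> *\<^sub>R a + \<eta> *\<^sub>R b)) b"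
proof -
  have B: "x + p *\<^sub>R a + q *\<^sub>R b \<in> ball x r" if "0 \<le> p" "p \<le> s" "0 \<le> q" "q \<le> s" for p q
  proof -
    have "norm (p *\<^sub>R a + q *\<^sub>R b) \<le> p * norm a + q * norm b"
      using that norm_triangle_ineq[of "p *\<^sub>R a" "q *\<^sub>R b"] by simp
    also have "\<dots> \<le> s * norm a + s * norm b"
      using that by (intro add_mono mult_right_mono) auto
    also have "\<dots> < r" using assms by (simp add: distrib_left)
    finally have "norm (p *\<^sub>R a + q *\<^sub>R b) < r" .
    moreover have "dist x (x + p *\<^sub>R a + q *\<^sub>R b) = norm (p *\<^sub>R a + q *\<^sub>R b)"
      by (simp add: dist_norm add.assoc norm_minus_cancel[of "p *\<^sub>R a + q *\<^sub>R b", symmetric] del: norm_minus_cancel)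
    ultimately show ?thesis by simp
  qed
  have der: "((\<lambda>p. h' (y + p *\<^sub>R c)) has_real_derivative frechet_derivative h' (at (y + p *\<^sub>R c)) c) (at p)"
    if "y + p *\<^sub>R c \<in> ball x r" "Cinf (ball x r) h'" for h' :: "'a \<Rightarrow> real" and y c p
  proof -
    have lin: "linear (frechet_derivative h' (at (y + p *\<^sub>R c)))"
      using linear_frechet_derivative Cinf_differentiable that by blast
    have "((\<lambda>p. h' (y + p *\<^sub>R c)) has_derivative (\<lambda>t. frechet_derivative h' (at (y + p *\<^sub>R c)) (t *\<^sub>R c))) (at p)"
      using Cinf_has_derivative[OF that(2,1)]
      by (intro has_derivative_compose[of "\<lambda>p. y + p *\<^sub>R c" _ _ _ h']) (auto intro!: derivative_eq_intros)
    moreover have "(\<lambda>t. frechet_derivative h' (at (y + p *\<^sub>R c)) (t *\<^sub>R c))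
        = (\<lambda>t. frechet_derivative h' (at (y + p *\<^sub>R c)) c * t)"
      by (rule ext) (metis linear_cmul[OF lin] mult.commute real_scaleR_def)
    ultimately show ?thesis unfolding has_field_derivative_def by metis
  qed
  define k where "k p = h (x + s *\<^sub>R b + p *\<^sub>R a) - h (x + p *\<^sub>R a)" for p
  have "(k has_real_derivative frechet_derivative h (at (x + s *\<^sub>R b + p *\<^sub>R a)) a
      - frechet_derivative h (at (x + p *\<^sub>R a)) a) (at p)" if "0 \<le> p" "p \<le> s" for p
    unfolding k_def using that assms B[of p s] B[of p 0]
    by (intro DERIV_diff der) (auto simp: add_ac)
  from MVT2[OF assms(2) this] obtain \<xi> where \<xi>: "0 < \<xi>" "\<xi> < s"
    "k s - k 0 = (s - 0) * (frechet_derivative h (at (x + s *\<^sub>R b + \<xi> *\<^sub>R a)) a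
      - frechet_derivative h (at (x + \<xi> *\<^sub>R a)) a)" by auto
  define l where "l q = frechet_derivative h (at (x + \<xi> *\<^sub>R a + q *\<^sub>R b)) a" for q
  have "(l has_real_derivative frechet_derivative (\<lambda>y. frechet_derivative h (at y) a) (at (x + \<xi> *\<^sub>R a + q *\<^sub>R b)) b) (at q)"
    if "0 \<le> q" "q \<le> s" for q
    unfolding l_def using that assms B[of \<xi> q] \<xi> by (intro der Cinf_frechet) auto
  from MVT2[OF assms(2) this] obtain \<eta> where \<eta>: "0 < \<eta>" "\<eta> < s"
    "l s - l 0 = (s - 0) * frechet_derivative (\<lambda>y. frechet_derivative h (at y) a) (at (x + \<xi> *\<^sub>R a + \<eta> *\<^sub>R b)) b"
    by auto
  show ?thesis
    by (rule that[OF \<xi>(1,2) \<eta>(1,2)]) (use \<xi>(3) \<eta>(3) in \<open>simp add: k_def l_def add_ac\<close>)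
qed

text \<open>The second difference is symmetric in \<open>a\<close> and \<open>b\<close>, so both
  mixed derivatives take one common value at points close to \<open>x\<close>. If they differed at
  \<open>x\<close>, continuity would keep their nearby values apart.\<close>

lemma frechet_derivative_commute_real:
  fixes h :: "'a::euclidean_space \<Rightarrow> real"
  assumes "open S" "Cinf S h" "x \<in> S"
  shows "frechet_derivative (\<lambda>y. frechet_derivative h (at y) a) (at x) b
       = frechet_derivative (\<lambda>y. frechet_derivative h (at y) b) (at x) a"
    (is "?P x = ?Q x")
proof (rule ccontr)
  assume ne: "?P x \<noteq> ?Q x"
  obtain r where r: "r > 0" "ball x r \<subseteq> S" using assms openE by blast
  have Ch: "Cinf (ball x r) h" using assms r Cinf_subset by blast
  have cont: "isCont ?P x" "isCont ?Q x"
    using Cinf_continuous_on[OF Cinf_frechet[OF Cinf_frechet[OF assms(2)]]] assms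
    by (auto simp: continuous_on_eq_continuous_at)
  define e where "e = \<bar>?P x - ?Q x\<bar> / 2"
  have e: "e > 0" using ne by (simp add: e_def)
  obtain d where d: "d > 0" "\<And>y. dist y x < d \<Longrightarrow> \<bar>?P y - ?P x\<bar> < e" "\<And>y. dist y x < d \<Longrightarrow> \<bar>?Q y - ?Q x\<bar> < e"
  proof -
    obtain d1 where "d1 > 0" "\<And>y. dist y x < d1 \<Longrightarrow> \<bar>?P y - ?P x\<bar> < e"
      using cont(1) e unfolding continuous_at_eps_delta dist_real_def by blast
    moreover obtain d2 where "d2 > 0" "\<And>y. dist y x < d2 \<Longrightarrow> \<bar>?Q y - ?Q x\<bar> < e"
      using cont(2) e unfolding continuous_at_eps_delta dist_real_def by blast
    ultimately show ?thesis using that[of "min d1 d2"] by auto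
  qed
  define m where "m = min r d"
  define N where "N = norm a + norm b + 1"
  \<comment> \<open>Small enough for the parallelogram with sides \<open>s\<close> times
    \<open>a\<close> and \<open>b\<close> to stay in the ball of smoothness and where both mixed
    derivatives vary by less than \<open>e\<close>. The summand 1 in \<open>N\<close> keeps the
    denominator positive.\<close>
  define s where "s = m / (2 * N)"
  have N: "N > 0" by (simp add: N_def add_nonneg_pos)
  have m: "m > 0" using r d by (simp add: m_def)
  have s: "s > 0" using N m by (simp add: s_def)
  have sN: "s * N < m" using N m by (simp add: s_def)
  then have sm: "s * (norm a + norm b) < m" "s * (norm b + norm a) < m"
    using s by (auto simp: N_def distrib_left)
  have near: "dist (x + p *\<^sub>R a + q *\<^sub>R b) x < d" if "0 < p" "p < s" "0 < q" "q < s" for p q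
  proof -
    have "norm (p *\<^sub>R a + q *\<^sub>R b) \<le> p * norm a + q * norm b"
      using that norm_triangle_ineq[of "p *\<^sub>R a" "q *\<^sub>R b"] by simp
    also have "\<dots> \<le> s * norm a + s * norm b"
      using that by (intro add_mono mult_right_mono) auto
    also have "\<dots> < d" using sm by (simp add: distrib_left m_def)
    finally show ?thesis by (simp add: dist_norm add.assoc)
  qed
  have "s * (norm a + norm b) < r" "s * (norm b + norm a) < r" using sm by (auto simp: m_def)
  then obtain \<xi> \<eta> \<xi>' \<eta>' where
    1: "0 < \<xi>" "\<xi> < s" "0 < \<eta>" "\<eta> < s"
      "h (x + s *\<^sub>R a + s *\<^sub>R b) - h (x + s *\<^sub>R a) - h (x + s *\<^sub>R b) + h x = s * s * ?P (x + \<xi> *\<^sub>R a + \<eta> *\<^sub>R b)" and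
    2: "0 < \<xi>'" "\<xi>' < s" "0 < \<eta>'" "\<eta>' < s"
      "h (x + s *\<^sub>R b + s *\<^sub>R a) - h (x + s *\<^sub>R b) - h (x + s *\<^sub>R a) + h x = s * s * ?Q (x + \<xi>' *\<^sub>R b + \<eta>' *\<^sub>R a)"
    using real_second_difference_mvt[OF Ch s, of a b] real_second_difference_mvt[OF Ch s, of b a] by metis
  have "s * s * ?P (x + \<xi> *\<^sub>R a + \<eta> *\<^sub>R b) = s * s * ?Q (x + \<xi>' *\<^sub>R b + \<eta>' *\<^sub>R a)"
  proof -
    have xx: "x + s *\<^sub>R b + s *\<^sub>R a = x + s *\<^sub>R a + s *\<^sub>R b" by simp
    then show ?thesis using 1(5) 2(5)[unfolded xx] by linarith
  qed
  then have eq: "?P (x + \<xi> *\<^sub>R a + \<eta> *\<^sub>R b) = ?Q (x + \<xi>' *\<^sub>R b + \<eta>' *\<^sub>R a)" using s by simp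
  have "\<bar>?P (x + \<xi> *\<^sub>R a + \<eta> *\<^sub>R b) - ?P x\<bar> < e" using d(2) near 1 by blast
  moreover have "\<bar>?Q (x + \<xi>' *\<^sub>R b + \<eta>' *\<^sub>R a) - ?Q x\<bar> < e"
    using d(3) near[OF 2(3,4,1,2)] by (simp add: add_ac)
  moreover have False if "\<bar>A - P\<bar> < \<bar>P - Q\<bar> / 2" "\<bar>A - Q\<bar> < \<bar>P - Q\<bar> / 2" for A P Q :: real
    using that by (smt (verit) field_sum_of_halves)
  ultimately show False unfolding eq e_def by blast
qed

lemma frechet_derivative_linear:
  assumes "bounded_linear L" "f differentiable (at x)"
  shows "frechet_derivative (\<lambda>y. L (f y)) (at x) v = L (frechet_derivative f (at x) v)"
  using frechet_derivative_at[OF bounded_linear.has_derivative[OF assms(1) assms(2)[unfolded frechet_derivative_works]]]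
  by metis

lemma frechet_derivative_commute:
  fixes h :: "'a::euclidean_space \<Rightarrow> complex"
  assumes "open S" "Cinf S h" "x \<in> S"
  shows "frechet_derivative (\<lambda>y. frechet_derivative h (at y) a) (at x) b
       = frechet_derivative (\<lambda>y. frechet_derivative h (at y) b) (at x) a"
proof -
  have *: "frechet_derivative (\<lambda>y. frechet_derivative (\<lambda>z. L (h z)) (at y) a) (at x) b
       = L (frechet_derivative (\<lambda>y. frechet_derivative h (at y) a) (at x) b)"
    if "bounded_linear L" for L :: "complex \<Rightarrow> real" and a b
  proof -
    have "frechet_derivative (\<lambda>y. L (frechet_derivative h (at y) a)) (at x)
        = frechet_derivative (\<lambda>y. frechet_derivative (\<lambda>z. L (h z)) (at y) a) (at x)"
      using assms that
      by (intro frechet_derivative_transform_within_open[of _ _ S])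
        (auto intro!: Cinf_differentiable[OF Cinf_linear[OF that]] Cinf_frechet
          simp: frechet_derivative_linear Cinf_differentiable)
    then show ?thesis
      using frechet_derivative_linear[OF that Cinf_differentiable[OF Cinf_frechet[OF assms(2)] assms(3)]]
      by metis
  qed
  have "L (frechet_derivative (\<lambda>y. frechet_derivative h (at y) a) (at x) b)
      = L (frechet_derivative (\<lambda>y. frechet_derivative h (at y) b) (at x) a)"
    if "bounded_linear L" for L :: "complex \<Rightarrow> real"
    using frechet_derivative_commute_real[OF assms(1) Cinf_linear[OF that assms(1,2)] assms(3), of a b]
    by (simp add: *[OF that])
  from this[OF bounded_linear_Re] this[OF bounded_linear_Im] show ?thesis
    by (rule complex_eqI)
qed

section \<open>Complexified directional derivatives\<close>

text \<open>The derivative along the complex tangent vector \<open>a + \<i> b\<close>.\<close>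

definition cder :: "'a::euclidean_space \<Rightarrow> 'a \<Rightarrow> ('a \<Rightarrow> complex) \<Rightarrow> 'a \<Rightarrow> complex" where
  "cder a b h x = frechet_derivative h (at x) a + \<i> * frechet_derivative h (at x) b"

lemma Cinf_cder: "open S \<Longrightarrow> Cinf S h \<Longrightarrow> Cinf S (cder a b h)"
  unfolding cder_def by (intro Cinf_add Cinf_mult Cinf_frechet Cinf_const)

lemma cder_cong:
  assumes "open S" "x \<in> S" "\<And>y. y \<in> S \<Longrightarrow> h y = k y" "h differentiable (at x)"
  shows "cder a b h x = cder a b k x"
  using frechet_derivative_transform_within_open[OF assms(4,1,2,3)] by (simp add: cder_def)

lemma cder_const: "cder a b (\<lambda>x. c) x = 0"
  by (simp add: cder_def)

lemma cder_add:
  assumes "h differentiable (at x)" "k differentiable (at x)"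
  shows "cder a b (\<lambda>y. h y + k y) x = cder a b h x + cder a b k x"
proof -
  have "frechet_derivative (\<lambda>y. h y + k y) (at x)
     = (\<lambda>v. frechet_derivative h (at x) v + frechet_derivative k (at x) v)"
    by (rule frechet_derivative_at[symmetric])
      (intro has_derivative_add assms[unfolded frechet_derivative_works])
  then show ?thesis by (simp add: cder_def algebra_simps)
qed

lemma cder_mult:
  assumes "h differentiable (at x)" "k differentiable (at x)"
  shows "cder a b (\<lambda>y. h y * k y) x = h x * cder a b k x + cder a b h x * k x"
proof -
  have "frechet_derivative (\<lambda>y. h y * k y) (at x)
     = (\<lambda>v. h x * frechet_derivative k (at x) v + frechet_derivative h (at x) v * k x)"
    by (rule frechet_derivative_at[symmetric])
      (intro has_derivative_mult assms[unfolded frechet_derivative_works])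
  then show ?thesis by (simp add: cder_def algebra_simps)
qed

lemma cder_cmult: "h differentiable (at x) \<Longrightarrow> cder a b (\<lambda>y. c * h y) x = c * cder a b h x"
  by (subst cder_mult) (auto simp: cder_const)

lemma cder_minus: "h differentiable (at x) \<Longrightarrow> cder a b (\<lambda>y. - h y) x = - cder a b h x"
  using cder_cmult[of h x a b "-1"] by simp

lemma cder_diff:
  assumes "h differentiable (at x)" "k differentiable (at x)"
  shows "cder a b (\<lambda>y. h y - k y) x = cder a b h x - cder a b k x"
  using cder_add[of h x "\<lambda>y. - k y" a b] assms by (simp add: cder_minus)

lemma cder_sum:
  assumes "\<And>i. i \<in> I \<Longrightarrow> h i differentiable (at x)"
  shows "cder a b (\<lambda>y. \<Sum>i\<in>I. h i y) x = (\<Sum>i\<in>I. cder a b (h i) x)"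
  using assms
proof (induction I rule: infinite_finite_induct)
  case (insert i I)
  then have "(\<lambda>y. \<Sum>i\<in>I. h i y) differentiable (at x)" by (intro differentiable_sum) auto
  then show ?case using insert by (simp add: cder_add)
qed (simp_all add: cder_const)

lemma cder_cnj:
  assumes "h differentiable (at x)"
  shows "cder a b (\<lambda>y. cnj (h y)) x = cnj (cder a (- b) h x)"
proof -
  have "linear (frechet_derivative h (at x))" using assms by (rule linear_frechet_derivative)
  then show ?thesis
    by (simp add: cder_def frechet_derivative_linear[OF bounded_linear_cnj assms] linear_neg)
qed

lemma cder_compose_real:
  fixes r :: "'a::euclidean_space \<Rightarrow> real" and \<phi> :: "real \<Rightarrow> real"
  assumes "r differentiable (at x)" "(\<phi> has_real_derivative d) (at (r x))"
  shows "cder a b (\<lambda>y. of_real (\<phi> (r y))) x = of_real d * cder a b (\<lambda>y. of_real (r y)) x"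
proof -
  have r: "(r has_derivative frechet_derivative r (at x)) (at x)"
    using assms(1) by (simp add: frechet_derivative_works)
  have "frechet_derivative (\<lambda>y. complex_of_real (r y)) (at x)
      = (\<lambda>v. of_real (frechet_derivative r (at x) v))"
    using has_derivative_of_real[OF r] by (rule frechet_derivative_at[symmetric])
  moreover have "((\<lambda>y. \<phi> (r y)) has_derivative (\<lambda>v. d * frechet_derivative r (at x) v)) (at x)"
    using has_derivative_compose[OF r assms(2)[unfolded has_field_derivative_def]] .
  from has_derivative_of_real[OF this]
  have "frechet_derivative (\<lambda>y. complex_of_real (\<phi> (r y))) (at x)
      = (\<lambda>v. of_real (d * frechet_derivative r (at x) v))"
    by (rule frechet_derivative_at[symmetric])
  ultimately show ?thesis by (simp add: cder_def algebra_simps)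
qed

lemma cder_commute:
  assumes "open S" "Cinf S h" "x \<in> S"
  shows "cder a b (cder c d h) x = cder c d (cder a b h) x"
proof -
  have *: "cder p q (cder r s h) x
     = frechet_derivative (\<lambda>y. frechet_derivative h (at y) r) (at x) p
     + \<i> * frechet_derivative (\<lambda>y. frechet_derivative h (at y) s) (at x) p
     + \<i> * (frechet_derivative (\<lambda>y. frechet_derivative h (at y) r) (at x) q
     + \<i> * frechet_derivative (\<lambda>y. frechet_derivative h (at y) s) (at x) q)" for p q r s
  proof -
    have d: "(\<lambda>y. frechet_derivative h (at y) r) differentiable at x" for r
      using Cinf_differentiable[OF Cinf_frechet[OF assms(2)] assms(3)] .
    then have d': "(\<lambda>y. \<i> * frechet_derivative h (at y) r) differentiable at x" for r
      by (intro differentiable_mult) auto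
    have "cder p q (cder r s h) x = cder p q (\<lambda>y. frechet_derivative h (at y) r) x
        + \<i> * cder p q (\<lambda>y. frechet_derivative h (at y) s) x"
      unfolding cder_def[of r s, abs_def] by (simp add: cder_add d d' cder_cmult)
    then show ?thesis by (simp add: cder_def algebra_simps)
  qed
  show ?thesis
    unfolding * using frechet_derivative_commute[OF assms] by (simp add: algebra_simps)
qed

section \<open>The operators \<open>\<partial>\<^sub>v\<close> and their conjugates\<close>

text \<open>For differentiable functions this is half of the derivative along \<open>v\<close> minus
  \<open>\<i>\<close> times the one along \<open>\<i> *s v\<close>. It is complex linear in
  \<open>v\<close>, and \<open>dzb\<close> is conjugate linear, so any constant frame can be
  inserted in place of coordinate vectors. Going through \<open>cder\<close> lets both inherit the
  product, chain and commutation rules.\<close>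

definition dz :: "complex^'n::finite \<Rightarrow> (complex^'n \<Rightarrow> complex) \<Rightarrow> complex^'n \<Rightarrow> complex" where
  "dz v = cder ((1/2) *\<^sub>R v) (- ((1/2) *\<^sub>R (\<i> *s v)))"

definition dzb :: "complex^'n::finite \<Rightarrow> (complex^'n \<Rightarrow> complex) \<Rightarrow> complex^'n \<Rightarrow> complex" where
  "dzb v = cder ((1/2) *\<^sub>R v) ((1/2) *\<^sub>R (\<i> *s v))"

lemmas Cinf_dz = Cinf_cder[of _ _ "(1/2) *\<^sub>R v" "- ((1/2) *\<^sub>R (\<i> *s v))" for v, folded dz_def]
lemmas Cinf_dzb = Cinf_cder[of _ _ "(1/2) *\<^sub>R v" "(1/2) *\<^sub>R (\<i> *s v)" for v, folded dzb_def]

lemma dz_eq: "h differentiable (at x) \<Longrightarrow>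
    dz v h x = (frechet_derivative h (at x) v - \<i> * frechet_derivative h (at x) (\<i> *s v)) / 2"
  using linear_frechet_derivative[of h "at x"]
  by (simp add: dz_def cder_def linear_neg linear_scale) (simp add: scaleR_conv_of_real field_simps)

lemma dzb_eq: "h differentiable (at x) \<Longrightarrow>
    dzb v h x = (frechet_derivative h (at x) v + \<i> * frechet_derivative h (at x) (\<i> *s v)) / 2"
  using linear_frechet_derivative[of h "at x"]
  by (simp add: dzb_def cder_def linear_scale) (simp add: scaleR_conv_of_real field_simps)

lemma i_axis: "\<i> *s axis j (1::complex) = axis j \<i>"
  by (simp add: vec_eq_iff axis_def)

lemma wirtinger_eq: "h differentiable (at x) \<Longrightarrow> wirtinger j h x = dz (axis j 1) h x"
  by (simp add: wirtinger_def dz_eq i_axis)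

lemma wirtinger_bar_eq: "h differentiable (at x) \<Longrightarrow> wirtinger_bar j h x = dzb (axis j 1) h x"
  by (simp add: wirtinger_bar_def dzb_eq i_axis)

lemma dz_scale:
  assumes "h differentiable (at x)" shows "dz (c *s v) h x = c * dz v h x"
proof -
  let ?D = "frechet_derivative h (at x)"
  have l: "linear ?D" using assms by (rule linear_frechet_derivative)
  have "c *s v = Re c *\<^sub>R v + Im c *\<^sub>R (\<i> *s v)" "\<i> *s (c *s v) = Re c *\<^sub>R (\<i> *s v) - Im c *\<^sub>R v"
    by (simp_all add: vec_eq_iff complex_eq_iff)
  then have "?D (c *s v) = Re c *\<^sub>R ?D v + Im c *\<^sub>R ?D (\<i> *s v)"
     "?D (\<i> *s (c *s v)) = Re c *\<^sub>R ?D (\<i> *s v) - Im c *\<^sub>R ?D v"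
    using l by (simp_all add: linear_add linear_scale linear_diff)
  then show ?thesis
    unfolding dz_eq[OF assms] by (simp add: complex_eq_iff scaleR_conv_of_real) (simp add: field_simps)
qed

lemma dzb_scale:
  assumes "h differentiable (at x)" shows "dzb (c *s v) h x = cnj c * dzb v h x"
proof -
  let ?D = "frechet_derivative h (at x)"
  have l: "linear ?D" using assms by (rule linear_frechet_derivative)
  have "c *s v = Re c *\<^sub>R v + Im c *\<^sub>R (\<i> *s v)" "\<i> *s (c *s v) = Re c *\<^sub>R (\<i> *s v) - Im c *\<^sub>R v"
    by (simp_all add: vec_eq_iff complex_eq_iff)
  then have "?D (c *s v) = Re c *\<^sub>R ?D v + Im c *\<^sub>R ?D (\<i> *s v)"
     "?D (\<i> *s (c *s v)) = Re c *\<^sub>R ?D (\<i> *s v) - Im c *\<^sub>R ?D v"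
    using l by (simp_all add: linear_add linear_scale linear_diff)
  then show ?thesis
    unfolding dzb_eq[OF assms] by (simp add: complex_eq_iff scaleR_conv_of_real) (simp add: field_simps)
qed

lemma dz_vsum:
  assumes "h differentiable (at x)" shows "dz (\<Sum>i\<in>I. v i) h x = (\<Sum>i\<in>I. dz (v i) h x)"
proof -
  have l: "linear (frechet_derivative h (at x))" using assms by (rule linear_frechet_derivative)
  have "\<i> *s (\<Sum>i\<in>I. v i) = (\<Sum>i\<in>I. \<i> *s v i)"
    by (simp add: vec_eq_iff sum_distrib_left)
  then show ?thesis
    by (simp add: dz_eq assms linear_sum[OF l] sum_divide_distrib[symmetric] sum_subtractf sum_distrib_left)
qed

lemma dzb_vsum:
  assumes "h differentiable (at x)" shows "dzb (\<Sum>i\<in>I. v i) h x = (\<Sum>i\<in>I. dzb (v i) h x)"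
proof -
  have l: "linear (frechet_derivative h (at x))" using assms by (rule linear_frechet_derivative)
  have "\<i> *s (\<Sum>i\<in>I. v i) = (\<Sum>i\<in>I. \<i> *s v i)"
    by (simp add: vec_eq_iff sum_distrib_left)
  then show ?thesis
    by (simp add: dzb_eq assms linear_sum[OF l] sum_divide_distrib[symmetric] sum.distrib sum_distrib_left)
qed

lemma vec_axis_sum: "v = (\<Sum>j\<in>UNIV. v $ j *s axis j (1::complex))"
  by (simp add: vec_eq_iff axis_def if_distrib cong: if_cong)

lemma dz_coords:
  "h differentiable (at x) \<Longrightarrow> dz v h x = (\<Sum>j\<in>UNIV. v $ j * dz (axis j 1) h x)"
  by (subst vec_axis_sum[of v]) (simp add: dz_vsum dz_scale)

lemma dzb_coords:
  "h differentiable (at x) \<Longrightarrow> dzb v h x = (\<Sum>j\<in>UNIV. cnj (v $ j) * dzb (axis j 1) h x)"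
  by (subst vec_axis_sum[of v]) (simp add: dzb_vsum dzb_scale)

lemma dz_cnj: "h differentiable (at x) \<Longrightarrow> dz v (\<lambda>y. cnj (h y)) x = cnj (dzb v h x)"
  by (simp add: dz_def dzb_def cder_cnj)

lemma dzb_cnj: "h differentiable (at x) \<Longrightarrow> dzb v (\<lambda>y. cnj (h y)) x = cnj (dz v h x)"
  by (simp add: dz_def dzb_def cder_cnj)

lemma dzb_real: "(\<lambda>y. complex_of_real (r y)) differentiable (at x) \<Longrightarrow>
    dzb v (\<lambda>y. of_real (r y)) x = cnj (dz v (\<lambda>y. of_real (r y)) x)"
  using dzb_cnj[of "\<lambda>y. of_real (r y)" x v] by simp

lemma dz_dzb_commute:
  "open S \<Longrightarrow> Cinf S h \<Longrightarrow> x \<in> S \<Longrightarrow> dz v (dzb w h) x = dzb w (dz v h) x"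
  unfolding dz_def dzb_def by (rule cder_commute)

lemma dz_dz_commute:
  "open S \<Longrightarrow> Cinf S h \<Longrightarrow> x \<in> S \<Longrightarrow> dz v (dz w h) x = dz w (dz v h) x"
  unfolding dz_def by (rule cder_commute)

lemma dzb_dzb_commute:
  "open S \<Longrightarrow> Cinf S h \<Longrightarrow> x \<in> S \<Longrightarrow> dzb v (dzb w h) x = dzb w (dzb v h) x"
  unfolding dzb_def by (rule cder_commute)

section \<open>Hermitian forms and orthonormal frames\<close>

definition hform :: "complex^'n::finite^'n \<Rightarrow> complex^'n \<Rightarrow> complex^'n \<Rightarrow> complex" where
  "hform M a b = (\<Sum>j\<in>UNIV. \<Sum>k\<in>UNIV. M $ k $ j * a $ j * cnj (b $ k))"

definition hermitian :: "complex^'n::finite^'n \<Rightarrow> bool" where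
  "hermitian M \<longleftrightarrow> (\<forall>j k. M $ k $ j = cnj (M $ j $ k))"

definition orthonormal :: "complex^'n::finite^'n \<Rightarrow> ('n \<Rightarrow> complex^'n) \<Rightarrow> bool" where
  "orthonormal M e \<longleftrightarrow> (\<forall>k l. hform M (e k) (e l) = (if k = l then 1 else 0))"

text \<open>The barred index comes first, as in the matrices of (1,1)-forms. For a frame orthonormal
  for \<open>M\<close> the result is the unit matrix, the point at which derivatives of determinants
  are easy.\<close>

definition gram :: "complex^'n::finite^'n \<Rightarrow> ('n \<Rightarrow> complex^'n) \<Rightarrow> complex^'n^'n" where
  "gram M e = (\<chi> l k. hform M (e k) (e l))"

lemma hermitian_posdef_alt:
  "hermitian_posdef M \<longleftrightarrow> hermitian M \<and> (\<forall>v. v \<noteq> 0 \<longrightarrow> Re (hform M v v) > 0)"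
  unfolding hermitian_posdef_def hermitian_def hform_def ..

lemma hform_add_left: "hform M (a + a') b = hform M a b + hform M a' b"
  by (simp add: hform_def sum.distrib algebra_simps)

lemma hform_add_right: "hform M a (b + b') = hform M a b + hform M a b'"
  by (simp add: hform_def sum.distrib algebra_simps)

lemma hform_scale_left: "hform M (c *s a) b = c * hform M a b"
  by (simp add: hform_def sum_distrib_left algebra_simps)

lemma hform_scale_right: "hform M a (c *s b) = cnj c * hform M a b"
  by (simp add: hform_def sum_distrib_left algebra_simps)

lemma hform_zero: "hform M 0 b = 0" "hform M a 0 = 0"
  by (simp_all add: hform_def)

lemma hform_sum_left: "hform M (\<Sum>i\<in>I. a i) b = (\<Sum>i\<in>I. hform M (a i) b)"
  by (induction I rule: infinite_finite_induct) (auto simp: hform_zero hform_add_left)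

lemma hform_sum_right: "hform M a (\<Sum>i\<in>I. b i) = (\<Sum>i\<in>I. hform M a (b i))"
  by (induction I rule: infinite_finite_induct) (auto simp: hform_zero hform_add_right)

lemma hform_axis: "hform M (axis j 1) (axis k 1) = M $ k $ j"
proof -
  have "hform M (axis j 1) (axis k 1) = (\<Sum>a\<in>UNIV. \<Sum>b\<in>UNIV. if b = k then (if a = j then M $ b $ a else 0) else 0)"
    unfolding hform_def axis_def by (intro sum.cong refl) simp
  then show ?thesis by simp
qed

lemma hform_plus: "hform (M + N) a b = hform M a b + hform N a b"
  by (simp add: hform_def sum.distrib algebra_simps)

lemma hform_swap:
  assumes "hermitian M" shows "hform M b a = cnj (hform M a b)"
proof -
  have "hform M b a = (\<Sum>j\<in>UNIV. \<Sum>k\<in>UNIV. M $ j $ k * b $ k * cnj (a $ j))"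
    unfolding hform_def by (rule sum.swap)
  also have "\<dots> = cnj (hform M a b)"
  proof -
    have "cnj (M $ k $ j) = M $ j $ k" for j k
      using assms unfolding hermitian_def by (metis complex_cnj_cnj)
    then show ?thesis unfolding hform_def by (simp add: mult_ac)
  qed
  finally show ?thesis .
qed

lemma hform_self_real: "hermitian M \<Longrightarrow> hform M v v = of_real (Re (hform M v v))"
  by (metis Reals_cnj_iff of_real_Re hform_swap)

lemma det_cnj: "det (map_matrix cnj A) = cnj (det (A :: complex^'n::finite^'n))"
  by (simp add: det_def)

lemma gram_matrix:
  "gram M e = map_matrix cnj (vec_lambda e) ** M ** transpose (vec_lambda e)"
  by (simp add: vec_eq_iff gram_def hform_def matrix_matrix_mult_def transpose_def
      sum_distrib_left sum_distrib_right mult_ac)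

lemma det_gram:
  "det (gram M e) = of_real ((cmod (det (vec_lambda e)))\<^sup>2) * det M"
  by (simp add: gram_matrix det_mul det_cnj complex_norm_square mult_ac del: of_real_power)

lemma orthonormal_gram: "orthonormal M e \<longleftrightarrow> gram M e = mat 1"
  unfolding orthonormal_def gram_def vec_eq_iff mat_def vec_lambda_beta by (metis (full_types))

text \<open>With the frame vectors as rows of \<open>P\<close>, orthonormality says that the
  conjugate of \<open>P\<close>, times \<open>M\<close>, times the transpose of \<open>P\<close> is
  the unit matrix. For square matrices the last factor may be moved to the front, which exhibits the
  inverse of \<open>M\<close>.\<close>

lemma orthonormal_inverse:
  fixes M :: "complex^'n::finite^'n"
  assumes "orthonormal M e"
  defines "P \<equiv> vec_lambda e"
  shows "transpose P ** map_matrix cnj P ** M = mat 1"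
    "M ** (transpose P ** map_matrix cnj P) = mat 1"
proof -
  have "(map_matrix cnj P ** M) ** transpose P = mat 1"
    using assms by (simp add: orthonormal_gram gram_matrix)
  then have "transpose P ** (map_matrix cnj P ** M) = mat 1"
    using matrix_left_right_inverse by blast
  then show 1: "transpose P ** map_matrix cnj P ** M = mat 1"
    by (simp add: matrix_mul_assoc)
  then show "M ** (transpose P ** map_matrix cnj P) = mat 1"
    using matrix_left_right_inverse by blast
qed

text \<open>\<open>matrix_inv\<close> is defined by choice; uniqueness of two-sided inverses
  identifies the chosen matrix.\<close>

lemma matrix_inv_eq:
  fixes A B :: "complex^'n::finite^'n"
  assumes "A ** B = mat 1" shows "matrix_inv A = B"
proof -
  have "B ** A = mat 1" using assms matrix_left_right_inverse by blast
  then have "A ** matrix_inv A = mat 1 \<and> matrix_inv A ** A = mat 1"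
    unfolding matrix_inv_def
    using someI[of "\<lambda>A'. A ** A' = mat 1 \<and> A' ** A = mat 1" B] assms \<open>B ** A = mat 1\<close> by blast
  then show ?thesis
    by (metis \<open>B ** A = mat 1\<close> matrix_mul_assoc matrix_mul_lid matrix_mul_rid)
qed

lemma orthonormal_matrix_inv:
  assumes "orthonormal M e"
  shows "matrix_inv M = transpose (vec_lambda e) ** map_matrix cnj (vec_lambda e)"
  by (rule matrix_inv_eq[OF orthonormal_inverse(2)[OF assms]])

lemma matrix_inv_frame:
  "orthonormal M e \<Longrightarrow> matrix_inv M $ j $ m = (\<Sum>k\<in>UNIV. e k $ j * cnj (e k $ m))"
  by (simp add: orthonormal_matrix_inv matrix_matrix_mult_def transpose_def)

text \<open>Cyclicity moves the transposed frame matrix to the right end and leaves the trace of the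
  Gram matrix. Both Tr h and Laplacians with respect to the background are computed in frames
  through this formula.\<close>

lemma trace_frame:
  assumes "orthonormal M e"
  shows "trace (matrix_inv M ** G) = (\<Sum>k\<in>UNIV. hform G (e k) (e k))"
proof -
  let ?P = "vec_lambda e"
  have "trace (matrix_inv M ** G) = trace (transpose ?P ** (map_matrix cnj ?P ** G))"
    by (simp add: orthonormal_matrix_inv[OF assms] matrix_mul_assoc)
  also have "\<dots> = trace (gram G e)"
    by (subst trace_mul_sym) (simp add: gram_matrix matrix_mul_assoc)
  finally show ?thesis by (simp add: trace_def gram_def)
qed

lemma orthonormal_expand:
  assumes "orthonormal M e"
  shows "v = (\<Sum>k\<in>UNIV. hform M v (e k) *s e k)"
proof -
  let ?P = "vec_lambda e"
  have 1: "v = transpose ?P *v (map_matrix cnj ?P *v (M *v v))"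
    by (simp add: matrix_vector_mul_assoc matrix_mul_assoc orthonormal_inverse[OF assms])
  have 2: "(map_matrix cnj ?P *v (M *v v)) $ k = hform M v (e k)" for k
    unfolding hform_def
    by (subst sum.swap) (simp add: matrix_vector_mult_def sum_distrib_left mult_ac)
  have "transpose ?P *v y = (\<Sum>k\<in>UNIV. y $ k *s e k)" for y
    by (simp add: vec_eq_iff matrix_vector_mult_def transpose_def mult.commute)
  from trans[OF 1 this] show ?thesis unfolding 2 .
qed

lemma hform_expand:
  assumes "orthonormal M e"
  shows "hform G v w = (\<Sum>k\<in>UNIV. \<Sum>l\<in>UNIV. hform M v (e k) * cnj (hform M w (e l)) * hform G (e k) (e l))"
proof -
  have sub: "hform G v w = hform G a b" if "v = a" "w = b" for a b using that by simp
  have *: "hform G v w = hform G (\<Sum>k\<in>UNIV. hform M v (e k) *s e k) (\<Sum>l\<in>UNIV. hform M w (e l) *s e l)"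
    by (rule sub) (rule orthonormal_expand[OF assms])+
  show ?thesis
    unfolding * hform_sum_left hform_scale_left hform_sum_right hform_scale_right
    by (subst sum.swap) (simp add: sum_distrib_left mult_ac)
qed

lemma hform_parseval:
  assumes "orthonormal M e"
  shows "hform M v w = (\<Sum>k\<in>UNIV. hform M v (e k) * cnj (hform M w (e k)))"
proof -
  have *: "hform M (e k) (e l) = (if k = l then 1 else 0)" for k l
    using assms by (simp add: orthonormal_def)
  show ?thesis
    by (subst hform_expand[OF assms]) (simp add: * if_distrib cong: if_cong)
qed

lemma det_nz_frame:
  fixes M :: "complex^'n::finite^'n"
  assumes "orthonormal M e"
  shows "\<exists>d>0. det M = of_real d"
proof -
  let ?p = "(cmod (det (vec_lambda e)))\<^sup>2"
  have "of_real ?p * det M = 1"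
    using det_gram[of M e] assms by (simp add: orthonormal_gram)
  moreover from this have "?p > 0" by (cases "det (vec_lambda e) = 0") auto
  ultimately show ?thesis
    by (intro exI[of _ "1 / ?p"]) (auto simp: field_simps)
qed

text \<open>Gram-Schmidt with the projection replaced by a dimension count: a nonzero vector
  orthogonal to those already found is a kernel vector of a singular matrix, and it is then
  normalized.\<close>

lemma orthonormal_extend:
  fixes M :: "complex^'n::finite^'n" and S :: "'n set"
  assumes "hermitian_posdef M" "finite S"
  shows "\<exists>e. \<forall>k\<in>S. \<forall>l\<in>S. hform M (e k) (e l) = (if k = l then 1 else 0)"
  using assms(2)
proof (induction S)
  case (insert k S)
  then obtain e where e: "\<And>i j. i \<in> S \<Longrightarrow> j \<in> S \<Longrightarrow> hform M (e i) (e j) = (if i = j then 1 else 0)"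
    by blast
  \<comment> \<open>Row \<open>i\<close> in \<open>S\<close> represents the functional sending
    \<open>w\<close> to \<open>hform M w (e i)\<close>. The row of the new index \<open>k\<close> is
    zero, which makes the matrix singular.\<close>
  define B :: "complex^'n^'n" where
    "B = (\<chi> i j. if i \<in> S then \<Sum>m\<in>UNIV. M $ m $ j * cnj (e i $ m) else 0)"
  have "row k B = 0" using insert.hyps by (simp add: B_def row_def vec_eq_iff)
  then have "det B = 0" by (rule det_zero_row)
  then have "\<not> (\<exists>A. A ** B = mat 1)" using invertible_det_nz invertible_left_inverse by blast
  then obtain w where w: "B *v w = 0" "w \<noteq> 0" unfolding matrix_left_invertible_ker by blast
  have ort: "hform M w (e i) = 0" if "i \<in> S" for i
  proof -
    have "hform M w (e i) = (B *v w) $ i"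
      using that by (simp add: B_def matrix_vector_mult_def hform_def sum_distrib_left sum_distrib_right mult_ac)
    then show ?thesis using w by simp
  qed
  have her: "hermitian M" and q: "Re (hform M w w) > 0"
    using assms(1) w by (auto simp: hermitian_posdef_alt)
  define r where "r = 1 / sqrt (Re (hform M w w))"
  have r2: "r * r * Re (hform M w w) = 1" using q by (simp add: r_def)
  define e' where "e' = e(k := of_real r *s w)"
  have kk: "hform M (e' k) (e' k) = 1"
    using r2 hform_self_real[OF her, of w]
    by (simp add: e'_def hform_scale_left hform_scale_right complex_eq_iff)
  have "hform M (e i) w = 0" if "i \<in> S" for i
    using ort[OF that] hform_swap[OF her, of "e i" w] by simp
  then have "hform M (e' i) (e' j) = (if i = j then 1 else 0)"
    if "i \<in> insert k S" "j \<in> insert k S" for i j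
    using that e ort insert.hyps kk
    by (cases "i = k"; cases "j = k") (auto simp: e'_def hform_scale_left hform_scale_right)
  then show ?case by blast
qed simp

lemma orthonormal_exists:
  fixes M :: "complex^'n::finite^'n"
  assumes "hermitian_posdef M" obtains e where "orthonormal M e"
proof -
  obtain e :: "'n \<Rightarrow> complex^'n" where
    "\<forall>k\<in>UNIV. \<forall>l\<in>UNIV. hform M (e k) (e l) = (if k = l then 1 else 0)"
    using orthonormal_extend[OF assms finite_class.finite_UNIV] by blast
  then have "orthonormal M e" unfolding orthonormal_def by blast
  then show ?thesis by (rule that)
qed

lemma hermitian_posdef_det: "hermitian_posdef M \<Longrightarrow> \<exists>d>0. det M = of_real d"
  using orthonormal_exists det_nz_frame by blast

lemma hermitian_posdef_inv:
  assumes "hermitian_posdef M"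
  shows "matrix_inv M ** M = mat 1" "M ** matrix_inv M = mat 1"
proof -
  obtain e where e: "orthonormal M e" using orthonormal_exists[OF assms] .
  show "matrix_inv M ** M = mat 1" "M ** matrix_inv M = mat 1"
    unfolding orthonormal_matrix_inv[OF e] by (rule orthonormal_inverse[OF e])+
qed

lemma hermitian_inv:
  assumes "hermitian_posdef M" shows "hermitian (matrix_inv M)"
proof -
  obtain e where "orthonormal M e" using orthonormal_exists[OF assms] .
  then show ?thesis by (simp add: hermitian_def matrix_inv_frame mult.commute)
qed

text \<open>A null vector of a semidefinite form is orthogonal to everything, since otherwise a
  small move along some \<open>w\<close> would make the form negative. It then lies in the kernel of
  \<open>M\<close>, against the nonzero determinant. Along the flow this prevents positivity from
  degenerating.\<close>

lemma psd_posdef: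
  fixes M :: "complex^'n::finite^'n"
  assumes her: "hermitian M" and psd: "\<And>v. Re (hform M v v) \<ge> 0" and nz: "det M \<noteq> 0"
  shows "hermitian_posdef M"
  unfolding hermitian_posdef_alt
proof (intro conjI allI impI her)
  fix v :: "complex^'n" assume v: "v \<noteq> 0"
  show "Re (hform M v v) > 0"
  proof (rule ccontr)
    assume "\<not> Re (hform M v v) > 0"
    then have q0: "hform M v v = 0" using psd[of v] hform_self_real[OF her, of v] by (simp add: complex_eq_iff)
    have zero: "hform M v w = 0" for w
    proof (rule ccontr)
      assume a: "hform M v w \<noteq> 0"
      define z where "z = hform M v w"
      \<comment> \<open>Close to the minimizing step along \<open>w\<close>. The summand 1 keeps it
        defined when \<open>w\<close> is null itself; with \<open>q\<close> the form at
        \<open>w\<close>, the new value \<open>|z|^2 (s^2 q - 2 s)\<close> is still negative because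
        \<open>s q \<le> 1\<close>.\<close>
      define s where "s = 1 / (1 + Re (hform M w w))"
      have den: "1 + Re (hform M w w) > 0" using psd[of w] by linarith
      have wz: "hform M w v = cnj z" using hform_swap[OF her, of w v] by (simp add: z_def)
      let ?c = "- (of_real s * z)"
      have "Re (hform M (v + ?c *s w) (v + ?c *s w)) = (cmod z)\<^sup>2 * (s * s * Re (hform M w w) - 2 * s)"
      proof -
        have vz: "hform M v w = z" by (simp add: z_def)
        have ww: "hform M w w = of_real (Re (hform M w w))" by (rule hform_self_real[OF her])
        have "hform M (v + ?c *s w) (v + ?c *s w) = cnj ?c * z + ?c * cnj z + ?c * cnj ?c * of_real (Re (hform M w w))"
          unfolding hform_add_left hform_add_right hform_scale_left hform_scale_right q0 wz vz
          by (subst ww) (simp add: algebra_simps)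
        also have "Re \<dots> = (cmod z)\<^sup>2 * (s * s * Re (hform M w w) - 2 * s)"
          by (simp add: cmod_power2) (simp add: power2_eq_square algebra_simps)
        finally show ?thesis .
      qed
      moreover have "s * Re (hform M w w) \<le> 1" using den by (simp add: s_def field_simps)
      then have "s * (s * Re (hform M w w)) - 2 * s < 0"
      proof -
        have "s > 0" using den by (simp add: s_def)
        then show ?thesis using mult_left_mono[of "s * Re (hform M w w)" 1 s] \<open>s * Re (hform M w w) \<le> 1\<close> by linarith
      qed
      ultimately have "Re (hform M (v + ?c *s w) (v + ?c *s w)) < 0"
        using a by (simp add: z_def mult_pos_neg mult.assoc)
      then show False using psd by (meson not_less)
    qed
    have "(M *v v) $ k = hform M v (axis k 1)" for k
      by (simp add: matrix_vector_mult_def hform_def axis_def if_distrib cong: if_cong)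
    then have "M *v v = 0" using zero by (simp add: vec_eq_iff)
    then show False
      using v nz invertible_det_nz invertible_left_inverse matrix_left_invertible_ker by metis
  qed
qed

text \<open>In a frame orthonormal for \<open>M\<close> the form is the sum of the squared
  coordinates. A perturbation with frame entries at most \<open>1 / (2 * n)\<close> changes it by at
  most half of its value, by Cauchy-Schwarz.\<close>

lemma posdef_near:
  fixes M :: "complex^'n::finite^'n"
  assumes M: "hermitian_posdef M"
  obtains d where "d > 0"
    "\<And>N. hermitian N \<Longrightarrow> (\<And>j k. cmod (N $ j $ k - M $ j $ k) < d) \<Longrightarrow> hermitian_posdef N"
proof -
  obtain e where e: "orthonormal M e" using orthonormal_exists[OF M] .
  define B where "B = (\<Sum>k\<in>UNIV. \<Sum>j\<in>UNIV. cmod (e k $ j)) + 1"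
  have "0 \<le> (\<Sum>k\<in>UNIV. \<Sum>j\<in>UNIV. cmod (e k $ j))" by (intro sum_nonneg) auto
  then have B: "B > 0" by (simp add: B_def)
  have eb: "cmod (e k $ j) \<le> B" for k j
  proof -
    have "cmod (e k $ j) \<le> (\<Sum>j\<in>UNIV. cmod (e k $ j))" by (rule member_le_sum) auto
    also have "\<dots> \<le> (\<Sum>k\<in>UNIV. \<Sum>j\<in>UNIV. cmod (e k $ j))"
      by (rule member_le_sum[of k UNIV "\<lambda>k. \<Sum>j\<in>UNIV. cmod (e k $ j)"]) (auto intro: sum_nonneg)
    finally show ?thesis by (simp add: B_def)
  qed
  define n where "n = real CARD('n)"
  have n: "n \<ge> 1" by (simp add: n_def Suc_leI)
  \<comment> \<open>Passing to the frame costs \<open>n * n\<close> summands and two factors bounded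
    by \<open>B\<close>; what remains is the required \<open>1 / (2 * n)\<close>.\<close>
  define d where "d = 1 / (2 * n * n * n * B * B)"
  have d: "d > 0" using n B by (simp add: d_def)
  show ?thesis
  proof (rule that[OF d])
    fix N :: "complex^'n^'n"
    assume N: "hermitian N" and close: "\<And>j k. cmod (N $ j $ k - M $ j $ k) < d"
    have diff: "cmod (hform (N - M) (e k) (e l)) \<le> 1 / (2 * n)" for k l
    proof -
      have "cmod (hform (N - M) (e k) (e l)) \<le> (\<Sum>i\<in>UNIV. \<Sum>j\<in>UNIV. cmod ((N - M) $ j $ i) * cmod (e k $ i) * cmod (e l $ j))"
        unfolding hform_def by (intro order_trans[OF norm_sum] sum_mono) (simp add: norm_mult)
      also have "\<dots> \<le> (\<Sum>i\<in>(UNIV::'n set). \<Sum>j\<in>(UNIV::'n set). d * B * B)"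
        using close[THEN less_imp_le] d B eb by (intro sum_mono mult_mono) auto
      also have "\<dots> = 1 / (2 * n)" using n B by (simp add: d_def n_def field_simps)
      finally show ?thesis .
    qed
    have "Re (hform N v v) > 0" if "v \<noteq> 0" for v
    proof -
      define a where "a k = cmod (hform M v (e k))" for k
      have hN: "hform N v v = hform M v v + hform (N - M) v v"
        using hform_plus[of M "N - M" v v] by simp
      have qM: "Re (hform M v v) = (\<Sum>k\<in>UNIV. (a k)\<^sup>2)"
        by (subst hform_parseval[OF e]) (simp add: a_def cmod_power2, simp add: power2_eq_square)
      have pos: "Re (hform M v v) > 0" using M that by (simp add: hermitian_posdef_alt)
      have "cmod (hform (N - M) v v) \<le> (\<Sum>k\<in>UNIV. \<Sum>l\<in>UNIV. a k * a l * (1 / (2 * n)))"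
        unfolding hform_expand[OF e, of "N - M" v v] a_def
        by (intro order_trans[OF norm_sum] sum_mono) (simp only: norm_mult complex_mod_cnj, intro mult_left_mono diff, simp)
      also have "\<dots> = (\<Sum>k\<in>UNIV. a k)\<^sup>2 / (2 * n)"
        by (simp add: power2_eq_square sum_product sum_divide_distrib)
      also have "\<dots> \<le> (n * (\<Sum>k\<in>UNIV. (a k)\<^sup>2)) / (2 * n)"
        using n sum_squared_le_sum_of_squares[of a UNIV] by (intro divide_right_mono) (auto simp: n_def mult.commute)
      also have "\<dots> = Re (hform M v v) / 2" unfolding qM using n by (simp add: field_simps)
      finally have "cmod (hform (N - M) v v) \<le> Re (hform M v v) / 2" .
      moreover have "Re (hform N v v) = Re (hform M v v) + Re (hform (N - M) v v)"
        by (simp only: hN plus_complex.simps)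
      ultimately show ?thesis using pos abs_Re_le_cmod[of "hform (N - M) v v"] by linarith
    qed
    then show "hermitian_posdef N" using N by (simp add: hermitian_posdef_alt)
  qed
qed

lemma det_bound:
  fixes M :: "complex^'n::finite^'n"
  assumes "\<And>i j. cmod (M $ i $ j) \<le> m"
  shows "cmod (det M) \<le> fact CARD('n) * m ^ CARD('n)"
proof -
  have "cmod (det M) \<le> (\<Sum>p\<in>{p. p permutes (UNIV::'n set)}. m ^ CARD('n))"
    unfolding det_def
  proof (intro order_trans[OF norm_sum] sum_mono)
    fix p :: "'n \<Rightarrow> 'n"
    have "cmod (\<Prod>i\<in>UNIV. M $ i $ p i) \<le> (\<Prod>i\<in>(UNIV::'n set). m)"
      unfolding prod_norm[symmetric] using assms by (intro prod_mono) auto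
    then show "cmod (of_int (sign p) * (\<Prod>i\<in>UNIV. M $ i $ p i)) \<le> m ^ CARD('n)"
      by (simp add: norm_mult sign_def)
  qed
  then show ?thesis by (simp add: card_permutations)
qed

text \<open>Cramer's rule writes an entry of \<open>B\<close> as \<open>det B\<close> times a
  determinant whose entries are those of \<open>A\<close>, or 0 and 1 in one column;
  \<open>m \<ge> 1\<close> takes care of that column.\<close>

lemma inverse_entry_bound:
  fixes A B :: "complex^'n::finite^'n"
  assumes "A ** B = mat 1" "\<And>i j. cmod (A $ i $ j) \<le> m" "m \<ge> 1"
  shows "cmod (B $ i $ k) \<le> cmod (det B) * (fact CARD('n) * m ^ CARD('n))"
proof -
  have dd: "det A * det B = 1" using assms(1) by (metis det_mul det_I)
  have "A *v (column k B) = axis k 1"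
    using assms(1) by (auto simp: vec_eq_iff matrix_vector_mult_def column_def matrix_matrix_mult_def mat_def axis_def)
  then have "column k B $ i = det (\<chi> a b. if b = i then axis k 1 $ a else A $ a $ b) / det A"
  proof -
    have "det A \<noteq> 0" using dd by auto
    from \<open>A *v (column k B) = axis k 1\<close>[unfolded cramer[OF this]] show ?thesis
      by (metis (no_types, lifting) vec_lambda_beta)
  qed
  moreover have "1 / det A = det B" using dd by (metis mult_zero_left nonzero_eq_divide_eq mult.commute zero_neq_one)
  ultimately have "B $ i $ k = det (\<chi> a b. if b = i then axis k 1 $ a else A $ a $ b) * det B"
    by (simp add: column_def divide_inverse)
  moreover have "cmod (det (\<chi> a b. if b = i then axis k 1 $ a else A $ a $ b)) \<le> fact CARD('n) * m ^ CARD('n)"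
    by (rule det_bound) (use assms in \<open>auto simp: axis_def\<close>)
  ultimately show ?thesis by (simp add: norm_mult mult_left_mono mult.commute)
qed

section \<open>Derivatives of determinants\<close>

definition Cinf_mat :: "'a::euclidean_space set \<Rightarrow> ('a \<Rightarrow> complex^'n::finite^'n) \<Rightarrow> bool" where
  "Cinf_mat S M \<longleftrightarrow> (\<forall>i j. Cinf S (\<lambda>y. M y $ i $ j))"

lemma Cinf_mat_nth: "Cinf_mat S M \<Longrightarrow> Cinf S (\<lambda>y. M y $ i $ j)"
  by (simp add: Cinf_mat_def)

lemma Cinf_hform: "open S \<Longrightarrow> Cinf_mat S M \<Longrightarrow> Cinf S (\<lambda>y. hform (M y) a b)"
  unfolding hform_def by (intro Cinf_sum Cinf_mult Cinf_const Cinf_mat_nth)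

lemma Cinf_mat_gram: "open S \<Longrightarrow> Cinf_mat S M \<Longrightarrow> Cinf_mat S (\<lambda>y. gram (M y) e)"
  unfolding Cinf_mat_def gram_def by (simp add: Cinf_hform Cinf_mat_def)

lemma Cinf_det: "open S \<Longrightarrow> Cinf_mat S M \<Longrightarrow> Cinf S (\<lambda>y. det (M y))"
  unfolding det_def by (intro Cinf_sum Cinf_mult Cinf_const Cinf_prod Cinf_mat_nth)

lemma hermitian_posdef_det_Re:
  assumes "hermitian_posdef M"
  shows "det M = of_real (Re (det M))" "Re (det M) > 0"
  using hermitian_posdef_det[OF assms] by auto

text \<open>The determinant of a positive form is real and positive, so Cramer's rule makes the
  entries of the inverse polynomials in the entries of \<open>A\<close> times the reciprocal of a
  positive real function. Smoothness of the inverse can be read off from this form.\<close>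

lemma matrix_inv_cramer:
  fixes A :: "complex^'n::finite^'n"
  assumes "hermitian_posdef A"
  shows "matrix_inv A $ i $ k = det (\<chi> a b. if b = i then axis k 1 $ a else A $ a $ b) * of_real (inverse (Re (det A)))"
proof -
  have nz: "det A \<noteq> 0" using hermitian_posdef_det_Re(2)[OF assms] by auto
  have "A ** matrix_inv A = mat 1" by (rule hermitian_posdef_inv[OF assms])
  then have "A *v (column k (matrix_inv A)) = axis k 1"
    by (auto simp: vec_eq_iff matrix_vector_mult_def column_def matrix_matrix_mult_def mat_def axis_def)
  from this[unfolded cramer[OF nz]]
  have "column k (matrix_inv A) $ i = det (\<chi> a b. if b = i then axis k 1 $ a else A $ a $ b) / det A"
    by (metis (no_types, lifting) vec_lambda_beta)
  then have "matrix_inv A $ i $ k = det (\<chi> a b. if b = i then axis k 1 $ a else A $ a $ b) / det A"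
    by (simp add: column_def)
  also have "\<dots> = det (\<chi> a b. if b = i then axis k 1 $ a else A $ a $ b) * of_real (inverse (Re (det A)))"
  proof -
    have "x / of_real d = x * complex_of_real (inverse d)" for x and d :: real by (simp add: divide_inverse)
    then have "x / det A = x * complex_of_real (inverse (Re (det A)))" for x
      using hermitian_posdef_det_Re(1)[OF assms] by metis
    then show ?thesis .
  qed
  finally show ?thesis .
qed

lemma Cinf_inverse_Re_det:
  assumes "open S" "Cinf_mat S M" "\<And>y. y \<in> S \<Longrightarrow> hermitian_posdef (M y)"
  shows "Cinf S (\<lambda>y. inverse (Re (det (M y))))"
  using assms hermitian_posdef_det_Re
  by (intro Cinf_compose_real[OF Cinf_inverse] Cinf_Re Cinf_det) auto

lemma Cinf_mat_inv:
  fixes M :: "'a::euclidean_space \<Rightarrow> complex^'n::finite^'n"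
  assumes "open S" "Cinf_mat S M" "\<And>y. y \<in> S \<Longrightarrow> hermitian_posdef (M y)"
  shows "Cinf_mat S (\<lambda>y. matrix_inv (M y))"
  unfolding Cinf_mat_def
proof (intro allI)
  fix i k
  have "Cinf_mat S (\<lambda>y. \<chi> a b. if b = i then axis k 1 $ a else M y $ a $ b)"
    unfolding Cinf_mat_def
  proof (intro allI)
    fix a b
    show "Cinf S (\<lambda>y. (\<chi> a b. if b = i then axis k 1 $ a else M y $ a $ b) $ a $ b)"
      using Cinf_mat_nth[OF assms(2), of a b] by (cases "b = i") (simp_all add: Cinf_const)
  qed
  then have "Cinf S (\<lambda>y. det (\<chi> a b. if b = i then axis k 1 $ a else M y $ a $ b) * of_real (inverse (Re (det (M y)))))"
    using assms by (intro Cinf_mult Cinf_of_real Cinf_inverse_Re_det Cinf_det)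
  then show "Cinf S (\<lambda>y. matrix_inv (M y) $ i $ k)"
    by (rule Cinf_cong[OF assms(1), rotated]) (simp add: matrix_inv_cramer[OF assms(3)])
qed

lemma differentiable_prod:
  fixes h :: "'i \<Rightarrow> 'a::real_normed_vector \<Rightarrow> complex"
  assumes "\<And>i. i \<in> I \<Longrightarrow> h i differentiable (at x)"
  shows "(\<lambda>y. \<Prod>i\<in>I. h i y) differentiable (at x)"
  using assms by (induction I rule: infinite_finite_induct) (auto intro: differentiable_mult)

lemma cder_prod:
  assumes "finite I" "\<And>i. i \<in> I \<Longrightarrow> h i differentiable (at x)"
  shows "cder a b (\<lambda>y. \<Prod>i\<in>I. h i y) x = (\<Sum>i\<in>I. cder a b (h i) x * (\<Prod>j\<in>I - {i}. h j x))"
  using assms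
proof (induction I rule: finite_induct)
  case (insert i I)
  have d: "(\<lambda>y. \<Prod>i\<in>I. h i y) differentiable (at x)"
    using insert by (intro differentiable_prod) auto
  have "(\<Prod>j\<in>insert i I - {k}. h j x) = h i x * (\<Prod>j\<in>I - {k}. h j x)" if "k \<in> I" for k
  proof -
    have "insert i I - {k} = insert i (I - {k})" using that insert by auto
    then show ?thesis using insert by simp
  qed
  moreover have "insert i I - {i} = I" using insert by auto
  ultimately show ?case
    using insert d by (simp add: cder_mult sum_distrib_left mult_ac)
qed (simp add: cder_const)

text \<open>In the Leibniz sum a permutation other than the identity moves at least two indices.
  After one factor is differentiated, an off-diagonal entry of the unit matrix remains and the term
  vanishes.\<close>

lemma cder_det_id:
  fixes M :: "'a::euclidean_space \<Rightarrow> complex^'n::finite^'n"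
  assumes d: "\<And>i j. (\<lambda>y. M y $ i $ j) differentiable (at x)" and id: "M x = mat 1"
  shows "cder a b (\<lambda>y. det (M y)) x = (\<Sum>i\<in>UNIV. cder a b (\<lambda>y. M y $ i $ i) x)"
proof -
  have dp: "(\<lambda>y. \<Prod>i\<in>UNIV. M y $ i $ p i) differentiable (at x)" for p
    by (intro differentiable_prod d)
  have tm: "cder a b (\<lambda>y. \<Prod>i\<in>UNIV. M y $ i $ p i) x
      = (if p = id then (\<Sum>i\<in>UNIV. cder a b (\<lambda>y. M y $ i $ i) x) else 0)"
    if p: "p permutes UNIV" for p
  proof -
    have eq: "cder a b (\<lambda>y. \<Prod>i\<in>UNIV. M y $ i $ p i) x
       = (\<Sum>i\<in>UNIV. cder a b (\<lambda>y. M y $ i $ p i) x * (\<Prod>j\<in>UNIV - {i}. M x $ j $ p j))"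
      by (rule cder_prod) (auto intro: d)
    show ?thesis
    proof (cases "p = id")
      case True then show ?thesis unfolding eq by (simp add: id mat_def)
    next
      case False
      have "\<exists>j\<in>UNIV - {i}. M x $ j $ p j = 0" for i
      proof (rule ccontr)
        assume "\<not> ?thesis"
        then have fx: "p j = j" if "j \<noteq> i" for j using that by (auto simp: id mat_def split: if_splits)
        have "p i = i" using fx p by (metis permutes_def)
        then have "p = id" using fx by (metis eq_id_iff)
        then show False using False by simp
      qed
      then have z: "(\<Prod>j\<in>UNIV - {i}. M x $ j $ p j) = 0" for i by (intro prod_zero) auto
      show ?thesis unfolding eq z using False by simp
    qed
  qed
  have "cder a b (\<lambda>y. det (M y)) x
      = (\<Sum>p\<in>{p. p permutes (UNIV::'n set)}. of_int (sign p) * cder a b (\<lambda>y. \<Prod>i\<in>UNIV. M y $ i $ p i) x)"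
    unfolding det_def using dp by (subst cder_sum) (auto simp: cder_cmult)
  also have "\<dots> = (\<Sum>p\<in>{p. p permutes (UNIV::'n set)}. if p = id then (\<Sum>i\<in>UNIV. cder a b (\<lambda>y. M y $ i $ i) x) else 0)"
    by (intro sum.cong refl) (auto simp: tm)
  also have "\<dots> = (\<Sum>i\<in>UNIV. cder a b (\<lambda>y. M y $ i $ i) x)"
    by (simp add: finite_permutations permutes_id)
  finally show ?thesis .
qed

text \<open>Jacobi's formula, reduced to the unit matrix by multiplying with the constant matrix
  \<open>N\<close>, the inverse at the point.\<close>

lemma cder_det:
  fixes M :: "'a::euclidean_space \<Rightarrow> complex^'n::finite^'n"
  assumes d: "\<And>i j. (\<lambda>y. M y $ i $ j) differentiable (at x)" and inv: "N ** M x = mat 1"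
  shows "cder a b (\<lambda>y. det (M y)) x
     = det (M x) * (\<Sum>i\<in>UNIV. \<Sum>j\<in>UNIV. N $ i $ j * cder a b (\<lambda>y. M y $ j $ i) x)"
proof -
  have "det N * det (M x) = 1" using inv by (metis det_mul det_I)
  then have eq: "det (M y) = det (M x) * det (N ** M y)" for y
    unfolding det_mul by (metis mult.assoc mult.commute mult_1)
  have dN: "(\<lambda>y. (N ** M y) $ i $ j) differentiable (at x)" for i j
    unfolding matrix_matrix_mult_def using d
    by (auto intro!: differentiable_sum differentiable_mult)
  have "(\<lambda>y. det (N ** M y)) differentiable (at x)"
    unfolding det_def
    by (intro differentiable_sum differentiable_mult differentiable_prod dN ballI)
      (auto simp: finite_permutations)
  then have "cder a b (\<lambda>y. det (M y)) x = det (M x) * cder a b (\<lambda>y. det (N ** M y)) x"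
    by (subst eq) (rule cder_cmult)
  also have "cder a b (\<lambda>y. det (N ** M y)) x = (\<Sum>i\<in>UNIV. cder a b (\<lambda>y. (N ** M y) $ i $ i) x)"
    by (rule cder_det_id[OF dN inv])
  also have "\<dots> = (\<Sum>i\<in>UNIV. \<Sum>j\<in>UNIV. N $ i $ j * cder a b (\<lambda>y. M y $ j $ i) x)"
    unfolding matrix_matrix_mult_def using d
    by (simp add: cder_sum cder_cmult differentiable_mult)
  finally show ?thesis .
qed

lemma cder2_compose_real:
  fixes r :: "'a::euclidean_space \<Rightarrow> real"
  assumes "open S" "Cinf S r" "x \<in> S"
    and d1: "\<And>y. y \<in> S \<Longrightarrow> (\<phi> has_real_derivative \<phi>1 (r y)) (at (r y))"
    and d2: "(\<phi>1 has_real_derivative \<phi>2) (at (r x))"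
  shows "cder a b (cder c d (\<lambda>y. of_real (\<phi> (r y)))) x
     = of_real \<phi>2 * cder a b (\<lambda>y. of_real (r y)) x * cder c d (\<lambda>y. of_real (r y)) x
     + of_real (\<phi>1 (r x)) * cder a b (cder c d (\<lambda>y. of_real (r y))) x"
proof -
  let ?k = "\<lambda>y. of_real (\<phi>1 (r y)) * cder c d (\<lambda>y. of_real (r y)) y"
  have rd: "r differentiable (at y)" if "y \<in> S" for y using assms that by (intro Cinf_differentiable)
  have eq: "?k y = cder c d (\<lambda>y. of_real (\<phi> (r y))) y" if "y \<in> S" for y
    by (rule cder_compose_real[symmetric, OF rd[OF that] d1[OF that]])
  have "(\<lambda>y. \<phi>1 (r y)) differentiable (at x)"
    using has_derivative_compose[of r _ x UNIV \<phi>1 "\<lambda>v. \<phi>2 * v"] d2 rd[OF assms(3)]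
    by (auto simp: differentiable_def has_field_derivative_def)
  then have diff1: "(\<lambda>y. complex_of_real (\<phi>1 (r y))) differentiable (at x)"
    unfolding differentiable_def using has_derivative_of_real by blast
  have diff2: "cder c d (\<lambda>y. complex_of_real (r y)) differentiable (at x)"
    using assms by (intro Cinf_differentiable[of S] Cinf_cder Cinf_of_real)
  have "cder a b (cder c d (\<lambda>y. of_real (\<phi> (r y)))) x = cder a b ?k x"
    by (rule cder_cong[symmetric, OF assms(1,3) eq]) (auto intro: differentiable_mult diff1 diff2)
  also have "\<dots> = of_real \<phi>2 * cder a b (\<lambda>y. of_real (r y)) x * cder c d (\<lambda>y. of_real (r y)) x
     + of_real (\<phi>1 (r x)) * cder a b (cder c d (\<lambda>y. of_real (r y))) x"
    by (simp add: cder_mult diff1 diff2 cder_compose_real[OF rd[OF assms(3)] d2])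
  finally show ?thesis .
qed

text \<open>Jacobi's formula holds in a neighbourhood, with the varying inverse of \<open>M\<close>,
  and is differentiated once more. At the unit matrix the derivative of the inverse is minus that of
  \<open>M\<close>, whence the negative quadratic term.\<close>

lemma cder2_det_id:
  fixes M :: "'a::euclidean_space \<Rightarrow> complex^'n::finite^'n"
  assumes S: "open S" "x \<in> S" and M: "Cinf_mat S M" and pd: "\<And>y. y \<in> S \<Longrightarrow> hermitian_posdef (M y)"
    and id: "M x = mat 1"
  shows "cder a b (cder c d (\<lambda>y. det (M y))) x
     = (\<Sum>i\<in>UNIV. cder a b (\<lambda>y. M y $ i $ i) x) * (\<Sum>i\<in>UNIV. cder c d (\<lambda>y. M y $ i $ i) x)
     - (\<Sum>i\<in>UNIV. \<Sum>j\<in>UNIV. cder a b (\<lambda>y. M y $ i $ j) x * cder c d (\<lambda>y. M y $ j $ i) x)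
     + (\<Sum>i\<in>UNIV. cder a b (cder c d (\<lambda>y. M y $ i $ i)) x)"
proof -
  let ?N = "\<lambda>y. matrix_inv (M y)"
  have N: "Cinf_mat S ?N" by (rule Cinf_mat_inv[OF S(1) M pd])
  have dM: "(\<lambda>y. M y $ i $ j) differentiable (at y)" if "y \<in> S" for i j y
    using Cinf_differentiable[OF Cinf_mat_nth[OF M] that] .
  have dN: "(\<lambda>y. ?N y $ i $ j) differentiable (at y)" if "y \<in> S" for i j y
    using Cinf_differentiable[OF Cinf_mat_nth[OF N] that] .
  have Nx: "?N x = mat 1" using id hermitian_posdef_inv(1)[OF pd[OF S(2)]] by (simp add: matrix_inv_eq)
  have ddM: "cder c d (\<lambda>y. M y $ i $ j) differentiable (at x)" for i j
    using Cinf_differentiable[OF Cinf_cder[OF S(1) Cinf_mat_nth[OF M]] S(2)] .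
  have dNM: "cder a b (\<lambda>y. ?N y $ i $ j) x = - cder a b (\<lambda>y. M y $ i $ j) x" for i j
  proof -
    have "0 = cder a b (\<lambda>y. (mat 1 :: complex^'n^'n) $ i $ j) x" by (simp add: cder_const)
    also have "\<dots> = cder a b (\<lambda>y. \<Sum>k\<in>UNIV. ?N y $ i $ k * M y $ k $ j) x"
    proof (rule cder_cong[OF S])
      show "(mat 1 :: complex^'n^'n) $ i $ j = (\<Sum>k\<in>UNIV. ?N y $ i $ k * M y $ k $ j)" if "y \<in> S" for y
        unfolding hermitian_posdef_inv(1)[OF pd[OF that], symmetric] by (simp add: matrix_matrix_mult_def)
    qed simp
    also have "\<dots> = (\<Sum>k\<in>UNIV. ?N x $ i $ k * cder a b (\<lambda>y. M y $ k $ j) x + cder a b (\<lambda>y. ?N y $ i $ k) x * M x $ k $ j)"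
      using dM[OF S(2)] dN[OF S(2)] by (simp add: cder_sum cder_mult differentiable_mult)
    also have "\<dots> = cder a b (\<lambda>y. M y $ i $ j) x + cder a b (\<lambda>y. ?N y $ i $ j) x"
    proof -
      have "(\<Sum>k\<in>UNIV. ?N x $ i $ k * cder a b (\<lambda>y. M y $ k $ j) x) = cder a b (\<lambda>y. M y $ i $ j) x"
        unfolding Nx mat_def by (simp add: if_distrib if_distribR cong: if_cong)
      moreover have "(\<Sum>k\<in>UNIV. cder a b (\<lambda>y. ?N y $ i $ k) x * M x $ k $ j) = cder a b (\<lambda>y. ?N y $ i $ j) x"
        unfolding id by (simp add: mat_def if_distrib if_distribR cong: if_cong)
      ultimately show ?thesis by (simp add: sum.distrib)
    qed
    finally show ?thesis by (metis add_eq_0_iff)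
  qed
  let ?s = "\<lambda>y. \<Sum>i\<in>UNIV. \<Sum>j\<in>UNIV. ?N y $ i $ j * cder c d (\<lambda>y. M y $ j $ i) y"
  have Cs: "Cinf S ?s"
    by (intro Cinf_sum Cinf_mult Cinf_cder S(1) Cinf_mat_nth[OF M] Cinf_mat_nth[OF N])
  have ds: "?s differentiable (at x)" by (rule Cinf_differentiable[OF Cs S(2)])
  have ddet: "(\<lambda>y. det (M y)) differentiable (at x)"
    by (rule Cinf_differentiable[OF Cinf_det[OF S(1) M] S(2)])
  have "cder a b (cder c d (\<lambda>y. det (M y))) x = cder a b (\<lambda>y. det (M y) * ?s y) x"
  proof (rule cder_cong[symmetric, OF S])
    show "det (M y) * ?s y = cder c d (\<lambda>y. det (M y)) y" if "y \<in> S" for y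
      using cder_det[OF dM[OF that] hermitian_posdef_inv(1)[OF pd[OF that]], where a = c and b = d] by metis
  qed (intro differentiable_mult ddet ds)
  also have "\<dots> = det (M x) * cder a b ?s x + cder a b (\<lambda>y. det (M y)) x * ?s x"
    by (rule cder_mult[OF ddet ds])
  also have "cder a b (\<lambda>y. det (M y)) x = (\<Sum>i\<in>UNIV. cder a b (\<lambda>y. M y $ i $ i) x)"
    by (rule cder_det_id[OF dM[OF S(2)] id])
  also have "?s x = (\<Sum>i\<in>UNIV. cder c d (\<lambda>y. M y $ i $ i) x)"
  proof -
    have "(\<Sum>j\<in>UNIV. ?N x $ i $ j * cder c d (\<lambda>y. M y $ j $ i) x) = cder c d (\<lambda>y. M y $ i $ i) x" for i
      unfolding Nx mat_def by (simp add: if_distrib if_distribR cong: if_cong)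
    then show ?thesis by simp
  qed
  also have "cder a b ?s x = (\<Sum>i\<in>UNIV. \<Sum>j\<in>UNIV. ?N x $ i $ j * cder a b (cder c d (\<lambda>y. M y $ j $ i)) x
       + cder a b (\<lambda>y. ?N y $ i $ j) x * cder c d (\<lambda>y. M y $ j $ i) x)"
    using ddM dN[OF S(2)] by (simp add: cder_sum cder_mult differentiable_mult differentiable_sum)
  also have "\<dots> = (\<Sum>i\<in>UNIV. cder a b (cder c d (\<lambda>y. M y $ i $ i)) x)
      - (\<Sum>i\<in>UNIV. \<Sum>j\<in>UNIV. cder a b (\<lambda>y. M y $ i $ j) x * cder c d (\<lambda>y. M y $ j $ i) x)"
  proof -
    have "(\<Sum>j\<in>UNIV. ?N x $ i $ j * cder a b (cder c d (\<lambda>y. M y $ j $ i)) x) = cder a b (cder c d (\<lambda>y. M y $ i $ i)) x" for i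
      unfolding Nx mat_def by (simp add: if_distrib if_distribR cong: if_cong)
    then show ?thesis unfolding sum.distrib dNM by (simp add: sum_negf)
  qed
  finally show ?thesis by (simp add: id)
qed

lemma gram_posdef:
  fixes M :: "complex^'n::finite^'n"
  assumes M: "hermitian_posdef M" and e: "orthonormal K e"
  shows "hermitian_posdef (gram M e)"
  unfolding hermitian_posdef_alt
proof (intro conjI allI impI)
  have her: "hermitian M" using M by (simp add: hermitian_posdef_alt)
  show "hermitian (gram M e)"
    unfolding hermitian_def gram_def vec_lambda_beta using hform_swap[OF her] by blast
  fix v :: "complex^'n" assume v: "v \<noteq> 0"
  define w where "w = (\<Sum>k\<in>UNIV. v $ k *s e k)"
  have eq: "hform (gram M e) v v = hform M w w"
    unfolding w_def hform_sum_left hform_scale_left hform_sum_right hform_scale_right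
    unfolding hform_def[of "gram M e"]
    by (subst sum.swap) (simp add: gram_def sum_distrib_left mult_ac)
  have "hform K w (e k) = v $ k" for k
  proof -
    have *: "hform K (e i) (e k) = (if i = k then 1 else 0)" for i using e by (simp add: orthonormal_def)
    show ?thesis unfolding w_def hform_sum_left hform_scale_left by (simp add: * if_distrib cong: if_cong)
  qed
  then have "w \<noteq> 0" using v by (metis hform_zero(1) vec_eq_iff zero_index)
  then show "Re (hform (gram M e) v v) > 0" using M eq by (simp add: hermitian_posdef_alt)
qed

lemma ln_det_gram:
  fixes K :: "complex^'n::finite^'n"
  assumes "orthonormal K f"
  obtains c :: real where "c > 0" "\<And>M. Re (det (gram M f)) = c * Re (det (M :: complex^'n^'n))"
proof
  let ?p = "(cmod (det (vec_lambda f)))\<^sup>2"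
  have "of_real ?p * det K = 1"
    using det_gram[of K f] assms by (simp add: orthonormal_gram)
  then show "?p > 0" by (cases "det (vec_lambda f) = 0") auto
  show "Re (det (gram M f)) = ?p * Re (det M)" for M by (simp add: det_gram)
qed

text \<open>The frame \<open>f\<close> is constant, so the Gram matrix has the same
  \<open>ln det\<close> as \<open>M\<close> up to a constant, and it is the unit matrix at
  \<open>x\<close>. There the second derivative -1 of the logarithm cancels the product of the two
  traces. The surviving quadratic term becomes the good third order term of the estimate.\<close>

lemma cder_ln_det:
  fixes M :: "'a::euclidean_space \<Rightarrow> complex^'n::finite^'n"
  assumes S: "open S" "x \<in> S" and M: "Cinf_mat S M" and pd: "\<And>y. y \<in> S \<Longrightarrow> hermitian_posdef (M y)"
    and f: "orthonormal (M x) f"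
  shows "cder a b (\<lambda>y. of_real (ln (Re (det (M y))))) x = (\<Sum>i\<in>UNIV. cder a b (\<lambda>y. hform (M y) (f i) (f i)) x)"
    and "cder a b (cder c d (\<lambda>y. of_real (ln (Re (det (M y)))))) x
     = (\<Sum>i\<in>UNIV. cder a b (cder c d (\<lambda>y. hform (M y) (f i) (f i))) x)
     - (\<Sum>i\<in>UNIV. \<Sum>j\<in>UNIV. cder a b (\<lambda>y. hform (M y) (f i) (f j)) x * cder c d (\<lambda>y. hform (M y) (f j) (f i)) x)"
proof -
  define G where "G y = gram (M y) f" for y
  define r where "r y = Re (det (G y))" for y
  have G: "Cinf_mat S G" unfolding G_def by (rule Cinf_mat_gram[OF S(1) M])
  have Gpd: "hermitian_posdef (G y)" if "y \<in> S" for y unfolding G_def by (rule gram_posdef[OF pd[OF that] f])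
  have Gx: "G x = mat 1" unfolding G_def using f by (simp add: orthonormal_gram)
  have Gij: "(\<lambda>y. G y $ i $ j) = (\<lambda>y. hform (M y) (f j) (f i))" for i j by (simp add: G_def gram_def)
  have r: "Cinf S r" unfolding r_def by (intro Cinf_Re Cinf_det S G)
  have rpos: "r y > 0" if "y \<in> S" for y unfolding r_def by (rule hermitian_posdef_det_Re(2)[OF Gpd[OF that]])
  have rdet: "det (G y) = of_real (r y)" if "y \<in> S" for y
    unfolding r_def by (rule hermitian_posdef_det_Re(1)[OF Gpd[OF that]])
  have rx: "r x = 1" by (simp add: r_def Gx)
  obtain k :: real where k: "k > 0" "\<And>M. Re (det (gram M f)) = k * Re (det M)"
    using ln_det_gram[OF f] by metis
  have lneq: "ln (Re (det (M y))) = ln (r y) - ln k" if "y \<in> S" for y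
    using k hermitian_posdef_det_Re(2)[OF pd[OF that]] by (simp add: r_def G_def ln_mult)
  have Cl: "Cinf S (\<lambda>y. complex_of_real (ln (r y)))"
    by (intro Cinf_of_real Cinf_compose_real[OF Cinf_ln] S r) (use rpos in auto)
  have Cl': "Cinf S (\<lambda>y. complex_of_real (ln (r y)) - of_real (ln k))"
    by (intro Cinf_diff Cl Cinf_const S)
  have first: "cder a b (\<lambda>y. complex_of_real (ln (Re (det (M y))))) y = cder a b (\<lambda>y. complex_of_real (ln (r y))) y"
    if "y \<in> S" for a b y
  proof -
    have "cder a b (\<lambda>y. complex_of_real (ln (r y)) - of_real (ln k)) y = cder a b (\<lambda>y. complex_of_real (ln (Re (det (M y))))) y"
      by (rule cder_cong[OF S(1) that]) (use lneq that Cinf_differentiable[OF Cl'] in auto)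
    then show ?thesis
      using Cinf_differentiable[OF Cl that] by (simp add: cder_diff cder_const)
  qed
  have rd: "r differentiable (at x)" by (rule Cinf_differentiable[OF r S(2)])
  have lnd: "(ln has_real_derivative inverse (r y)) (at (r y))" if "y \<in> S" for y
    using rpos[OF that] by (auto intro!: derivative_eq_intros simp: field_simps)
  have dr: "cder a b (\<lambda>y. of_real (r y)) y = cder a b (\<lambda>y. det (G y)) y" if "y \<in> S" for a b y
    by (rule cder_cong[symmetric, OF S(1) that]) (use rdet Cinf_differentiable[OF Cinf_det[OF S(1) G]] that in auto)
  have tr: "cder a b (\<lambda>y. of_real (r y)) x = (\<Sum>i\<in>UNIV. cder a b (\<lambda>y. hform (M y) (f i) (f i)) x)" for a b
    unfolding dr[OF S(2)] Gij[symmetric]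
    by (rule cder_det_id[OF Cinf_differentiable[OF Cinf_mat_nth[OF G] S(2)] Gx])
  have "cder a b (\<lambda>y. of_real (ln (r y))) x = of_real (inverse (r x)) * cder a b (\<lambda>y. of_real (r y)) x"
    by (rule cder_compose_real[OF rd lnd[OF S(2)]])
  then show "cder a b (\<lambda>y. of_real (ln (Re (det (M y))))) x = (\<Sum>i\<in>UNIV. cder a b (\<lambda>y. hform (M y) (f i) (f i)) x)"
    unfolding first[OF S(2)] by (simp add: rx tr)
  have dd: "cder a b (cder c d (\<lambda>y. of_real (r y))) x = cder a b (cder c d (\<lambda>y. det (G y))) x"
    by (rule cder_cong[OF S dr]) (auto intro: Cinf_differentiable[OF Cinf_cder[OF S(1) Cinf_of_real[OF S(1) r]] S(2)])
  have d2: "(inverse has_real_derivative - 1) (at (r x))"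
    unfolding rx by (auto intro!: derivative_eq_intros)
  have "cder a b (cder c d (\<lambda>y. of_real (ln (Re (det (M y)))))) x = cder a b (cder c d (\<lambda>y. of_real (ln (r y)))) x"
    by (rule cder_cong[symmetric, OF S first[symmetric]])
      (auto intro: Cinf_differentiable[OF Cinf_cder[OF S(1) Cl] S(2)])
  also have "\<dots> = of_real (-1) * cder a b (\<lambda>y. of_real (r y)) x * cder c d (\<lambda>y. of_real (r y)) x
     + of_real (inverse (r x)) * cder a b (cder c d (\<lambda>y. of_real (r y))) x"
    by (rule cder2_compose_real[OF S(1) r S(2) lnd d2])
  also have "\<dots> = (\<Sum>i\<in>UNIV. cder a b (cder c d (\<lambda>y. hform (M y) (f i) (f i))) x)
     - (\<Sum>i\<in>UNIV. \<Sum>j\<in>UNIV. cder a b (\<lambda>y. hform (M y) (f j) (f i)) x * cder c d (\<lambda>y. hform (M y) (f i) (f j)) x)"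
    unfolding dd using cder2_det_id[OF S G Gpd Gx, of a b c d] unfolding Gij by (simp add: rx tr)
  also have "(\<Sum>i\<in>UNIV. \<Sum>j\<in>UNIV. cder a b (\<lambda>y. hform (M y) (f j) (f i)) x * cder c d (\<lambda>y. hform (M y) (f i) (f j)) x)
     = (\<Sum>i\<in>UNIV. \<Sum>j\<in>UNIV. cder a b (\<lambda>y. hform (M y) (f i) (f j)) x * cder c d (\<lambda>y. hform (M y) (f j) (f i)) x)"
    by (rule sum.swap)
  finally show "cder a b (cder c d (\<lambda>y. of_real (ln (Re (det (M y)))))) x
     = (\<Sum>i\<in>UNIV. cder a b (cder c d (\<lambda>y. hform (M y) (f i) (f i))) x)
     - (\<Sum>i\<in>UNIV. \<Sum>j\<in>UNIV. cder a b (\<lambda>y. hform (M y) (f i) (f j)) x * cder c d (\<lambda>y. hform (M y) (f j) (f i)) x)" .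
qed

section \<open>The complex Hessian\<close>

lemmas dz_mult = cder_mult[where a = "(1/2) *\<^sub>R v" and b = "- ((1/2) *\<^sub>R (\<i> *s v))" for v, folded dz_def]
  and dz_add = cder_add[where a = "(1/2) *\<^sub>R v" and b = "- ((1/2) *\<^sub>R (\<i> *s v))" for v, folded dz_def]
  and dz_diff = cder_diff[where a = "(1/2) *\<^sub>R v" and b = "- ((1/2) *\<^sub>R (\<i> *s v))" for v, folded dz_def]
  and dz_cmult = cder_cmult[where a = "(1/2) *\<^sub>R v" and b = "- ((1/2) *\<^sub>R (\<i> *s v))" for v, folded dz_def]
  and dz_sum = cder_sum[where a = "(1/2) *\<^sub>R v" and b = "- ((1/2) *\<^sub>R (\<i> *s v))" for v, folded dz_def]
  and dz_cong = cder_cong[where a = "(1/2) *\<^sub>R v" and b = "- ((1/2) *\<^sub>R (\<i> *s v))" for v, folded dz_def]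
  and dz_compose_real = cder_compose_real[where a = "(1/2) *\<^sub>R v" and b = "- ((1/2) *\<^sub>R (\<i> *s v))" for v, folded dz_def]
lemmas dzb_mult = cder_mult[where a = "(1/2) *\<^sub>R v" and b = "(1/2) *\<^sub>R (\<i> *s v)" for v, folded dzb_def]
  and dzb_add = cder_add[where a = "(1/2) *\<^sub>R v" and b = "(1/2) *\<^sub>R (\<i> *s v)" for v, folded dzb_def]
  and dzb_diff = cder_diff[where a = "(1/2) *\<^sub>R v" and b = "(1/2) *\<^sub>R (\<i> *s v)" for v, folded dzb_def]
  and dzb_cmult = cder_cmult[where a = "(1/2) *\<^sub>R v" and b = "(1/2) *\<^sub>R (\<i> *s v)" for v, folded dzb_def]
  and dzb_sum = cder_sum[where a = "(1/2) *\<^sub>R v" and b = "(1/2) *\<^sub>R (\<i> *s v)" for v, folded dzb_def]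
  and dzb_cong = cder_cong[where a = "(1/2) *\<^sub>R v" and b = "(1/2) *\<^sub>R (\<i> *s v)" for v, folded dzb_def]

lemma dz_dzb_compose_real:
  fixes r :: "complex^'n::finite \<Rightarrow> real"
  assumes "open S" "Cinf S r" "x \<in> S"
    and "\<And>y. y \<in> S \<Longrightarrow> (\<phi> has_real_derivative \<phi>1 (r y)) (at (r y))"
    and "(\<phi>1 has_real_derivative \<phi>2) (at (r x))"
  shows "dz v (dzb v (\<lambda>y. of_real (\<phi> (r y)))) x
     = of_real (\<phi>2 * (cmod (dz v (\<lambda>y. of_real (r y)) x))\<^sup>2)
     + of_real (\<phi>1 (r x)) * dz v (dzb v (\<lambda>y. of_real (r y))) x"
proof -
  have d: "(\<lambda>y. complex_of_real (r y)) differentiable (at x)"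
    using Cinf_differentiable[OF Cinf_of_real[OF assms(1,2)] assms(3)] .
  show ?thesis
    using cder2_compose_real[OF assms, of "(1/2) *\<^sub>R v" "- ((1/2) *\<^sub>R (\<i> *s v))" "(1/2) *\<^sub>R v" "(1/2) *\<^sub>R (\<i> *s v)",
        folded dz_def dzb_def]
    unfolding dzb_real[OF d]
    by (simp add: complex_norm_square mult_ac del: of_real_power)
qed

lemma dz_dzb_coords:
  assumes "open S" "Cinf S h" "x \<in> S"
  shows "dz v (dzb w h) x = (\<Sum>j\<in>UNIV. \<Sum>k\<in>UNIV. v $ j * cnj (w $ k) * dz (axis j 1) (dzb (axis k 1) h) x)"
proof -
  have d: "dzb a h differentiable (at x)" for a
    by (rule Cinf_differentiable[OF Cinf_dzb[OF assms(1,2)] assms(3)])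
  have "dz v (dzb w h) x = dz v (\<lambda>y. \<Sum>k\<in>UNIV. cnj (w $ k) * dzb (axis k 1) h y) x"
    by (rule dz_cong[OF assms(1,3) _ d]) (rule dzb_coords[OF Cinf_differentiable[OF assms(2)]])
  also have "\<dots> = (\<Sum>k\<in>UNIV. cnj (w $ k) * dz v (dzb (axis k 1) h) x)"
    by (simp add: dz_sum dz_cmult d differentiable_mult)
  also have "\<dots> = (\<Sum>k\<in>UNIV. \<Sum>j\<in>UNIV. v $ j * cnj (w $ k) * dz (axis j 1) (dzb (axis k 1) h) x)"
    by (subst dz_coords[OF d]) (simp add: sum_distrib_left mult_ac)
  also have "\<dots> = (\<Sum>j\<in>UNIV. \<Sum>k\<in>UNIV. v $ j * cnj (w $ k) * dz (axis j 1) (dzb (axis k 1) h) x)"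
    by (rule sum.swap)
  finally show ?thesis .
qed

lemma dz_hform:
  assumes "\<And>i j. (\<lambda>y. M y $ i $ j) differentiable (at x)"
  shows "dz v (\<lambda>y. hform (M y) a b) x = hform (\<chi> k j. dz v (\<lambda>y. M y $ k $ j) x) a b"
proof -
  have "dz v (\<lambda>y. M y $ k $ j * a $ j * cnj (b $ k)) x = dz v (\<lambda>y. M y $ k $ j) x * a $ j * cnj (b $ k)" for j k
    using dz_cmult[OF assms, of v "a $ j * cnj (b $ k)" k j] by (simp add: mult_ac)
  then show ?thesis
    unfolding hform_def using assms by (simp add: dz_sum differentiable_sum differentiable_mult)
qed

lemma dzb_hform:
  assumes "\<And>i j. (\<lambda>y. M y $ i $ j) differentiable (at x)"
  shows "dzb v (\<lambda>y. hform (M y) a b) x = hform (\<chi> k j. dzb v (\<lambda>y. M y $ k $ j) x) a b"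
proof -
  have "dzb v (\<lambda>y. M y $ k $ j * a $ j * cnj (b $ k)) x = dzb v (\<lambda>y. M y $ k $ j) x * a $ j * cnj (b $ k)" for j k
    using dzb_cmult[OF assms, of v "a $ j * cnj (b $ k)" k j] by (simp add: mult_ac)
  then show ?thesis
    unfolding hform_def using assms by (simp add: dzb_sum differentiable_sum differentiable_mult)
qed

lemma dz_dzb_hform:
  assumes S: "open S" "x \<in> S" and M: "Cinf_mat S M"
  shows "dz v (dzb w (\<lambda>y. hform (M y) a b)) x = hform (\<chi> k j. dz v (dzb w (\<lambda>y. M y $ k $ j)) x) a b"
proof -
  have "dz v (dzb w (\<lambda>y. hform (M y) a b)) x = dz v (\<lambda>y. hform (\<chi> k j. dzb w (\<lambda>y. M y $ k $ j) y) a b) x"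
    by (rule dz_cong[OF S])
      (auto intro!: dzb_hform Cinf_differentiable[OF Cinf_mat_nth[OF M]]
        Cinf_differentiable[OF Cinf_dzb[OF S(1) Cinf_hform[OF S(1) M]] S(2)])
  also have "\<dots> = hform (\<chi> k j. dz v (\<lambda>y. (\<chi> k j. dzb w (\<lambda>y. M y $ k $ j) y) $ k $ j) x) a b"
    by (rule dz_hform) (simp add: Cinf_differentiable[OF Cinf_dzb[OF S(1) Cinf_mat_nth[OF M]] S(2)])
  finally show ?thesis by simp
qed

definition hess :: "(complex^'n::finite \<Rightarrow> real) \<Rightarrow> complex^'n \<Rightarrow> complex^'n^'n" where
  "hess u y = (\<chi> k j. dz (axis j 1) (dzb (axis k 1) (\<lambda>z. of_real (u z))) y)"

lemma Cinf_mat_hess: "open S \<Longrightarrow> Cinf S u \<Longrightarrow> Cinf_mat S (hess u)"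
  unfolding Cinf_mat_def hess_def by (simp add: Cinf_dz Cinf_dzb Cinf_of_real)

lemma hform_hess:
  assumes "open S" "Cinf S u" "y \<in> S"
  shows "hform (hess u y) a b = dz a (dzb b (\<lambda>z. of_real (u z))) y"
  using dz_dzb_coords[OF assms(1) Cinf_of_real[OF assms(1,2)] assms(3), of a b]
  by (simp add: hform_def hess_def mult_ac)

lemma hermitian_hess:
  assumes "open S" "Cinf S u" "y \<in> S"
  shows "hermitian (hess u y)"
  unfolding hermitian_def
proof (intro allI)
  fix j k
  let ?U = "\<lambda>z. complex_of_real (u z)"
  have C: "Cinf S ?U" using assms by (intro Cinf_of_real)
  have d: "dz a ?U differentiable (at y)" for a
    by (rule Cinf_differentiable[OF Cinf_dz[OF assms(1) C] assms(3)])
  have "hess u y $ k $ j = dz (axis j 1) (dzb (axis k 1) ?U) y" by (simp add: hess_def)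
  also have "\<dots> = dz (axis j 1) (\<lambda>z. cnj (dz (axis k 1) ?U z)) y"
    by (rule dz_cong[OF assms(1,3)])
      (auto intro: dzb_real Cinf_differentiable[OF C] Cinf_differentiable[OF Cinf_dzb[OF assms(1) C] assms(3)])
  also have "\<dots> = cnj (dzb (axis j 1) (dz (axis k 1) ?U) y)" by (rule dz_cnj[OF d])
  also have "dzb (axis j 1) (dz (axis k 1) ?U) y = dz (axis k 1) (dzb (axis j 1) ?U) y"
    by (rule dz_dzb_commute[OF assms(1) C assms(3), symmetric])
  finally show "hess u y $ k $ j = cnj (hess u y $ j $ k)" by (simp add: hess_def)
qed

section \<open>Pointwise data of a pair of metrics\<close>

text \<open>\<open>e\<close> is a frame at \<open>x\<close> that is orthonormal for the background metric \<open>H\<close>, and \<open>f\<close> one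
  that is orthonormal for the evolving metric \<open>G\<close>.\<close>

locale metric_pair =
  fixes S :: "(complex^'n::finite) set" and x :: "complex^'n" and H :: "complex^'n \<Rightarrow> complex^'n^'n"
    and u :: "complex^'n \<Rightarrow> real" and e f :: "'n \<Rightarrow> complex^'n"
  assumes S: "open S" and xS: "x \<in> S" and H: "Cinf_mat S H" and u: "Cinf S u"
    and Hpd: "\<And>y. y \<in> S \<Longrightarrow> hermitian_posdef (H y)"
    and Gpd: "\<And>y. y \<in> S \<Longrightarrow> hermitian_posdef (H y + hess u y)"
    and e: "orthonormal (H x) e" and f: "orthonormal (H x + hess u x) f"
begin

definition G :: "complex^'n \<Rightarrow> complex^'n^'n" where "G y = H y + hess u y"

text \<open>This is Tr h as a function of the coordinates. Its counterpart \<open>\<zeta>\<close> is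
  the opposite trace, of the background with respect to the evolving metric, and is wanted at the
  point \<open>x\<close> only.\<close>

definition \<tau> :: "complex^'n \<Rightarrow> real" where "\<tau> y = Re (trace (matrix_inv (H y) ** G y))"

definition \<zeta> :: real where "\<zeta> = (\<Sum>i\<in>UNIV. Re (hform (H x) (f i) (f i)))"

definition \<beta> :: "'n \<Rightarrow> 'n \<Rightarrow> complex" where "\<beta> k j = hform (G x) (e k) (f j)"

text \<open>The third order term: derivatives along background unit vectors of the components of
  \<open>G\<close> in its own frame. It is the combination whose square occurs in the second
  derivatives of \<open>ln (det G)\<close>.\<close>

definition X :: "'n \<Rightarrow> 'n \<Rightarrow> 'n \<Rightarrow> complex" where
  "X k i j = dz (e k) (\<lambda>y. hform (G y) (f i) (f j)) x"

text \<open>The coefficients of \<partial>\<chi> on constant vectors, that is, the torsion of the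
  background, which is zero if \<chi> is Kaehler. As third derivatives of \<open>u\<close> commute,
  it also measures the asymmetry of the first derivatives of \<open>G\<close>.\<close>

definition T :: "complex^'n \<Rightarrow> complex^'n \<Rightarrow> complex^'n \<Rightarrow> complex" where
  "T v a b = dz v (\<lambda>y. hform (H y) a b) x - dz a (\<lambda>y. hform (H y) v b) x"

lemma Gmat: "Cinf_mat S G"
  using H Cinf_mat_hess[OF S u] S unfolding Cinf_mat_def G_def by (simp add: Cinf_add)

lemma GPD: "y \<in> S \<Longrightarrow> hermitian_posdef (G y)"
  by (simp add: G_def Gpd)

lemma fG: "orthonormal (G x) f"
  using f by (simp add: G_def)

lemma hermG: "y \<in> S \<Longrightarrow> hermitian (G y)"
  using GPD by (auto simp: hermitian_posdef_alt)

lemma CG: "Cinf S (\<lambda>y. hform (G y) a b)"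
  by (rule Cinf_hform[OF S Gmat])

lemma CH: "Cinf S (\<lambda>y. hform (H y) a b)"
  by (rule Cinf_hform[OF S H])

lemma dG: "(\<lambda>y. G y $ i $ j) differentiable (at x)"
  by (rule Cinf_differentiable[OF Cinf_mat_nth[OF Gmat] xS])

lemma CU: "Cinf S (\<lambda>y. complex_of_real (u y))"
  by (rule Cinf_of_real[OF S u])

lemma hform_G: "y \<in> S \<Longrightarrow> hform (G y) a b = hform (H y) a b + dz a (dzb b (\<lambda>z. of_real (u z))) y"
  by (simp add: G_def hform_plus hform_hess[OF S u])

lemma dz_hform_G:
  "y \<in> S \<Longrightarrow> dz v (\<lambda>y. hform (G y) a b) y
     = dz v (\<lambda>y. hform (H y) a b) y + dz v (dz a (dzb b (\<lambda>z. of_real (u z)))) y"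
proof -
  assume y: "y \<in> S"
  have "dz v (\<lambda>y. hform (G y) a b) y = dz v (\<lambda>y. hform (H y) a b + dz a (dzb b (\<lambda>z. of_real (u z))) y) y"
    by (rule dz_cong[OF S y]) (auto simp: hform_G intro: Cinf_differentiable[OF CG y])
  also have "\<dots> = dz v (\<lambda>y. hform (H y) a b) y + dz v (dz a (dzb b (\<lambda>z. of_real (u z)))) y"
    by (rule dz_add) (auto intro: Cinf_differentiable[OF CH y] Cinf_differentiable[OF Cinf_dz[OF S Cinf_dzb[OF S CU]] y])
  finally show ?thesis .
qed

lemma dz_swap: "dz v (\<lambda>y. hform (G y) a b) x = dz a (\<lambda>y. hform (G y) v b) x + T v a b"
  unfolding dz_hform_G[OF xS] T_def
  using dz_dz_commute[OF S Cinf_dzb[OF S CU] xS, of v a b] by simp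

lemma dzb_hform_G: "y \<in> S \<Longrightarrow> dzb v (\<lambda>y. hform (G y) a b) y = cnj (dz v (\<lambda>y. hform (G y) b a) y)"
proof -
  assume y: "y \<in> S"
  have "dzb v (\<lambda>y. hform (G y) a b) y = dzb v (\<lambda>y. cnj (hform (G y) b a)) y"
    by (rule dzb_cong[OF S y]) (auto intro: hform_swap[OF hermG] Cinf_differentiable[OF CG y])
  then show ?thesis by (simp add: dzb_cnj Cinf_differentiable[OF CG y])
qed

text \<open>Fourth derivatives of \<open>u\<close> do not depend on their order, so exchanging the
  direction of differentiation with that of the components is felt by the background metric
  alone.\<close>

lemma ddbar_swap:
  "dz v (dzb v (\<lambda>y. hform (G y) a a)) x - dz a (dzb a (\<lambda>y. hform (G y) v v)) x
   = dz v (dzb v (\<lambda>y. hform (H y) a a)) x - dz a (dzb a (\<lambda>y. hform (H y) v v)) x"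
proof -
  let ?U = "\<lambda>z. complex_of_real (u z)"
  have *: "dz v (dzb v (\<lambda>y. hform (G y) a a)) x
      = dz v (dzb v (\<lambda>y. hform (H y) a a)) x + dz v (dzb v (dz a (dzb a ?U))) x" for v a
  proof -
    have 1: "dzb v (\<lambda>y. hform (G y) a a) y = dzb v (\<lambda>y. hform (H y) a a) y + dzb v (dz a (dzb a ?U)) y" if y: "y \<in> S" for y
    proof -
      have "dzb v (\<lambda>y. hform (G y) a a) y = dzb v (\<lambda>y. hform (H y) a a + dz a (dzb a ?U) y) y"
        by (rule dzb_cong[OF S y]) (auto simp: hform_G intro: Cinf_differentiable[OF CG y])
      then show ?thesis
        by (simp add: dzb_add Cinf_differentiable[OF CH y] Cinf_differentiable[OF Cinf_dz[OF S Cinf_dzb[OF S CU]] y])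
    qed
    have "dz v (dzb v (\<lambda>y. hform (G y) a a)) x
        = dz v (\<lambda>y. dzb v (\<lambda>y. hform (H y) a a) y + dzb v (dz a (dzb a ?U)) y) x"
      by (rule dz_cong[OF S xS]) (auto simp: 1 intro: Cinf_differentiable[OF Cinf_dzb[OF S CG] xS])
    then show ?thesis
      by (simp add: dz_add Cinf_differentiable[OF Cinf_dzb[OF S CH] xS]
        Cinf_differentiable[OF Cinf_dzb[OF S Cinf_dz[OF S Cinf_dzb[OF S CU]]] xS])
  qed
  have "dz v (dzb v (dz a (dzb a ?U))) x = dz v (dz a (dzb v (dzb a ?U))) x"
    by (rule dz_cong[OF S xS])
      (auto intro: dz_dzb_commute[OF S Cinf_dzb[OF S CU], symmetric]
        Cinf_differentiable[OF Cinf_dzb[OF S Cinf_dz[OF S Cinf_dzb[OF S CU]]] xS])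
  also have "\<dots> = dz a (dz v (dzb v (dzb a ?U))) x"
    by (rule dz_dz_commute[OF S Cinf_dzb[OF S Cinf_dzb[OF S CU]] xS])
  also have "\<dots> = dz a (dz v (dzb a (dzb v ?U))) x"
  proof (rule dz_cong[OF S xS])
    show "dz v (dzb v (dzb a ?U)) y = dz v (dzb a (dzb v ?U)) y" if "y \<in> S" for y
      by (rule dz_cong[OF S that])
        (auto intro: dzb_dzb_commute[OF S CU] Cinf_differentiable[OF Cinf_dzb[OF S Cinf_dzb[OF S CU]] that])
  qed (rule Cinf_differentiable[OF Cinf_dz[OF S Cinf_dzb[OF S Cinf_dzb[OF S CU]]] xS])
  also have "\<dots> = dz a (dzb a (dz v (dzb v ?U))) x"
    by (rule dz_cong[OF S xS])
      (auto intro: dz_dzb_commute[OF S Cinf_dzb[OF S CU]]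
        Cinf_differentiable[OF Cinf_dz[OF S Cinf_dzb[OF S Cinf_dzb[OF S CU]]] xS])
  finally show ?thesis unfolding * by simp
qed

end

section \<open>First and second derivatives of the trace of h\<close>

lemma hermitianD: "hermitian M \<Longrightarrow> M $ k $ j = cnj (M $ j $ k)"
  unfolding hermitian_def by blast

lemma Re_sum_conj: "z = a + (p + q) + cnj (p + q) + b \<Longrightarrow> Re z = Re a + Re b + 2 * Re p + 2 * Re q"
  by simp

context metric_pair
begin

lemma trace_\<tau>:
  assumes "y \<in> S" shows "trace (matrix_inv (H y) ** G y) = of_real (\<tau> y)"
proof -
  obtain e' where e': "orthonormal (H y) e'" using orthonormal_exists[OF Hpd[OF assms]] .
  have "trace (matrix_inv (H y) ** G y) = (\<Sum>k\<in>UNIV. hform (G y) (e' k) (e' k))"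
    by (rule trace_frame[OF e'])
  also have "\<dots> = (\<Sum>k\<in>UNIV. of_real (Re (hform (G y) (e' k) (e' k))))"
    by (intro sum.cong refl hform_self_real hermG assms)
  finally have "trace (matrix_inv (H y) ** G y) = of_real (\<Sum>k\<in>UNIV. Re (hform (G y) (e' k) (e' k)))"
    by simp
  then show ?thesis by (simp add: \<tau>_def)
qed

lemma \<tau>_coords:
  "y \<in> S \<Longrightarrow> complex_of_real (\<tau> y) = (\<Sum>j\<in>UNIV. \<Sum>m\<in>UNIV. matrix_inv (H y) $ j $ m * G y $ m $ j)"
  unfolding trace_\<tau>[symmetric] by (simp add: trace_def matrix_matrix_mult_def)

lemma Hinv: "Cinf_mat S (\<lambda>y. matrix_inv (H y))"
  by (rule Cinf_mat_inv[OF S H Hpd])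

lemma C\<tau>: "Cinf S \<tau>"
proof -
  have "Cinf S (\<lambda>y. Re (\<Sum>j\<in>UNIV. \<Sum>m\<in>UNIV. matrix_inv (H y) $ j $ m * G y $ m $ j))"
    by (intro Cinf_Re Cinf_sum Cinf_mult S Cinf_mat_nth[OF Hinv] Cinf_mat_nth[OF Gmat])
  then show ?thesis
    by (rule Cinf_cong[OF S, rotated]) (simp add: \<tau>_coords[symmetric])
qed

lemma hform_G_ee: "hform (G x) (e k) (e l) = (\<Sum>j\<in>UNIV. \<beta> k j * cnj (\<beta> l j))"
  unfolding \<beta>_def by (rule hform_parseval[OF fG])

lemma e_expand: "e k = (\<Sum>j\<in>UNIV. \<beta> k j *s f j)"
  unfolding \<beta>_def by (rule orthonormal_expand[OF fG])

lemma \<tau>_\<beta>: "\<tau> x = (\<Sum>k\<in>UNIV. \<Sum>j\<in>UNIV. (cmod (\<beta> k j))\<^sup>2)"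
proof -
  have "complex_of_real (\<tau> x) = (\<Sum>k\<in>UNIV. hform (G x) (e k) (e k))"
    unfolding trace_\<tau>[OF xS, symmetric] by (rule trace_frame[OF e])
  also have "\<dots> = of_real (\<Sum>k\<in>UNIV. \<Sum>j\<in>UNIV. (cmod (\<beta> k j))\<^sup>2)"
    unfolding hform_G_ee by (simp add: complex_norm_square del: of_real_power)
  finally show ?thesis by (simp only: of_real_eq_iff)
qed

lemma \<tau>_pos: "\<tau> x > 0"
proof -
  have "e k \<noteq> 0" for k
    using e by (metis hform_zero(1) orthonormal_def zero_neq_one)
  then have "Re (hform (G x) (e k) (e k)) > 0" for k
    using GPD[OF xS] by (simp add: hermitian_posdef_alt)
  then have "(\<Sum>k\<in>UNIV. Re (hform (G x) (e k) (e k))) > 0" by (intro sum_pos) auto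
  moreover have "complex_of_real (\<tau> x) = (\<Sum>k\<in>UNIV. hform (G x) (e k) (e k))"
    unfolding trace_\<tau>[OF xS, symmetric] by (rule trace_frame[OF e])
  then have "\<tau> x = (\<Sum>k\<in>UNIV. Re (hform (G x) (e k) (e k)))" by (metis Re_complex_of_real Re_sum)
  ultimately show ?thesis by simp
qed

text \<open>The components in the frame \<open>e\<close> of a contravariant 2-tensor with coordinate
  components \<open>c j m\<close>. Derivatives of the inverse metric are tensors of this kind, to be
  contracted with frame components of \<open>G\<close>.\<close>

definition fr :: "('n \<Rightarrow> 'n \<Rightarrow> complex) \<Rightarrow> 'n \<Rightarrow> 'n \<Rightarrow> complex" where
  "fr c k l = (\<Sum>j\<in>UNIV. \<Sum>m\<in>UNIV. c j m * (hform (H x) (axis j 1) (e k) * cnj (hform (H x) (axis m 1) (e l))))"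

lemma fr_expand:
  "(\<Sum>j\<in>UNIV. \<Sum>m\<in>UNIV. c j m * M $ m $ j) = (\<Sum>k\<in>UNIV. \<Sum>l\<in>UNIV. fr c k l * hform M (e k) (e l))"
proof -
  let ?a = "\<lambda>j k. hform (H x) (axis j 1) (e k)"
  have M: "M $ m $ j = (\<Sum>k\<in>UNIV. \<Sum>l\<in>UNIV. ?a j k * cnj (?a m l) * hform M (e k) (e l))" for m j
    using hform_expand[OF e, of M "axis j 1" "axis m 1"] by (simp add: hform_axis)
  have "(\<Sum>j\<in>UNIV. \<Sum>m\<in>UNIV. c j m * M $ m $ j)
     = (\<Sum>j\<in>UNIV. \<Sum>m\<in>UNIV. \<Sum>k\<in>UNIV. \<Sum>l\<in>UNIV. c j m * (?a j k * cnj (?a m l)) * hform M (e k) (e l))"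
    by (subst M) (simp add: sum_distrib_left mult_ac)
  also have "\<dots> = (\<Sum>j\<in>UNIV. \<Sum>k\<in>UNIV. \<Sum>l\<in>UNIV. \<Sum>m\<in>UNIV. c j m * (?a j k * cnj (?a m l)) * hform M (e k) (e l))"
    by (rule sum.cong[OF refl], subst sum.swap, rule sum.cong[OF refl], rule sum.swap)
  also have "\<dots> = (\<Sum>k\<in>UNIV. \<Sum>l\<in>UNIV. \<Sum>j\<in>UNIV. \<Sum>m\<in>UNIV. c j m * (?a j k * cnj (?a m l)) * hform M (e k) (e l))"
    by (subst sum.swap, rule sum.cong[OF refl], rule sum.swap)
  also have "\<dots> = (\<Sum>k\<in>UNIV. \<Sum>l\<in>UNIV. fr c k l * hform M (e k) (e l))"
    unfolding fr_def sum_distrib_right ..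
  finally show ?thesis .
qed

definition c :: "'n \<Rightarrow> 'n \<Rightarrow> 'n \<Rightarrow> complex" where
  "c i = fr (\<lambda>j m. dz (f i) (\<lambda>y. matrix_inv (H y) $ j $ m) x)"

text \<open>First derivatives of the inverse background metric, with one index moved to the frame
  \<open>f\<close> by \<open>\<beta>\<close>. In this form they have the index type of
  \<open>X\<close> and can be added to it.\<close>

definition Y :: "'n \<Rightarrow> 'n \<Rightarrow> 'n \<Rightarrow> complex" where
  "Y l i j = (\<Sum>k\<in>UNIV. c i k l * \<beta> k j)"

text \<open>The contracted torsion in the direction \<open>f i\<close>. It is left over when the
  direction of differentiation \<open>f i\<close> is exchanged with the component direction
  \<open>e k\<close> in the derivative of the trace.\<close>

definition E :: "'n \<Rightarrow> complex" where
  "E i = (\<Sum>k\<in>UNIV. T (f i) (e k) (e k))"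

lemma dHinv: "(\<lambda>y. matrix_inv (H y) $ i $ j) differentiable (at x)"
  by (rule Cinf_differentiable[OF Cinf_mat_nth[OF Hinv] xS])

lemma dz_trace:
  "(\<Sum>j\<in>UNIV. \<Sum>m\<in>UNIV. matrix_inv (H x) $ j $ m * M $ m $ j) = (\<Sum>k\<in>UNIV. hform M (e k) (e k))"
  using trace_frame[OF e, of M] by (simp add: trace_def matrix_matrix_mult_def)

lemma dz_e_hform: "dz v (\<lambda>y. hform (G y) a (e k)) x = (\<Sum>j\<in>UNIV. cnj (\<beta> k j) * dz v (\<lambda>y. hform (G y) a (f j)) x)"
  unfolding dz_hform[OF dG]
  by (subst e_expand) (simp add: hform_sum_right hform_scale_right)

lemma dz_f_G_ee: "dz (f i) (\<lambda>y. hform (G y) (e l) (e k)) x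
    = (\<Sum>j\<in>UNIV. cnj (\<beta> k j) * X l i j) + T (f i) (e l) (e k)"
  unfolding X_def dz_e_hform[symmetric] by (rule dz_swap)

lemma sum_fr_\<beta>:
  "(\<Sum>k\<in>UNIV. \<Sum>l\<in>UNIV. c i k l * (\<Sum>j\<in>UNIV. \<beta> k j * Z l j)) = (\<Sum>l\<in>UNIV. \<Sum>j\<in>UNIV. Y l i j * Z l j)"
proof -
  have "(\<Sum>k\<in>UNIV. \<Sum>l\<in>UNIV. c i k l * (\<Sum>j\<in>UNIV. \<beta> k j * Z l j))
      = (\<Sum>l\<in>UNIV. \<Sum>k\<in>UNIV. \<Sum>j\<in>UNIV. c i k l * \<beta> k j * Z l j)"
    by (subst sum.swap) (simp add: sum_distrib_left mult_ac)
  also have "\<dots> = (\<Sum>l\<in>UNIV. \<Sum>j\<in>UNIV. \<Sum>k\<in>UNIV. c i k l * \<beta> k j * Z l j)"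
    by (rule sum.cong[OF refl], rule sum.swap)
  finally show ?thesis by (simp add: Y_def sum_distrib_right)
qed

text \<open>Derivatives of the diagonal components along \<open>f i\<close> are turned by
  \<open>dz_swap\<close> into derivatives along \<open>e k\<close>, so that the same
  \<open>X\<close> appears as in the formula for \<open>ln (det G)\<close>. The torsion
  \<open>E\<close> is the cost of the exchange.\<close>

lemma dz_\<tau>:
  "dz (f i) (\<lambda>y. of_real (\<tau> y)) x = (\<Sum>k\<in>UNIV. \<Sum>j\<in>UNIV. cnj (\<beta> k j) * (X k i j + Y k i j)) + E i"
proof -
  let ?\<eta> = "\<lambda>y. matrix_inv (H y)"
  have "dz (f i) (\<lambda>y. of_real (\<tau> y)) x = dz (f i) (\<lambda>y. \<Sum>j\<in>UNIV. \<Sum>m\<in>UNIV. ?\<eta> y $ j $ m * G y $ m $ j) x"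
    by (rule dz_cong[OF S xS])
      (auto simp: \<tau>_coords intro: Cinf_differentiable[OF Cinf_of_real[OF S C\<tau>] xS])
  also have "\<dots> = (\<Sum>j\<in>UNIV. \<Sum>m\<in>UNIV. ?\<eta> x $ j $ m * (\<chi> k j. dz (f i) (\<lambda>y. G y $ k $ j) x) $ m $ j)
       + (\<Sum>j\<in>UNIV. \<Sum>m\<in>UNIV. dz (f i) (\<lambda>y. ?\<eta> y $ j $ m) x * G x $ m $ j)"
    by (simp add: dz_sum dz_mult dHinv dG differentiable_sum differentiable_mult sum.distrib)
  also have "\<dots> = (\<Sum>k\<in>UNIV. dz (f i) (\<lambda>y. hform (G y) (e k) (e k)) x)
       + (\<Sum>k\<in>UNIV. \<Sum>l\<in>UNIV. c i k l * hform (G x) (e k) (e l))"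
    unfolding dz_trace fr_expand dz_hform[OF dG] c_def ..
  also have "(\<Sum>k\<in>UNIV. \<Sum>l\<in>UNIV. c i k l * hform (G x) (e k) (e l)) = (\<Sum>l\<in>UNIV. \<Sum>j\<in>UNIV. Y l i j * cnj (\<beta> l j))"
    unfolding hform_G_ee by (rule sum_fr_\<beta>)
  finally show ?thesis
    unfolding dz_f_G_ee E_def by (simp add: sum.distrib algebra_simps)
qed

text \<open>The product rule for the inverse metric times \<open>G\<close> gives four sums. The two
  mixed ones are conjugate because both matrices are hermitian, so they add up to twice a real part;
  in frames they pair \<open>Y\<close> with \<open>X\<close> and leave a torsion remainder.\<close>

lemma dz_dzb_\<tau>:
  "Re (dz (f i) (dzb (f i) (\<lambda>y. of_real (\<tau> y))) x)
   = Re (\<Sum>k\<in>UNIV. dz (f i) (dzb (f i) (\<lambda>y. hform (G y) (e k) (e k))) x)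
   + Re (\<Sum>j\<in>UNIV. \<Sum>m\<in>UNIV. dz (f i) (dzb (f i) (\<lambda>y. matrix_inv (H y) $ j $ m)) x * G x $ m $ j)
   + 2 * Re (\<Sum>l\<in>UNIV. \<Sum>j\<in>UNIV. Y l i j * cnj (X l i j))
   + 2 * Re (\<Sum>k\<in>UNIV. \<Sum>l\<in>UNIV. c i k l * cnj (T (f i) (e l) (e k)))"
proof -
  let ?\<eta> = "\<lambda>y. matrix_inv (H y)" and ?v = "f i"
  have d\<eta>: "(\<lambda>y. ?\<eta> y $ a $ b) differentiable (at y)" "(\<lambda>y. G y $ a $ b) differentiable (at y)"
    "dzb ?v (\<lambda>y. ?\<eta> y $ a $ b) differentiable (at y)" "dzb ?v (\<lambda>y. G y $ a $ b) differentiable (at y)"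
    if "y \<in> S" for a b y
    using that by (auto intro!: Cinf_differentiable[of S] Cinf_dzb S Cinf_mat_nth[OF Hinv] Cinf_mat_nth[OF Gmat])
  let ?A = "\<lambda>y. \<Sum>j\<in>UNIV. \<Sum>m\<in>UNIV. ?\<eta> y $ j $ m * dzb ?v (\<lambda>y. G y $ m $ j) y + dzb ?v (\<lambda>y. ?\<eta> y $ j $ m) y * G y $ m $ j"
  have 1: "dzb ?v (\<lambda>y. of_real (\<tau> y)) y = ?A y" if y: "y \<in> S" for y
  proof -
    have "dzb ?v (\<lambda>y. of_real (\<tau> y)) y = dzb ?v (\<lambda>y. \<Sum>j\<in>UNIV. \<Sum>m\<in>UNIV. ?\<eta> y $ j $ m * G y $ m $ j) y"
      by (rule dzb_cong[OF S y])
        (auto simp: \<tau>_coords intro: Cinf_differentiable[OF Cinf_of_real[OF S C\<tau>] y])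
    also have "\<dots> = ?A y"
      by (simp add: dzb_sum dzb_mult d\<eta>[OF y] differentiable_sum differentiable_mult)
    finally show ?thesis .
  qed
  have "dz ?v (dzb ?v (\<lambda>y. of_real (\<tau> y))) x = dz ?v ?A x"
    by (rule dz_cong[OF S xS 1])
      (auto intro: Cinf_differentiable[OF Cinf_dzb[OF S Cinf_of_real[OF S C\<tau>]] xS])
  also have "\<dots> = (\<Sum>j\<in>UNIV. \<Sum>m\<in>UNIV. ?\<eta> x $ j $ m * (\<chi> m j. dz ?v (dzb ?v (\<lambda>y. G y $ m $ j)) x) $ m $ j)
      + (\<Sum>j\<in>UNIV. \<Sum>m\<in>UNIV. dz ?v (\<lambda>y. ?\<eta> y $ j $ m) x * (\<chi> m j. dzb ?v (\<lambda>y. G y $ m $ j) x) $ m $ j)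
      + (\<Sum>j\<in>UNIV. \<Sum>m\<in>UNIV. dzb ?v (\<lambda>y. ?\<eta> y $ j $ m) x * dz ?v (\<lambda>y. G y $ m $ j) x)
      + (\<Sum>j\<in>UNIV. \<Sum>m\<in>UNIV. dz ?v (dzb ?v (\<lambda>y. ?\<eta> y $ j $ m)) x * G x $ m $ j)"
    by (simp add: dz_sum dz_mult dz_add d\<eta>[OF xS] differentiable_sum differentiable_mult differentiable_add sum.distrib)
  also have "(\<Sum>j\<in>UNIV. \<Sum>m\<in>UNIV. ?\<eta> x $ j $ m * (\<chi> m j. dz ?v (dzb ?v (\<lambda>y. G y $ m $ j)) x) $ m $ j)
      = (\<Sum>k\<in>UNIV. dz ?v (dzb ?v (\<lambda>y. hform (G y) (e k) (e k))) x)"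
    unfolding dz_trace dz_dzb_hform[OF S xS Gmat] ..
  also have third: "(\<Sum>j\<in>UNIV. \<Sum>m\<in>UNIV. dz ?v (\<lambda>y. ?\<eta> y $ j $ m) x * (\<chi> m j. dzb ?v (\<lambda>y. G y $ m $ j) x) $ m $ j)
      = (\<Sum>l\<in>UNIV. \<Sum>j\<in>UNIV. Y l i j * cnj (X l i j)) + (\<Sum>k\<in>UNIV. \<Sum>l\<in>UNIV. c i k l * cnj (T (f i) (e l) (e k)))"
  proof -
    have "(\<Sum>j\<in>UNIV. \<Sum>m\<in>UNIV. dz ?v (\<lambda>y. ?\<eta> y $ j $ m) x * (\<chi> m j. dzb ?v (\<lambda>y. G y $ m $ j) x) $ m $ j)
      = (\<Sum>k\<in>UNIV. \<Sum>l\<in>UNIV. c i k l * dzb ?v (\<lambda>y. hform (G y) (e k) (e l)) x)"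
      unfolding fr_expand dzb_hform[OF dG] c_def ..
    also have "\<dots> = (\<Sum>k\<in>UNIV. \<Sum>l\<in>UNIV. c i k l * (\<Sum>j\<in>UNIV. \<beta> k j * cnj (X l i j)) + c i k l * cnj (T (f i) (e l) (e k)))"
      unfolding dzb_hform_G[OF xS] dz_f_G_ee by (simp add: algebra_simps)
    finally show ?thesis by (simp add: sum.distrib sum_fr_\<beta>)
  qed
  also have "(\<Sum>j\<in>UNIV. \<Sum>m\<in>UNIV. dzb ?v (\<lambda>y. ?\<eta> y $ j $ m) x * dz ?v (\<lambda>y. G y $ m $ j) x)
      = cnj (\<Sum>j\<in>UNIV. \<Sum>m\<in>UNIV. dz ?v (\<lambda>y. ?\<eta> y $ j $ m) x * (\<chi> m j. dzb ?v (\<lambda>y. G y $ m $ j) x) $ m $ j)"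
  proof -
    have \<eta>h: "dzb ?v (\<lambda>y. ?\<eta> y $ j $ m) x = cnj (dz ?v (\<lambda>y. ?\<eta> y $ m $ j) x)" for j m
    proof -
      have "dzb ?v (\<lambda>y. ?\<eta> y $ j $ m) x = dzb ?v (\<lambda>y. cnj (?\<eta> y $ m $ j)) x"
        by (rule dzb_cong[OF S xS]) (rule hermitianD[OF hermitian_inv[OF Hpd]], assumption, rule d\<eta>[OF xS])
      then show ?thesis by (simp add: dzb_cnj d\<eta>[OF xS])
    qed
    have Gh: "dz ?v (\<lambda>y. G y $ m $ j) x = cnj (dzb ?v (\<lambda>y. G y $ j $ m) x)" for j m
    proof -
      have "dz ?v (\<lambda>y. G y $ m $ j) x = dz ?v (\<lambda>y. cnj (G y $ j $ m)) x"
        by (rule dz_cong[OF S xS]) (rule hermitianD[OF hermG], assumption, rule d\<eta>[OF xS])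
      then show ?thesis by (simp add: dz_cnj d\<eta>[OF xS])
    qed
    show ?thesis unfolding \<eta>h Gh by (subst sum.swap) (simp only: cnj_sum complex_cnj_mult vec_lambda_beta)
  qed
  finally show ?thesis unfolding third by (rule Re_sum_conj)
qed

lemma dz_dzb_ln_det:
  "dz (e k) (dzb (e k) (\<lambda>y. of_real (ln (Re (det (G y)))))) x
   = (\<Sum>i\<in>UNIV. dz (e k) (dzb (e k) (\<lambda>y. hform (G y) (f i) (f i))) x)
   - of_real (\<Sum>i\<in>UNIV. \<Sum>j\<in>UNIV. (cmod (X k i j))\<^sup>2)"
  using cder_ln_det(2)[OF S xS Gmat GPD fG, of "(1/2) *\<^sub>R e k" "- ((1/2) *\<^sub>R (\<i> *s e k))" "(1/2) *\<^sub>R e k" "(1/2) *\<^sub>R (\<i> *s e k)",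
        folded dz_def dzb_def]
  unfolding dzb_hform_G[OF xS] X_def[symmetric]
  by (simp add: complex_norm_square del: of_real_power)

text \<open>Both Laplacians contain fourth derivatives of \<open>u\<close>, once traced over
  \<open>f\<close> with components in \<open>e\<close> and once the other way round; in the
  difference they cancel by \<open>ddbar_swap\<close>. The determinant contributes the square of
  \<open>X\<close>. The remaining terms involve at most two derivatives of the background and no
  third derivatives of \<open>u\<close>, except in the pairing of \<open>Y\<close> with
  \<open>X\<close>.\<close>

lemma laplace_\<tau>:
  "Re (\<Sum>i\<in>UNIV. dz (f i) (dzb (f i) (\<lambda>y. of_real (\<tau> y))) x)
   - Re (\<Sum>k\<in>UNIV. dz (e k) (dzb (e k) (\<lambda>y. of_real (ln (Re (det (G y)))))) x)
   = (\<Sum>k\<in>UNIV. \<Sum>i\<in>UNIV. \<Sum>j\<in>UNIV. (cmod (X k i j))\<^sup>2 + 2 * Re (Y k i j * cnj (X k i j)))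
   + Re (\<Sum>i\<in>UNIV. \<Sum>k\<in>UNIV. dz (f i) (dzb (f i) (\<lambda>y. hform (H y) (e k) (e k))) x
        - dz (e k) (dzb (e k) (\<lambda>y. hform (H y) (f i) (f i))) x)
   + Re (\<Sum>i\<in>UNIV. \<Sum>j\<in>UNIV. \<Sum>m\<in>UNIV. dz (f i) (dzb (f i) (\<lambda>y. matrix_inv (H y) $ j $ m)) x * G x $ m $ j)
   + 2 * Re (\<Sum>i\<in>UNIV. \<Sum>k\<in>UNIV. \<Sum>l\<in>UNIV. c i k l * cnj (T (f i) (e l) (e k)))"
proof -
  have a: "Re (\<Sum>i\<in>UNIV. dz (f i) (dzb (f i) (\<lambda>y. of_real (\<tau> y))) x)
     = Re (\<Sum>i\<in>UNIV. \<Sum>k\<in>UNIV. dz (f i) (dzb (f i) (\<lambda>y. hform (G y) (e k) (e k))) x)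
     + Re (\<Sum>i\<in>UNIV. \<Sum>j\<in>UNIV. \<Sum>m\<in>UNIV. dz (f i) (dzb (f i) (\<lambda>y. matrix_inv (H y) $ j $ m)) x * G x $ m $ j)
     + 2 * Re (\<Sum>i\<in>UNIV. \<Sum>l\<in>UNIV. \<Sum>j\<in>UNIV. Y l i j * cnj (X l i j))
     + 2 * Re (\<Sum>i\<in>UNIV. \<Sum>k\<in>UNIV. \<Sum>l\<in>UNIV. c i k l * cnj (T (f i) (e l) (e k)))"
    unfolding Re_sum[of _ UNIV] dz_dzb_\<tau> by (simp only: sum.distrib sum_distrib_left)
  have b: "Re (\<Sum>k\<in>UNIV. dz (e k) (dzb (e k) (\<lambda>y. of_real (ln (Re (det (G y)))))) x)
     = Re (\<Sum>i\<in>UNIV. \<Sum>k\<in>UNIV. dz (e k) (dzb (e k) (\<lambda>y. hform (G y) (f i) (f i))) x)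
     - (\<Sum>k\<in>UNIV. \<Sum>i\<in>UNIV. \<Sum>j\<in>UNIV. (cmod (X k i j))\<^sup>2)"
    unfolding dz_dzb_ln_det by (subst (2) sum.swap) (simp add: sum_subtractf)
  have s: "(\<Sum>i\<in>UNIV. \<Sum>k\<in>UNIV. dz (f i) (dzb (f i) (\<lambda>y. hform (G y) (e k) (e k))) x)
      - (\<Sum>i\<in>UNIV. \<Sum>k\<in>UNIV. dz (e k) (dzb (e k) (\<lambda>y. hform (G y) (f i) (f i))) x)
     = (\<Sum>i\<in>UNIV. \<Sum>k\<in>UNIV. dz (f i) (dzb (f i) (\<lambda>y. hform (H y) (e k) (e k))) x
        - dz (e k) (dzb (e k) (\<lambda>y. hform (H y) (f i) (f i))) x)"
    unfolding sum_subtractf[symmetric] ddbar_swap ..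
  have y: "(\<Sum>i\<in>UNIV. \<Sum>l\<in>UNIV. \<Sum>j\<in>UNIV. Y l i j * cnj (X l i j)) = (\<Sum>k\<in>UNIV. \<Sum>i\<in>UNIV. \<Sum>j\<in>UNIV. Y k i j * cnj (X k i j))"
    by (rule sum.swap)
  show ?thesis
    unfolding a b y s[symmetric]
    by (simp add: sum.distrib sum_distrib_left)
qed

text \<open>Cauchy-Schwarz over the pair of indices \<open>k\<close>, \<open>j\<close> in
  \<open>dz_\<tau>\<close>, where the squares of \<open>\<beta>\<close> add up to the trace itself.
  The constant 1 matters: the gradient term produced by \<open>ln \<tau>\<close> has exactly this
  coefficient.\<close>

lemma gradient_\<tau>:
  "(\<Sum>i\<in>UNIV. (cmod (dz (f i) (\<lambda>y. of_real (\<tau> y)) x - E i))\<^sup>2)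
   \<le> \<tau> x * (\<Sum>k\<in>UNIV. \<Sum>i\<in>UNIV. \<Sum>j\<in>UNIV. (cmod (X k i j + Y k i j))\<^sup>2)"
proof -
  have "(cmod (dz (f i) (\<lambda>y. of_real (\<tau> y)) x - E i))\<^sup>2
     \<le> \<tau> x * (\<Sum>k\<in>UNIV. \<Sum>j\<in>UNIV. (cmod (X k i j + Y k i j))\<^sup>2)" for i
  proof -
    have "cmod (dz (f i) (\<lambda>y. of_real (\<tau> y)) x - E i) \<le> (\<Sum>k\<in>UNIV. \<Sum>j\<in>UNIV. cmod (\<beta> k j) * cmod (X k i j + Y k i j))"
      unfolding dz_\<tau> add_diff_cancel_right'
      by (rule order_trans[OF norm_sum], rule sum_mono, rule order_trans[OF norm_sum], rule sum_mono) (simp add: norm_mult)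
    also have "\<dots> = (\<Sum>p\<in>UNIV. cmod (\<beta> (fst p) (snd p)) * cmod (X (fst p) i (snd p) + Y (fst p) i (snd p)))"
      unfolding sum.cartesian_product UNIV_Times_UNIV split_def ..
    finally have "(cmod (dz (f i) (\<lambda>y. of_real (\<tau> y)) x - E i))\<^sup>2
      \<le> (\<Sum>p\<in>UNIV. cmod (\<beta> (fst p) (snd p)) * cmod (X (fst p) i (snd p) + Y (fst p) i (snd p)))\<^sup>2"
      by (rule power_mono) simp
    also have "\<dots> \<le> (\<Sum>p\<in>UNIV. (cmod (\<beta> (fst p) (snd p)))\<^sup>2) * (\<Sum>p\<in>UNIV. (cmod (X (fst p) i (snd p) + Y (fst p) i (snd p)))\<^sup>2)"
      by (rule Cauchy_Schwarz_ineq_sum)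
    also have "\<dots> = \<tau> x * (\<Sum>k\<in>UNIV. \<Sum>j\<in>UNIV. (cmod (X k i j + Y k i j))\<^sup>2)"
      unfolding \<tau>_\<beta> sum.cartesian_product UNIV_Times_UNIV split_def ..
    finally show ?thesis .
  qed
  then have "(\<Sum>i\<in>UNIV. (cmod (dz (f i) (\<lambda>y. of_real (\<tau> y)) x - E i))\<^sup>2)
     \<le> (\<Sum>i\<in>UNIV. \<tau> x * (\<Sum>k\<in>UNIV. \<Sum>j\<in>UNIV. (cmod (X k i j + Y k i j))\<^sup>2))"
    by (intro sum_mono)
  also have "\<dots> = \<tau> x * (\<Sum>k\<in>UNIV. \<Sum>i\<in>UNIV. \<Sum>j\<in>UNIV. (cmod (X k i j + Y k i j))\<^sup>2)"
    unfolding sum_distrib_left[symmetric] by (subst sum.swap) simp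
  finally show ?thesis .
qed

end

section \<open>Bounds for the error terms by jets of the background\<close>

definition l1 :: "complex^'n::finite \<Rightarrow> real" where "l1 v = (\<Sum>j\<in>UNIV. cmod (v $ j))"

lemma l1_nonneg: "l1 v \<ge> 0" by (simp add: l1_def sum_nonneg)

lemma l1_axis: "l1 (axis j 1) = 1"
  unfolding l1_def axis_def by (simp add: if_distrib cong: if_cong)

lemma hform_bound:
  assumes "\<And>i j. cmod (M $ i $ j) \<le> B"
  shows "cmod (hform M a b) \<le> B * l1 a * l1 b"
proof -
  have "cmod (hform M a b) \<le> (\<Sum>j\<in>UNIV. \<Sum>k\<in>UNIV. B * (cmod (a $ j) * cmod (b $ k)))"
    unfolding hform_def
    by (rule order_trans[OF norm_sum], rule sum_mono, rule order_trans[OF norm_sum], rule sum_mono)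
      (simp add: norm_mult mult.assoc mult_right_mono assms)
  then show ?thesis by (simp only: l1_def sum_product sum_distrib_left[symmetric] mult.assoc)
qed

lemma dz_bound:
  assumes "h differentiable (at x)" "\<And>j. cmod (dz (axis j 1) h x) \<le> B"
  shows "cmod (dz v h x) \<le> B * l1 v"
  unfolding dz_coords[OF assms(1), of v] l1_def sum_distrib_left
  by (rule order_trans[OF norm_sum], rule sum_mono)
    (simp add: norm_mult mult.commute[of B] mult_left_mono assms)

lemma dz_dzb_bound:
  assumes "open S" "Cinf S h" "x \<in> S" "\<And>j k. cmod (dz (axis j 1) (dzb (axis k 1) h) x) \<le> B"
  shows "cmod (dz v (dzb w h) x) \<le> B * l1 v * l1 w"
proof -
  have "cmod (dz v (dzb w h) x) \<le> (\<Sum>j\<in>UNIV. \<Sum>k\<in>UNIV. B * (cmod (v $ j) * cmod (w $ k)))"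
    unfolding dz_dzb_coords[OF assms(1-3), of v w]
    by (rule order_trans[OF norm_sum], rule sum_mono, rule order_trans[OF norm_sum], rule sum_mono)
      (simp add: norm_mult mult.commute[of B] mult_left_mono assms)
  then show ?thesis by (simp only: l1_def sum_product sum_distrib_left[symmetric] mult.assoc)
qed

text \<open>Passing from coordinates to the frame \<open>e\<close> costs
  \<open>N ^ 4 * K ^ 5\<close> for derivatives of the inverse metric and
  \<open>2 * N\<^sup>2 * K ^ 3\<close> for the torsion; apart from factors \<open>p i\<close>, this
  number dominates both.\<close>

definition frame_const :: "real \<Rightarrow> real \<Rightarrow> real" where
  "frame_const N K = 2 * N ^ 4 * K ^ 5"

text \<open>The bracket adds up the coefficients of the error terms: \<open>Y\<close> and the
  product of \<open>c\<close> with the torsion give \<open>3 * N\<^sup>2 * c\<^sup>2\<close>, second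
  derivatives of the inverse metric and of the metric give the other two. The factor
  \<open>N ^ 3 * K ^ 2\<close> converts lengths of the frame \<open>f\<close> into
  \<open>\<zeta>\<close>. The last summand serves the Laplacian of \<open>\<rho>\<close>.\<close>

definition geo_const :: "real \<Rightarrow> real \<Rightarrow> real" where
  "geo_const N K = (let c = frame_const N K in N ^ 3 * K ^ 2 * (3 * N\<^sup>2 * c\<^sup>2 + N\<^sup>2 * c + 2 * N * c) + N ^ 3 * K ^ 3)"

locale metric_pair_bounded = metric_pair S x H u e f
  for S :: "(complex^'n::finite) set" and x H u e f +
  fixes K N :: real
  assumes card_N [simp]: "real CARD('n) = N"
    and K: "K \<ge> 1"
    and bH: "\<And>i j. cmod (H x $ i $ j) \<le> K"
    and b\<eta>: "\<And>i j. cmod (matrix_inv (H x) $ i $ j) \<le> K"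
    and bdH: "\<And>a i j. cmod (dz (axis a 1) (\<lambda>y. H y $ i $ j) x) \<le> K"
    and bd\<eta>: "\<And>a i j. cmod (dz (axis a 1) (\<lambda>y. matrix_inv (H y) $ i $ j) x) \<le> K"
    and bddH: "\<And>a b i j. cmod (dz (axis a 1) (dzb (axis b 1) (\<lambda>y. H y $ i $ j)) x) \<le> K"
    and bdd\<eta>: "\<And>a b i j. cmod (dz (axis a 1) (dzb (axis b 1) (\<lambda>y. matrix_inv (H y) $ i $ j)) x) \<le> K"
begin

abbreviation c1 :: real where "c1 \<equiv> frame_const N K"

definition p :: "'n \<Rightarrow> real" where "p i = l1 (f i)"

lemma N: "N \<ge> 1" unfolding card_N[symmetric] by (simp add: Suc_leI del: card_N)

lemma K_powers: "K \<le> K ^ 5" "K ^ 3 \<le> K ^ 5" "N\<^sup>2 \<le> N ^ 4" "1 \<le> N ^ 4" "1 \<le> K ^ 5" "0 \<le> K"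
  using K N power_increasing[of 1 5 K] power_increasing[of 3 5 K] power_increasing[of 2 4 N]
  by (auto simp: one_le_power)

lemma c1: "c1 \<ge> 0" "N ^ 4 * K ^ 5 \<le> c1" "2 * N\<^sup>2 * K ^ 3 \<le> c1" "N\<^sup>2 * K ^ 3 \<le> c1"
proof -
  have a: "0 \<le> N ^ 4 * K ^ 5" using K N by simp
  have b: "N\<^sup>2 * K ^ 3 \<le> N ^ 4 * K ^ 5" using K_powers K by (intro mult_mono) auto
  have d: "0 \<le> N\<^sup>2 * K ^ 3" using K N by simp
  have c: "c1 = 2 * (N ^ 4 * K ^ 5)" by (simp add: frame_const_def)
  show "c1 \<ge> 0" "N ^ 4 * K ^ 5 \<le> c1" "2 * N\<^sup>2 * K ^ 3 \<le> c1" "N\<^sup>2 * K ^ 3 \<le> c1"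
    using a b c d by linarith+
qed

lemma p_nonneg: "p i \<ge> 0" by (simp add: p_def l1_nonneg)

lemma e_nth: "cmod (e k $ j) \<le> K"
proof -
  have "matrix_inv (H x) $ j $ j = of_real (\<Sum>k\<in>UNIV. (cmod (e k $ j))\<^sup>2)"
    unfolding matrix_inv_frame[OF e] by (simp add: complex_norm_square del: of_real_power)
  then have "(\<Sum>k\<in>UNIV. (cmod (e k $ j))\<^sup>2) = cmod (matrix_inv (H x) $ j $ j)"
    by (simp add: sum_nonneg del: of_real_sum)
  moreover have "(cmod (e k $ j))\<^sup>2 \<le> (\<Sum>k\<in>UNIV. (cmod (e k $ j))\<^sup>2)" by (rule member_le_sum) auto
  ultimately have "(cmod (e k $ j))\<^sup>2 \<le> K" using b\<eta>[of j j] by simp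
  also have "K \<le> K\<^sup>2" using K by (simp add: power2_eq_square)
  finally show ?thesis by (rule power2_le_imp_le) (use K in simp)
qed

lemma e_l1: "l1 (e k) \<le> N * K"
  unfolding l1_def using sum_bounded_above[of UNIV "\<lambda>j. cmod (e k $ j)" K] e_nth by simp

lemma e_l1_sq: "l1 (e k) * l1 (e l) \<le> N\<^sup>2 * K\<^sup>2"
  using mult_mono[OF e_l1[of k] e_l1[of l]] l1_nonneg[of "e l"] N K by (simp add: power2_eq_square mult_ac)

lemma \<zeta>_frame: "\<zeta> = (\<Sum>i\<in>UNIV. \<Sum>k\<in>UNIV. (cmod (hform (H x) (f i) (e k)))\<^sup>2)"
proof -
  have "Re (hform (H x) (f i) (f i)) = (\<Sum>k\<in>UNIV. (cmod (hform (H x) (f i) (e k)))\<^sup>2)" for i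
  proof -
    have "hform (H x) (f i) (f i) = of_real (\<Sum>k\<in>UNIV. (cmod (hform (H x) (f i) (e k)))\<^sup>2)"
      unfolding hform_parseval[OF e, of "f i" "f i"] by (simp add: complex_norm_square del: of_real_power)
    then show ?thesis by simp
  qed
  then show ?thesis by (simp add: \<zeta>_def)
qed

lemma \<zeta>_nonneg: "\<zeta> \<ge> 0" unfolding \<zeta>_frame by (intro sum_nonneg) auto

text \<open>When \<open>f i\<close> is expanded in the frame \<open>e\<close>, the squared
  coefficients add up to \<open>\<zeta>\<close> over all \<open>i\<close>. Hence error terms
  quadratic in the frame \<open>f\<close> are multiples of \<open>\<zeta>\<close>, the quantity that
  the barrier dominates.\<close>

lemma p_sum: "(\<Sum>i\<in>UNIV. (p i)\<^sup>2) \<le> N ^ 3 * K\<^sup>2 * \<zeta>"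
proof -
  have "(p i)\<^sup>2 \<le> N ^ 3 * K\<^sup>2 * (\<Sum>k\<in>UNIV. (cmod (hform (H x) (f i) (e k)))\<^sup>2)" for i
  proof -
    let ?a = "\<lambda>k. cmod (hform (H x) (f i) (e k))"
    have "cmod (f i $ j) \<le> K * (\<Sum>k\<in>UNIV. ?a k)" for j
    proof -
      have "f i $ j = (\<Sum>k\<in>UNIV. hform (H x) (f i) (e k) *s e k) $ j"
        by (rule arg_cong[OF orthonormal_expand[OF e]])
      also have "\<dots> = (\<Sum>k\<in>UNIV. hform (H x) (f i) (e k) * e k $ j)" by simp
      also have "cmod \<dots> \<le> (\<Sum>k\<in>UNIV. K * ?a k)"
        by (rule order_trans[OF norm_sum], rule sum_mono) (simp add: norm_mult mult.commute[of K] mult_left_mono e_nth)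
      finally show ?thesis by (simp add: sum_distrib_left)
    qed
    then have "p i \<le> N * (K * (\<Sum>k\<in>UNIV. ?a k))"
      unfolding p_def l1_def using sum_bounded_above[of UNIV "\<lambda>j. cmod (f i $ j)" "K * (\<Sum>k\<in>UNIV. ?a k)"] by simp
    then have "(p i)\<^sup>2 \<le> (N * (K * (\<Sum>k\<in>UNIV. ?a k)))\<^sup>2" by (rule power_mono[OF _ p_nonneg])
    also have "\<dots> = N\<^sup>2 * K\<^sup>2 * (\<Sum>k\<in>UNIV. ?a k)\<^sup>2" by (simp add: power_mult_distrib)
    also have "\<dots> \<le> N\<^sup>2 * K\<^sup>2 * ((\<Sum>k\<in>UNIV. (?a k)\<^sup>2) * N)"
      using sum_squared_le_sum_of_squares[of ?a UNIV] by (intro mult_left_mono) auto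
    finally show ?thesis by (simp add: power2_eq_square power3_eq_cube mult_ac)
  qed
  then have "(\<Sum>i\<in>UNIV. (p i)\<^sup>2) \<le> (\<Sum>i\<in>UNIV. N ^ 3 * K\<^sup>2 * (\<Sum>k\<in>UNIV. (cmod (hform (H x) (f i) (e k)))\<^sup>2))"
    by (intro sum_mono)
  then show ?thesis unfolding \<zeta>_frame by (simp add: sum_distrib_left)
qed

lemma fr_bound:
  assumes "\<And>j m. cmod (b j m) \<le> B" shows "cmod (fr b k l) \<le> B * (N ^ 4 * K ^ 4)"
proof -
  have B: "B \<ge> 0" using assms norm_ge_zero order_trans by blast
  have a: "cmod (hform (H x) (axis j 1) (e k)) \<le> N * K\<^sup>2" for j k
  proof -
    have "cmod (hform (H x) (axis j 1) (e k)) \<le> K * l1 (axis j 1) * l1 (e k)"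
      by (rule hform_bound[OF bH])
    also have "\<dots> \<le> K * (N * K)" using K e_l1 by (simp add: l1_axis mult_left_mono)
    finally show ?thesis by (simp add: power2_eq_square mult_ac)
  qed
  have "cmod (fr b k l) \<le> (\<Sum>j\<in>(UNIV::'n set). \<Sum>m\<in>(UNIV::'n set). B * ((N * K\<^sup>2) * (N * K\<^sup>2)))"
    unfolding fr_def
    by (rule order_trans[OF norm_sum], rule sum_mono, rule order_trans[OF norm_sum], rule sum_mono)
      (simp only: norm_mult complex_mod_cnj, intro mult_mono assms a; use B N in simp)
  also have "\<dots> = B * (N ^ 4 * K ^ 4)" by (simp add: power2_eq_square power4_eq_xxxx mult_ac)
  finally show ?thesis .
qed

lemma c_bound: "cmod (c i k l) \<le> c1 * p i"
proof -
  have "cmod (c i k l) \<le> (K * p i) * (N ^ 4 * K ^ 4)"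
    unfolding c_def p_def by (rule fr_bound, rule dz_bound[OF dHinv bd\<eta>])
  also have "\<dots> = (N ^ 4 * K ^ 5) * p i" by (simp add: power_numeral_reduce)
  also have "\<dots> \<le> c1 * p i" using c1 p_nonneg by (intro mult_right_mono)
  finally show ?thesis .
qed

lemma T_bound: "cmod (T (f i) (e l) (e k)) \<le> c1 * p i"
proof -
  have dH: "(\<lambda>y. H y $ i $ j) differentiable (at x)" for i j
    by (rule Cinf_differentiable[OF Cinf_mat_nth[OF H] xS])
  have b: "cmod (dz v (\<lambda>y. hform (H y) a b) x) \<le> K * l1 v * l1 a * l1 b" for v a b
    unfolding dz_hform[OF dH] by (rule hform_bound) (simp add: dz_bound[OF dH bdH])
  have "cmod (T (f i) (e l) (e k)) \<le> K * p i * l1 (e l) * l1 (e k) + K * l1 (e l) * p i * l1 (e k)"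
    unfolding T_def p_def by (rule order_trans[OF norm_triangle_ineq4 add_mono[OF b b]])
  also have "\<dots> = 2 * (K * p i) * (l1 (e l) * l1 (e k))" by (simp add: mult_ac)
  also have "\<dots> \<le> 2 * (K * p i) * (N\<^sup>2 * K\<^sup>2)"
    using e_l1_sq K p_nonneg by (intro mult_left_mono) auto
  also have "\<dots> = (2 * N\<^sup>2 * K ^ 3) * p i" by (simp add: power2_eq_square power3_eq_cube mult_ac)
  also have "\<dots> \<le> c1 * p i" using c1 p_nonneg by (intro mult_right_mono)
  finally show ?thesis .
qed

lemma ddH_bound:
  "cmod (dz (f i) (dzb (f i) (\<lambda>y. hform (H y) (e k) (e k))) x) \<le> c1 * (p i)\<^sup>2"
  "cmod (dz (e k) (dzb (e k) (\<lambda>y. hform (H y) (f i) (f i))) x) \<le> c1 * (p i)\<^sup>2"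
proof -
  have b: "cmod (dz v (dzb v (\<lambda>y. hform (H y) a a)) x) \<le> K * l1 v * l1 v * l1 a * l1 a" for v a
    unfolding dz_dzb_hform[OF S xS H]
    by (rule hform_bound) (simp add: dz_dzb_bound[OF S Cinf_mat_nth[OF H] xS bddH])
  have "K * (p i)\<^sup>2 * (l1 (e k) * l1 (e k)) \<le> K * (p i)\<^sup>2 * (N\<^sup>2 * K\<^sup>2)"
    using e_l1_sq K by (intro mult_left_mono) auto
  also have "\<dots> = N\<^sup>2 * K ^ 3 * (p i)\<^sup>2" by (simp add: power2_eq_square power3_eq_cube mult_ac)
  also have "\<dots> \<le> c1 * (p i)\<^sup>2" using c1 by (intro mult_right_mono) auto
  finally have *: "K * (p i)\<^sup>2 * (l1 (e k) * l1 (e k)) \<le> c1 * (p i)\<^sup>2" .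
  show "cmod (dz (f i) (dzb (f i) (\<lambda>y. hform (H y) (e k) (e k))) x) \<le> c1 * (p i)\<^sup>2"
    using b[of "f i" "e k"] * by (simp add: p_def power2_eq_square mult_ac)
  show "cmod (dz (e k) (dzb (e k) (\<lambda>y. hform (H y) (f i) (f i))) x) \<le> c1 * (p i)\<^sup>2"
    using b[of "e k" "f i"] * by (simp add: p_def power2_eq_square mult_ac)
qed

lemma \<beta>_column: "(\<Sum>j\<in>UNIV. (cmod (\<beta> k j))\<^sup>2) \<le> \<tau> x"
  unfolding \<tau>_\<beta> by (rule member_le_sum[of k UNIV "\<lambda>k. \<Sum>j\<in>UNIV. (cmod (\<beta> k j))\<^sup>2"]) (auto intro: sum_nonneg)

lemma G_ee_bound: "cmod (hform (G x) (e k) (e l)) \<le> \<tau> x"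
proof -
  have "cmod (hform (G x) (e k) (e l)) \<le> (\<Sum>j\<in>UNIV. ((cmod (\<beta> k j))\<^sup>2 + (cmod (\<beta> l j))\<^sup>2) / 2)"
    unfolding hform_G_ee
  proof (rule order_trans[OF norm_sum], rule sum_mono)
    fix j
    show "cmod (\<beta> k j * cnj (\<beta> l j)) \<le> ((cmod (\<beta> k j))\<^sup>2 + (cmod (\<beta> l j))\<^sup>2) / 2"
      using sum_squares_bound[of "cmod (\<beta> k j)" "cmod (\<beta> l j)"] by (simp add: norm_mult)
  qed
  also have "\<dots> = ((\<Sum>j\<in>UNIV. (cmod (\<beta> k j))\<^sup>2) + (\<Sum>j\<in>UNIV. (cmod (\<beta> l j))\<^sup>2)) / 2"
    by (simp add: sum.distrib sum_divide_distrib[symmetric])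
  also have "\<dots> \<le> \<tau> x" using \<beta>_column[of k] \<beta>_column[of l] by simp
  finally show ?thesis .
qed

lemma dd\<eta>_bound:
  "cmod (\<Sum>j\<in>UNIV. \<Sum>m\<in>UNIV. dz (f i) (dzb (f i) (\<lambda>y. matrix_inv (H y) $ j $ m)) x * G x $ m $ j)
    \<le> N\<^sup>2 * c1 * (p i)\<^sup>2 * \<tau> x"
proof -
  let ?b = "fr (\<lambda>j m. dz (f i) (dzb (f i) (\<lambda>y. matrix_inv (H y) $ j $ m)) x)"
  have "cmod (?b k l) \<le> c1 * (p i)\<^sup>2" for k l
  proof -
    have "cmod (?b k l) \<le> (K * p i * p i) * (N ^ 4 * K ^ 4)"
      unfolding p_def by (rule fr_bound, rule dz_dzb_bound[OF S Cinf_mat_nth[OF Hinv] xS bdd\<eta>])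
    also have "\<dots> = (N ^ 4 * K ^ 5) * (p i)\<^sup>2" by (simp add: power_numeral_reduce)
    also have "\<dots> \<le> c1 * (p i)\<^sup>2" using c1 by (intro mult_right_mono) auto
    finally show ?thesis .
  qed
  then have "cmod (\<Sum>k\<in>UNIV. \<Sum>l\<in>UNIV. ?b k l * hform (G x) (e k) (e l))
     \<le> (\<Sum>k\<in>(UNIV::'n set). \<Sum>l\<in>(UNIV::'n set). (c1 * (p i)\<^sup>2) * \<tau> x)"
    by (intro order_trans[OF norm_sum] sum_mono) (simp only: norm_mult, intro mult_mono G_ee_bound; use c1 in simp)
  then show ?thesis unfolding fr_expand by (simp add: power2_eq_square mult_ac)
qed

lemma Y_bound: "(\<Sum>k\<in>UNIV. \<Sum>i\<in>UNIV. \<Sum>j\<in>UNIV. (cmod (Y k i j))\<^sup>2) \<le> N\<^sup>2 * c1\<^sup>2 * (\<Sum>i\<in>UNIV. (p i)\<^sup>2) * \<tau> x"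
proof -
  have "(cmod (Y l i j))\<^sup>2 \<le> c1\<^sup>2 * (p i)\<^sup>2 * (N * (\<Sum>k\<in>UNIV. (cmod (\<beta> k j))\<^sup>2))" for l i j
  proof -
    have "cmod (Y l i j) \<le> c1 * p i * (\<Sum>k\<in>UNIV. cmod (\<beta> k j))"
      unfolding Y_def sum_distrib_left
      by (rule order_trans[OF norm_sum], rule sum_mono) (simp add: norm_mult mult_right_mono c_bound)
    then have "(cmod (Y l i j))\<^sup>2 \<le> (c1 * p i * (\<Sum>k\<in>UNIV. cmod (\<beta> k j)))\<^sup>2" by (rule power_mono) simp
    also have "\<dots> = c1\<^sup>2 * (p i)\<^sup>2 * (\<Sum>k\<in>UNIV. cmod (\<beta> k j))\<^sup>2" by (simp add: power_mult_distrib)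
    also have "\<dots> \<le> c1\<^sup>2 * (p i)\<^sup>2 * (N * (\<Sum>k\<in>UNIV. (cmod (\<beta> k j))\<^sup>2))"
      using sum_squared_le_sum_of_squares[of "\<lambda>k. cmod (\<beta> k j)" UNIV]
      by (intro mult_left_mono) (auto simp: mult.commute)
    finally show ?thesis .
  qed
  then have "(\<Sum>k\<in>UNIV. \<Sum>i\<in>UNIV. \<Sum>j\<in>UNIV. (cmod (Y k i j))\<^sup>2)
      \<le> (\<Sum>l\<in>(UNIV::'n set). \<Sum>i\<in>UNIV. \<Sum>j\<in>UNIV. c1\<^sup>2 * (p i)\<^sup>2 * (N * (\<Sum>k\<in>UNIV. (cmod (\<beta> k j))\<^sup>2)))"
    by (intro sum_mono)
  also have "\<dots> = N * (\<Sum>i\<in>UNIV. c1\<^sup>2 * (p i)\<^sup>2 * (N * \<tau> x))"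
    unfolding \<tau>_\<beta> sum_distrib_left[symmetric] by (subst (2) sum.swap) simp
  also have "\<dots> = N\<^sup>2 * c1\<^sup>2 * (\<Sum>i\<in>UNIV. (p i)\<^sup>2) * \<tau> x"
    by (simp add: sum_distrib_left sum_distrib_right power2_eq_square mult_ac)
  finally show ?thesis .
qed

lemma E_bound: "(\<Sum>i\<in>UNIV. (cmod (E i))\<^sup>2) \<le> N\<^sup>2 * c1\<^sup>2 * (\<Sum>i\<in>UNIV. (p i)\<^sup>2)"
proof -
  have "(cmod (E i))\<^sup>2 \<le> N\<^sup>2 * c1\<^sup>2 * (p i)\<^sup>2" for i
  proof -
    have "cmod (E i) \<le> (\<Sum>k\<in>(UNIV::'n set). c1 * p i)"
      unfolding E_def by (rule order_trans[OF norm_sum], rule sum_mono) (rule T_bound)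
    then have "(cmod (E i))\<^sup>2 \<le> (N * (c1 * p i))\<^sup>2" by (intro power_mono) auto
    then show ?thesis by (simp add: power_mult_distrib mult_ac)
  qed
  then show ?thesis unfolding sum_distrib_left by (intro sum_mono)
qed

lemma geo_const_bounds:
  assumes "t \<ge> 0"
  shows "N\<^sup>2 * c1\<^sup>2 * (\<Sum>i\<in>UNIV. (p i)\<^sup>2) \<le> geo_const N K * \<zeta>"
    and "(N\<^sup>2 * c1\<^sup>2 * t + N\<^sup>2 * c1 * t + 2 * N * c1 + 2 * N\<^sup>2 * c1\<^sup>2) * (\<Sum>i\<in>UNIV. (p i)\<^sup>2) \<le> geo_const N K * (t + 1) * \<zeta>"
    and "N ^ 3 * K ^ 3 \<le> geo_const N K"
    and "geo_const N K \<ge> 0"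
proof -
  let ?P = "\<Sum>i\<in>UNIV. (p i)\<^sup>2" and ?q = "3 * N\<^sup>2 * c1\<^sup>2 + N\<^sup>2 * c1 + 2 * N * c1"
  have q: "?q \<ge> 0" "N ^ 3 * K ^ 3 \<ge> 0" "N ^ 3 * K\<^sup>2 \<ge> 0" "N\<^sup>2 * c1\<^sup>2 \<ge> 0" "N\<^sup>2 * c1 \<ge> 0" "2 * N * c1 \<ge> 0"
    using c1 N K by auto
  have g: "geo_const N K = N ^ 3 * K\<^sup>2 * ?q + N ^ 3 * K ^ 3" by (simp add: geo_const_def Let_def)
  show "N ^ 3 * K ^ 3 \<le> geo_const N K" "geo_const N K \<ge> 0" unfolding g using q by auto
  have P: "0 \<le> ?P" by (intro sum_nonneg) auto
  have main: "?q * ?P \<le> geo_const N K * \<zeta>"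
  proof -
    have "?q * ?P \<le> ?q * (N ^ 3 * K\<^sup>2 * \<zeta>)" by (intro mult_left_mono p_sum q)
    also have "\<dots> \<le> geo_const N K * \<zeta>"
      unfolding g using mult_nonneg_nonneg[OF q(2) \<zeta>_nonneg] by (simp add: algebra_simps)
    finally show ?thesis .
  qed
  have "N\<^sup>2 * c1\<^sup>2 * ?P \<le> ?q * ?P" using q P by (intro mult_right_mono) auto
  with main show "N\<^sup>2 * c1\<^sup>2 * ?P \<le> geo_const N K * \<zeta>" by linarith
  have "(N\<^sup>2 * c1\<^sup>2 * t + N\<^sup>2 * c1 * t + 2 * N * c1 + 2 * N\<^sup>2 * c1\<^sup>2) * ?P \<le> (?q * (t + 1)) * ?P"
  proof (intro mult_right_mono P)
    have "?q * (t + 1) - (N\<^sup>2 * c1\<^sup>2 * t + N\<^sup>2 * c1 * t + 2 * N * c1 + 2 * N\<^sup>2 * c1\<^sup>2)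
       = 2 * (N\<^sup>2 * c1\<^sup>2) * t + N\<^sup>2 * c1\<^sup>2 + N\<^sup>2 * c1 + 2 * N * c1 * t" by (simp add: algebra_simps)
    moreover have "\<dots> \<ge> 0" using q assms c1(1) N by (intro add_nonneg_nonneg mult_nonneg_nonneg) auto
    ultimately show "N\<^sup>2 * c1\<^sup>2 * t + N\<^sup>2 * c1 * t + 2 * N * c1 + 2 * N\<^sup>2 * c1\<^sup>2 \<le> ?q * (t + 1)" by linarith
  qed
  also have "\<dots> = (?q * ?P) * (t + 1)" by (simp only: mult_ac)
  also have "\<dots> \<le> (geo_const N K * \<zeta>) * (t + 1)" using main assms by (intro mult_right_mono) auto
  finally show "(N\<^sup>2 * c1\<^sup>2 * t + N\<^sup>2 * c1 * t + 2 * N * c1 + 2 * N\<^sup>2 * c1\<^sup>2) * ?P \<le> geo_const N K * (t + 1) * \<zeta>"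
    by (simp only: mult_ac)
qed

lemma E_geo: "(\<Sum>i\<in>UNIV. (cmod (E i))\<^sup>2) \<le> geo_const N K * \<zeta>"
  using E_bound geo_const_bounds(1)[of 0] by linarith

text \<open>Completing the square with \<open>Y\<close> absorbs the first derivatives of the background metric without
  losing a multiple of the third order term, so that the gradient term of \<open>ln \<tau>\<close> is controlled
  exactly and no normal coordinates are needed.\<close>

lemma laplace_\<tau>_lower:
  "Re (\<Sum>k\<in>UNIV. dz (e k) (dzb (e k) (\<lambda>y. of_real (ln (Re (det (G y)))))) x)
     + (\<Sum>i\<in>UNIV. (cmod (dz (f i) (\<lambda>y. of_real (\<tau> y)) x - E i))\<^sup>2) / \<tau> x
     - geo_const N K * (\<tau> x + 1) * \<zeta>
   \<le> Re (\<Sum>i\<in>UNIV. dz (f i) (dzb (f i) (\<lambda>y. of_real (\<tau> y))) x)"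
proof -
  let ?P = "\<Sum>i\<in>UNIV. (p i)\<^sup>2"
  let ?XY = "\<Sum>k\<in>UNIV. \<Sum>i\<in>UNIV. \<Sum>j\<in>UNIV. (cmod (X k i j + Y k i j))\<^sup>2"
  let ?YY = "\<Sum>k\<in>UNIV. \<Sum>i\<in>UNIV. \<Sum>j\<in>UNIV. (cmod (Y k i j))\<^sup>2"
  have sq: "(cmod (X k i j))\<^sup>2 + 2 * Re (Y k i j * cnj (X k i j)) = (cmod (X k i j + Y k i j))\<^sup>2 - (cmod (Y k i j))\<^sup>2" for k i j
    unfolding cmod_power2 by (simp add: power2_eq_square algebra_simps)
  have A: "(\<Sum>k\<in>UNIV. \<Sum>i\<in>UNIV. \<Sum>j\<in>UNIV. (cmod (X k i j))\<^sup>2 + 2 * Re (Y k i j * cnj (X k i j))) = ?XY - ?YY"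
    unfolding sq sum_subtractf ..
  let ?r1 = "\<Sum>i\<in>UNIV. \<Sum>k\<in>UNIV. dz (f i) (dzb (f i) (\<lambda>y. hform (H y) (e k) (e k))) x
        - dz (e k) (dzb (e k) (\<lambda>y. hform (H y) (f i) (f i))) x"
  let ?r2 = "\<Sum>i\<in>UNIV. \<Sum>j\<in>UNIV. \<Sum>m\<in>UNIV. dz (f i) (dzb (f i) (\<lambda>y. matrix_inv (H y) $ j $ m)) x * G x $ m $ j"
  let ?r3 = "\<Sum>i\<in>UNIV. \<Sum>k\<in>UNIV. \<Sum>l\<in>UNIV. c i k l * cnj (T (f i) (e l) (e k))"
  have "cmod ?r1 \<le> (\<Sum>i\<in>UNIV. \<Sum>k\<in>(UNIV::'n set). c1 * (p i)\<^sup>2 + c1 * (p i)\<^sup>2)"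
    by (rule order_trans[OF norm_sum], rule sum_mono, rule order_trans[OF norm_sum], rule sum_mono)
      (rule order_trans[OF norm_triangle_ineq4 add_mono[OF ddH_bound]])
  also have "\<dots> = 2 * N * c1 * ?P" by (simp add: sum_distrib_left mult_ac)
  finally have r1: "- (2 * N * c1 * ?P) \<le> Re ?r1" using abs_Re_le_cmod[of ?r1] by linarith
  have "cmod ?r2 \<le> (\<Sum>i\<in>UNIV. N\<^sup>2 * c1 * (p i)\<^sup>2 * \<tau> x)"
    by (rule order_trans[OF norm_sum], rule sum_mono) (rule dd\<eta>_bound)
  also have "\<dots> = N\<^sup>2 * c1 * \<tau> x * ?P" by (simp add: sum_distrib_left mult_ac)
  finally have r2: "- (N\<^sup>2 * c1 * \<tau> x * ?P) \<le> Re ?r2" using abs_Re_le_cmod[of ?r2] by linarith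
  have "cmod ?r3 \<le> (\<Sum>i\<in>UNIV. \<Sum>k\<in>(UNIV::'n set). \<Sum>l\<in>(UNIV::'n set). (c1 * p i) * (c1 * p i))"
    by (rule order_trans[OF norm_sum], rule sum_mono, rule order_trans[OF norm_sum], rule sum_mono,
        rule order_trans[OF norm_sum], rule sum_mono)
      (simp only: norm_mult complex_mod_cnj, intro mult_mono c_bound T_bound; use c1 p_nonneg in simp)
  also have "\<dots> = N\<^sup>2 * c1\<^sup>2 * ?P" by (simp add: sum_distrib_left power2_eq_square mult_ac)
  finally have r3: "- (N\<^sup>2 * c1\<^sup>2 * ?P) \<le> Re ?r3" using abs_Re_le_cmod[of ?r3] by linarith
  have g: "(\<Sum>i\<in>UNIV. (cmod (dz (f i) (\<lambda>y. of_real (\<tau> y)) x - E i))\<^sup>2) / \<tau> x \<le> ?XY"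
    using gradient_\<tau> \<tau>_pos by (simp add: divide_le_eq mult.commute)
  have "N\<^sup>2 * c1\<^sup>2 * ?P * \<tau> x + N\<^sup>2 * c1 * \<tau> x * ?P + 2 * N * c1 * ?P + 2 * (N\<^sup>2 * c1\<^sup>2 * ?P)
      = (N\<^sup>2 * c1\<^sup>2 * \<tau> x + N\<^sup>2 * c1 * \<tau> x + 2 * N * c1 + 2 * N\<^sup>2 * c1\<^sup>2) * ?P"
    by (simp add: algebra_simps)
  also have "\<dots> \<le> geo_const N K * (\<tau> x + 1) * \<zeta>"
    using geo_const_bounds(2)[of "\<tau> x"] \<tau>_pos by simp
  finally show ?thesis
    using laplace_\<tau>[unfolded A] Y_bound r1 r2 r3 g by linarith
qed

lemma laplace_\<rho>_bound:
  assumes "Cinf S \<rho>" "\<And>a b. cmod (dz (axis a 1) (dzb (axis b 1) (\<lambda>y. of_real (\<rho> y))) x) \<le> K"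
  shows "\<bar>Re (\<Sum>k\<in>UNIV. dz (e k) (dzb (e k) (\<lambda>y. of_real (\<rho> y))) x)\<bar> \<le> geo_const N K"
proof -
  have "cmod (dz (e k) (dzb (e k) (\<lambda>y. of_real (\<rho> y))) x) \<le> N\<^sup>2 * K ^ 3" for k
  proof -
    have "cmod (dz (e k) (dzb (e k) (\<lambda>y. of_real (\<rho> y))) x) \<le> K * l1 (e k) * l1 (e k)"
      by (rule dz_dzb_bound[OF S Cinf_of_real[OF S assms(1)] xS assms(2)])
    also have "\<dots> \<le> K * (N\<^sup>2 * K\<^sup>2)" using e_l1_sq[of k k] K by (simp add: mult.assoc mult_left_mono)
    finally show ?thesis by (simp add: power2_eq_square power3_eq_cube mult_ac)
  qed
  then have "cmod (\<Sum>k\<in>UNIV. dz (e k) (dzb (e k) (\<lambda>y. of_real (\<rho> y))) x) \<le> (\<Sum>k\<in>(UNIV::'n set). N\<^sup>2 * K ^ 3)"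
    by (intro order_trans[OF norm_sum] sum_mono)
  also have "\<dots> = N ^ 3 * K ^ 3" by (simp add: power2_eq_square power3_eq_cube)
  also have "\<dots> \<le> geo_const N K" by (rule geo_const_bounds(3)[of 0]) simp
  finally show ?thesis using abs_Re_le_cmod order_trans by blast
qed

end

section \<open>Comparison of the two metrics and the Laplacian of the speed\<close>

lemma det_frame:
  fixes M :: "complex^'n::finite^'n"
  assumes e: "orthonormal M e"
  shows "det (matrix_inv M ** G) = det (gram G e)"
proof -
  let ?p = "complex_of_real ((cmod (det (vec_lambda e)))\<^sup>2)"
  have "?p * det M = 1" using det_gram[of M e] e by (simp add: orthonormal_gram)
  moreover have "det (matrix_inv M) * det M = 1"
    using orthonormal_inverse(1)[OF e] unfolding orthonormal_matrix_inv[OF e] by (metis det_mul det_I)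
  ultimately have "?p = det (matrix_inv M)" by (metis mult.commute mult_cancel_left mult_zero_left zero_neq_one)
  then show ?thesis by (simp only: det_gram det_mul)
qed

context metric_pair_bounded
begin

text \<open>In its own frame \<open>G\<close> has trace \<open>N\<close>, and \<open>G\<close> is
  the background plus the Hessian of \<open>u\<close>. This is how differentiating the barrier
  produces a large multiple of \<open>\<zeta>\<close>.\<close>

lemma laplace_u: "Re (\<Sum>i\<in>UNIV. dz (f i) (dzb (f i) (\<lambda>y. of_real (u y))) x) = N - \<zeta>"
proof -
  have "Re (dz (f i) (dzb (f i) (\<lambda>y. of_real (u y))) x) = 1 - Re (hform (H x) (f i) (f i))" for i
  proof -
    have "hform (G x) (f i) (f i) = 1" using fG by (simp add: orthonormal_def)
    then have "1 = hform (H x) (f i) (f i) + dz (f i) (dzb (f i) (\<lambda>y. of_real (u y))) x"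
      using hform_G[OF xS, of "f i" "f i"] by simp
    from arg_cong[OF this, of Re] show ?thesis by simp
  qed
  then show ?thesis by (simp add: \<zeta>_def sum_subtractf)
qed

text \<open>The vector \<open>e k\<close> has coefficients \<open>\<beta> k j\<close> in the frame
  \<open>f\<close>, so Cauchy-Schwarz costs a factor \<open>\<tau> x\<close>. That factor disappears
  when the evolution of the trace is divided by the trace.\<close>

lemma gradient_compare:
  assumes "h differentiable (at x)"
  shows "(\<Sum>k\<in>UNIV. (cmod (dz (e k) h x))\<^sup>2) \<le> \<tau> x * (\<Sum>j\<in>UNIV. (cmod (dz (f j) h x))\<^sup>2)"
proof -
  have "(cmod (dz (e k) h x))\<^sup>2 \<le> (\<Sum>j\<in>UNIV. (cmod (\<beta> k j))\<^sup>2) * (\<Sum>j\<in>UNIV. (cmod (dz (f j) h x))\<^sup>2)" for k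
  proof -
    have "dz (e k) h x = (\<Sum>j\<in>UNIV. \<beta> k j * dz (f j) h x)"
      by (subst e_expand) (simp add: dz_vsum[OF assms] dz_scale[OF assms])
    then have "cmod (dz (e k) h x) \<le> (\<Sum>j\<in>UNIV. cmod (\<beta> k j) * cmod (dz (f j) h x))"
      by (simp add: sum_norm_le norm_mult)
    then have "(cmod (dz (e k) h x))\<^sup>2 \<le> (\<Sum>j\<in>UNIV. cmod (\<beta> k j) * cmod (dz (f j) h x))\<^sup>2"
      by (rule power_mono) simp
    also have "\<dots> \<le> (\<Sum>j\<in>UNIV. (cmod (\<beta> k j))\<^sup>2) * (\<Sum>j\<in>UNIV. (cmod (dz (f j) h x))\<^sup>2)"
      by (rule Cauchy_Schwarz_ineq_sum)
    finally show ?thesis .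
  qed
  then show ?thesis unfolding \<tau>_\<beta> sum_distrib_right by (intro sum_mono)
qed

definition hdet :: real where "hdet = Re (det (matrix_inv (H x) ** G x))"

lemma hdet_\<beta>: "hdet = (cmod (det (vec_lambda (\<lambda>k. vec_lambda (\<beta> k)))))\<^sup>2"
proof -
  let ?b = "vec_lambda (\<lambda>k. vec_lambda (\<beta> k)) :: complex^'n^'n"
  have "gram (G x) e = map_matrix cnj ?b ** transpose ?b"
    by (simp add: vec_eq_iff gram_def hform_G_ee matrix_matrix_mult_def transpose_def mult.commute)
  then have "det (gram (G x) e) = of_real ((cmod (det ?b))\<^sup>2)"
    by (simp add: det_mul det_cnj complex_norm_square mult.commute del: of_real_power)
  then show ?thesis by (simp add: hdet_def det_frame[OF e])
qed

text \<open>As det h is the squared modulus of \<open>det \<beta>\<close>, and no entry of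
  \<open>\<beta>\<close> exceeds the root of the trace, the Leibniz formula yields a crude
  arithmetic-geometric mean inequality. It serves to keep the trace away from zero.\<close>

lemma \<tau>_lower: "hdet \<le> (fact CARD('n))\<^sup>2 * \<tau> x ^ CARD('n)"
proof -
  let ?b = "vec_lambda (\<lambda>k. vec_lambda (\<beta> k)) :: complex^'n^'n"
  have "cmod (?b $ k $ j) \<le> sqrt (\<tau> x)" for k j
  proof -
    have "(cmod (\<beta> k j))\<^sup>2 \<le> (\<Sum>j\<in>UNIV. (cmod (\<beta> k j))\<^sup>2)" by (rule member_le_sum) auto
    then have "(cmod (\<beta> k j))\<^sup>2 \<le> \<tau> x" using \<beta>_column[of k] by linarith
    then show ?thesis by (simp add: real_le_rsqrt)
  qed
  then have "cmod (det ?b) \<le> fact CARD('n) * sqrt (\<tau> x) ^ CARD('n)" by (rule det_bound)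
  then have "(cmod (det ?b))\<^sup>2 \<le> (fact CARD('n) * sqrt (\<tau> x) ^ CARD('n))\<^sup>2" by (rule power_mono) simp
  also have "\<dots> = (fact CARD('n))\<^sup>2 * ((sqrt (\<tau> x))\<^sup>2) ^ CARD('n)"
    by (simp only: power_mult_distrib power_mult[symmetric] mult.commute[of 2])
  finally show ?thesis using \<tau>_pos by (simp add: hdet_\<beta>)
qed

text \<open>The inverse of \<open>\<beta>\<close> is the matrix of \<open>f\<close> in the frame
  \<open>e\<close>, with entries bounded through \<open>\<zeta>\<close>. Cramer's rule and the value
  of det h then bound \<open>\<beta>\<close>, so control of one trace and of the determinant gives
  control of the other trace.\<close>

lemma \<tau>_upper:
  assumes "\<zeta> \<le> Z"
  shows "\<tau> x \<le> N\<^sup>2 * (hdet * (fact CARD('n) * (1 + Z) ^ CARD('n))\<^sup>2)"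
proof -
  let ?b = "vec_lambda (\<lambda>k. vec_lambda (\<beta> k)) :: complex^'n^'n"
  let ?a = "vec_lambda (\<lambda>i. vec_lambda (\<lambda>k. hform (H x) (f i) (e k))) :: complex^'n^'n"
  have Z: "Z \<ge> 0" using assms \<zeta>_nonneg by linarith
  have "(?b ** ?a) $ k $ l = hform (H x) (e k) (e l)" for k l
  proof -
    have "hform (H x) (e k) (e l) = hform (H x) (\<Sum>j\<in>UNIV. \<beta> k j *s f j) (e l)"
      by (rule arg_cong[OF e_expand])
    then show ?thesis by (simp add: matrix_matrix_mult_def hform_sum_left hform_scale_left)
  qed
  then have "?b ** ?a = mat 1" using e by (simp add: vec_eq_iff orthonormal_def mat_def)
  then have ab: "?a ** ?b = mat 1" using matrix_left_right_inverse by blast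
  have "cmod (?a $ i $ k) \<le> 1 + Z" for i k
  proof -
    have "(cmod (hform (H x) (f i) (e k)))\<^sup>2 \<le> (\<Sum>k\<in>UNIV. (cmod (hform (H x) (f i) (e k)))\<^sup>2)"
      by (rule member_le_sum) auto
    also have "\<dots> \<le> \<zeta>" unfolding \<zeta>_frame
      by (rule member_le_sum[of i UNIV "\<lambda>i. \<Sum>k\<in>UNIV. (cmod (hform (H x) (f i) (e k)))\<^sup>2"]) (auto intro: sum_nonneg)
    also have "\<dots> \<le> (1 + Z)\<^sup>2"
    proof -
      have "(1 + Z)\<^sup>2 = 1 + 2 * Z + Z\<^sup>2" by (simp add: power2_sum)
      moreover have "0 \<le> Z\<^sup>2" by simp
      ultimately show ?thesis using assms Z by linarith
    qed
    finally show ?thesis unfolding vec_lambda_beta by (rule power2_le_imp_le) (use Z in simp)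
  qed
  then have "cmod (?b $ k $ j) \<le> cmod (det ?b) * (fact CARD('n) * (1 + Z) ^ CARD('n))" for k j
    using inverse_entry_bound[OF ab, of "1 + Z"] Z by simp
  then have "(cmod (\<beta> k j))\<^sup>2 \<le> (cmod (det ?b) * (fact CARD('n) * (1 + Z) ^ CARD('n)))\<^sup>2" for k j
    by (intro power_mono) auto
  then have "\<tau> x \<le> (\<Sum>k\<in>(UNIV::'n set). \<Sum>j\<in>(UNIV::'n set). (cmod (det ?b) * (fact CARD('n) * (1 + Z) ^ CARD('n)))\<^sup>2)"
    unfolding \<tau>_\<beta> by (intro sum_mono)
  then show ?thesis unfolding hdet_\<beta> power_mult_distrib[of "cmod (det ?b)"] by (simp add: power2_eq_square mult_ac)
qed

text \<open>\<open>w = \<Phi> \<psi>\<close> is the speed of the flow, with \<open>\<psi> = ln (det G) - \<rho>\<close>. As \<open>\<Phi>\<close> need not be concave,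
  the term with \<open>\<Phi>''\<close> can have the bad sign; it is bounded by the gradient of the speed itself.\<close>

lemma laplace_speed:
  assumes \<rho>: "Cinf S \<rho>" "\<And>a b. cmod (dz (axis a 1) (dzb (axis b 1) (\<lambda>y. of_real (\<rho> y))) x) \<le> K"
    and w: "\<And>y. y \<in> S \<Longrightarrow> w y = \<Phi> (ln (Re (det (G y))) - \<rho> y)"
    and \<Phi>1: "\<And>y. y \<in> S \<Longrightarrow> (\<Phi> has_real_derivative \<Phi>1 (ln (Re (det (G y))) - \<rho> y)) (at (ln (Re (det (G y))) - \<rho> y))"
    and \<Phi>2: "(\<Phi>1 has_real_derivative \<Phi>2) (at (ln (Re (det (G x))) - \<rho> x))"
    and a: "a = \<Phi>1 (ln (Re (det (G x))) - \<rho> x)" "a > 0"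
    and wC: "Cinf S w"
  shows "Re (\<Sum>k\<in>UNIV. dz (e k) (dzb (e k) (\<lambda>y. of_real (w y))) x)
    \<le> \<bar>\<Phi>2\<bar> / a\<^sup>2 * \<tau> x * (\<Sum>j\<in>UNIV. (cmod (dz (f j) (\<lambda>y. of_real (w y)) x))\<^sup>2)
     + a * (Re (\<Sum>i\<in>UNIV. dz (f i) (dzb (f i) (\<lambda>y. of_real (\<tau> y))) x)
            - (\<Sum>i\<in>UNIV. (cmod (dz (f i) (\<lambda>y. of_real (\<tau> y)) x - E i))\<^sup>2) / \<tau> x
            + geo_const N K * (\<tau> x + 1) * \<zeta> + geo_const N K)"
proof -
  define L where "L y = ln (Re (det (G y)))" for y
  have LC: "Cinf S L"
    unfolding L_def
    by (intro Cinf_compose_real[OF Cinf_ln] Cinf_Re Cinf_det S Gmat) (use hermitian_posdef_det_Re(2)[OF GPD] in auto)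
  let ?\<psi> = "\<lambda>y. L y - \<rho> y"
  have \<psi>C: "Cinf S ?\<psi>" by (intro Cinf_diff S LC \<rho>)
  have cong: "dz v (\<lambda>y. of_real (w y)) y = dz v (\<lambda>y. of_real (\<Phi> (?\<psi> y))) y"
     "dzb v (\<lambda>y. of_real (w y)) y = dzb v (\<lambda>y. of_real (\<Phi> (?\<psi> y))) y" if "y \<in> S" for v y
    using that w Cinf_differentiable[OF Cinf_of_real[OF S wC] that]
    by (auto intro!: dz_cong[OF S] dzb_cong[OF S] simp: L_def)
  have grad: "dz v (\<lambda>y. of_real (w y)) x = of_real a * dz v (\<lambda>y. of_real (?\<psi> y)) x" for v
    unfolding cong(1)[OF xS] a(1)
    by (rule dz_compose_real[OF Cinf_differentiable[OF \<psi>C xS]]) (use \<Phi>1[OF xS] in \<open>simp add: L_def\<close>)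
  have lap: "dz v (dzb v (\<lambda>y. of_real (w y))) x = of_real (\<Phi>2 * (cmod (dz v (\<lambda>y. of_real (?\<psi> y)) x))\<^sup>2)
      + of_real a * dz v (dzb v (\<lambda>y. of_real (?\<psi> y))) x" for v
  proof -
    have "dz v (dzb v (\<lambda>y. of_real (w y))) x = dz v (dzb v (\<lambda>y. of_real (\<Phi> (?\<psi> y)))) x"
      by (rule dz_cong[OF S xS cong(2)]) (auto intro: Cinf_differentiable[OF Cinf_dzb[OF S Cinf_of_real[OF S wC]] xS])
    also have "\<dots> = of_real (\<Phi>2 * (cmod (dz v (\<lambda>y. of_real (?\<psi> y)) x))\<^sup>2)
      + of_real (\<Phi>1 (?\<psi> x)) * dz v (dzb v (\<lambda>y. of_real (?\<psi> y))) x"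
      by (rule dz_dzb_compose_real[OF S \<psi>C xS]) (use \<Phi>1 \<Phi>2 in \<open>auto simp: L_def\<close>)
    finally show ?thesis by (simp add: a(1) L_def)
  qed
  have diff: "dz v (dzb v (\<lambda>y. of_real (?\<psi> y))) x = dz v (dzb v (\<lambda>y. of_real (L y))) x - dz v (dzb v (\<lambda>y. of_real (\<rho> y))) x" for v
  proof -
    have "dzb v (\<lambda>y. of_real (?\<psi> y)) y = dzb v (\<lambda>y. of_real (L y)) y - dzb v (\<lambda>y. of_real (\<rho> y)) y" if "y \<in> S" for y
      using that by (simp add: dzb_diff Cinf_differentiable[OF Cinf_of_real[OF S LC]] Cinf_differentiable[OF Cinf_of_real[OF S \<rho>(1)]])
    then have "dz v (dzb v (\<lambda>y. of_real (?\<psi> y))) x = dz v (\<lambda>y. dzb v (\<lambda>y. of_real (L y)) y - dzb v (\<lambda>y. of_real (\<rho> y)) y) x"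
      by (rule dz_cong[OF S xS _ Cinf_differentiable[OF Cinf_dzb[OF S Cinf_of_real[OF S \<psi>C]] xS]])
    also have "\<dots> = dz v (dzb v (\<lambda>y. of_real (L y))) x - dz v (dzb v (\<lambda>y. of_real (\<rho> y))) x"
      by (rule dz_diff) (auto intro: Cinf_differentiable[OF Cinf_dzb[OF S Cinf_of_real[OF S LC]] xS]
          Cinf_differentiable[OF Cinf_dzb[OF S Cinf_of_real[OF S \<rho>(1)]] xS])
    finally show ?thesis .
  qed
  let ?We = "\<Sum>k\<in>UNIV. (cmod (dz (e k) (\<lambda>y. of_real (?\<psi> y)) x))\<^sup>2"
  let ?Wf = "\<Sum>j\<in>UNIV. (cmod (dz (f j) (\<lambda>y. of_real (?\<psi> y)) x))\<^sup>2"
  let ?LL = "Re (\<Sum>k\<in>UNIV. dz (e k) (dzb (e k) (\<lambda>y. of_real (L y))) x)"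
  let ?L\<rho> = "Re (\<Sum>k\<in>UNIV. dz (e k) (dzb (e k) (\<lambda>y. of_real (\<rho> y))) x)"
  have eq: "Re (\<Sum>k\<in>UNIV. dz (e k) (dzb (e k) (\<lambda>y. of_real (w y))) x) = \<Phi>2 * ?We + a * (?LL - ?L\<rho>)"
    unfolding lap diff by (simp add: sum.distrib sum_distrib_left sum_subtractf right_diff_distrib)
  have "\<Phi>2 * ?We \<le> \<bar>\<Phi>2\<bar> * ?We" by (intro mult_right_mono sum_nonneg) auto
  also have "\<dots> \<le> \<bar>\<Phi>2\<bar> * (\<tau> x * ?Wf)"
    by (intro mult_left_mono gradient_compare Cinf_differentiable[OF Cinf_of_real[OF S \<psi>C] xS]) auto
  also have "?Wf = (\<Sum>j\<in>UNIV. (cmod (dz (f j) (\<lambda>y. of_real (w y)) x))\<^sup>2) / a\<^sup>2"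
    unfolding grad using a(2) by (simp add: norm_mult power_mult_distrib sum_distrib_left[symmetric])
  finally have 1: "\<Phi>2 * ?We \<le> \<bar>\<Phi>2\<bar> / a\<^sup>2 * \<tau> x * (\<Sum>j\<in>UNIV. (cmod (dz (f j) (\<lambda>y. of_real (w y)) x))\<^sup>2)"
    by simp
  have "\<bar>?L\<rho>\<bar> \<le> geo_const N K" by (rule laplace_\<rho>_bound[OF \<rho>])
  \<comment> \<open>The lower bound for the Laplacian of the trace is read backwards: it bounds the
    background Laplacian of \<open>ln (det G)\<close>, the leading part of the Laplacian of the
    speed, from above.\<close>
  then have "?LL - ?L\<rho> \<le> Re (\<Sum>i\<in>UNIV. dz (f i) (dzb (f i) (\<lambda>y. of_real (\<tau> y))) x)
            - (\<Sum>i\<in>UNIV. (cmod (dz (f i) (\<lambda>y. of_real (\<tau> y)) x - E i))\<^sup>2) / \<tau> x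
            + geo_const N K * (\<tau> x + 1) * \<zeta> + geo_const N K"
    using laplace_\<tau>_lower unfolding L_def by linarith
  then have "a * (?LL - ?L\<rho>) \<le> a * (Re (\<Sum>i\<in>UNIV. dz (f i) (dzb (f i) (\<lambda>y. of_real (\<tau> y))) x)
            - (\<Sum>i\<in>UNIV. (cmod (dz (f i) (\<lambda>y. of_real (\<tau> y)) x - E i))\<^sup>2) / \<tau> x
            + geo_const N K * (\<tau> x + 1) * \<zeta> + geo_const N K)"
    using a(2) by (intro mult_left_mono) auto
  then show ?thesis using eq 1 by linarith
qed

end

text \<open>The algebra at an interior maximum of \<open>ln \<tau> + B w\<^sup>2 + \<gamma> \<phi>\<close>: \<open>D\<close>, \<open>W\<close>, \<open>U\<close> are the gradients of
  \<open>\<tau>\<close>, \<open>w\<close>, \<open>u\<close> in a frame, and \<open>L\<close> denotes Laplacians.\<close>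

lemma maximum_point_estimate:
  fixes D W U E :: "'n::finite \<Rightarrow> complex" and \<tau> \<zeta> a M C B Kw A c0 w \<gamma>1 \<gamma>2 m1 N :: real
  assumes \<tau>: "\<tau> \<ge> c0" "c0 > 0" and \<zeta>: "\<zeta> \<ge> 0" and a: "a \<ge> m1" "m1 > 0" and N: "N \<ge> 0"
    and M: "M \<le> B * a" and B: "B > 0" and C: "C \<ge> 0" and w: "\<bar>w\<bar> \<le> Kw"
    and \<gamma>: "- (A + 1) \<le> \<gamma>1" "\<gamma>1 \<le> - A" "A \<ge> 0" "\<gamma>2 > 0"
    and E: "(\<Sum>i\<in>UNIV. (cmod (E i))\<^sup>2) \<le> C * \<zeta>"
    and grad: "\<And>i. D i / of_real \<tau> + of_real (2 * B * w) * W i + of_real \<gamma>1 * U i = 0"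
    and hess: "L\<tau> / \<tau> - (\<Sum>i\<in>UNIV. (cmod (D i))\<^sup>2) / \<tau>\<^sup>2 + 2 * B * w * Lw + 2 * B * (\<Sum>i\<in>UNIV. (cmod (W i))\<^sup>2)
       + \<gamma>1 * (N - \<zeta>) + \<gamma>2 * (\<Sum>i\<in>UNIV. (cmod (U i))\<^sup>2) \<le> 0"
    and time: "0 \<le> \<tau>t / \<tau> + 2 * B * w * (a * Lw) + \<gamma>1 * (w - Kw)"
    and \<tau>t: "\<tau>t \<le> M * \<tau> * (\<Sum>i\<in>UNIV. (cmod (W i))\<^sup>2)
       + a * (L\<tau> - (\<Sum>i\<in>UNIV. (cmod (D i - E i))\<^sup>2) / \<tau> + C * (\<tau> + 1) * \<zeta> + C)"
    and A: "A = 4 * B * Kw\<^sup>2 * C / c0\<^sup>2 + C * (1 + 1 / c0) + 2"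
  shows "\<tau>\<^sup>2 < C * (A + 1)\<^sup>2 / \<gamma>2 \<or> \<zeta> \<le> C / c0 + (A + 1) * N + 2 * (A + 1) * Kw / m1"
proof (rule disjCI)
  assume "\<not> \<zeta> \<le> C / c0 + (A + 1) * N + 2 * (A + 1) * Kw / m1"
  then have \<zeta>big: "\<zeta> > C / c0 + (A + 1) * N + 2 * (A + 1) * Kw / m1" by simp
  show "\<tau>\<^sup>2 < C * (A + 1)\<^sup>2 / \<gamma>2"
  proof (rule ccontr)
    assume "\<not> \<tau>\<^sup>2 < C * (A + 1)\<^sup>2 / \<gamma>2"
    then have big: "C * (A + 1)\<^sup>2 / \<gamma>2 \<le> \<tau>\<^sup>2" by simp
    have t0: "\<tau> > 0" and a0: "a > 0" and Kw: "Kw \<ge> 0" using \<tau> a w by auto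
    let ?DD = "\<Sum>i\<in>UNIV. (cmod (D i))\<^sup>2" and ?WW = "\<Sum>i\<in>UNIV. (cmod (W i))\<^sup>2" and ?UU = "\<Sum>i\<in>UNIV. (cmod (U i))\<^sup>2"
      and ?EE = "\<Sum>i\<in>UNIV. (cmod (E i))\<^sup>2" and ?DE = "\<Sum>i\<in>UNIV. (cmod (D i - E i))\<^sup>2"
    have WW: "?WW \<ge> 0" by (auto intro: sum_nonneg)
    \<comment> \<open>At a critical point \<open>D i\<close> is \<open>- \<tau>\<close> times a
      combination of \<open>W i\<close> and \<open>U i\<close>, so the torsion cross term
      \<open>2 * |D i| * |E i|\<close> splits in two. Young's inequality charges the first product
      to \<open>B * |W i|^2\<close>, half of what the square of \<open>w\<close> provides, and the
      second to \<open>\<gamma>2 * |U i|^2\<close>.\<close>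
    have pt: "(cmod (D i))\<^sup>2 - (cmod (D i - E i))\<^sup>2
        \<le> \<tau>\<^sup>2 * (B * (cmod (W i))\<^sup>2 + \<gamma>2 * (cmod (U i))\<^sup>2) + (4 * B * Kw\<^sup>2 + (A + 1)\<^sup>2 / \<gamma>2) * (cmod (E i))\<^sup>2" for i
    proof -
      have "D i = - of_real \<tau> * (of_real (2 * B * w) * W i + of_real \<gamma>1 * U i)"
        using grad[of i] t0 by (simp add: field_simps add_eq_0_iff)
      then have "cmod (D i) = \<tau> * cmod (of_real (2 * B * w) * W i + of_real \<gamma>1 * U i)"
        using t0 by (simp add: norm_mult)
      also have "\<dots> \<le> \<tau> * (2 * B * Kw * cmod (W i) + (A + 1) * cmod (U i))"
      proof (intro mult_left_mono order_trans[OF norm_triangle_ineq] add_mono)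
        show "cmod (of_real (2 * B * w) * W i) \<le> 2 * B * Kw * cmod (W i)"
          using w B by (simp add: norm_mult abs_mult mult_right_mono mult_left_mono)
        show "cmod (of_real \<gamma>1 * U i) \<le> (A + 1) * cmod (U i)"
          unfolding norm_mult norm_of_real using \<gamma> by (intro mult_right_mono) auto
      qed (use t0 in simp)
      finally have Dle: "cmod (D i) \<le> \<tau> * (2 * B * Kw * cmod (W i) + (A + 1) * cmod (U i))" .
      have "(cmod (D i))\<^sup>2 - (cmod (D i - E i))\<^sup>2 \<le> 2 * cmod (D i) * cmod (E i)"
      proof -
        have "(cmod (D i - E i))\<^sup>2 = (cmod (D i))\<^sup>2 + (cmod (E i))\<^sup>2 - 2 * Re (D i * cnj (E i))"
          unfolding cmod_power2 by (simp add: power2_eq_square algebra_simps)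
        moreover have "Re (D i * cnj (E i)) \<le> cmod (D i) * cmod (E i)"
          using complex_Re_le_cmod[of "D i * cnj (E i)"] by (simp add: norm_mult)
        moreover have "0 \<le> (cmod (E i))\<^sup>2" by simp
        moreover have "2 * cmod (D i) * cmod (E i) = 2 * (cmod (D i) * cmod (E i))" by simp
        ultimately show ?thesis by linarith
      qed
      also have "\<dots> \<le> 2 * (\<tau> * (2 * B * Kw * cmod (W i) + (A + 1) * cmod (U i))) * cmod (E i)"
        using Dle by (intro mult_right_mono mult_left_mono) auto
      also have "\<dots> = B * (2 * (\<tau> * cmod (W i)) * (2 * Kw * cmod (E i))) + 2 * (\<tau> * cmod (U i)) * ((A + 1) * cmod (E i))"
        by (simp add: algebra_simps)
      also have "\<dots> \<le> B * ((\<tau> * cmod (W i))\<^sup>2 + (2 * Kw * cmod (E i))\<^sup>2)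
          + (\<gamma>2 * (\<tau> * cmod (U i))\<^sup>2 + ((A + 1) * cmod (E i))\<^sup>2 / \<gamma>2)"
      proof (intro add_mono mult_left_mono sum_squares_bound)
        let ?u = "\<tau> * cmod (U i)" and ?v = "(A + 1) * cmod (E i)"
        have "0 \<le> (\<gamma>2 * ?u - ?v)\<^sup>2 / \<gamma>2" using \<gamma> by simp
        also have "\<dots> = \<gamma>2 * ?u\<^sup>2 + ?v\<^sup>2 / \<gamma>2 - 2 * ?u * ?v"
          using \<gamma> by (simp add: power2_diff power2_eq_square field_simps)
        finally show "2 * ?u * ?v \<le> \<gamma>2 * ?u\<^sup>2 + ?v\<^sup>2 / \<gamma>2" by simp
      qed (use B in simp)
      also have "\<dots> = \<tau>\<^sup>2 * (B * (cmod (W i))\<^sup>2 + \<gamma>2 * (cmod (U i))\<^sup>2) + (4 * B * Kw\<^sup>2 + (A + 1)\<^sup>2 / \<gamma>2) * (cmod (E i))\<^sup>2"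
        unfolding power_mult_distrib by (simp add: algebra_simps)
      finally show ?thesis .
    qed
    have "?DD - ?DE \<le> (\<Sum>i\<in>UNIV. \<tau>\<^sup>2 * (B * (cmod (W i))\<^sup>2 + \<gamma>2 * (cmod (U i))\<^sup>2) + (4 * B * Kw\<^sup>2 + (A + 1)\<^sup>2 / \<gamma>2) * (cmod (E i))\<^sup>2)"
      unfolding sum_subtractf[symmetric] by (intro sum_mono pt)
    also have "\<dots> = \<tau>\<^sup>2 * (B * ?WW + \<gamma>2 * ?UU) + (4 * B * Kw\<^sup>2 + (A + 1)\<^sup>2 / \<gamma>2) * ?EE"
      by (simp add: sum.distrib sum_distrib_left algebra_simps)
    also have "\<dots> \<le> \<tau>\<^sup>2 * (B * ?WW + \<gamma>2 * ?UU) + (4 * B * Kw\<^sup>2 + (A + 1)\<^sup>2 / \<gamma>2) * (C * \<zeta>)"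
      using E B \<gamma> by (intro add_left_mono mult_left_mono) auto
    \<comment> \<open>Outside the first alternative \<open>C * (A + 1)\<^sup>2 / \<gamma>2\<close>
      is at most \<open>\<tau>\<^sup>2\<close>, so after division by \<open>\<tau>\<^sup>2\<close>
      it costs only one \<open>\<zeta>\<close>. In the application \<open>1 / \<gamma>2\<close>
      grows like the cube of \<open>y + 1\<close>, which is why the alternative cannot be avoided by
      a larger constant.\<close>
    also have "\<dots> \<le> \<tau>\<^sup>2 * (B * ?WW + \<gamma>2 * ?UU) + \<tau>\<^sup>2 * ((4 * B * Kw\<^sup>2 * C / c0\<^sup>2 + 1) * \<zeta>)"
    proof -
      have "4 * B * Kw\<^sup>2 * C \<le> \<tau>\<^sup>2 * (4 * B * Kw\<^sup>2 * C / c0\<^sup>2)"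
      proof -
        have "c0\<^sup>2 \<le> \<tau>\<^sup>2" using \<tau> by (intro power_mono) auto
        then have "c0\<^sup>2 * (4 * B * Kw\<^sup>2 * C / c0\<^sup>2) \<le> \<tau>\<^sup>2 * (4 * B * Kw\<^sup>2 * C / c0\<^sup>2)"
          using B C by (intro mult_right_mono) auto
        then show ?thesis using \<tau> by simp
      qed
      then have "4 * B * Kw\<^sup>2 * C + C * (A + 1)\<^sup>2 / \<gamma>2 \<le> \<tau>\<^sup>2 * (4 * B * Kw\<^sup>2 * C / c0\<^sup>2) + \<tau>\<^sup>2"
        using big by linarith
      then have "(4 * B * Kw\<^sup>2 * C + C * (A + 1)\<^sup>2 / \<gamma>2) * \<zeta> \<le> (\<tau>\<^sup>2 * (4 * B * Kw\<^sup>2 * C / c0\<^sup>2) + \<tau>\<^sup>2) * \<zeta>"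
        using \<zeta> by (intro mult_right_mono)
      then show ?thesis by (simp add: algebra_simps)
    qed
    finally have DE: "(?DD - ?DE) / \<tau>\<^sup>2 \<le> B * ?WW + \<gamma>2 * ?UU + (4 * B * Kw\<^sup>2 * C / c0\<^sup>2 + 1) * \<zeta>"
      using t0 by (simp add: divide_le_eq algebra_simps)
    have "\<tau>t / \<tau> \<le> (M * \<tau> * ?WW + a * (L\<tau> - ?DE / \<tau> + C * (\<tau> + 1) * \<zeta> + C)) / \<tau>"
      using \<tau>t t0 by (intro divide_right_mono) auto
    also have "\<dots> = M * ?WW + a * (L\<tau> / \<tau> - ?DE / \<tau>\<^sup>2 + C * (1 + 1 / \<tau>) * \<zeta> + C / \<tau>)"
      using t0 by (simp add: field_simps power2_eq_square)
    \<comment> \<open>Here the second half of the gradient term is used: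
      \<open>M \<le> B * a\<close> puts the contribution of the second derivative of \<Phi> below
      \<open>B * a * ?WW\<close>.\<close>
    also have "\<dots> \<le> B * a * ?WW + a * (L\<tau> / \<tau> - ?DE / \<tau>\<^sup>2 + C * (1 + 1 / c0) * \<zeta> + C / c0)"
    proof -
      have "1 / \<tau> \<le> 1 / c0" using \<tau> by (intro divide_left_mono) auto
      then have 1: "C * (1 + 1 / \<tau>) * \<zeta> \<le> C * (1 + 1 / c0) * \<zeta>"
        using C \<zeta> by (intro mult_right_mono mult_left_mono) auto
      have 2: "C / \<tau> \<le> C / c0" using C \<tau> t0 by (intro divide_left_mono) auto
      have "M * ?WW \<le> B * a * ?WW" using M WW by (rule mult_right_mono)
      moreover have "a * (L\<tau> / \<tau> - ?DE / \<tau>\<^sup>2 + C * (1 + 1 / \<tau>) * \<zeta> + C / \<tau>)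
          \<le> a * (L\<tau> / \<tau> - ?DE / \<tau>\<^sup>2 + C * (1 + 1 / c0) * \<zeta> + C / c0)"
        using 1 2 a0 by (intro mult_left_mono) auto
      ultimately show ?thesis by linarith
    qed
    finally have \<tau>t': "\<tau>t / \<tau> \<le> B * a * ?WW + a * (L\<tau> / \<tau> - ?DE / \<tau>\<^sup>2 + C * (1 + 1 / c0) * \<zeta> + C / c0)" .
    have "a * (L\<tau> / \<tau> - ?DE / \<tau>\<^sup>2 + 2 * B * w * Lw + B * ?WW)
       \<le> a * ((?DD - ?DE) / \<tau>\<^sup>2 - B * ?WW - \<gamma>1 * (N - \<zeta>) - \<gamma>2 * ?UU)"
      using hess a0 by (intro mult_left_mono) (auto simp: diff_divide_distrib)
    also have "\<dots> \<le> a * ((4 * B * Kw\<^sup>2 * C / c0\<^sup>2 + 1) * \<zeta> - \<gamma>1 * (N - \<zeta>))"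
      using DE a0 by (intro mult_left_mono) auto
    finally have h: "a * (L\<tau> / \<tau> - ?DE / \<tau>\<^sup>2 + 2 * B * w * Lw + B * ?WW) \<le> a * ((4 * B * Kw\<^sup>2 * C / c0\<^sup>2 + 1) * \<zeta> - \<gamma>1 * (N - \<zeta>))" .
    have "0 \<le> a * (L\<tau> / \<tau> - ?DE / \<tau>\<^sup>2 + 2 * B * w * Lw + B * ?WW) + a * (C * (1 + 1 / c0) * \<zeta> + C / c0) + \<gamma>1 * (w - Kw)"
      using time \<tau>t' by (simp add: algebra_simps)
    also have "\<dots> \<le> a * ((4 * B * Kw\<^sup>2 * C / c0\<^sup>2 + 1) * \<zeta> - \<gamma>1 * (N - \<zeta>)) + a * (C * (1 + 1 / c0) * \<zeta> + C / c0) + \<gamma>1 * (w - Kw)"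
      using h by simp
    \<comment> \<open>By the choice of \<open>A\<close> the terms in \<open>\<zeta>\<close> other
      than that of the barrier add up to \<open>(A - 1) * \<zeta>\<close>. With
      \<open>\<gamma>1 \<le> - A\<close> a full \<open>- \<zeta>\<close> is left over, and it bounds
      \<open>\<zeta>\<close>.\<close>
    also have "\<dots> = a * ((A - 1) * \<zeta> + C / c0 - \<gamma>1 * N + \<gamma>1 * \<zeta>) + \<gamma>1 * (w - Kw)"
      unfolding A by (simp add: algebra_simps)
    also have "\<dots> \<le> a * ((A - 1) * \<zeta> + C / c0 + (A + 1) * N - A * \<zeta>) + (A + 1) * (2 * Kw)"
    proof (intro add_mono mult_left_mono)
      have "- \<gamma>1 * N \<le> (A + 1) * N" "\<gamma>1 * \<zeta> \<le> - A * \<zeta>"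
        using \<gamma> N \<zeta> mult_right_mono[of "- \<gamma>1" "A + 1" N] mult_right_mono[of \<gamma>1 "- A" \<zeta>] by auto
      then show "(A - 1) * \<zeta> + C / c0 - \<gamma>1 * N + \<gamma>1 * \<zeta> \<le> (A - 1) * \<zeta> + C / c0 + (A + 1) * N - A * \<zeta>" by simp
      have "\<gamma>1 * (w - Kw) = (- \<gamma>1) * (Kw - w)" by (simp add: algebra_simps)
      also have "\<dots> \<le> (A + 1) * (2 * Kw)" using \<gamma> w by (intro mult_mono) auto
      finally show "\<gamma>1 * (w - Kw) \<le> (A + 1) * (2 * Kw)" .
    qed (use a0 in simp)
    finally have "a * \<zeta> \<le> a * (C / c0 + (A + 1) * N) + (A + 1) * (2 * Kw)" by (simp add: algebra_simps)
    also have "\<dots> \<le> a * (C / c0 + (A + 1) * N) + a * (2 * (A + 1) * Kw / m1)"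
    proof -
      have "m1 * (2 * (A + 1) * Kw / m1) \<le> a * (2 * (A + 1) * Kw / m1)"
        using a \<gamma> Kw by (intro mult_right_mono) auto
      moreover have "m1 * (2 * (A + 1) * Kw / m1) = (A + 1) * (2 * Kw)" using a by simp
      ultimately show ?thesis by linarith
    qed
    finally have "a * \<zeta> \<le> a * (C / c0 + (A + 1) * N + 2 * (A + 1) * Kw / m1)" by (simp add: algebra_simps)
    then show False using \<zeta>big a0 by simp
  qed
qed

section \<open>Change of charts\<close>

text \<open>Velocity \<open>\<gamma>1\<close> and acceleration \<open>\<gamma>2\<close> are given
  separately, the latter at 0 only. Expanding the velocity in the standard basis reduces everything
  to the scalar product rule, and symmetry of the second derivative of \<open>h\<close> puts the sum
  together again.\<close>

lemma second_derivative_along_curve: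
  fixes h :: "'a::euclidean_space \<Rightarrow> real" and \<gamma> \<gamma>1 :: "real \<Rightarrow> 'a"
  assumes S: "open S" and h: "Cinf S h" and d: "d > 0"
    and \<gamma>: "\<And>s. \<bar>s\<bar> < d \<Longrightarrow> (\<gamma> has_vector_derivative \<gamma>1 s) (at s)" "\<And>s. \<bar>s\<bar> < d \<Longrightarrow> \<gamma> s \<in> S"
    and \<gamma>1: "(\<gamma>1 has_vector_derivative \<gamma>2) (at 0)"
  shows "\<And>s. \<bar>s\<bar> < d \<Longrightarrow> ((\<lambda>s. h (\<gamma> s)) has_real_derivative frechet_derivative h (at (\<gamma> s)) (\<gamma>1 s)) (at s)"
    and "((\<lambda>s. frechet_derivative h (at (\<gamma> s)) (\<gamma>1 s)) has_real_derivative
       frechet_derivative (\<lambda>y. frechet_derivative h (at y) (\<gamma>1 0)) (at (\<gamma> 0)) (\<gamma>1 0)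
       + frechet_derivative h (at (\<gamma> 0)) \<gamma>2) (at 0)"
proof -
  have comp: "((\<lambda>s. k (\<gamma> s)) has_real_derivative frechet_derivative k (at (\<gamma> s)) (\<gamma>1 s)) (at s)"
    if s: "\<bar>s\<bar> < d" and k: "Cinf S k" for k :: "'a \<Rightarrow> real" and s
  proof -
    have lin: "linear (frechet_derivative k (at (\<gamma> s)))"
      using linear_frechet_derivative[OF Cinf_differentiable[OF k \<gamma>(2)[OF s]]] .
    have "((\<lambda>s. k (\<gamma> s)) has_derivative (\<lambda>t. frechet_derivative k (at (\<gamma> s)) (t *\<^sub>R \<gamma>1 s))) (at s)"
      using has_derivative_compose[OF \<gamma>(1)[OF s, unfolded has_vector_derivative_def]
          Cinf_has_derivative[OF k \<gamma>(2)[OF s]]] .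
    then show ?thesis
      unfolding has_field_derivative_def linear_scale[OF lin] by (simp add: mult.commute[of _ "frechet_derivative k (at (\<gamma> s)) (\<gamma>1 s)"])
  qed
  show "((\<lambda>s. h (\<gamma> s)) has_real_derivative frechet_derivative h (at (\<gamma> s)) (\<gamma>1 s)) (at s)" if "\<bar>s\<bar> < d" for s
    by (rule comp[OF that h])
  have expand: "frechet_derivative k (at y) w = (\<Sum>b\<in>Basis. (w \<bullet> b) * frechet_derivative k (at y) b)"
    if "y \<in> S" "Cinf S k" for y w and k :: "'a \<Rightarrow> real"
  proof -
    have lin: "linear (frechet_derivative k (at y))"
      using linear_frechet_derivative[OF Cinf_differentiable[OF that(2,1)]] .
    have "frechet_derivative k (at y) w = frechet_derivative k (at y) (\<Sum>b\<in>Basis. (w \<bullet> b) *\<^sub>R b)"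
      by (simp add: euclidean_representation)
    then show ?thesis by (simp add: linear_sum[OF lin] linear_scale[OF lin])
  qed
  have g0: "\<gamma> 0 \<in> S" using \<gamma>(2)[of 0] d by simp
  have \<gamma>1b: "((\<lambda>s. \<gamma>1 s \<bullet> b) has_real_derivative \<gamma>2 \<bullet> b) (at 0)" for b
    using has_derivative_inner_left[OF \<gamma>1[unfolded has_vector_derivative_def], of b]
    by (simp add: has_field_derivative_def mult.commute[of _ "\<gamma>2 \<bullet> b"])
  have "((\<lambda>s. \<Sum>b\<in>Basis. (\<gamma>1 s \<bullet> b) * frechet_derivative h (at (\<gamma> s)) b) has_real_derivative
      (\<Sum>b\<in>Basis. (\<gamma>1 0 \<bullet> b) * frechet_derivative (\<lambda>y. frechet_derivative h (at y) b) (at (\<gamma> 0)) (\<gamma>1 0)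
        + (\<gamma>2 \<bullet> b) * frechet_derivative h (at (\<gamma> 0)) b)) (at 0)"
  proof (rule DERIV_sum)
    fix b
    show "((\<lambda>s. (\<gamma>1 s \<bullet> b) * frechet_derivative h (at (\<gamma> s)) b) has_real_derivative
      (\<gamma>1 0 \<bullet> b) * frechet_derivative (\<lambda>y. frechet_derivative h (at y) b) (at (\<gamma> 0)) (\<gamma>1 0)
        + (\<gamma>2 \<bullet> b) * frechet_derivative h (at (\<gamma> 0)) b) (at 0)"
      using DERIV_mult[OF \<gamma>1b[of b] comp[OF _ Cinf_frechet[OF h], of 0 b]] d
      by (simp add: algebra_simps)
  qed
  moreover have "(\<Sum>b\<in>Basis. (\<gamma>1 0 \<bullet> b) * frechet_derivative (\<lambda>y. frechet_derivative h (at y) b) (at (\<gamma> 0)) (\<gamma>1 0)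
        + (\<gamma>2 \<bullet> b) * frechet_derivative h (at (\<gamma> 0)) b)
     = frechet_derivative (\<lambda>y. frechet_derivative h (at y) (\<gamma>1 0)) (at (\<gamma> 0)) (\<gamma>1 0)
       + frechet_derivative h (at (\<gamma> 0)) \<gamma>2"
  proof -
    have "(\<Sum>b\<in>Basis. (\<gamma>1 0 \<bullet> b) * frechet_derivative (\<lambda>y. frechet_derivative h (at y) b) (at (\<gamma> 0)) (\<gamma>1 0))
       = (\<Sum>b\<in>Basis. (\<gamma>1 0 \<bullet> b) * frechet_derivative (\<lambda>y. frechet_derivative h (at y) (\<gamma>1 0)) (at (\<gamma> 0)) b)"
      by (intro sum.cong refl) (simp add: frechet_derivative_commute_real[OF S h g0, of _ "\<gamma>1 0"])
    also have "\<dots> = frechet_derivative (\<lambda>y. frechet_derivative h (at y) (\<gamma>1 0)) (at (\<gamma> 0)) (\<gamma>1 0)"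
      by (rule expand[OF g0 Cinf_frechet[OF h], symmetric])
    finally show ?thesis using expand[OF g0 h, of \<gamma>2] by (simp add: sum.distrib)
  qed
  ultimately have D: "((\<lambda>s. \<Sum>b\<in>Basis. (\<gamma>1 s \<bullet> b) * frechet_derivative h (at (\<gamma> s)) b) has_real_derivative
      frechet_derivative (\<lambda>y. frechet_derivative h (at y) (\<gamma>1 0)) (at (\<gamma> 0)) (\<gamma>1 0)
       + frechet_derivative h (at (\<gamma> 0)) \<gamma>2) (at 0)" by simp
  show "((\<lambda>s. frechet_derivative h (at (\<gamma> s)) (\<gamma>1 s)) has_real_derivative
       frechet_derivative (\<lambda>y. frechet_derivative h (at y) (\<gamma>1 0)) (at (\<gamma> 0)) (\<gamma>1 0)
       + frechet_derivative h (at (\<gamma> 0)) \<gamma>2) (at 0)"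
  proof (rule has_field_derivative_transform_within_open[OF D, of "{-d<..<d}"])
    show "(\<Sum>b\<in>Basis. (\<gamma>1 s \<bullet> b) * frechet_derivative h (at (\<gamma> s)) b) = frechet_derivative h (at (\<gamma> s)) (\<gamma>1 s)"
      if "s \<in> {-d<..<d}" for s using expand[OF \<gamma>(2) h, of s] that by auto
  qed (use d in auto)
qed

text \<open>The mixed derivatives cancel by symmetry, leaving a quarter of the Laplacian in the real
  directions \<open>v\<close> and \<open>\<i> *s v\<close>. In this form the behaviour under
  coordinate changes and at maxima can be read off along real lines.\<close>

lemma dz_dzb_real:
  fixes h :: "complex^'n::finite \<Rightarrow> real"
  assumes S: "open S" and h: "Cinf S h" and x: "x \<in> S"
  shows "dz v (dzb v (\<lambda>y. of_real (h y))) x = of_real ((frechet_derivative (\<lambda>y. frechet_derivative h (at y) v) (at x) v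
     + frechet_derivative (\<lambda>y. frechet_derivative h (at y) (\<i> *s v)) (at x) (\<i> *s v)) / 4)"
proof -
  have C: "Cinf S (\<lambda>y. complex_of_real (h y))" using S h by (rule Cinf_of_real)
  have fd: "frechet_derivative (\<lambda>y. complex_of_real (h y)) (at y) w = of_real (frechet_derivative h (at y) w)" if "y \<in> S" for y w
    by (rule frechet_derivative_linear[OF bounded_linear_of_real Cinf_differentiable[OF h that]])
  let ?a = "\<lambda>w y. frechet_derivative h (at y) w"
  have Ca: "Cinf S (?a w)" for w by (rule Cinf_frechet[OF h])
  have fa: "frechet_derivative (\<lambda>y. complex_of_real (?a w y)) (at x) w' = of_real (frechet_derivative (?a w) (at x) w')" for w w'
    by (rule frechet_derivative_linear[OF bounded_linear_of_real Cinf_differentiable[OF Ca x]])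
  have da: "(\<lambda>y. complex_of_real (?a w y)) differentiable (at x)" for w
    by (rule Cinf_differentiable[OF Cinf_of_real[OF S Ca] x])
  have "dz v (dzb v (\<lambda>y. of_real (h y))) x = dz v (\<lambda>y. (1/2) * (of_real (?a v y) + \<i> * of_real (?a (\<i> *s v) y))) x"
    by (rule dz_cong[OF S x]) (auto simp: dzb_eq Cinf_differentiable[OF C] fd intro: Cinf_differentiable[OF Cinf_dzb[OF S C] x])
  also have "\<dots> = (1/2) * (dz v (\<lambda>y. of_real (?a v y)) x + \<i> * dz v (\<lambda>y. of_real (?a (\<i> *s v) y)) x)"
  proof -
    have di: "(\<lambda>y. \<i> * complex_of_real (?a (\<i> *s v) y)) differentiable (at x)"
      by (intro differentiable_mult da differentiable_const)
    show ?thesis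
      unfolding dz_cmult[OF differentiable_add[OF da di]] dz_add[OF da di] dz_cmult[OF da] ..
  qed
  also have "\<dots> = of_real ((frechet_derivative (?a v) (at x) v + frechet_derivative (?a (\<i> *s v)) (at x) (\<i> *s v)) / 4)"
    unfolding dz_eq[OF da] fa using frechet_derivative_commute_real[OF S h x, of v "\<i> *s v"]
    by (simp add: algebra_simps complex_eq_iff)
  finally show ?thesis .
qed

lemma scaleR_vec_nth: "(t *\<^sub>R (w :: complex^'n::finite)) $ b = of_real t * w $ b"
  by (simp add: complex_eq_iff)

text \<open>Only the restriction of the coordinate change to complex lines is needed: there it is a
  holomorphic function of one variable and hence smooth, and its second derivative cancels.\<close>

lemma hess_pullback:
  fixes \<phi> :: "complex^'n::finite \<Rightarrow> complex^'m::finite" and h :: "complex^'m \<Rightarrow> real"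
  assumes W: "open W" "x \<in> W" and S: "open S" "\<phi> ` W \<subseteq> S" and hol: "holomorphic_map_on \<phi> W"
    and h: "Cinf S h" and k: "Cinf W k" "\<And>y. y \<in> W \<Longrightarrow> k y = h (\<phi> y)"
    and J: "(\<phi> has_derivative J) (at x)"
  shows "hform (hess k x) v v = hform (hess h (\<phi> x)) (J v) (J v)"
proof -
  define \<Gamma> where "\<Gamma> z = \<phi> (x + z *s v)" for z
  define Z where "Z = (\<lambda>z. x + z *s v) -` W"
  have contL: "continuous_on UNIV (\<lambda>z. x + z *s v)"
    by (simp add: vector_scalar_mult_def) (intro continuous_intros continuous_on_vec_lambda)
  have Z: "open Z" "0 \<in> Z"
    using W(1) continuous_on_open_vimage[OF open_UNIV, of "\<lambda>z. x + z *s v"] contL W(2) by (auto simp: Z_def)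
  have dL: "((\<lambda>z. x + z *s v) has_derivative (\<lambda>z. z *s v)) (at z)" for z
  proof -
    have bl: "bounded_linear (\<lambda>z. z *s v)"
      by (rule linear_conv_bounded_linear[THEN iffD1]) (auto intro!: linearI simp: vec_eq_iff algebra_simps)
    show ?thesis
      using has_derivative_add[OF has_derivative_const bounded_linear_imp_has_derivative[OF bl]] by simp
  qed
  have der: "\<exists>D. (\<phi> has_derivative D) (at (x + z *s v)) \<and> ((\<lambda>z. \<Gamma> z $ b) has_field_derivative D v $ b) (at z)"
    if z: "z \<in> Z" for z b
  proof -
    obtain D where D: "(\<phi> has_derivative D) (at (x + z *s v))" "\<And>a v. D (a *s v) = a *s D v"
    proof -
      have "x + z *s v \<in> W" using z by (simp add: Z_def)
      then show ?thesis using hol that unfolding holomorphic_map_on_def by blast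
    qed
    have "(\<Gamma> has_derivative (\<lambda>z. D (z *s v))) (at z)"
      unfolding \<Gamma>_def by (rule has_derivative_compose[OF dL D(1)])
    then have "((\<lambda>z. \<Gamma> z $ b) has_derivative (\<lambda>z. D (z *s v) $ b)) (at z)"
      by (rule bounded_linear.has_derivative[OF bounded_linear_vec_nth])
    then have "((\<lambda>z. \<Gamma> z $ b) has_field_derivative D v $ b) (at z)"
      unfolding has_field_derivative_def D(2) by (simp add: mult.commute[of _ "D v $ b"])
    then show ?thesis using D(1) by blast
  qed
  have holb: "(\<lambda>z. \<Gamma> z $ b) holomorphic_on Z" for b
    using der Z(1) unfolding holomorphic_on_open[OF Z(1)] by blast
  define \<Gamma>1 where "\<Gamma>1 z = (\<chi> b. deriv (\<lambda>z. \<Gamma> z $ b) z)" for z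
  define \<Gamma>2 where "\<Gamma>2 = (\<chi> b. deriv (deriv (\<lambda>z. \<Gamma> z $ b)) 0)"
  have d1: "((\<lambda>z. \<Gamma> z $ b) has_field_derivative \<Gamma>1 z $ b) (at z)" if "z \<in> Z" for z b
    unfolding \<Gamma>1_def using holomorphic_derivI[OF holb Z(1) that] by simp
  have d2: "((\<lambda>z. \<Gamma>1 z $ b) has_field_derivative \<Gamma>2 $ b) (at 0)" for b
    unfolding \<Gamma>1_def \<Gamma>2_def using holomorphic_derivI[OF holomorphic_deriv[OF holb Z(1)] Z] by simp
  have \<Gamma>10: "\<Gamma>1 0 = J v"
  proof -
    have "\<Gamma>1 0 $ b = J v $ b" for b
    proof -
      obtain D where "(\<phi> has_derivative D) (at x)" "((\<lambda>z. \<Gamma> z $ b) has_field_derivative D v $ b) (at 0)"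
        using der[OF Z(2), of b] by auto
      moreover from this(1) have "D = J" using J has_derivative_unique by blast
      ultimately show ?thesis using DERIV_unique[OF d1[OF Z(2)]] by blast
    qed
    then show ?thesis by (simp add: vec_eq_iff)
  qed
  obtain r where r: "r > 0" "ball 0 r \<subseteq> Z" using Z openE by blast
  have vd: "((\<lambda>s. g (of_real s * a)) has_vector_derivative a *s g' (of_real s * a)) (at s)"
    if g: "\<And>b. ((\<lambda>z. g z $ b) has_field_derivative g' (of_real s * a) $ b) (at (of_real s * a))"
    for g g' :: "complex \<Rightarrow> complex^'m" and a s
  proof -
    have "((\<lambda>s. of_real s * a) has_derivative (\<lambda>s. of_real s * a)) (at s)"
      by (auto intro!: derivative_eq_intros)
    from has_derivative_compose[OF this g[unfolded has_field_derivative_def]]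
    have "((\<lambda>s. g (of_real s * a) $ b) has_derivative (\<lambda>t. g' (of_real s * a) $ b * (of_real t * a))) (at s)" for b .
    then have "((\<lambda>s. g (of_real s * a)) has_derivative (\<lambda>t. \<chi> b. g' (of_real s * a) $ b * (of_real t * a))) (at s)"
      by (subst has_derivative_componentwise_within, subst has_derivative_componentwise_within)
        (auto simp: Basis_vec_def inner_axis intro!: has_derivative_inner_left)
    moreover have "(\<lambda>t. \<chi> b. g' (of_real s * a) $ b * (of_real t * a)) = (\<lambda>t. t *\<^sub>R (a *s g' (of_real s * a)))"
      by (rule ext) (simp add: vec_eq_iff scaleR_vec_nth mult_ac del: vector_scaleR_component)
    ultimately show ?thesis by (simp add: has_vector_derivative_def)
  qed
  have line: "frechet_derivative (\<lambda>y. frechet_derivative k (at y) (a *s v)) (at x) (a *s v)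
      = frechet_derivative (\<lambda>y. frechet_derivative h (at y) (a *s J v)) (at (\<phi> x)) (a *s J v)
       + frechet_derivative h (at (\<phi> x)) (a *s (a *s \<Gamma>2))" if a: "cmod a = 1" for a
  proof -
    have inZ: "of_real s * a \<in> Z" if "\<bar>s\<bar> < r" for s
      using that a r(2) by (auto simp: norm_mult subset_iff)
    have \<gamma>: "((\<lambda>s. \<Gamma> (of_real s * a)) has_vector_derivative a *s \<Gamma>1 (of_real s * a)) (at s)" if "\<bar>s\<bar> < r" for s
      by (rule vd) (rule d1[OF inZ[OF that]])
    have \<gamma>S: "\<Gamma> (of_real s * a) \<in> S" if "\<bar>s\<bar> < r" for s
      using inZ[OF that] S(2) by (auto simp: \<Gamma>_def Z_def)
    have "((\<lambda>s. \<Gamma>1 (of_real s * a)) has_vector_derivative a *s (\<lambda>_. \<Gamma>2) (of_real 0 * a)) (at 0)"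
      by (rule vd) (simp add: d2)
    then have \<gamma>1: "((\<lambda>s. a *s \<Gamma>1 (of_real s * a)) has_vector_derivative a *s (a *s \<Gamma>2)) (at 0)"
      by (intro bounded_linear.has_vector_derivative[of "\<lambda>w. a *s w"])
        (auto intro!: linear_conv_bounded_linear[THEN iffD1] linearI simp: vec_eq_iff algebra_simps)
    have eqv: "x + (of_real s * a) *s v = x + s *\<^sub>R (a *s v)" for s
      by (simp add: vec_eq_iff scaleR_vec_nth mult_ac del: vector_scaleR_component)
    have lin1: "((\<lambda>s. x + s *\<^sub>R (a *s v)) has_vector_derivative a *s v) (at s)" for s :: real
      by (auto intro!: derivative_eq_intros simp: has_vector_derivative_def)
    have linW: "x + s *\<^sub>R (a *s v) \<in> W" if "\<bar>s\<bar> < r" for s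
      using inZ[OF that] eqv[of s] by (simp add: Z_def)
    have c0: "((\<lambda>s::real. a *s v) has_vector_derivative 0) (at 0)" by simp
    have K1: "((\<lambda>s. k (x + s *\<^sub>R (a *s v))) has_real_derivative frechet_derivative k (at (x + s *\<^sub>R (a *s v))) (a *s v)) (at s)"
      if "\<bar>s\<bar> < r" for s
      by (rule second_derivative_along_curve(1)[OF W(1) k(1) r(1) lin1 linW c0 that])
    have K2: "((\<lambda>s. frechet_derivative k (at (x + s *\<^sub>R (a *s v))) (a *s v)) has_real_derivative
        frechet_derivative (\<lambda>y. frechet_derivative k (at y) (a *s v)) (at x) (a *s v) + frechet_derivative k (at x) 0) (at 0)"
      using second_derivative_along_curve(2)[OF W(1) k(1) r(1) lin1 linW c0] by simp
    have H1: "((\<lambda>s. h (\<Gamma> (of_real s * a))) has_real_derivative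
        frechet_derivative h (at (\<Gamma> (of_real s * a))) (a *s \<Gamma>1 (of_real s * a))) (at s)" if "\<bar>s\<bar> < r" for s
      by (rule second_derivative_along_curve(1)[OF S(1) h r(1) \<gamma> \<gamma>S \<gamma>1 that])
    have H2: "((\<lambda>s. frechet_derivative h (at (\<Gamma> (of_real s * a))) (a *s \<Gamma>1 (of_real s * a))) has_real_derivative
       frechet_derivative (\<lambda>y. frechet_derivative h (at y) (a *s \<Gamma>1 0)) (at (\<Gamma> 0)) (a *s \<Gamma>1 0)
       + frechet_derivative h (at (\<Gamma> 0)) (a *s (a *s \<Gamma>2))) (at 0)"
      using second_derivative_along_curve(2)[OF S(1) h r(1) \<gamma> \<gamma>S \<gamma>1] by simp
    have same: "k (x + s *\<^sub>R (a *s v)) = h (\<Gamma> (of_real s * a))" if "\<bar>s\<bar> < r" for s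
      using k(2)[OF linW[OF that]] eqv[of s] by (simp add: \<Gamma>_def)
    have first: "frechet_derivative k (at (x + s *\<^sub>R (a *s v))) (a *s v)
        = frechet_derivative h (at (\<Gamma> (of_real s * a))) (a *s \<Gamma>1 (of_real s * a))" if s: "\<bar>s\<bar> < r" for s
    proof -
      have "((\<lambda>s. h (\<Gamma> (of_real s * a))) has_real_derivative frechet_derivative k (at (x + s *\<^sub>R (a *s v))) (a *s v)) (at s)"
        by (rule has_field_derivative_transform_within_open[OF K1[OF s], of "{-r<..<r}"]) (use s same in auto)
      then show ?thesis using H1[OF s] DERIV_unique by blast
    qed
    have "((\<lambda>s. frechet_derivative h (at (\<Gamma> (of_real s * a))) (a *s \<Gamma>1 (of_real s * a))) has_real_derivative
        frechet_derivative (\<lambda>y. frechet_derivative k (at y) (a *s v)) (at x) (a *s v) + frechet_derivative k (at x) 0) (at 0)"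
      by (rule has_field_derivative_transform_within_open[OF K2, of "{-r<..<r}"])
        (use first r(1) in auto)
    from DERIV_unique[OF this H2]
    have "frechet_derivative (\<lambda>y. frechet_derivative k (at y) (a *s v)) (at x) (a *s v) + frechet_derivative k (at x) 0
       = frechet_derivative (\<lambda>y. frechet_derivative h (at y) (a *s \<Gamma>1 0)) (at (\<Gamma> 0)) (a *s \<Gamma>1 0)
       + frechet_derivative h (at (\<Gamma> 0)) (a *s (a *s \<Gamma>2))" .
    moreover have "frechet_derivative k (at x) 0 = 0"
      using linear_0[OF linear_frechet_derivative[OF Cinf_differentiable[OF k(1) W(2)]]] .
    moreover have "\<Gamma> 0 = \<phi> x" by (simp add: \<Gamma>_def)
    ultimately show ?thesis by (simp add: \<Gamma>10)
  qed
  have hx: "\<phi> x \<in> S" using W S by auto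
  \<comment> \<open>Along the real line in direction \<open>a *s v\<close> the image curve has
    acceleration \<open>a *s (a *s \<Gamma>2)\<close>. For \<open>a = 1\<close> and
    \<open>a = \<i>\<close> these are opposite, so the first derivative of \<open>h\<close> drops
    out of the sum.\<close>
  have "frechet_derivative h (at (\<phi> x)) (1 *s (1 *s \<Gamma>2)) + frechet_derivative h (at (\<phi> x)) (\<i> *s (\<i> *s \<Gamma>2)) = 0"
  proof -
    have "\<i> *s (\<i> *s \<Gamma>2) = - \<Gamma>2" by (simp add: vec_eq_iff)
    then show ?thesis using linear_neg[OF linear_frechet_derivative[OF Cinf_differentiable[OF h hx]], of \<Gamma>2] by simp
  qed
  then have "frechet_derivative (\<lambda>y. frechet_derivative k (at y) v) (at x) v
     + frechet_derivative (\<lambda>y. frechet_derivative k (at y) (\<i> *s v)) (at x) (\<i> *s v)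
     = frechet_derivative (\<lambda>y. frechet_derivative h (at y) (J v)) (at (\<phi> x)) (J v)
     + frechet_derivative (\<lambda>y. frechet_derivative h (at y) (\<i> *s J v)) (at (\<phi> x)) (\<i> *s J v)"
    using line[of 1] line[of \<i>] by simp
  then show ?thesis
    unfolding hform_hess[OF W(1) k(1) W(2)] hform_hess[OF S(1) h hx] dz_dzb_real[OF W(1) k(1) W(2)] dz_dzb_real[OF S(1) h hx]
    by simp
qed

lemma hform_polarization:
  "4 * hform M v w = hform M (v + w) (v + w) - hform M (v + (-1) *s w) (v + (-1) *s w)
     + \<i> * hform M (v + \<i> *s w) (v + \<i> *s w) - \<i> * hform M (v + (-\<i>) *s w) (v + (-\<i>) *s w)"
  unfolding hform_add_left hform_add_right hform_scale_left hform_scale_right by (simp add: algebra_simps)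

text \<open>Restriction to complex lines gives the form only on the diagonal; complex linearity of
  \<open>J\<close> and polarization recover the rest.\<close>

lemma hform_eq_from_quadratic:
  assumes "linear J" "\<And>a v. J (a *s v) = a *s J v" "\<And>v. hform M v v = hform M' (J v) (J v)"
  shows "hform M v w = hform M' (J v) (J w)"
proof -
  have J: "J (v + a *s w) = J v + a *s J w" for a using linear_add[OF assms(1)] assms(2) by simp
  have "4 * hform M v w = 4 * hform M' (J v) (J w)"
    unfolding hform_polarization[of M v w] hform_polarization[of M' "J v" "J w"] assms(3) J
    using linear_add[OF assms(1), of v w] by simp
  then show ?thesis by simp
qed

section \<open>Maxima\<close>

lemma second_derivative_test:
  fixes \<phi> \<phi>1 :: "real \<Rightarrow> real"
  assumes d: "d > 0" and D: "\<And>s. \<bar>s\<bar> < d \<Longrightarrow> (\<phi> has_real_derivative \<phi>1 s) (at s)"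
    and D2: "(\<phi>1 has_real_derivative L) (at 0)" and max: "\<And>s. \<bar>s\<bar> < d \<Longrightarrow> \<phi> s \<le> \<phi> 0"
  shows "\<phi>1 0 = 0" "L \<le> 0"
proof -
  show z: "\<phi>1 0 = 0"
    by (rule DERIV_local_max[OF D d]) (use d max in auto)
  show "L \<le> 0"
  proof (rule ccontr)
    assume "\<not> L \<le> 0"
    then obtain r where r: "r > 0" "\<And>h. 0 < h \<Longrightarrow> h < r \<Longrightarrow> \<phi>1 0 < \<phi>1 (0 + h)"
      using DERIV_pos_inc_right[OF D2] by auto
    define s where "s = min r d / 2"
    have s: "0 < s" "s < r" "s < d" using r d by (auto simp: s_def min_def)
    obtain \<xi> where \<xi>: "0 < \<xi>" "\<xi> < s" "\<phi> s - \<phi> 0 = (s - 0) * \<phi>1 \<xi>"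
      using MVT2[of 0 s \<phi> \<phi>1] s D by auto
    have "\<phi>1 \<xi> > 0" using r(2)[of \<xi>] \<xi> s z by simp
    then have "\<phi> s - \<phi> 0 > 0" unfolding \<xi>(3) using s by simp
    then show False using max[of s] s by simp
  qed
qed

text \<open>Along every real line through \<open>x\<close> the second derivative is nonpositive, and
  the mixed complex derivative is a quarter of the sum of two of them, along \<open>v\<close> and
  along \<open>\<i> *s v\<close>.\<close>

lemma spatial_maximum:
  fixes h :: "complex^'n::finite \<Rightarrow> real"
  assumes S: "open S" and h: "Cinf S h" and x: "x \<in> S" and max: "\<And>y. y \<in> S \<Longrightarrow> h y \<le> h x"
  shows "dz v (\<lambda>y. of_real (h y)) x = 0" "Re (dz v (dzb v (\<lambda>y. of_real (h y))) x) \<le> 0"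
proof -
  have *: "frechet_derivative h (at x) w = 0 \<and>
      frechet_derivative (\<lambda>y. frechet_derivative h (at y) w) (at x) w \<le> 0" for w
  proof -
    obtain r where r: "r > 0" "ball x r \<subseteq> S" using S x openE by blast
    define d where "d = r / (norm w + 1)"
    have nw: "norm w + 1 > 0" by (simp add: add_nonneg_pos)
    have d: "d > 0" using r nw by (simp add: d_def)
    have inS: "x + s *\<^sub>R w \<in> S" if "\<bar>s\<bar> < d" for s
    proof -
      have "\<bar>s\<bar> * norm w \<le> \<bar>s\<bar> * (norm w + 1)" by (intro mult_left_mono) auto
      also have "\<dots> < r" using that nw by (simp add: d_def less_divide_eq)
      finally show ?thesis using r(2) by (auto simp: dist_norm)
    qed
    have vd: "((\<lambda>s. x + s *\<^sub>R w) has_vector_derivative w) (at s)" for s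
      by (auto intro!: derivative_eq_intros simp: has_vector_derivative_def)
    have c0: "((\<lambda>s::real. w) has_vector_derivative 0) (at 0)" by simp
    have 1: "((\<lambda>s. h (x + s *\<^sub>R w)) has_real_derivative frechet_derivative h (at (x + s *\<^sub>R w)) w) (at s)"
      if "\<bar>s\<bar> < d" for s
      by (rule second_derivative_along_curve(1)[OF S h d vd inS c0 that])
    have z: "frechet_derivative h (at x) 0 = 0"
      using linear_0[OF linear_frechet_derivative[OF Cinf_differentiable[OF h x]]] .
    have 2: "((\<lambda>s. frechet_derivative h (at (x + s *\<^sub>R w)) w) has_real_derivative
        frechet_derivative (\<lambda>y. frechet_derivative h (at y) w) (at x) w) (at 0)"
      using second_derivative_along_curve(2)[OF S h d vd inS c0] z by simp
    show ?thesis
      using second_derivative_test[OF d 1 2] max[OF inS] by simp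
  qed
  have fd: "frechet_derivative (\<lambda>y. complex_of_real (h y)) (at x) w = of_real (frechet_derivative h (at x) w)" for w
    by (rule frechet_derivative_linear[OF bounded_linear_of_real Cinf_differentiable[OF h x]])
  show "dz v (\<lambda>y. of_real (h y)) x = 0"
    using * by (simp add: dz_eq Cinf_differentiable[OF Cinf_of_real[OF S h] x] fd)
  show "Re (dz v (dzb v (\<lambda>y. of_real (h y))) x) \<le> 0"
    unfolding dz_dzb_real[OF S h x] using *[of v] *[of "\<i> *s v"] by simp
qed

text \<open>Only earlier times are compared, because the maximum over a time interval may sit at its
  end. What survives is a sign of the derivative and not its vanishing.\<close>

lemma left_maximum_derivative:
  fixes \<phi> :: "real \<Rightarrow> real"
  assumes "(\<phi> has_real_derivative L) (at t within S)" "d > 0"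
    and "\<And>s. t - d < s \<Longrightarrow> s < t \<Longrightarrow> s \<in> S \<and> \<phi> s \<le> \<phi> t"
  shows "L \<ge> 0"
proof (rule ccontr)
  assume "\<not> L \<ge> 0"
  then obtain r where r: "r > 0" "\<And>h. h > 0 \<Longrightarrow> t - h \<in> S \<Longrightarrow> h < r \<Longrightarrow> \<phi> t < \<phi> (t - h)"
    using has_real_derivative_neg_dec_left[OF assms(1)] by auto
  define h where "h = min r d / 2"
  have "h > 0" "h < r" "h < d" using r(1) assms(2) by (auto simp: h_def min_def)
  then show False using r(2)[of h] assms(3)[of "t - h"] by force
qed

section \<open>Hermitian manifolds\<close>

locale hermitian_manifold =
  fixes A :: "('a::{t2_space,second_countable_topology}, 'n::finite) chart set"
    and \<omega> :: "('a, 'n) chart \<Rightarrow> 'a \<Rightarrow> complex^'n^'n"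
  assumes compact: "compact (UNIV :: 'a set)" and atlas: "complex_atlas A" and metric: "hermitian_metric A \<omega>"
begin

lemma chart_exists: "\<exists>c\<in>A. p \<in> fst c"
  using atlas[unfolded complex_atlas_def, THEN conjunct1] by blast

lemma open_chart: "c \<in> A \<Longrightarrow> open (fst c)" "c \<in> A \<Longrightarrow> open (chart_image c)"
  using atlas unfolding complex_atlas_def by blast+

lemma chart_homeo: "c \<in> A \<Longrightarrow> homeomorphism (fst c) (chart_image c) (snd c) (chart_inv c)"
  using atlas unfolding complex_atlas_def by blast

lemma chart_inv:
  assumes "c \<in> A"
  shows "p \<in> fst c \<Longrightarrow> snd c p \<in> chart_image c" "p \<in> fst c \<Longrightarrow> chart_inv c (snd c p) = p"
    "x \<in> chart_image c \<Longrightarrow> chart_inv c x \<in> fst c" "x \<in> chart_image c \<Longrightarrow> snd c (chart_inv c x) = x"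
    "continuous_on (fst c) (snd c)" "continuous_on (chart_image c) (chart_inv c)"
proof -
  note h = chart_homeo[OF assms, unfolded homeomorphism_def]
  show "p \<in> fst c \<Longrightarrow> snd c p \<in> chart_image c" by (simp add: chart_image_def)
  show "p \<in> fst c \<Longrightarrow> chart_inv c (snd c p) = p" using h by blast
  show "x \<in> chart_image c \<Longrightarrow> chart_inv c x \<in> fst c" using h by blast
  show "x \<in> chart_image c \<Longrightarrow> snd c (chart_inv c x) = x" using h by blast
  show "continuous_on (fst c) (snd c)" "continuous_on (chart_image c) (chart_inv c)" using h by blast+
qed

lemma open_coords:
  assumes "c \<in> A" "open V" shows "open (snd c -` V \<inter> fst c)"
  using open_chart(1)[OF assms(1)] chart_inv(5)[OF assms(1)] assms(2)
  by (metis continuous_on_open_vimage)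

lemma open_coords_image:
  assumes "c \<in> A" "open V" "V \<subseteq> fst c" shows "open (snd c ` V)"
proof -
  have "snd c ` V = chart_inv c -` V \<inter> chart_image c"
  proof
    show "snd c ` V \<subseteq> chart_inv c -` V \<inter> chart_image c"
      using chart_inv[OF assms(1)] assms(3) by auto
    show "chart_inv c -` V \<inter> chart_image c \<subseteq> snd c ` V"
      using chart_inv(4)[OF assms(1)] by force
  qed
  then show ?thesis
    using open_chart(2)[OF assms(1)] chart_inv(6)[OF assms(1)] assms(2) by (metis continuous_on_open_vimage)
qed

definition metric_at :: "('a, 'n) chart \<Rightarrow> complex^'n \<Rightarrow> complex^'n^'n" where
  "metric_at c x = \<omega> c (chart_inv c x)"

lemma metric_at_smooth: assumes "c \<in> A" shows "Cinf_mat (chart_image c) (metric_at c)"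
proof -
  have "smooth_on (\<omega> c \<circ> chart_inv c) (chart_image c)"
    using metric[unfolded hermitian_metric_def, THEN conjunct1] assms by blast
  then have "Cinf (chart_image c) (\<lambda>x. metric_at c x)"
    using Cinf_smooth_on open_chart(2)[OF assms] by (simp add: metric_at_def o_def)
  then show ?thesis
    unfolding Cinf_mat_def by (intro allI Cinf_nth open_chart(2)[OF assms])
qed

lemma metric_posdef: "c \<in> A \<Longrightarrow> p \<in> fst c \<Longrightarrow> hermitian_posdef (\<omega> c p)"
  using metric[unfolded hermitian_metric_def, THEN conjunct1] by blast

lemma metric_at_posdef: "c \<in> A \<Longrightarrow> x \<in> chart_image c \<Longrightarrow> hermitian_posdef (metric_at c x)"
  unfolding metric_at_def by (intro metric_posdef chart_inv)

abbreviation coord :: "('a, 'n) chart \<Rightarrow> ('a \<Rightarrow> real) \<Rightarrow> complex^'n \<Rightarrow> real" where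
  "coord c u \<equiv> (\<lambda>x. u (chart_inv c x))"

lemma smooth_fun_Cinf: "smooth_fun A u \<Longrightarrow> c \<in> A \<Longrightarrow> Cinf (chart_image c) (coord c u)"
  unfolding smooth_fun_def o_def using Cinf_smooth_on open_chart(2) by blast

lemma ddbar_hess:
  assumes c: "c \<in> A" "p \<in> fst c" and u: "Cinf (chart_image c) (coord c u)"
  shows "ddbar c u p = hess (coord c u) (snd c p)"
proof -
  let ?x = "snd c p" and ?O = "chart_image c" and ?U = "\<lambda>x. complex_of_real (u (chart_inv c x))"
  have O: "open ?O" "?x \<in> ?O" using open_chart(2)[OF c(1)] chart_inv(1)[OF c] by auto
  have C: "Cinf ?O ?U" by (rule Cinf_of_real[OF O(1) u])
  have "wirtinger j (wirtinger_bar k ?U) ?x = dz (axis j 1) (dzb (axis k 1) ?U) ?x" for j k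
  proof -
    have d: "dzb (axis k 1) ?U differentiable (at ?x)"
      by (rule Cinf_differentiable[OF Cinf_dzb[OF O(1) C] O(2)])
    have eq: "dzb (axis k 1) ?U y = wirtinger_bar k ?U y" if "y \<in> ?O" for y
      by (rule wirtinger_bar_eq[OF Cinf_differentiable[OF C that], symmetric])
    have "frechet_derivative (dzb (axis k 1) ?U) (at ?x) = frechet_derivative (wirtinger_bar k ?U) (at ?x)"
      by (rule frechet_derivative_transform_within_open[OF d O eq])
    then have "wirtinger j (wirtinger_bar k ?U) ?x = wirtinger j (dzb (axis k 1) ?U) ?x"
      by (simp add: wirtinger_def)
    then show ?thesis by (simp add: wirtinger_eq[OF d])
  qed
  then show ?thesis by (simp add: ddbar_def hess_def vec_eq_iff)
qed

text \<open>\<open>J\<close> is the differential of the coordinate change at \<open>p\<close>. The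
  metric transforms by it through its transformation law and the complex Hessian through the chain
  rule, so whatever is formed from both in a frame is independent of the chart.\<close>

lemma transition:
  assumes c: "c \<in> A" "p \<in> fst c" and d: "d \<in> A" "p \<in> fst d"
  obtains J where "linear J" "\<And>a v. J (a *s v) = a *s J v"
    "\<And>v w. hform (\<omega> c p) v w = hform (\<omega> d p) (J v) (J w)"
    "\<And>u v w. Cinf (chart_image c) (coord c u) \<Longrightarrow> Cinf (chart_image d) (coord d u) \<Longrightarrow>
       hform (ddbar c u p) v w = hform (ddbar d u p) (J v) (J w)"
proof -
  define \<phi> where "\<phi> = snd d \<circ> chart_inv c"
  define W where "W = snd c ` (fst c \<inter> fst d)"
  have W: "open W" "snd c p \<in> W"
    unfolding W_def using open_chart(1)[OF c(1)] open_chart(1)[OF d(1)] c d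
    by (auto intro!: open_coords_image)
  have hol: "holomorphic_map_on \<phi> W"
    using atlas c d unfolding complex_atlas_def \<phi>_def W_def by blast
  obtain J where J: "(\<phi> has_derivative J) (at (snd c p))" "\<And>a v. J (a *s v) = a *s J v"
    using hol W(2) unfolding holomorphic_map_on_def by blast
  have lin: "linear J" using J(1) has_derivative_linear by blast
  have Wc: "W \<subseteq> chart_image c" by (auto simp: W_def chart_image_def)
  have \<phi>W: "\<phi> ` W \<subseteq> chart_image d"
    unfolding W_def \<phi>_def using chart_inv(2)[OF c(1)] by (auto simp: chart_image_def)
  have \<phi>p: "\<phi> (snd c p) = snd d p" using chart_inv(2)[OF c] by (simp add: \<phi>_def)
  have Jsum: "J v = (\<Sum>j\<in>UNIV. v $ j *s J (axis j 1))" for v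
  proof -
    have "J v = J (\<Sum>j\<in>UNIV. v $ j *s axis j 1)" by (rule arg_cong[OF vec_axis_sum])
    then show ?thesis by (simp add: linear_sum[OF lin] J(2))
  qed
  have wj: "wirtinger j (\<lambda>x. snd d (chart_inv c x) $ a) (snd c p) = J (axis j 1) $ a" for j a
  proof -
    have "((\<lambda>x. snd d (chart_inv c x) $ a) has_derivative (\<lambda>v. J v $ a)) (at (snd c p))"
      using bounded_linear.has_derivative[OF bounded_linear_vec_nth J(1)] by (simp add: \<phi>_def o_def)
    then have fd: "frechet_derivative (\<lambda>x. snd d (chart_inv c x) $ a) (at (snd c p)) = (\<lambda>v. J v $ a)"
      by (rule frechet_derivative_at[symmetric])
    have "J (axis j \<i>) = \<i> *s J (axis j 1)" unfolding J(2)[symmetric] i_axis ..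
    then show ?thesis unfolding wirtinger_def fd by simp
  qed
  have entries: "\<omega> c p $ k $ j = hform (\<omega> d p) (J (axis j 1)) (J (axis k 1))" for j k
  proof -
    have "\<omega> c p $ k $ j = (\<Sum>a\<in>UNIV. \<Sum>b\<in>UNIV. \<omega> d p $ b $ a *
             wirtinger j (\<lambda>x. snd d (chart_inv c x) $ a) (snd c p) *
             cnj (wirtinger k (\<lambda>x. snd d (chart_inv c x) $ b) (snd c p)))"
      using metric[unfolded hermitian_metric_def, THEN conjunct2] c d by blast
    then show ?thesis unfolding wj hform_def .
  qed
  have 1: "hform (\<omega> c p) v w = hform (\<omega> d p) (J v) (J w)" for v w
  proof -
    have "hform (\<omega> d p) (J v) (J w) = hform (\<omega> d p) (\<Sum>j\<in>UNIV. v $ j *s J (axis j 1)) (\<Sum>k\<in>UNIV. w $ k *s J (axis k 1))"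
      by (rule arg_cong2[where f = "hform (\<omega> d p)"]) (rule Jsum)+
    also have "\<dots> = (\<Sum>j\<in>UNIV. \<Sum>k\<in>UNIV. \<omega> c p $ k $ j * v $ j * cnj (w $ k))"
      unfolding hform_sum_left hform_sum_right hform_scale_left hform_scale_right entries
      by (subst sum.swap) (simp add: sum_distrib_left mult_ac)
    finally show ?thesis by (simp add: hform_def)
  qed
  have 2: "hform (ddbar c u p) v w = hform (ddbar d u p) (J v) (J w)"
    if uc: "Cinf (chart_image c) (coord c u)" and ud: "Cinf (chart_image d) (coord d u)" for u v w
  proof (rule hform_eq_from_quadratic[OF lin J(2)])
    fix v
    have "hform (hess (coord c u) (snd c p)) v v = hform (hess (coord d u) (\<phi> (snd c p))) (J v) (J v)"
    proof (rule hess_pullback[OF W open_chart(2)[OF d(1)] \<phi>W hol ud Cinf_subset[OF uc Wc] _ J(1)])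
      fix y assume "y \<in> W"
      then obtain q where q: "y = snd c q" "q \<in> fst c" "q \<in> fst d" by (auto simp: W_def)
      then show "u (chart_inv c y) = u (chart_inv d (\<phi> y))"
        using chart_inv(2)[OF c(1)] chart_inv(2)[OF d(1)] by (simp add: \<phi>_def)
    qed
    then show "hform (ddbar c u p) v v = hform (ddbar d u p) (J v) (J v)"
      unfolding ddbar_hess[OF c uc] ddbar_hess[OF d ud] \<phi>p .
  qed
  show ?thesis by (rule that[OF lin J(2) 1 2])
qed

lemma endo_eq:
  assumes "c \<in> A" "p \<in> fst c"
  shows "endo \<omega> c u p = matrix_inv (\<omega> c p) ** (\<omega> c p + ddbar c u p)"
  unfolding endo_def matrix_add_ldistrib hermitian_posdef_inv(1)[OF metric_posdef[OF assms]] ..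

text \<open>\<open>J\<close> carries an orthonormal frame of one chart to an orthonormal frame of
  the other, and trace and determinant of h are those of a Gram matrix in such a frame.\<close>

lemma endo_invariant:
  assumes c: "c \<in> A" "p \<in> fst c" and d: "d \<in> A" "p \<in> fst d"
    and u: "Cinf (chart_image c) (coord c u)" "Cinf (chart_image d) (coord d u)"
  shows "trace (endo \<omega> c u p) = trace (endo \<omega> d u p)" "det (endo \<omega> c u p) = det (endo \<omega> d u p)"
proof -
  obtain J where J: "\<And>v w. hform (\<omega> c p) v w = hform (\<omega> d p) (J v) (J w)"
    "\<And>u v w. Cinf (chart_image c) (coord c u) \<Longrightarrow> Cinf (chart_image d) (coord d u) \<Longrightarrow>
       hform (ddbar c u p) v w = hform (ddbar d u p) (J v) (J w)"
    using transition[OF c d] by metis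
  obtain e where e: "orthonormal (\<omega> c p) e" using orthonormal_exists[OF metric_posdef[OF c]] .
  have e': "orthonormal (\<omega> d p) (\<lambda>k. J (e k))" using e by (simp add: orthonormal_def J(1))
  have g: "hform (\<omega> c p + ddbar c u p) v w = hform (\<omega> d p + ddbar d u p) (J v) (J w)" for v w
    by (simp add: hform_plus J(1) J(2)[OF u])
  show "trace (endo \<omega> c u p) = trace (endo \<omega> d u p)"
    unfolding endo_eq[OF c] endo_eq[OF d] trace_frame[OF e] trace_frame[OF e'] g ..
  show "det (endo \<omega> c u p) = det (endo \<omega> d u p)"
    unfolding endo_eq[OF c] endo_eq[OF d] det_frame[OF e] det_frame[OF e'] gram_def g ..
qed

end

section \<open>Smooth functions of time and space\<close>

lemma Cinf_slices:
  fixes g :: "real \<times> 'b::euclidean_space \<Rightarrow> 'c::real_normed_vector"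
  assumes "open P" "open B" "Cinf (P \<times> B) g"
  shows "t \<in> P \<Longrightarrow> Cinf B (\<lambda>x. g (t, x))" "x \<in> B \<Longrightarrow> Cinf P (\<lambda>t. g (t, x))"
proof -
  have b1: "bounded_linear (\<lambda>x::'b. (0::real, x))" by (intro bounded_linear_Pair bounded_linear_zero bounded_linear_ident)
  have b2: "bounded_linear (\<lambda>t::real. (t, 0::'b))" by (intro bounded_linear_Pair bounded_linear_zero bounded_linear_ident)
  show "Cinf B (\<lambda>x. g (t, x))" if "t \<in> P"
    using Cinf_affine[OF assms(2,3) b1, of "(t, 0)"] that by auto
  show "Cinf P (\<lambda>t. g (t, x))" if "x \<in> B"
    using Cinf_affine[OF assms(1,3) b2, of "(0, x)"] that by auto
qed

lemma frechet_slices: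
  fixes g :: "real \<times> 'b::euclidean_space \<Rightarrow> 'c::real_normed_vector"
  assumes "g differentiable (at (t, x))"
  shows "frechet_derivative (\<lambda>x. g (t, x)) (at x) v = frechet_derivative g (at (t, x)) (0, v)"
    "frechet_derivative (\<lambda>t. g (t, x)) (at t) s = frechet_derivative g (at (t, x)) (s, 0)"
proof -
  have g: "(g has_derivative frechet_derivative g (at (t, x))) (at (t, x))"
    using assms frechet_derivative_works by blast
  have "((\<lambda>x. (t, x)) has_derivative (\<lambda>v. (0, v))) (at x)" "((\<lambda>t. (t, x)) has_derivative (\<lambda>s. (s, 0))) (at t)"
    by (auto intro!: derivative_eq_intros)
  from has_derivative_compose[OF this(1) g] has_derivative_compose[OF this(2) g]
  show "frechet_derivative (\<lambda>x. g (t, x)) (at x) v = frechet_derivative g (at (t, x)) (0, v)"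
    "frechet_derivative (\<lambda>t. g (t, x)) (at t) s = frechet_derivative g (at (t, x)) (s, 0)"
    by (metis frechet_derivative_at)+
qed

text \<open>\<open>slice_hess g k j (t, x)\<close> is the entry of the complex Hessian of \<open>g (t, \<cdot>)\<close> at \<open>x\<close>, as a smooth function
  of \<open>(t, x)\<close>.\<close>

definition slice_hess :: "(real \<times> (complex^'n::finite) \<Rightarrow> real) \<Rightarrow> 'n \<Rightarrow> 'n \<Rightarrow> real \<times> (complex^'n) \<Rightarrow> complex" where
  "slice_hess g k j = cder (0, (1/2) *\<^sub>R axis j 1) (0, - ((1/2) *\<^sub>R (\<i> *s axis j 1)))
     (cder (0, (1/2) *\<^sub>R axis k 1) (0, (1/2) *\<^sub>R (\<i> *s axis k 1)) (\<lambda>z. of_real (g z)))"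

lemma cder_slice:
  fixes k :: "real \<times> 'b::euclidean_space \<Rightarrow> complex"
  assumes "k differentiable (at (t, x))"
  shows "cder a b (\<lambda>x. k (t, x)) x = cder (0, a) (0, b) k (t, x)"
  by (simp add: cder_def frechet_slices[OF assms])

lemma Cinf_slice_hess: "open W \<Longrightarrow> Cinf W g \<Longrightarrow> Cinf W (slice_hess g k j)"
  unfolding slice_hess_def by (intro Cinf_cder Cinf_of_real)

lemma hess_slice:
  fixes g :: "real \<times> (complex^'n::finite) \<Rightarrow> real"
  assumes P: "open P" "t \<in> P" and B: "open B" "x \<in> B" and g: "Cinf (P \<times> B) g"
  shows "hess (\<lambda>x. g (t, x)) x $ k $ j = slice_hess g k j (t, x)"
proof -
  have PB: "open (P \<times> B)" using P B by (simp add: open_Times)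
  let ?gc = "\<lambda>z. complex_of_real (g z)"
  have gc: "Cinf (P \<times> B) ?gc" by (rule Cinf_of_real[OF PB g])
  let ?q = "cder (0, (1/2) *\<^sub>R axis k 1) (0, (1/2) *\<^sub>R (\<i> *s axis k 1)) ?gc"
  have q: "Cinf (P \<times> B) ?q" by (rule Cinf_cder[OF PB gc])
  have "dzb (axis k 1) (\<lambda>z. ?gc (t, z)) y = ?q (t, y)" if "y \<in> B" for y
    unfolding dzb_def using P that by (intro cder_slice Cinf_differentiable[OF gc]) auto
  moreover have "dzb (axis k 1) (\<lambda>z. ?gc (t, z)) differentiable (at x)"
    using Cinf_slices(1)[OF P(1) B(1) gc P(2)] by (intro Cinf_differentiable[OF Cinf_dzb[OF B(1)] B(2)])
  ultimately have "dz (axis j 1) (dzb (axis k 1) (\<lambda>z. ?gc (t, z))) x = dz (axis j 1) (\<lambda>y. ?q (t, y)) x"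
    by (intro dz_cong[OF B])
  also have "\<dots> = slice_hess g k j (t, x)"
    unfolding dz_def slice_hess_def using P B by (intro cder_slice Cinf_differentiable[OF q]) auto
  finally show ?thesis by (simp add: hess_def)
qed

text \<open>Time is treated as one more real coordinate, so the time derivative and the complex
  Hessian commute like derivatives in any two constant directions.\<close>

lemma hess_time_derivative:
  fixes g :: "real \<times> (complex^'n::finite) \<Rightarrow> real"
  assumes P: "open P" "t \<in> P" and B: "open B" "x \<in> B" and g: "Cinf (P \<times> B) g"
  shows "Cinf_mat P (\<lambda>t. hess (\<lambda>x. g (t, x)) x)"
    and "cder 1 0 (\<lambda>t. hess (\<lambda>x. g (t, x)) x $ k $ j) t
       = hess (\<lambda>y. frechet_derivative g (at (t, y)) (1, 0)) x $ k $ j"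
proof -
  have PB: "open (P \<times> B)" using P B by (simp add: open_Times)
  have sl: "Cinf P (\<lambda>t. slice_hess g k j (t, x))" for k j
    by (rule Cinf_slices(2)[OF P(1) B(1) Cinf_slice_hess[OF PB g] B(2)])
  have eq: "slice_hess g k j (t, x) = hess (\<lambda>x. g (t, x)) x $ k $ j" if "t \<in> P" for t k j
    by (rule hess_slice[OF P(1) that B g, symmetric])
  show "Cinf_mat P (\<lambda>t. hess (\<lambda>x. g (t, x)) x)"
    unfolding Cinf_mat_def by (intro allI Cinf_cong[OF P(1) eq sl])
  have gc: "Cinf (P \<times> B) (\<lambda>z. complex_of_real (g z))" by (rule Cinf_of_real[OF PB g])
  let ?w = "\<lambda>z. frechet_derivative g (at z) (1, 0)"
  have w: "Cinf (P \<times> B) ?w" by (rule Cinf_frechet[OF g])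
  have cw: "cder (1, 0) 0 (\<lambda>z. complex_of_real (g z)) z = of_real (?w z)" if "z \<in> P \<times> B" for z
  proof -
    have "frechet_derivative (\<lambda>z. complex_of_real (g z)) (at z) v = of_real (frechet_derivative g (at z) v)" for v
      by (rule frechet_derivative_linear[OF bounded_linear_of_real Cinf_differentiable[OF g that]])
    then show ?thesis
      using linear_0[OF linear_frechet_derivative[OF Cinf_differentiable[OF g that]]] by (simp add: cder_def)
  qed
  have tx: "(t, x) \<in> P \<times> B" using P B by simp
  have "cder 1 0 (\<lambda>t. hess (\<lambda>x. g (t, x)) x $ k $ j) t = cder 1 0 (\<lambda>t. slice_hess g k j (t, x)) t"
    by (rule cder_cong[symmetric, OF P eq Cinf_differentiable[OF sl P(2)]])
  also have "\<dots> = cder (1, 0) 0 (slice_hess g k j) (t, x)"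
    by (simp add: cder_def frechet_slices[OF Cinf_differentiable[OF Cinf_slice_hess[OF PB g] tx]] zero_prod_def)
  also have "\<dots> = slice_hess ?w k j (t, x)"
  proof -
    let ?a = "(0::real, (1/2) *\<^sub>R axis j (1::complex))" and ?b = "(0::real, - ((1/2) *\<^sub>R (\<i> *s axis j (1::complex))))"
      and ?c = "(0::real, (1/2) *\<^sub>R axis k (1::complex))" and ?d = "(0::real, (1/2) *\<^sub>R (\<i> *s axis k (1::complex)))"
    have "cder (1, 0) 0 (slice_hess g k j) (t, x) = cder ?a ?b (cder (1, 0) 0 (cder ?c ?d (\<lambda>z. of_real (g z)))) (t, x)"
      unfolding slice_hess_def by (rule cder_commute[OF PB Cinf_cder[OF PB gc] tx])
    also have "\<dots> = cder ?a ?b (cder ?c ?d (cder (1, 0) 0 (\<lambda>z. of_real (g z)))) (t, x)"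
      by (rule cder_cong[OF PB tx cder_commute[OF PB gc]])
        (auto intro: Cinf_differentiable[OF Cinf_cder[OF PB Cinf_cder[OF PB gc]] tx])
    also have "\<dots> = cder ?a ?b (cder ?c ?d (\<lambda>z. of_real (?w z))) (t, x)"
    proof (rule cder_cong[OF PB tx])
      show "cder ?c ?d (cder (1, 0) 0 (\<lambda>z. of_real (g z))) y = cder ?c ?d (\<lambda>z. of_real (?w z)) y" if "y \<in> P \<times> B" for y
        by (rule cder_cong[OF PB that cw]) (auto intro: Cinf_differentiable[OF Cinf_cder[OF PB gc] that])
    qed (rule Cinf_differentiable[OF Cinf_cder[OF PB Cinf_cder[OF PB gc]] tx])
    finally show ?thesis by (simp add: slice_hess_def)
  qed
  also have "\<dots> = hess (\<lambda>y. ?w (t, y)) x $ k $ j"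
    by (rule hess_slice[OF P B w, symmetric])
  finally show "cder 1 0 (\<lambda>t. hess (\<lambda>x. g (t, x)) x $ k $ j) t
       = hess (\<lambda>y. frechet_derivative g (at (t, y)) (1, 0)) x $ k $ j" .
qed

lemma cder_real_derivative:
  fixes h :: "real \<Rightarrow> complex"
  assumes "h differentiable (at t)"
  shows "((\<lambda>t. Re (h t)) has_real_derivative Re (cder 1 0 h t)) (at t)"
proof -
  have lin: "linear (frechet_derivative h (at t))" using assms by (rule linear_frechet_derivative)
  have "((\<lambda>t. Re (h t)) has_derivative (\<lambda>s. Re (frechet_derivative h (at t) s))) (at t)"
    using bounded_linear.has_derivative[OF bounded_linear_Re] assms frechet_derivative_works by blast
  moreover have "Re (frechet_derivative h (at t) s) = Re (cder 1 0 h t) * s" for s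
  proof -
    have "frechet_derivative h (at t) (s *\<^sub>R 1) = s *\<^sub>R frechet_derivative h (at t) 1" by (rule linear_scale[OF lin])
    then show ?thesis using linear_0[OF lin] by (simp add: cder_def mult.commute)
  qed
  ultimately show ?thesis by (simp add: has_field_derivative_def)
qed

lemma cder_hform:
  fixes M :: "'a::euclidean_space \<Rightarrow> complex^'n::finite^'n"
  assumes "\<And>i j. (\<lambda>y. M y $ i $ j) differentiable (at x)"
  shows "cder p q (\<lambda>y. hform (M y) a b) x = hform (\<chi> k j. cder p q (\<lambda>y. M y $ k $ j) x) a b"
proof -
  have "cder p q (\<lambda>y. M y $ k $ j * a $ j * cnj (b $ k)) x = cder p q (\<lambda>y. M y $ k $ j) x * a $ j * cnj (b $ k)" for j k
    using cder_cmult[OF assms, of p q "a $ j * cnj (b $ k)" k j] by (simp add: mult_ac)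
  then show ?thesis
    unfolding hform_def using assms by (simp add: cder_sum differentiable_sum differentiable_mult)
qed

section \<open>Solutions of the flow\<close>

locale flow = hermitian_manifold A \<omega>
  for A :: "('a::{t2_space,second_countable_topology}, 'n::finite) chart set" and \<omega> +
  fixes f u0 :: "'a \<Rightarrow> real" and F :: "real \<Rightarrow> real" and T :: ereal and u :: "real \<Rightarrow> 'a \<Rightarrow> real"
  assumes f: "smooth_fun A f" and F: "smooth_on F {0<..}" and F': "\<forall>s>0. deriv F s > 0"
    and T: "0 < T" and sol: "flow_solution A \<omega> f F u0 T u"
    and pos0: "\<forall>c\<in>A. \<forall>p\<in>fst c. hermitian_posdef (\<omega> c p + ddbar c u0 p)"
begin

abbreviation I :: "real set" where "I \<equiv> time_interval T"

lemma u_smooth_time: "smooth_fun_time A I u" and u_zero: "u 0 = u0"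
  and pde: "t \<in> I \<Longrightarrow> c \<in> A \<Longrightarrow> p \<in> fst c \<Longrightarrow> ((\<lambda>s. u s p) has_real_derivative
       F (exp (- f p) * Re (det (endo \<omega> c (u t) p)))) (at t within I)"
  and det_pos: "t \<in> I \<Longrightarrow> c \<in> A \<Longrightarrow> p \<in> fst c \<Longrightarrow> Re (det (endo \<omega> c (u t) p)) > 0"
  using sol unfolding flow_solution_def by blast+

lemma zero_I: "0 \<in> I"
  using T by (simp add: time_interval_def zero_ereal_def[symmetric] less_imp_le)

lemma I_interval: "t \<in> I \<Longrightarrow> 0 \<le> s \<Longrightarrow> s \<le> t \<Longrightarrow> s \<in> I" "t \<in> I \<Longrightarrow> 0 \<le> t"
  unfolding time_interval_def using order_trans[of "ereal s" "ereal t" T] by auto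

lemma I_connected: "connected I"
  unfolding connected_iff_interval using I_interval order_trans by metis

text \<open>Positivity of \<open>T\<close> makes the interval nondegenerate, so one-sided
  derivatives at its end points are unique.\<close>

lemma I_limit: assumes "t \<in> I" shows "at t within I \<noteq> bot"
proof -
  have "\<exists>s\<in>I. s > 0"
  proof (cases T)
    case (real r)
    then show ?thesis using T by (intro bexI[of _ r]) (auto simp: time_interval_def)
  next
    case PInf
    then show ?thesis by (intro bexI[of _ 1]) (auto simp: time_interval_def)
  next
    case MInf
    then show ?thesis using T by simp
  qed
  then obtain s where s: "s \<in> I" "s > 0" by blast
  then have "I \<noteq> {x}" for x using zero_I by (metis less_irrefl singletonD)
  then have "t islimpt I"
    using connected_imp_perfect[OF I_connected assms] by blast
  then show ?thesis by (simp add: trivial_limit_within)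
qed

text \<open>Smoothness up to the boundary supplies an extension to an open set. Cut down to a
  product, it has two-sided time derivatives even at the ends of \<open>I\<close>, while it agrees
  with the solution for times in \<open>I\<close> only.\<close>

lemma local_extension:
  assumes t: "t \<in> I" and c: "c \<in> A" and x: "x \<in> chart_image c"
  obtains r B g where "r > 0" "open B" "x \<in> B" "B \<subseteq> chart_image c" "Cinf ({t - r<..<t + r} \<times> B) g"
    "\<And>s y. s \<in> I \<Longrightarrow> \<bar>s - t\<bar> < r \<Longrightarrow> y \<in> B \<Longrightarrow> g (s, y) = u s (chart_inv c y)"
proof -
  have "smooth_on (\<lambda>(t, x). u t (chart_inv c x)) (I \<times> chart_image c)"
    using u_smooth_time c unfolding smooth_fun_time_def by blast
  moreover have "(t, x) \<in> I \<times> chart_image c" using t x by simp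
  ultimately obtain U g where U: "open U" "(t, x) \<in> U" "\<forall>k. Ck_on k g U"
    "\<forall>y\<in>(I \<times> chart_image c) \<inter> U. g y = (case y of (t, x) \<Rightarrow> u t (chart_inv c x))"
    unfolding smooth_on_def by blast
  obtain P Q where PQ: "open P" "open Q" "t \<in> P" "x \<in> Q" "P \<times> Q \<subseteq> U"
    using open_prod_elim[OF U(1,2)] by (metis SigmaE2)
  obtain r where r: "r > 0" "ball t r \<subseteq> P" using PQ openE by blast
  have bP: "{t - r<..<t + r} \<subseteq> P" using r(2) by (auto simp: ball_def dist_real_def abs_if split: if_splits)
  show ?thesis
  proof (rule that[of r "Q \<inter> chart_image c" g])
    have sub: "{t - r<..<t + r} \<times> (Q \<inter> chart_image c) \<subseteq> U" using bP PQ(5) by auto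
    show "Cinf ({t - r<..<t + r} \<times> (Q \<inter> chart_image c)) g"
      using Cinf_subset[OF _ sub] U(3) by (simp add: Cinf_def)
    show "g (s, y) = u s (chart_inv c y)" if "s \<in> I" "\<bar>s - t\<bar> < r" "y \<in> Q \<inter> chart_image c" for s y
    proof -
      have "(s, y) \<in> {t - r<..<t + r} \<times> (Q \<inter> chart_image c)" using that by (auto simp: abs_less_iff)
      then have "(s, y) \<in> (I \<times> chart_image c) \<inter> U" using that sub by blast
      then show ?thesis using U(4) by force
    qed
  qed (use r PQ x open_chart(2)[OF c] in auto)
qed

lemma u_smooth: assumes "t \<in> I" "c \<in> A" shows "Cinf (chart_image c) (coord c (u t))"
  unfolding Cinf_def
proof (intro allI Ck_on_local)
  fix k x assume x: "x \<in> chart_image c"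
  obtain r B g where g: "r > 0" "open B" "x \<in> B" "Cinf ({t - r<..<t + r} \<times> B) g"
    "\<And>s y. s \<in> I \<Longrightarrow> \<bar>s - t\<bar> < r \<Longrightarrow> y \<in> B \<Longrightarrow> g (s, y) = u s (chart_inv c y)"
    using local_extension[OF assms x] by metis
  have "Cinf B (\<lambda>y. g (t, y))" by (rule Cinf_slices(1)[OF _ g(2,4)]) (use g(1) in auto)
  then have "Cinf B (coord c (u t))" by (rule Cinf_cong[OF g(2), rotated]) (use g assms in auto)
  then show "\<exists>U. open U \<and> x \<in> U \<and> Ck_on k (coord c (u t)) U" using g unfolding Cinf_def by blast
qed

lemma hess_u_slice:
  assumes "t \<in> I" "open B" "B \<subseteq> chart_image c" "c \<in> A" "x \<in> B"
    "\<And>y. y \<in> B \<Longrightarrow> g (t, y) = u t (chart_inv c y)"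
  shows "hess (\<lambda>y. g (t, y)) x = ddbar c (u t) (chart_inv c x)"
proof -
  have xc: "x \<in> chart_image c" using assms by auto
  have C: "Cinf B (\<lambda>y. complex_of_real (u t (chart_inv c y)))"
    using assms u_smooth by (intro Cinf_of_real Cinf_subset[OF _ assms(3)])
  have "dz a (dzb b (\<lambda>y. of_real (g (t, y)))) x = dz a (dzb b (\<lambda>y. of_real (u t (chart_inv c y)))) x" for a b
  proof (rule dz_cong[symmetric, OF assms(2,5)])
    show "dzb b (\<lambda>y. complex_of_real (u t (chart_inv c y))) y = dzb b (\<lambda>y. complex_of_real (g (t, y))) y" if "y \<in> B" for y
      by (rule dzb_cong[OF assms(2) that]) (auto simp: assms(6) intro: Cinf_differentiable[OF C that])
  qed (rule Cinf_differentiable[OF Cinf_dzb[OF assms(2) C] assms(5)])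
  then have "hess (\<lambda>y. g (t, y)) x = hess (coord c (u t)) x" by (simp add: hess_def)
  also have "\<dots> = ddbar c (u t) (chart_inv c x)"
    using ddbar_hess[OF assms(4) chart_inv(3)[OF assms(4) xc] u_smooth[OF assms(1,4)]] chart_inv(4)[OF assms(4) xc] by simp
  finally show ?thesis .
qed

lemma ddbar_hermitian:
  assumes "t \<in> I" "c \<in> A" "p \<in> fst c" shows "hermitian (ddbar c (u t) p)"
  unfolding ddbar_hess[OF assms(2,3) u_smooth[OF assms(1,2)]]
  by (rule hermitian_hess[OF open_chart(2) u_smooth chart_inv(1)]) (use assms in auto)

lemma hermitian_add: "hermitian M \<Longrightarrow> hermitian N \<Longrightarrow> hermitian (M + N)"
  unfolding hermitian_def by (metis complex_cnj_add vector_add_component)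

lemma ddbar_continuous_time:
  assumes t: "t \<in> I" and c: "c \<in> A" "p \<in> fst c"
  shows "((\<lambda>s. ddbar c (u s) p $ k $ j) \<longlongrightarrow> ddbar c (u t) p $ k $ j) (at t within I)"
proof -
  let ?x = "snd c p"
  obtain r B g where g: "r > 0" "open B" "?x \<in> B" "B \<subseteq> chart_image c" "Cinf ({t - r<..<t + r} \<times> B) g"
    "\<And>s y. s \<in> I \<Longrightarrow> \<bar>s - t\<bar> < r \<Longrightarrow> y \<in> B \<Longrightarrow> g (s, y) = u s (chart_inv c y)"
    using local_extension[OF t c(1) chart_inv(1)[OF c]] by metis
  have P: "open {t - r<..<t + r}" "t \<in> {t - r<..<t + r}" using g(1) by auto
  have "Cinf {t - r<..<t + r} (\<lambda>s. hess (\<lambda>y. g (s, y)) ?x $ k $ j)"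
    using hess_time_derivative(1)[OF P g(2,3,5)] by (rule Cinf_mat_nth)
  then have "isCont (\<lambda>s. hess (\<lambda>y. g (s, y)) ?x $ k $ j) t"
    using P Cinf_continuous_on by (metis continuous_on_eq_continuous_at)
  then have lim: "((\<lambda>s. hess (\<lambda>y. g (s, y)) ?x $ k $ j) \<longlongrightarrow> hess (\<lambda>y. g (t, y)) ?x $ k $ j) (at t within I)"
    unfolding isCont_def by (rule tendsto_within_subset[OF _ subset_UNIV])
  have eq: "hess (\<lambda>y. g (s, y)) ?x = ddbar c (u s) p" if "s \<in> I" "\<bar>s - t\<bar> < r" for s
    using hess_u_slice[OF that(1) g(2,4) c(1) g(3) g(6)[OF that]] chart_inv(2)[OF c] by simp
  have "eventually (\<lambda>s. hess (\<lambda>y. g (s, y)) ?x $ k $ j = ddbar c (u s) p $ k $ j) (at t within I)"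
    unfolding eventually_at by (rule exI[of _ r]) (use g(1) eq in \<open>auto simp: dist_real_def\<close>)
  from Lim_transform_eventually[OF lim this] show ?thesis using eq[OF t] g(1) by simp
qed

text \<open>Whether the form is positive is locally constant in time, and the interval is connected,
  so positivity at time 0 persists. Being positive is stable by \<open>posdef_near\<close>. Failing
  to be positive is stable too: by \<open>psd_posdef\<close> the nonzero determinant forces a
  strictly negative direction, which stays negative nearby.\<close>

lemma posdef:
  assumes t: "t \<in> I" and c: "c \<in> A" "p \<in> fst c"
  shows "hermitian_posdef (\<omega> c p + ddbar c (u t) p)"
proof -
  define M where "M s = \<omega> c p + ddbar c (u s) p" for s
  have her: "hermitian (M s)" if "s \<in> I" for s
    unfolding M_def
    by (intro hermitian_add ddbar_hermitian[OF that c]) (use metric_posdef[OF c] in \<open>simp add: hermitian_posdef_alt\<close>)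
  have lim: "((\<lambda>s. M s $ k $ j) \<longlongrightarrow> M t $ k $ j) (at t within I)" if "t \<in> I" for t k j
    unfolding M_def using tendsto_add[OF tendsto_const ddbar_continuous_time[OF that c]] by simp
  have nz: "det (M s) \<noteq> 0" if "s \<in> I" for s
    using det_pos[OF that c] unfolding endo_eq[OF c] M_def det_mul by auto
  have "hermitian_posdef (M 0) = hermitian_posdef (M t)"
  proof (rule connected_local_const[OF I_connected zero_I t], rule ballI)
    fix t assume t: "t \<in> I"
    show "eventually (\<lambda>s. hermitian_posdef (M t) = hermitian_posdef (M s)) (at t within I)"
    proof (cases "hermitian_posdef (M t)")
      case True
      obtain d where d: "d > 0" "\<And>N. hermitian N \<Longrightarrow> (\<And>j k. cmod (N $ j $ k - M t $ j $ k) < d) \<Longrightarrow> hermitian_posdef N"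
        using posdef_near[OF True] by metis
      have "eventually (\<lambda>s. \<forall>j k. cmod (M s $ j $ k - M t $ j $ k) < d) (at t within I)"
        using lim[OF t, THEN tendstoD, OF d(1)] by (intro eventually_all_finite) (simp add: dist_norm)
      moreover have "eventually (\<lambda>s. s \<in> I) (at t within I)" by (simp add: eventually_at_filter)
      ultimately show ?thesis by eventually_elim (use d(2) her True in blast)
    next
      case False
      then obtain v where v: "Re (hform (M t) v v) < 0"
        using psd_posdef[OF her[OF t] _ nz[OF t]] by (meson not_less)
      have "((\<lambda>s. Re (hform (M s) v v)) \<longlongrightarrow> Re (hform (M t) v v)) (at t within I)"
        unfolding hform_def by (intro tendsto_intros lim[OF t])
      from order_tendstoD(2)[OF this v]
      have "eventually (\<lambda>s. Re (hform (M s) v v) < 0) (at t within I)" .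
      then show ?thesis
      proof eventually_elim
        case (elim s)
        have "v \<noteq> 0" using v by (auto simp: hform_zero)
        then have "\<not> hermitian_posdef (M s)" using elim by (auto simp: hermitian_posdef_alt intro: less_asym)
        then show ?case using False by simp
      qed
    qed
  qed
  moreover have "hermitian_posdef (M 0)" using pos0 c by (simp add: M_def u_zero)
  ultimately show ?thesis by (simp add: M_def)
qed

end

section \<open>Evolution of the trace and of the speed\<close>

lemma has_real_derivative_within_unique:
  fixes h :: "real \<Rightarrow> real"
  assumes "(h has_real_derivative a) (at t within S)" "(h has_real_derivative b) (at t within S)" "at t within S \<noteq> bot"
  shows "a = b"
  using assms tendsto_unique unfolding has_field_derivative_iff by blast

lemma ln_Re_det_quotient:
  fixes M N :: "complex^'n::finite^'n"
  assumes "hermitian_posdef M" "hermitian_posdef N"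
  shows "Re (det (matrix_inv M ** N)) = exp (ln (Re (det N)) - ln (Re (det M)))"
proof -
  have "det (matrix_inv M) * det M = 1" using hermitian_posdef_inv(1)[OF assms(1)] by (metis det_mul det_I)
  then have "det (matrix_inv M) = 1 / det M" by (metis mult_zero_right nonzero_eq_divide_eq zero_neq_one)
  then have "det (matrix_inv M ** N) = of_real (Re (det N)) / of_real (Re (det M))"
    using hermitian_posdef_det_Re(1)[OF assms(1)] hermitian_posdef_det_Re(1)[OF assms(2)]
    unfolding det_mul by (metis times_divide_eq_left mult_1)
  then show ?thesis
    using hermitian_posdef_det_Re(2)[OF assms(1)] hermitian_posdef_det_Re(2)[OF assms(2)]
    by (simp add: exp_diff flip: of_real_divide)
qed

context hermitian_manifold
begin

text \<open>Chosen so that the logarithm of the argument of \<open>F\<close> is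
  \<open>ln (det G) - \<rho>\<close>: in a chart it splits into a part containing the solution and a
  fixed smooth function.\<close>

definition \<rho> :: "('a \<Rightarrow> real) \<Rightarrow> ('a, 'n) chart \<Rightarrow> complex^'n \<Rightarrow> real" where
  "\<rho> f c y = f (chart_inv c y) + ln (Re (det (metric_at c y)))"

end

context flow
begin

text \<open>Choosing one chart per point makes trace, density and speed functions on the manifold.
  \<open>endo_invariant\<close> then admits any other chart in computations.\<close>

definition chart_at :: "'a \<Rightarrow> ('a, 'n) chart" where
  "chart_at p = (SOME c. c \<in> A \<and> p \<in> fst c)"

definition trh :: "real \<Rightarrow> 'a \<Rightarrow> real" where "trh t p = Re (trace (endo \<omega> (chart_at p) (u t) p))"

definition dens :: "real \<Rightarrow> 'a \<Rightarrow> real" where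
  "dens t p = exp (- f p) * Re (det (endo \<omega> (chart_at p) (u t) p))"

definition speed :: "real \<Rightarrow> 'a \<Rightarrow> real" where "speed t p = F (dens t p)"

lemma chart_at: "chart_at p \<in> A" "p \<in> fst (chart_at p)"
  unfolding chart_at_def using someI_ex[of "\<lambda>c. c \<in> A \<and> p \<in> fst c"] chart_exists[of p] by blast+

lemma trh_eq: "t \<in> I \<Longrightarrow> c \<in> A \<Longrightarrow> p \<in> fst c \<Longrightarrow> trh t p = Re (trace (endo \<omega> c (u t) p))"
  unfolding trh_def using endo_invariant(1)[OF chart_at _ _ u_smooth[OF _ chart_at(1)] u_smooth] by simp

lemma dens_eq: "t \<in> I \<Longrightarrow> c \<in> A \<Longrightarrow> p \<in> fst c \<Longrightarrow> dens t p = exp (- f p) * Re (det (endo \<omega> c (u t) p))"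
  unfolding dens_def using endo_invariant(2)[OF chart_at _ _ u_smooth[OF _ chart_at(1)] u_smooth] by simp

lemma dens_pos: "t \<in> I \<Longrightarrow> dens t p > 0"
  unfolding dens_def using det_pos[OF _ chart_at] by simp

lemma u_time_derivative: "t \<in> I \<Longrightarrow> ((\<lambda>s. u s p) has_real_derivative speed t p) (at t within I)"
  unfolding speed_def dens_def by (rule pde[OF _ chart_at])

lemma dens_formula:
  assumes "t \<in> I" "c \<in> A" "p \<in> fst c"
  shows "dens t p = exp (ln (Re (det (\<omega> c p + ddbar c (u t) p))) - \<rho> f c (snd c p))"
  unfolding dens_eq[OF assms] endo_eq[OF assms(2,3)]
    ln_Re_det_quotient[OF metric_posdef[OF assms(2,3)] posdef[OF assms]]
  by (simp add: \<rho>_def metric_at_def chart_inv(2)[OF assms(2,3)] exp_diff exp_add exp_minus field_simps)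

lemma F_smooth: "Cinf {0<..} F"
  by (rule Cinf_smooth_on[OF F]) simp

lemma F_derivative: "s > 0 \<Longrightarrow> (F has_real_derivative deriv F s) (at s)"
  using Cinf_differentiable[OF F_smooth, of s] by (simp add: DERIV_deriv_iff_real_differentiable)

lemma Cinf_metric_pair:
  assumes "t \<in> I" "c \<in> A" "p \<in> fst c"
    "orthonormal (\<omega> c p) e" "orthonormal (\<omega> c p + ddbar c (u t) p) fr"
    "open B" "snd c p \<in> B" "B \<subseteq> chart_image c"
  shows "metric_pair B (snd c p) (metric_at c) (coord c (u t)) e fr"
proof
  have g: "metric_at c y + hess (coord c (u t)) y = \<omega> c (chart_inv c y) + ddbar c (u t) (chart_inv c y)"
    if "y \<in> chart_image c" for y
    using ddbar_hess[OF assms(2) chart_inv(3)[OF assms(2) that] u_smooth[OF assms(1,2)]] chart_inv(4)[OF assms(2) that]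
    by (simp add: metric_at_def)
  have x: "snd c p \<in> chart_image c" using assms by auto
  show "open B" "snd c p \<in> B" by (fact assms)+
  show "Cinf_mat B (metric_at c)"
    using metric_at_smooth[OF assms(2)] Cinf_subset[OF _ assms(8)] unfolding Cinf_mat_def by blast
  show "Cinf B (coord c (u t))" by (rule Cinf_subset[OF u_smooth[OF assms(1,2)] assms(8)])
  show "hermitian_posdef (metric_at c y)" if "y \<in> B" for y
    using metric_at_posdef[OF assms(2)] that assms(8) by blast
  show "hermitian_posdef (metric_at c y + hess (coord c (u t)) y)" if "y \<in> B" for y
    using g posdef[OF assms(1,2) chart_inv(3)[OF assms(2)]] that assms(8) by auto
  show "orthonormal (metric_at c (snd c p)) e"
    using assms(4) by (simp add: metric_at_def chart_inv(2)[OF assms(2,3)])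
  show "orthonormal (metric_at c (snd c p) + hess (coord c (u t)) (snd c p)) fr"
    unfolding g[OF x] using assms(5) by (simp add: chart_inv(2)[OF assms(2,3)])
qed

text \<open>The Hessian commutes with the time derivative, and the time derivative of
  \<open>u\<close> is the speed. So the trace evolves by the background Laplacian of the speed, and
  the logarithm of the density by the Laplacian of the speed with respect to the evolving metric;
  the chain rule for \<open>F\<close> turns the latter into a linear parabolic equation for the
  speed.\<close>

lemma local_flow:
  assumes t: "t \<in> I" and c: "c \<in> A" "p \<in> fst c"
    and e: "orthonormal (\<omega> c p) e" and fr: "orthonormal (\<omega> c p + ddbar c (u t) p) fr"
  obtains B where "open B" "snd c p \<in> B" "B \<subseteq> chart_image c" "Cinf B (coord c (speed t))"
    "((\<lambda>s. trh s p) has_real_derivative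
        Re (\<Sum>k\<in>UNIV. dz (e k) (dzb (e k) (\<lambda>y. of_real (coord c (speed t) y))) (snd c p))) (at t within I)"
    "((\<lambda>s. speed s p) has_real_derivative
        deriv F (dens t p) * dens t p * Re (\<Sum>i\<in>UNIV. dz (fr i) (dzb (fr i) (\<lambda>y. of_real (coord c (speed t) y))) (snd c p))) (at t within I)"
proof -
  let ?x = "snd c p"
  have xO: "?x \<in> chart_image c" by (rule chart_inv(1)[OF c])
  obtain r B g where g: "r > 0" "open B" "?x \<in> B" "B \<subseteq> chart_image c" "Cinf ({t - r<..<t + r} \<times> B) g"
    "\<And>s y. s \<in> I \<Longrightarrow> \<bar>s - t\<bar> < r \<Longrightarrow> y \<in> B \<Longrightarrow> g (s, y) = u s (chart_inv c y)"
    using local_extension[OF t c(1) xO] by metis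
  let ?P = "{t - r<..<t + r}"
  have P: "open ?P" "t \<in> ?P" using g(1) by auto
  \<comment> \<open>The time derivative of the local extension. On the slice at time
    \<open>t\<close> it equals the speed, by uniqueness of one-sided derivatives, and it is the
    reason why the speed is smooth in space.\<close>
  define W where "W y = frechet_derivative g (at (t, y)) (1, 0)" for y
  have CW: "Cinf B W"
    unfolding W_def by (rule Cinf_slices(1)[OF P(1) g(2) Cinf_frechet[OF g(5)] P(2)])
  have W: "W y = coord c (speed t) y" if y: "y \<in> B" for y
  proof -
    have d: "g differentiable (at (t, y))" by (rule Cinf_differentiable[OF g(5)]) (use P y in auto)
    have gy: "((\<lambda>s. g (s, y)) has_derivative frechet_derivative (\<lambda>s. g (s, y)) (at t)) (at t)"
      using Cinf_has_derivative[OF Cinf_slices(2)[OF P(1) g(2,5) y] P(2)] .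
    have "frechet_derivative (\<lambda>s. g (s, y)) (at t) s = W y * s" for s
    proof -
      have lin: "linear (frechet_derivative g (at (t, y)))" by (rule linear_frechet_derivative[OF d])
      have "frechet_derivative g (at (t, y)) (s *\<^sub>R (1, 0)) = s *\<^sub>R W y" unfolding W_def by (rule linear_scale[OF lin])
      then show ?thesis by (simp add: frechet_slices(2)[OF d] mult.commute)
    qed
    then have "((\<lambda>s. g (s, y)) has_real_derivative W y) (at t within I)"
      using gy unfolding has_field_derivative_def by (metis ext has_derivative_at_withinI)
    then have "((\<lambda>s. u s (chart_inv c y)) has_real_derivative W y) (at t within I)"
      by (rule has_field_derivative_transform_within[OF _ g(1) t]) (use g(6) y in \<open>auto simp: dist_real_def\<close>)
    then show ?thesis
      using has_real_derivative_within_unique[OF _ u_time_derivative[OF t] I_limit[OF t]] by metis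
  qed
  have Csp: "Cinf B (coord c (speed t))" by (rule Cinf_cong[OF g(2) W CW])
  have CWc: "Cinf B (\<lambda>y. complex_of_real (W y))" by (rule Cinf_of_real[OF g(2) CW])
  have hW: "hform (hess W ?x) v v = dz v (dzb v (\<lambda>y. of_real (coord c (speed t) y))) ?x" for v
  proof -
    have "dz v (dzb v (\<lambda>y. of_real (W y))) ?x = dz v (dzb v (\<lambda>y. of_real (coord c (speed t) y))) ?x"
    proof (rule dz_cong[OF g(2,3)])
      show "dzb v (\<lambda>y. complex_of_real (W y)) y = dzb v (\<lambda>y. complex_of_real (coord c (speed t) y)) y" if "y \<in> B" for y
        by (rule dzb_cong[OF g(2) that]) (auto simp: W intro: Cinf_differentiable[OF CWc that])
    qed (rule Cinf_differentiable[OF Cinf_dzb[OF g(2) CWc] g(3)])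
    then show ?thesis using hform_hess[OF g(2) CW g(3)] by simp
  qed
  define M where "M s = hess (\<lambda>y. g (s, y)) ?x" for s
  have M: "Cinf_mat ?P M" unfolding M_def by (rule hess_time_derivative(1)[OF P g(2,3,5)])
  have dM: "(\<lambda>s. M s $ k $ j) differentiable (at s)" if "s \<in> ?P" for s k j
    by (rule Cinf_differentiable[OF Cinf_mat_nth[OF M] that])
  have M': "cder 1 0 (\<lambda>s. M s $ k $ j) t = hess W ?x $ k $ j" for k j
    unfolding M_def W_def by (rule hess_time_derivative(2)[OF P g(2,3,5)])
  have Mu: "M s = ddbar c (u s) p" if "s \<in> I" "\<bar>s - t\<bar> < r" for s
    using hess_u_slice[OF that(1) g(2,4) c(1) g(3) g(6)[OF that]] chart_inv(2)[OF c] by (simp add: M_def)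
  have Mher: "hermitian (M s)" if "s \<in> ?P" for s
    unfolding M_def by (rule hermitian_hess[OF g(2) Cinf_slices(1)[OF P(1) g(2,5) that] g(3)])
  define N where "N s = \<omega> c p + M s" for s
  have N: "Cinf_mat ?P N"
    using M P(1) unfolding Cinf_mat_def N_def by (simp add: Cinf_add Cinf_const)
  have dN: "(\<lambda>s. N s $ k $ j) differentiable (at s)" if "s \<in> ?P" for s k j
    by (rule Cinf_differentiable[OF Cinf_mat_nth[OF N] that])
  have N': "cder 1 0 (\<lambda>s. N s $ k $ j) t = hess W ?x $ k $ j" for k j
    using cder_add[OF differentiable_const dM[OF P(2)], of 1 0 "\<omega> c p $ k $ j" k j]
    by (simp add: N_def cder_const M')
  have Nt: "N t = \<omega> c p + ddbar c (u t) p" using Mu[OF t] g(1) by (simp add: N_def)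
  have Nu: "N s = \<omega> c p + ddbar c (u s) p" if "s \<in> I" "\<bar>s - t\<bar> < r" for s
    using Mu[OF that] by (simp add: N_def)
  let ?\<eta> = "matrix_inv (\<omega> c p)"
  define k1 where "k1 s = (\<Sum>j\<in>UNIV. \<Sum>m\<in>UNIV. ?\<eta> $ j $ m * N s $ m $ j)" for s
  have k1d: "k1 differentiable (at t)"
    unfolding k1_def using dN[OF P(2)] by (intro differentiable_sum differentiable_mult) auto
  have "cder 1 0 k1 t = (\<Sum>j\<in>UNIV. \<Sum>m\<in>UNIV. ?\<eta> $ j $ m * hess W ?x $ m $ j)"
    unfolding k1_def using dN[OF P(2)] by (simp add: cder_sum cder_cmult differentiable_sum differentiable_mult N')
  also have "\<dots> = trace (?\<eta> ** hess W ?x)" by (simp add: trace_def matrix_matrix_mult_def)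
  also have "\<dots> = (\<Sum>k\<in>UNIV. dz (e k) (dzb (e k) (\<lambda>y. of_real (coord c (speed t) y))) ?x)"
    unfolding trace_frame[OF e] hW ..
  finally have "((\<lambda>s. Re (k1 s)) has_real_derivative
      Re (\<Sum>k\<in>UNIV. dz (e k) (dzb (e k) (\<lambda>y. of_real (coord c (speed t) y))) ?x)) (at t)"
    using cder_real_derivative[OF k1d] by simp
  then have tr: "((\<lambda>s. trh s p) has_real_derivative
        Re (\<Sum>k\<in>UNIV. dz (e k) (dzb (e k) (\<lambda>y. of_real (coord c (speed t) y))) ?x)) (at t within I)"
  proof (rule has_field_derivative_transform_within[OF has_field_derivative_at_within g(1) t])
    fix s assume s: "s \<in> I" "dist s t < r"
    then have "trh s p = Re (trace (?\<eta> ** N s))"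
      using trh_eq[OF s(1) c] endo_eq[OF c] Nu[OF s(1)] by (simp add: dist_real_def)
    then show "Re (k1 s) = trh s p" by (simp add: k1_def trace_def matrix_matrix_mult_def)
  qed
  \<comment> \<open>Outside \<open>I\<close> the extension is not known to give a positive form; for
    times close to \<open>t\<close> it does, so \<open>ln (det N)\<close> is smooth on an open
    interval around \<open>t\<close> and has a two-sided derivative there.\<close>
  obtain d where d: "d > 0" "\<And>N'. hermitian N' \<Longrightarrow> (\<And>j k. cmod (N' $ j $ k - N t $ j $ k) < d) \<Longrightarrow> hermitian_posdef N'"
    using posdef_near posdef[OF t c] unfolding Nt by metis
  have "\<forall>\<^sub>F s in nhds t. \<forall>j k. cmod (N s $ j $ k - N t $ j $ k) < d"
  proof (intro eventually_all_finite)
    fix j k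
    have "isCont (\<lambda>s. N s $ j $ k) t"
      using Cinf_continuous_on[OF Cinf_mat_nth[OF N]] P by (metis continuous_on_eq_continuous_at)
    then have "((\<lambda>s. N s $ j $ k) \<longlongrightarrow> N t $ j $ k) (nhds t)"
      unfolding isCont_def by (rule tendsto_at_iff_tendsto_nhds[THEN iffD1])
    from tendstoD[OF this d(1)] show "\<forall>\<^sub>F s in nhds t. cmod (N s $ j $ k - N t $ j $ k) < d" by (simp add: dist_norm)
  qed
  then obtain Q where Q: "open Q" "t \<in> Q" "\<And>s. s \<in> Q \<Longrightarrow> \<forall>j k. cmod (N s $ j $ k - N t $ j $ k) < d"
    unfolding eventually_nhds by blast
  have PQ: "open (?P \<inter> Q)" "t \<in> ?P \<inter> Q" using P Q by auto
  have NPQ: "Cinf_mat (?P \<inter> Q) N" using N Cinf_subset[of ?P _ "?P \<inter> Q"] unfolding Cinf_mat_def by blast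
  have Npd: "hermitian_posdef (N s)" if "s \<in> ?P \<inter> Q" for s
    using that Q(3)[of s] metric_posdef[OF c] unfolding N_def
    by (intro d(2)[unfolded N_def] hermitian_add Mher) (auto simp: hermitian_posdef_alt)
  have frN: "orthonormal (N t) fr" using fr Nt by simp
  define l where "l s = ln (Re (det (N s)))" for s
  have Cl: "Cinf (?P \<inter> Q) l"
    unfolding l_def by (intro Cinf_compose_real[OF Cinf_ln] Cinf_Re Cinf_det NPQ PQ(1)) (use hermitian_posdef_det_Re(2)[OF Npd] in auto)
  have "cder 1 0 (\<lambda>s. complex_of_real (l s)) t = (\<Sum>i\<in>UNIV. cder 1 0 (\<lambda>s. hform (N s) (fr i) (fr i)) t)"
    unfolding l_def by (rule cder_ln_det(1)[OF PQ NPQ Npd frN])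
  also have "\<dots> = (\<Sum>i\<in>UNIV. dz (fr i) (dzb (fr i) (\<lambda>y. of_real (coord c (speed t) y))) ?x)"
    unfolding cder_hform[OF dN[OF P(2)]] N' by (simp add: hW)
  finally have "((\<lambda>s. Re (complex_of_real (l s))) has_real_derivative
      Re (\<Sum>i\<in>UNIV. dz (fr i) (dzb (fr i) (\<lambda>y. of_real (coord c (speed t) y))) ?x)) (at t)"
    using cder_real_derivative[OF Cinf_differentiable[OF Cinf_of_real[OF PQ(1) Cl] PQ(2)]] by simp
  then have lder: "(l has_real_derivative Re (\<Sum>i\<in>UNIV. dz (fr i) (dzb (fr i) (\<lambda>y. of_real (coord c (speed t) y))) ?x)) (at t)"
    by simp
  let ?L = "Re (\<Sum>i\<in>UNIV. dz (fr i) (dzb (fr i) (\<lambda>y. of_real (coord c (speed t) y))) ?x)"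
  have den: "dens s p = exp (l s - \<rho> f c ?x)" if "s \<in> I" "\<bar>s - t\<bar> < r" for s
    using dens_formula[OF that(1) c] Nu[OF that] by (simp add: l_def)
  have dent: "dens t p = exp (l t - \<rho> f c ?x)" using den[OF t] g(1) by simp
  have "((\<lambda>s. exp (l s - \<rho> f c ?x)) has_real_derivative dens t p * ?L) (at t)"
    unfolding dent using lder by (auto intro!: derivative_eq_intros)
  moreover have "(F has_real_derivative deriv F (dens t p)) (at (exp (l t - \<rho> f c ?x)))"
    using F_derivative[OF dens_pos[OF t, of p]] by (simp only: dent)
  ultimately have "((\<lambda>s. F (exp (l s - \<rho> f c ?x))) has_real_derivative deriv F (dens t p) * (dens t p * ?L)) (at t)"
    by (rule DERIV_chain2[rotated])
  then have sp: "((\<lambda>s. speed s p) has_real_derivative deriv F (dens t p) * dens t p * ?L) (at t within I)"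
    unfolding mult.assoc
    by (rule has_field_derivative_transform_within[OF has_field_derivative_at_within g(1) t])
      (use den in \<open>auto simp: speed_def dist_real_def\<close>)
  show ?thesis by (rule that[OF g(2,3,4) Csp tr sp])
qed

lemma ddbar_tendsto:
  assumes t: "t \<in> I" and c: "c \<in> A" "p \<in> fst c"
  shows "((\<lambda>z. ddbar c (u (fst z)) (snd z) $ k $ j) \<longlongrightarrow> ddbar c (u t) p $ k $ j) (at (t, p) within I \<times> UNIV)"
    "((\<lambda>z. u (fst z) (snd z)) \<longlongrightarrow> u t p) (at (t, p) within I \<times> UNIV)"
proof -
  let ?x = "snd c p"
  have xO: "?x \<in> chart_image c" by (rule chart_inv(1)[OF c])
  obtain r B g where g: "r > 0" "open B" "?x \<in> B" "B \<subseteq> chart_image c" "Cinf ({t - r<..<t + r} \<times> B) g"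
    "\<And>s y. s \<in> I \<Longrightarrow> \<bar>s - t\<bar> < r \<Longrightarrow> y \<in> B \<Longrightarrow> g (s, y) = u s (chart_inv c y)"
    using local_extension[OF t c(1) xO] by metis
  let ?P = "{t - r<..<t + r}"
  have P: "open ?P" "t \<in> ?P" using g(1) by auto
  have PB: "open (?P \<times> B)" "(t, ?x) \<in> ?P \<times> B" using P g by (auto simp: open_Times)
  let ?F = "at (t, p) within I \<times> UNIV"
  have sc: "isCont (snd c) p"
    using chart_inv(5)[OF c(1)] open_chart(1)[OF c(1)] c(2) by (metis continuous_on_eq_continuous_at)
  have lim: "((\<lambda>z. (fst z, snd c (snd z))) \<longlongrightarrow> (t, ?x)) ?F"
  proof (rule tendsto_Pair)
    show "(fst \<longlongrightarrow> t) ?F" using tendsto_fst[OF tendsto_ident_at, of "(t, p)" "I \<times> UNIV"] by simp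
    have "(snd \<longlongrightarrow> p) ?F" using tendsto_snd[OF tendsto_ident_at, of "(t, p)" "I \<times> UNIV"] by simp
    then show "((\<lambda>z. snd c (snd z)) \<longlongrightarrow> ?x) ?F" by (rule isCont_tendsto_compose[OF sc])
  qed
  have near: "\<forall>\<^sub>F z in ?F. fst z \<in> I \<and> \<bar>fst z - t\<bar> < r \<and> snd z \<in> fst c \<and> snd c (snd z) \<in> B"
  proof -
    have op: "open (?P \<times> (snd c -` B \<inter> fst c))"
      using P(1) open_coords[OF c(1) g(2)] by (intro open_Times)
    have m: "(t, p) \<in> ?P \<times> (snd c -` B \<inter> fst c)" using P g c by auto
    have "\<forall>\<^sub>F z in ?F. z \<in> ?P \<times> (snd c -` B \<inter> fst c)" using op m eventually_at_topological by blast
    moreover have "\<forall>\<^sub>F z in ?F. z \<in> I \<times> UNIV" by (simp add: eventually_at_filter)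
    ultimately show ?thesis by eventually_elim (auto simp: abs_less_iff)
  qed
  have "isCont (slice_hess g k j) (t, ?x)"
    using Cinf_continuous_on[OF Cinf_slice_hess[OF PB(1) g(5)]] PB by (metis continuous_on_eq_continuous_at)
  from isCont_tendsto_compose[OF this lim]
  have 1: "((\<lambda>z. slice_hess g k j (fst z, snd c (snd z))) \<longlongrightarrow> slice_hess g k j (t, ?x)) ?F" .
  have eq: "slice_hess g k j (s, snd c q) = ddbar c (u s) q $ k $ j"
    if "s \<in> I" "\<bar>s - t\<bar> < r" "q \<in> fst c" "snd c q \<in> B" for s q
  proof -
    have "s \<in> ?P" using that(2) by (auto simp: abs_less_iff)
    then have "slice_hess g k j (s, snd c q) = hess (\<lambda>y. g (s, y)) (snd c q) $ k $ j"
      using hess_slice[OF P(1) _ g(2) that(4) g(5)] by metis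
    then show ?thesis
      using hess_u_slice[OF that(1) g(2,4) c(1) that(4) g(6)[OF that(1,2)]] chart_inv(2)[OF c(1) that(3)] by simp
  qed
  have "\<forall>\<^sub>F z in ?F. slice_hess g k j (fst z, snd c (snd z)) = ddbar c (u (fst z)) (snd z) $ k $ j"
    using near by eventually_elim (use eq in blast)
  from Lim_transform_eventually[OF 1 this] eq[OF t _ c(2) g(3)] g(1)
  show "((\<lambda>z. ddbar c (u (fst z)) (snd z) $ k $ j) \<longlongrightarrow> ddbar c (u t) p $ k $ j) ?F" by simp
  have "isCont g (t, ?x)" using Cinf_continuous_on[OF g(5)] PB by (metis continuous_on_eq_continuous_at)
  from isCont_tendsto_compose[OF this lim]
  have 2: "((\<lambda>z. g (fst z, snd c (snd z))) \<longlongrightarrow> g (t, ?x)) ?F" .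
  have "\<forall>\<^sub>F z in ?F. g (fst z, snd c (snd z)) = u (fst z) (snd z)"
    using near by eventually_elim (use g(6) chart_inv(2)[OF c(1)] in auto)
  from Lim_transform_eventually[OF 2 this] show "((\<lambda>z. u (fst z) (snd z)) \<longlongrightarrow> u t p) ?F"
    using g(6)[OF t _ g(3)] g(1) chart_inv(2)[OF c] by simp
qed

lemma coord_tendsto:
  assumes c: "c \<in> A" "p \<in> fst c" and h: "continuous_on (chart_image c) h"
  shows "((\<lambda>z. h (snd c (snd z))) \<longlongrightarrow> h (snd c p)) (at (t, p) within I \<times> UNIV)"
proof -
  have sc: "isCont (snd c) p"
    using chart_inv(5)[OF c(1)] open_chart(1)[OF c(1)] c(2) by (metis continuous_on_eq_continuous_at)
  have hc: "isCont h (snd c p)"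
    using h open_chart(2)[OF c(1)] chart_inv(1)[OF c] by (metis continuous_on_eq_continuous_at)
  have "(snd \<longlongrightarrow> p) (at (t, p) within I \<times> UNIV)" using tendsto_snd[OF tendsto_ident_at, of "(t, p)" "I \<times> UNIV"] by simp
  then show ?thesis by (intro isCont_tendsto_compose[OF hc] isCont_tendsto_compose[OF sc])
qed

text \<open>Joint continuity in time and space is what the attainment of maxima on compact cylinders
  rests on. Near each point it is checked in one fixed chart, where all entries converge.\<close>

lemma continuous_flow:
  "continuous_on (I \<times> UNIV) (\<lambda>z. trh (fst z) (snd z))"
  "continuous_on (I \<times> UNIV) (\<lambda>z. dens (fst z) (snd z))"
  "continuous_on (I \<times> UNIV) (\<lambda>z. u (fst z) (snd z))"
proof -
  let ?F = "\<lambda>t p. at (t, p) within I \<times> (UNIV :: 'a set)"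
  have loc: "\<forall>\<^sub>F z in ?F t p. fst z \<in> I \<and> snd z \<in> fst c" if "c \<in> A" "p \<in> fst c" for t p c
  proof -
    have op: "open (UNIV \<times> fst c)" "(t, p) \<in> UNIV \<times> fst c" using open_chart(1)[OF that(1)] that by (auto intro: open_Times)
    have "\<forall>\<^sub>F z in ?F t p. z \<in> UNIV \<times> fst c" using op eventually_at_topological by blast
    moreover have "\<forall>\<^sub>F z in ?F t p. z \<in> I \<times> UNIV" by (simp add: eventually_at_filter)
    ultimately show ?thesis by eventually_elim auto
  qed
  have ent: "((\<lambda>z. endo \<omega> c (u (fst z)) (snd z) $ i $ j) \<longlongrightarrow> endo \<omega> c (u t) p $ i $ j) (?F t p)"
    if t: "t \<in> I" and c: "c \<in> A" "p \<in> fst c" for t p c i j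
  proof -
    have inv: "((\<lambda>z. matrix_inv (\<omega> c (snd z)) $ i $ m) \<longlongrightarrow> matrix_inv (\<omega> c p) $ i $ m) (?F t p)" for m
    proof -
      have "continuous_on (chart_image c) (\<lambda>y. matrix_inv (metric_at c y) $ i $ m)"
        by (intro Cinf_continuous_on Cinf_mat_nth Cinf_mat_inv open_chart(2)[OF c(1)] metric_at_smooth[OF c(1)] metric_at_posdef[OF c(1)])
      from coord_tendsto[OF c this, of t]
      have "((\<lambda>z. matrix_inv (metric_at c (snd c (snd z))) $ i $ m) \<longlongrightarrow> matrix_inv (\<omega> c p) $ i $ m) (?F t p)"
        by (simp add: metric_at_def chart_inv(2)[OF c])
      moreover have "\<forall>\<^sub>F z in ?F t p. matrix_inv (metric_at c (snd c (snd z))) $ i $ m = matrix_inv (\<omega> c (snd z)) $ i $ m"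
        using loc[OF c] by eventually_elim (simp add: metric_at_def chart_inv(2)[OF c(1)])
      ultimately show ?thesis by (rule Lim_transform_eventually)
    qed
    show ?thesis
      unfolding endo_def vector_add_component matrix_matrix_mult_def vec_lambda_beta
      by (intro tendsto_intros inv ddbar_tendsto(1)[OF t c])
  qed
  show "continuous_on (I \<times> UNIV) (\<lambda>z. u (fst z) (snd z))"
    unfolding continuous_on_def using ddbar_tendsto(2)[OF _ chart_at] by auto
  show "continuous_on (I \<times> UNIV) (\<lambda>z. trh (fst z) (snd z))"
    unfolding continuous_on_def
  proof (rule ballI)
    fix z assume "z \<in> I \<times> (UNIV :: 'a set)"
    then obtain t p where z: "z = (t, p)" "t \<in> I" by auto
    note c = chart_at[of p]
    have "((\<lambda>z. Re (trace (endo \<omega> (chart_at p) (u (fst z)) (snd z)))) \<longlongrightarrow> Re (trace (endo \<omega> (chart_at p) (u t) p))) (?F t p)"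
      unfolding trace_def by (intro tendsto_intros ent[OF z(2) c])
    moreover have "\<forall>\<^sub>F z in ?F t p. Re (trace (endo \<omega> (chart_at p) (u (fst z)) (snd z))) = trh (fst z) (snd z)"
      using loc[OF c] by eventually_elim (use trh_eq[OF _ c(1)] in auto)
    ultimately have "((\<lambda>z. trh (fst z) (snd z)) \<longlongrightarrow> Re (trace (endo \<omega> (chart_at p) (u t) p))) (?F t p)"
      by (rule Lim_transform_eventually)
    then show "((\<lambda>z. trh (fst z) (snd z)) \<longlongrightarrow> trh (fst z) (snd z)) (at z within I \<times> UNIV)"
      using z trh_eq[OF z(2) c] by simp
  qed
  show "continuous_on (I \<times> UNIV) (\<lambda>z. dens (fst z) (snd z))"
    unfolding continuous_on_def
  proof (rule ballI)
    fix z assume "z \<in> I \<times> (UNIV :: 'a set)"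
    then obtain t p where z: "z = (t, p)" "t \<in> I" by auto
    note c = chart_at[of p]
    have fl: "((\<lambda>z. f (snd z)) \<longlongrightarrow> f p) (?F t p)"
    proof -
      have "((\<lambda>z. f (chart_inv (chart_at p) (snd (chart_at p) (snd z)))) \<longlongrightarrow> f p) (?F t p)"
        using coord_tendsto[OF c Cinf_continuous_on[OF smooth_fun_Cinf[OF f c(1)]], of t] by (simp add: chart_inv(2)[OF c])
      moreover have "\<forall>\<^sub>F z in ?F t p. f (chart_inv (chart_at p) (snd (chart_at p) (snd z))) = f (snd z)"
        using loc[OF c] by eventually_elim (simp add: chart_inv(2)[OF c(1)])
      ultimately show ?thesis by (rule Lim_transform_eventually)
    qed
    have "((\<lambda>z. exp (- f (snd z)) * Re (det (endo \<omega> (chart_at p) (u (fst z)) (snd z)))) \<longlongrightarrow>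
        exp (- f p) * Re (det (endo \<omega> (chart_at p) (u t) p))) (?F t p)"
      unfolding det_def by (intro tendsto_intros fl ent[OF z(2) c])
    moreover have "\<forall>\<^sub>F z in ?F t p. exp (- f (snd z)) * Re (det (endo \<omega> (chart_at p) (u (fst z)) (snd z))) = dens (fst z) (snd z)"
      using loc[OF c] by eventually_elim (use dens_eq[OF _ c(1)] in auto)
    ultimately have "((\<lambda>z. dens (fst z) (snd z)) \<longlongrightarrow> exp (- f p) * Re (det (endo \<omega> (chart_at p) (u t) p))) (?F t p)"
      by (rule Lim_transform_eventually)
    then show "((\<lambda>z. dens (fst z) (snd z)) \<longlongrightarrow> dens (fst z) (snd z)) (at z within I \<times> UNIV)"
      using z dens_eq[OF z(2) c] by simp
  qed
qed

end

section \<open>Maximum principle for the speed, and the mean of the solution\<close>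

context flow
begin

text \<open>The speed solves a linear parabolic equation; \<open>\<sigma>\<close> treats maxima and
  minima together. After \<open>\<epsilon> * t\<close> is subtracted, a maximum at a positive time
  is impossible: the time derivative of \<open>\<sigma>\<close> times the speed would be at least
  \<open>\<epsilon>\<close>, while the Laplacian term there is nonpositive.\<close>

lemma speed_maximum:
  assumes \<sigma>: "\<sigma> = 1 \<or> \<sigma> = -1" and init: "\<And>q. \<sigma> * speed 0 q \<le> m" and t1: "t1 \<in> I" and Fm: "continuous_on {0<..} F"
  shows "\<sigma> * speed t1 p \<le> m"
proof (rule field_le_epsilon)
  fix \<epsilon>' :: real assume \<epsilon>': "\<epsilon>' > 0"
  \<comment> \<open>The total loss \<open>\<epsilon> * t1\<close> must stay below
    \<open>\<epsilon>'\<close>; the summand 1 serves the case \<open>t1 = 0\<close>.\<close>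
  define \<epsilon> where "\<epsilon> = \<epsilon>' / (t1 + 1)"
  have t1pos: "t1 \<ge> 0" by (rule I_interval(2)[OF t1])
  have \<epsilon>: "\<epsilon> > 0" "\<epsilon> * t1 \<le> \<epsilon>'" using \<epsilon>' t1pos by (auto simp: \<epsilon>_def field_simps)
  let ?D = "{0..t1} \<times> (UNIV :: 'a set)"
  have sub: "?D \<subseteq> I \<times> UNIV" using I_interval(1)[OF t1] by auto
  have cont: "continuous_on ?D (\<lambda>z. \<sigma> * F (dens (fst z) (snd z)) - \<epsilon> * fst z)"
    using sub dens_pos
    by (intro continuous_intros continuous_on_compose2[OF Fm] continuous_on_subset[OF continuous_flow(2) sub]) auto
  have cpt: "compact ?D" using compact by (intro compact_Times) auto
  have ne: "?D \<noteq> {}" using t1pos by auto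
  obtain z where z: "z \<in> ?D"
    "\<And>y. y \<in> ?D \<Longrightarrow> \<sigma> * F (dens (fst y) (snd y)) - \<epsilon> * fst y \<le> \<sigma> * F (dens (fst z) (snd z)) - \<epsilon> * fst z"
    using continuous_attains_sup[OF cpt ne cont] by blast
  obtain t0 p0 where zt: "z = (t0, p0)" "0 \<le> t0" "t0 \<le> t1" using z(1) by (cases z) auto
  have max: "\<sigma> * speed s q - \<epsilon> * s \<le> \<sigma> * speed t0 p0 - \<epsilon> * t0" if "0 \<le> s" "s \<le> t1" for s q
    using z(2)[of "(s, q)"] that by (simp add: zt speed_def)
  have "\<sigma> * speed t0 p0 - \<epsilon> * t0 \<le> m"
  proof (cases "t0 = 0")
    case True then show ?thesis using init by simp
  next
    case False
    then have t0: "t0 > 0" "t0 \<in> I" using zt I_interval(1)[OF t1] by auto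
    define c where "c = chart_at p0"
    have c: "c \<in> A" "p0 \<in> fst c" using chart_at by (auto simp: c_def)
    obtain e where e: "orthonormal (\<omega> c p0) e" using orthonormal_exists[OF metric_posdef[OF c]] .
    obtain fr where fr: "orthonormal (\<omega> c p0 + ddbar c (u t0) p0) fr" using orthonormal_exists[OF posdef[OF t0(2) c]] .
    obtain B where B: "open B" "snd c p0 \<in> B" "B \<subseteq> chart_image c" "Cinf B (coord c (speed t0))"
      "((\<lambda>s. trh s p0) has_real_derivative
        Re (\<Sum>k\<in>UNIV. dz (e k) (dzb (e k) (\<lambda>y. of_real (coord c (speed t0) y))) (snd c p0))) (at t0 within I)"
      "((\<lambda>s. speed s p0) has_real_derivative deriv F (dens t0 p0) * dens t0 p0 *
        Re (\<Sum>i\<in>UNIV. dz (fr i) (dzb (fr i) (\<lambda>y. of_real (coord c (speed t0) y))) (snd c p0))) (at t0 within I)"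
      by (rule local_flow[OF t0(2) c e fr])
    let ?L = "\<lambda>i. dz (fr i) (dzb (fr i) (\<lambda>y. of_real (coord c (speed t0) y))) (snd c p0)"
    have neg: "\<sigma> * Re (?L i) \<le> 0" for i
    proof -
      have C: "Cinf B (\<lambda>y. \<sigma> * coord c (speed t0) y)" by (intro Cinf_mult Cinf_const B)
      have Cc: "Cinf B (\<lambda>y. complex_of_real (coord c (speed t0) y))" by (intro Cinf_of_real B)
      have "Re (dz (fr i) (dzb (fr i) (\<lambda>y. of_real (\<sigma> * coord c (speed t0) y))) (snd c p0)) \<le> 0"
        using max[OF zt(2,3)] by (intro spatial_maximum(2)[OF B(1) C B(2)]) (simp add: chart_inv(2)[OF c])
      moreover have "dz (fr i) (dzb (fr i) (\<lambda>y. of_real (\<sigma> * coord c (speed t0) y))) (snd c p0) = of_real \<sigma> * ?L i"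
      proof -
        have "dz (fr i) (dzb (fr i) (\<lambda>y. of_real (\<sigma> * coord c (speed t0) y))) (snd c p0)
           = dz (fr i) (\<lambda>y. of_real \<sigma> * dzb (fr i) (\<lambda>y. of_real (coord c (speed t0) y)) y) (snd c p0)"
          by (rule dz_cong[OF B(1,2)])
            (use Cinf_differentiable[OF Cinf_dzb[OF B(1) Cinf_of_real[OF B(1) C]] B(2)]
              in \<open>auto simp: dzb_cmult Cinf_differentiable[OF Cc]\<close>)
        then show ?thesis by (simp add: dz_cmult Cinf_differentiable[OF Cinf_dzb[OF B(1) Cc] B(2)])
      qed
      ultimately show ?thesis by simp
    qed
    have a: "deriv F (dens t0 p0) * dens t0 p0 > 0" using F' dens_pos[OF t0(2)] by simp
    have "((\<lambda>s. \<sigma> * speed s p0 - \<epsilon> * s) has_real_derivative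
       \<sigma> * (deriv F (dens t0 p0) * dens t0 p0 * Re (\<Sum>i\<in>UNIV. ?L i)) - \<epsilon>) (at t0 within I)"
      using B(6) by (auto intro!: derivative_eq_intros)
    then have "0 \<le> \<sigma> * (deriv F (dens t0 p0) * dens t0 p0 * Re (\<Sum>i\<in>UNIV. ?L i)) - \<epsilon>"
      by (rule left_maximum_derivative[OF _ t0(1)]) (use max I_interval(1)[OF t0(2)] zt in auto)
    moreover have "\<sigma> * Re (\<Sum>i\<in>UNIV. ?L i) \<le> 0"
      unfolding Re_sum sum_distrib_left using neg by (intro sum_nonpos) auto
    then have "deriv F (dens t0 p0) * dens t0 p0 * (\<sigma> * Re (\<Sum>i\<in>UNIV. ?L i)) \<le> 0"
      by (rule mult_nonneg_nonpos[OF less_imp_le[OF a]])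
    ultimately show ?thesis using \<epsilon>(1) by (simp add: mult_ac)
  qed
  then show "\<sigma> * speed t1 p \<le> m + \<epsilon>'"
    using max[of t1 p] t1pos \<epsilon>(2) by simp
qed

text \<open>The speed stays between the values of \<open>F\<close> at the initial bounds, and strict
  monotonicity of \<open>F\<close> translates this back to the density. The resulting interval does
  not grow with time.\<close>

lemma dens_bounds:
  assumes mono: "strict_mono_on {0<..} F" and d: "0 < d1" "\<And>q. d1 \<le> dens 0 q" "\<And>q. dens 0 q \<le> d2" and t: "t \<in> I"
  shows "d1 \<le> dens t p" "dens t p \<le> d2"
proof -
  have cF: "continuous_on {0<..} F" by (rule Cinf_continuous_on[OF F_smooth])
  have le: "F a \<le> F b" if "0 < a" "a \<le> b" for a b
    using mono that by (metis greaterThan_iff less_eq_real_def less_le_trans strict_mono_onD)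
  have d2: "0 < d2" using d dens_pos[OF zero_I] by (meson less_le_trans)
  have "1 * speed t p \<le> F d2"
    by (rule speed_maximum[OF _ _ t cF]) (use le[OF dens_pos[OF zero_I] d(3)] in \<open>auto simp: speed_def\<close>)
  moreover have "-1 * speed t p \<le> - F d1"
    by (rule speed_maximum[OF _ _ t cF]) (use le[OF d(1,2)] in \<open>auto simp: speed_def\<close>)
  ultimately show "d1 \<le> dens t p" "dens t p \<le> d2"
    using strict_mono_onD[OF mono] dens_pos[OF t, of p] d(1) d2
    by (auto simp: speed_def) (metis greaterThan_iff not_less)+
qed

lemma u_lipschitz:
  assumes K: "\<And>t q. t \<in> I \<Longrightarrow> \<bar>speed t q\<bar> \<le> K" and "s \<in> I" "t \<in> I"
  shows "\<bar>u t q - u s q\<bar> \<le> K * \<bar>t - s\<bar>"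
proof -
  have "convex I" using I_connected is_interval_connected_1 is_interval_convex_1 by blast
  then have "norm (u t q - u s q) \<le> K * norm (t - s)"
    by (rule field_differentiable_bound[of I "\<lambda>s. u s q" "\<lambda>s. speed s q"])
      (use assms u_time_derivative in auto)
  then show ?thesis by simp
qed

definition mean :: "'a measure \<Rightarrow> real \<Rightarrow> real" where
  "mean \<mu> t = (1 / measure \<mu> UNIV) * (\<integral>q. u t q \<partial>\<mu>)"

lemma u_continuous: "t \<in> I \<Longrightarrow> continuous_on UNIV (u t)"
proof -
  assume t: "t \<in> I"
  have "continuous_on UNIV (\<lambda>p. (\<lambda>z. u (fst z) (snd z)) (t, p))"
    by (rule continuous_on_compose2[OF continuous_flow(3)]) (use t in \<open>auto intro!: continuous_intros\<close>)
  then show ?thesis by simp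
qed

text \<open>The bound for the speed passes through the integral, with no differentiation under the
  integral sign. A Lipschitz bound is enough since the mean is later compared with a linear function
  of time.\<close>

lemma mean_lipschitz:
  assumes \<mu>: "sets \<mu> = sets borel" and K: "\<And>t q. t \<in> I \<Longrightarrow> \<bar>speed t q\<bar> \<le> K" and st: "s \<in> I" "t \<in> I"
  shows "mean \<mu> t - mean \<mu> s \<le> K * \<bar>t - s\<bar>"
proof (cases "measure \<mu> UNIV = 0")
  \<comment> \<open>By convention \<open>measure\<close> is 0 also for infinite total mass; division
    by zero then makes the mean vanish identically.\<close>
  case True
  have "0 \<le> K" using K[OF zero_I] by (meson abs_ge_zero order_trans)
  then show ?thesis using True by (simp add: mean_def)
next
  case False
  have sp: "space \<mu> = UNIV" using sets_eq_imp_space_eq[OF \<mu>] by simp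
  have "emeasure \<mu> (space \<mu>) \<noteq> \<infinity>" using False by (auto simp: sp measure_def)
  then interpret finite_measure \<mu> by (rule finite_measureI)
  have int: "integrable \<mu> (u r)" if "r \<in> I" for r
  proof -
    have "compact (u r ` UNIV)" using compact_continuous_image[OF u_continuous[OF that] compact] .
    then have "bounded (u r ` UNIV)" by (rule compact_imp_bounded)
    then obtain b where "\<forall>y\<in>u r ` UNIV. norm y \<le> b" unfolding bounded_iff by blast
    then have b: "\<And>q. \<bar>u r q\<bar> \<le> b" by simp
    have "u r \<in> borel_measurable borel" by (rule borel_measurable_continuous_onI[OF u_continuous[OF that]])
    then have "u r \<in> borel_measurable \<mu>" using measurable_cong_sets[OF \<mu> refl] by blast
    then show ?thesis by (intro integrable_const_bound[of _ b]) (auto simp: b)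
  qed
  have V: "measure \<mu> UNIV > 0" using False by (simp add: zero_less_measure_iff)
  have "(\<integral>q. u t q \<partial>\<mu>) - (\<integral>q. u s q \<partial>\<mu>) = (\<integral>q. u t q - u s q \<partial>\<mu>)"
    using int st by simp
  also have "\<dots> \<le> (\<integral>q. K * \<bar>t - s\<bar> \<partial>\<mu>)"
    using u_lipschitz[OF K st] int st by (intro integral_mono) (auto simp: abs_le_iff)
  also have "\<dots> = K * \<bar>t - s\<bar> * measure \<mu> UNIV" by (simp add: sp)
  finally have "((\<integral>q. u t q \<partial>\<mu>) - (\<integral>q. u s q \<partial>\<mu>)) / measure \<mu> UNIV \<le> K * \<bar>t - s\<bar>"
    using V by (simp add: divide_le_eq)
  then show ?thesis by (simp add: mean_def diff_divide_distrib)
qed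

end

section \<open>Uniform bounds for the geometry\<close>

context hermitian_manifold
begin

text \<open>A continuous function may blow up at the edge of its chart, so a uniform bound can only
  be asked for in a chart that depends on the point. The open sets where \<open>h c\<close> lies
  below a natural number cover the manifold, and finitely many of them suffice.\<close>

lemma bounded_in_some_chart:
  assumes "\<And>c. c \<in> A \<Longrightarrow> continuous_on (chart_image c) (h c)"
  obtains K :: real where "K \<ge> 1" "\<And>p. \<exists>c\<in>A. p \<in> fst c \<and> h c (snd c p) \<le> K"
proof -
  define U where "U cm = snd (fst cm) -` (h (fst cm) -` {..<real (snd cm)} \<inter> chart_image (fst cm)) \<inter> fst (fst cm)"
    for cm :: "('a, 'n) chart \<times> nat"
  have "open (U cm)" if "cm \<in> A \<times> UNIV" for cm
  proof -
    have c: "fst cm \<in> A" using that by auto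
    have "open (h (fst cm) -` {..<real (snd cm)} \<inter> chart_image (fst cm))"
      using assms[OF c] open_chart(2)[OF c] by (metis continuous_on_open_vimage open_lessThan)
    then show ?thesis unfolding U_def by (rule open_coords[OF c])
  qed
  moreover have "UNIV \<subseteq> (\<Union>cm\<in>A \<times> UNIV. U cm)"
  proof
    fix p
    obtain c where c: "c \<in> A" "p \<in> fst c" using chart_exists by blast
    obtain m :: nat where "h c (snd c p) < real m" using reals_Archimedean2 by blast
    then have "p \<in> U (c, m)" using c chart_inv(1)[OF c] by (simp add: U_def)
    then show "p \<in> (\<Union>cm\<in>A \<times> UNIV. U cm)" using c by blast
  qed
  ultimately obtain S where S: "S \<subseteq> A \<times> UNIV" "finite S" "UNIV \<subseteq> (\<Union>cm\<in>S. U cm)"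
    using compactE_image[OF compact, of "A \<times> UNIV" U] by metis
  define K where "K = 1 + (\<Sum>cm\<in>S. real (snd cm))"
  show ?thesis
  proof
    show "K \<ge> 1" unfolding K_def by (simp add: sum_nonneg)
    fix p
    obtain cm where cm: "cm \<in> S" "p \<in> U cm" using S(3) by blast
    have "h (fst cm) (snd (fst cm) p) \<le> real (snd cm)" "p \<in> fst (fst cm)" using cm(2) by (auto simp: U_def)
    moreover have "real (snd cm) \<le> (\<Sum>cm\<in>S. real (snd cm))" by (rule member_le_sum[OF cm(1)]) (use S in auto)
    moreover have "fst cm \<in> A" using cm(1) S(1) by auto
    ultimately show "\<exists>c\<in>A. p \<in> fst c \<and> h c (snd c p) \<le> K" unfolding K_def by (intro bexI[of _ "fst cm"]) auto
  qed
qed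

lemma double_sum_bound:
  fixes g :: "'i::finite \<Rightarrow> 'j::finite \<Rightarrow> real"
  assumes "\<And>i j. g i j \<ge> 0" shows "g i j \<le> (\<Sum>i\<in>UNIV. \<Sum>j\<in>UNIV. g i j)"
proof -
  have "g i j \<le> (\<Sum>j\<in>UNIV. g i j)" by (rule member_le_sum) (use assms in auto)
  also have "\<dots> \<le> (\<Sum>i\<in>UNIV. \<Sum>j\<in>UNIV. g i j)"
    by (rule member_le_sum[of i UNIV "\<lambda>i. \<Sum>j\<in>UNIV. g i j"]) (use assms in \<open>auto intro: sum_nonneg\<close>)
  finally show ?thesis .
qed

definition jets0 :: "(complex^'n \<Rightarrow> complex^'n^'n) \<Rightarrow> complex^'n \<Rightarrow> real" where
  "jets0 M y = (\<Sum>i\<in>UNIV. \<Sum>j\<in>UNIV. cmod (M y $ i $ j))"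

definition jets1 :: "(complex^'n \<Rightarrow> complex^'n^'n) \<Rightarrow> complex^'n \<Rightarrow> real" where
  "jets1 M y = (\<Sum>i\<in>UNIV. \<Sum>j\<in>UNIV. \<Sum>a\<in>UNIV. cmod (dz (axis a 1) (\<lambda>y. M y $ i $ j) y))"

definition jets2 :: "(complex^'n \<Rightarrow> complex) \<Rightarrow> complex^'n \<Rightarrow> real" where
  "jets2 h y = (\<Sum>a\<in>UNIV. \<Sum>b\<in>UNIV. cmod (dz (axis a 1) (dzb (axis b 1) h) y))"

lemma jets_nonneg: "jets0 M y \<ge> 0" "jets1 M y \<ge> 0" "jets2 h y \<ge> 0"
  unfolding jets0_def jets1_def jets2_def by (intro sum_nonneg norm_ge_zero)+

lemma jets_bound:
  "cmod (M y $ i $ j) \<le> jets0 M y"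
  "cmod (dz (axis a 1) (\<lambda>y. M y $ i $ j) y) \<le> jets1 M y"
  "cmod (dz (axis a 1) (dzb (axis b 1) h) y) \<le> jets2 h y"
proof -
  show "cmod (M y $ i $ j) \<le> jets0 M y"
    unfolding jets0_def using double_sum_bound[of "\<lambda>i j. cmod (M y $ i $ j)"] by simp
  show "cmod (dz (axis a 1) (dzb (axis b 1) h) y) \<le> jets2 h y"
    unfolding jets2_def using double_sum_bound[of "\<lambda>a b. cmod (dz (axis a 1) (dzb (axis b 1) h) y)"] by simp
  have "cmod (dz (axis a 1) (\<lambda>y. M y $ i $ j) y) \<le> (\<Sum>a\<in>UNIV. cmod (dz (axis a 1) (\<lambda>y. M y $ i $ j) y))"
    by (rule member_le_sum) auto
  also have "\<dots> \<le> jets1 M y"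
    unfolding jets1_def using double_sum_bound[of "\<lambda>i j. \<Sum>a\<in>UNIV. cmod (dz (axis a 1) (\<lambda>y. M y $ i $ j) y)"]
    by (simp add: sum_nonneg)
  finally show "cmod (dz (axis a 1) (\<lambda>y. M y $ i $ j) y) \<le> jets1 M y" .
qed

lemma jets_continuous:
  assumes "open S"
  shows "Cinf_mat S M \<Longrightarrow> continuous_on S (jets0 M)" "Cinf_mat S M \<Longrightarrow> continuous_on S (jets1 M)"
    "Cinf S h \<Longrightarrow> continuous_on S (jets2 h)"
  unfolding jets0_def jets1_def jets2_def
  by (intro continuous_on_sum continuous_on_norm Cinf_continuous_on Cinf_dz Cinf_dzb assms Cinf_mat_nth; assumption)+

lemma Cinf_ln_det: "open S \<Longrightarrow> Cinf_mat S M \<Longrightarrow> (\<And>y. y \<in> S \<Longrightarrow> hermitian_posdef (M y)) \<Longrightarrow> Cinf S (\<lambda>y. ln (Re (det (M y))))"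
  by (intro Cinf_compose_real[OF Cinf_ln] Cinf_Re Cinf_det) (use hermitian_posdef_det_Re(2) in auto)

lemma \<rho>_smooth:
  assumes "smooth_fun A f" "c \<in> A" shows "Cinf (chart_image c) (\<rho> f c)"
  unfolding \<rho>_def[abs_def]
  using smooth_fun_Cinf[OF assms] open_chart(2)[OF assms(2)] metric_at_smooth[OF assms(2)] metric_at_posdef[OF assms(2)]
  by (intro Cinf_add Cinf_ln_det)

text \<open>What the final constant depends on besides \<open>F\<close> and the dimension: jets of
  the background metric and of its inverse up to order two, the functions \<open>f\<close> and
  \<open>\<rho>\<close>, and the initial density and trace. Of the solution only \<open>u0\<close>
  enters, so \<open>K\<close> can be fixed in advance.\<close>

definition bounded_data :: "('a \<Rightarrow> real) \<Rightarrow> ('a \<Rightarrow> real) \<Rightarrow> real \<Rightarrow> ('a, 'n) chart \<Rightarrow> 'a \<Rightarrow> bool" where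
  "bounded_data f u0 K c p \<longleftrightarrow> p \<in> fst c \<and> jets0 (metric_at c) (snd c p) \<le> K \<and> jets0 (\<lambda>y. matrix_inv (metric_at c y)) (snd c p) \<le> K
       \<and> jets1 (metric_at c) (snd c p) \<le> K \<and> jets1 (\<lambda>y. matrix_inv (metric_at c y)) (snd c p) \<le> K
       \<and> (\<forall>i j. jets2 (\<lambda>y. metric_at c y $ i $ j) (snd c p) \<le> K)
       \<and> (\<forall>i j. jets2 (\<lambda>y. matrix_inv (metric_at c y) $ i $ j) (snd c p) \<le> K)
       \<and> jets2 (\<lambda>y. of_real (\<rho> f c y)) (snd c p) \<le> K \<and> \<bar>f p\<bar> \<le> K
       \<and> \<bar>ln (Re (det (\<omega> c p + ddbar c u0 p))) - \<rho> f c (snd c p)\<bar> \<le> K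
       \<and> Re (trace (endo \<omega> c u0 p)) \<le> K"

lemma uniform_bounds:
  assumes f: "smooth_fun A f" and u0: "smooth_fun A u0"
    and pos0: "\<forall>c\<in>A. \<forall>p\<in>fst c. hermitian_posdef (\<omega> c p + ddbar c u0 p)"
  obtains K where "K \<ge> 1" "\<And>p. \<exists>c\<in>A. bounded_data f u0 K c p"
proof -
  define G where "G c y = metric_at c y + hess (coord c u0) y" for c y
  define \<eta> where "\<eta> c y = matrix_inv (metric_at c y)" for c y
  define s2 where "s2 M y = (\<Sum>i\<in>UNIV. \<Sum>j\<in>UNIV. jets2 (\<lambda>y. M y $ i $ j) y)" for M :: "complex^'n \<Rightarrow> complex^'n^'n" and y
  \<comment> \<open>All quantities are added up into one continuous function with nonnegative
    summands, so that a single chart serves for all of them at once.\<close>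
  define h where "h c y = jets0 (metric_at c) y + jets0 (\<eta> c) y + jets1 (metric_at c) y + jets1 (\<eta> c) y
     + s2 (metric_at c) y + s2 (\<eta> c) y + jets2 (\<lambda>y. of_real (\<rho> f c y)) y + \<bar>coord c f y\<bar>
     + \<bar>ln (Re (det (G c y))) - \<rho> f c y\<bar> + \<bar>Re (trace (\<eta> c y ** G c y))\<bar>" for c y
  have G: "G c (snd c p) = \<omega> c p + ddbar c u0 p" if "c \<in> A" "p \<in> fst c" for c p
    using ddbar_hess[OF that smooth_fun_Cinf[OF u0 that(1)]] by (simp add: G_def metric_at_def chart_inv(2)[OF that])
  have "continuous_on (chart_image c) (h c)" if c: "c \<in> A" for c
  proof -
    note O = open_chart(2)[OF c]
    note H = metric_at_smooth[OF c]
    have E: "Cinf_mat (chart_image c) (\<eta> c)"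
      unfolding \<eta>_def[abs_def] by (rule Cinf_mat_inv[OF O H metric_at_posdef[OF c]])
    have GC: "Cinf_mat (chart_image c) (G c)"
      using H Cinf_mat_hess[OF O smooth_fun_Cinf[OF u0 c]] O unfolding Cinf_mat_def G_def by (simp add: Cinf_add)
    have Gp: "hermitian_posdef (G c y)" if "y \<in> chart_image c" for y
      using G[OF c chart_inv(3)[OF c that]] pos0 c chart_inv(3,4)[OF c that] by simp
    have s2: "continuous_on (chart_image c) (s2 M)" if "Cinf_mat (chart_image c) M" for M
      unfolding s2_def by (intro continuous_on_sum jets_continuous(3)[OF O] Cinf_mat_nth[OF that])
    have tr: "continuous_on (chart_image c) (\<lambda>y. Re (trace (\<eta> c y ** G c y)))"
      unfolding trace_def matrix_matrix_mult_def vec_lambda_beta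
      by (intro continuous_on_Re Cinf_continuous_on Cinf_sum Cinf_mult O Cinf_mat_nth[OF E] Cinf_mat_nth[OF GC])
    show ?thesis
      unfolding h_def
      by (intro continuous_on_add continuous_on_rabs continuous_on_diff jets_continuous[OF O] s2 H E tr
          Cinf_of_real[OF O] \<rho>_smooth[OF f c] Cinf_continuous_on[OF smooth_fun_Cinf[OF f c]]
          Cinf_continuous_on[OF \<rho>_smooth[OF f c]] Cinf_continuous_on[OF Cinf_ln_det[OF O GC Gp]])
  qed
  then obtain K where K: "K \<ge> 1" "\<And>p. \<exists>c\<in>A. p \<in> fst c \<and> h c (snd c p) \<le> K"
    using bounded_in_some_chart by metis
  show ?thesis
  proof (rule that[OF K(1)])
    fix p
    obtain c where c: "c \<in> A" "p \<in> fst c" "h c (snd c p) \<le> K" using K(2) by blast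
    let ?x = "snd c p"
    have s2: "jets2 (\<lambda>y. M y $ i $ j) ?x \<le> s2 M ?x" "0 \<le> s2 M ?x" for M i j
      unfolding s2_def
      by (rule double_sum_bound[of "\<lambda>i j. jets2 (\<lambda>y. M y $ i $ j) ?x"], rule jets_nonneg)
        (intro sum_nonneg jets_nonneg)
    have tr: "Re (trace (endo \<omega> c u0 p)) = Re (trace (\<eta> c ?x ** G c ?x))"
      unfolding endo_eq[OF c(1,2)] G[OF c(1,2)] \<eta>_def metric_at_def chart_inv(2)[OF c(1,2)] ..
    note nn = jets_nonneg(1)[of "metric_at c" ?x] jets_nonneg(1)[of "\<eta> c" ?x] jets_nonneg(2)[of "metric_at c" ?x]
      jets_nonneg(2)[of "\<eta> c" ?x] s2(2)[of "metric_at c"] s2(2)[of "\<eta> c"]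
      jets_nonneg(3)[of "\<lambda>y. of_real (\<rho> f c y)" ?x]
      abs_ge_zero[of "coord c f ?x"] abs_ge_zero[of "ln (Re (det (G c ?x))) - \<rho> f c ?x"]
      abs_ge_zero[of "Re (trace (\<eta> c ?x ** G c ?x))"]
    have "jets0 (metric_at c) ?x \<le> K" "jets0 (\<eta> c) ?x \<le> K" "jets1 (metric_at c) ?x \<le> K" "jets1 (\<eta> c) ?x \<le> K"
      "s2 (metric_at c) ?x \<le> K" "s2 (\<eta> c) ?x \<le> K" "jets2 (\<lambda>y. of_real (\<rho> f c y)) ?x \<le> K" "\<bar>coord c f ?x\<bar> \<le> K"
      "\<bar>ln (Re (det (G c ?x))) - \<rho> f c ?x\<bar> \<le> K" "\<bar>Re (trace (\<eta> c ?x ** G c ?x))\<bar> \<le> K"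
      using nn c(3) unfolding h_def by linarith+
    moreover from this have "jets2 (\<lambda>y. metric_at c y $ i $ j) ?x \<le> K" "jets2 (\<lambda>y. \<eta> c y $ i $ j) ?x \<le> K" for i j
      using order_trans[OF s2(1)] by blast+
    ultimately show "\<exists>c\<in>A. bounded_data f u0 K c p"
      unfolding bounded_data_def
      using c(1,2) G[OF c(1,2)] tr chart_inv(2)[OF c(1,2)]
      by (intro bexI[of _ c] conjI allI) (auto simp: \<eta>_def[abs_def])
  qed
qed

end

section \<open>The trace estimate\<close>

context metric_pair_bounded
begin

lemma \<tau>_pos_on: assumes "y \<in> S" shows "\<tau> y > 0"
proof -
  obtain e' where e': "orthonormal (H y) e'" using orthonormal_exists[OF Hpd[OF assms]] .
  obtain f' where f': "orthonormal (H y + hess u y) f'" using orthonormal_exists[OF Gpd[OF assms]] .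
  interpret y: metric_pair S y H u e' f'
    by unfold_locales (use S assms H u Hpd Gpd e' f' in auto)
  show ?thesis using y.\<tau>_pos unfolding y.\<tau>_def y.G_def \<tau>_def G_def .
qed

text \<open>\<open>\<gamma>1\<close> and \<open>\<gamma>2\<close> are the first two derivatives of
  the barrier \<open>1 / (z - k + 1) - A * (z - k)\<close> at \<open>z = u x\<close>. Time is fixed
  here, so a constant \<open>k\<close> can stand for the mean plus the infimum, and the chain rule
  turns the conditions for a spatial maximum into these two relations.\<close>

lemma test_function_maximum:
  assumes w: "Cinf S w" and k: "\<And>y. y \<in> S \<Longrightarrow> u y - k \<ge> 0"
    and max: "\<And>y. y \<in> S \<Longrightarrow> ln (\<tau> y) + B * (w y)\<^sup>2 + (1 / (u y - k + 1) - A * (u y - k))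
        \<le> ln (\<tau> x) + B * (w x)\<^sup>2 + (1 / (u x - k + 1) - A * (u x - k))"
  defines "\<gamma>1 \<equiv> - A - 1 / (u x - k + 1)\<^sup>2" and "\<gamma>2 \<equiv> 2 / (u x - k + 1) ^ 3"
  shows "dz v (\<lambda>y. of_real (\<tau> y)) x / of_real (\<tau> x) + of_real (2 * B * w x) * dz v (\<lambda>y. of_real (w y)) x
      + of_real \<gamma>1 * dz v (\<lambda>y. of_real (u y)) x = 0"
    and "Re (dz v (dzb v (\<lambda>y. of_real (\<tau> y))) x) / \<tau> x - (cmod (dz v (\<lambda>y. of_real (\<tau> y)) x))\<^sup>2 / (\<tau> x)\<^sup>2
      + 2 * B * w x * Re (dz v (dzb v (\<lambda>y. of_real (w y))) x) + 2 * B * (cmod (dz v (\<lambda>y. of_real (w y)) x))\<^sup>2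
      + \<gamma>1 * Re (dz v (dzb v (\<lambda>y. of_real (u y))) x) + \<gamma>2 * (cmod (dz v (\<lambda>y. of_real (u y)) x))\<^sup>2 \<le> 0"
proof -
  let ?\<gamma> = "\<lambda>z. 1 / (z - k + 1) - A * (z - k)"
  let ?\<gamma>' = "\<lambda>z. - 1 / (z - k + 1)\<^sup>2 - A"
  let ?a = "\<lambda>y. ln (\<tau> y)" and ?b = "\<lambda>y. B * (w y)\<^sup>2" and ?c = "\<lambda>y. ?\<gamma> (u y)"
  have pos: "u y - k + 1 > 0" if "y \<in> S" for y using k[OF that] by simp
  have Ca: "Cinf S ?a" by (intro Cinf_compose_real[OF Cinf_ln] S C\<tau>) (use \<tau>_pos_on in auto)
  have Cb: "Cinf S ?b" unfolding power2_eq_square by (intro Cinf_mult Cinf_const S w)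
  have Cc: "Cinf S ?c"
  proof -
    have "Cinf S (\<lambda>y. inverse (u y - k + 1))"
      by (intro Cinf_compose_real[OF Cinf_inverse] Cinf_add Cinf_diff Cinf_const S u) (use pos in auto)
    then show ?thesis unfolding inverse_eq_divide by (intro Cinf_diff Cinf_mult Cinf_const S u)
  qed
  have Cab: "Cinf S (\<lambda>y. ?a y + ?b y)" by (intro Cinf_add S Ca Cb)
  have Cabc: "Cinf S (\<lambda>y. ?a y + ?b y + ?c y)" by (intro Cinf_add S Cab Cc)
  have D\<tau>: "(ln has_real_derivative inverse (\<tau> y)) (at (\<tau> y))" if "y \<in> S" for y
    using \<tau>_pos_on[OF that] by (auto intro!: derivative_eq_intros simp: field_simps)
  have Dw: "((\<lambda>z. B * z\<^sup>2) has_real_derivative 2 * B * z) (at z)" for z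
    by (auto intro!: derivative_eq_intros)
  have D\<gamma>: "(?\<gamma> has_real_derivative ?\<gamma>' (u y)) (at (u y))" if "y \<in> S" for y
    using pos[OF that] by (auto intro!: derivative_eq_intros simp: power2_eq_square)
  have DD\<tau>: "(inverse has_real_derivative - (1 / (\<tau> x)\<^sup>2)) (at (\<tau> x))"
    using \<tau>_pos_on[OF xS] by (auto intro!: derivative_eq_intros simp: field_simps power2_eq_square)
  have DDw: "((\<lambda>z. 2 * B * z) has_real_derivative 2 * B) (at z)" for z
    by (auto intro!: derivative_eq_intros)
  have DD\<gamma>: "(?\<gamma>' has_real_derivative \<gamma>2) (at (u x))"
  proof -
    have p: "u x - k + 1 \<noteq> 0" using pos[OF xS] by simp
    have "((\<lambda>z. (z - k + 1)\<^sup>2) has_real_derivative 2 * (u x - k + 1)) (at (u x))"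
      by (auto intro!: derivative_eq_intros)
    from DERIV_inverse'[OF this] p
    have "((\<lambda>z. inverse ((z - k + 1)\<^sup>2)) has_real_derivative - (inverse ((u x - k + 1)\<^sup>2) * (2 * (u x - k + 1)) * inverse ((u x - k + 1)\<^sup>2))) (at (u x))"
      by simp
    from DERIV_diff[OF DERIV_minus[OF this] DERIV_const[of A]]
    have 1: "(?\<gamma>' has_real_derivative - (- (inverse ((u x - k + 1)\<^sup>2) * (2 * (u x - k + 1)) * inverse ((u x - k + 1)\<^sup>2))) - 0) (at (u x))"
      by (simp add: divide_inverse)
    have "- (- (inverse (q\<^sup>2) * (2 * q) * inverse (q\<^sup>2))) - 0 = 2 / q ^ 3" if "q \<noteq> 0" for q :: real
      using that by (simp add: field_simps power2_eq_square power3_eq_cube)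
    from 1[unfolded this[OF p]] show ?thesis unfolding \<gamma>2_def .
  qed
  have \<gamma>1: "?\<gamma>' (u x) = \<gamma>1" by (simp add: \<gamma>1_def)
  note d = Cinf_differentiable[OF _ xS]
  note dc = d[OF Cinf_of_real[OF S]]
  note M = spatial_maximum[OF S Cabc xS, OF max]
  have split1: "dz v (\<lambda>y. of_real (?a y + ?b y + ?c y)) x
     = dz v (\<lambda>y. of_real (?a y)) x + dz v (\<lambda>y. of_real (?b y)) x + dz v (\<lambda>y. of_real (?c y)) x"
    unfolding of_real_add[of _ "?c _"] of_real_add[of "?a _" "?b _"]
    using dz_add[OF dc[OF Cab] dc[OF Cc], of v] dz_add[OF dc[OF Ca] dc[OF Cb], of v] by simp
  have split2: "dz v (dzb v (\<lambda>y. of_real (?a y + ?b y + ?c y))) x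
     = dz v (dzb v (\<lambda>y. of_real (?a y))) x + dz v (dzb v (\<lambda>y. of_real (?b y))) x + dz v (dzb v (\<lambda>y. of_real (?c y))) x"
  proof -
    have "dz v (dzb v (\<lambda>y. of_real (h y + h' y))) x = dz v (dzb v (\<lambda>y. of_real (h y))) x + dz v (dzb v (\<lambda>y. of_real (h' y))) x"
      if h: "Cinf S h" "Cinf S h'" for h h' :: "complex^'n \<Rightarrow> real"
    proof -
      have "dz v (dzb v (\<lambda>y. of_real (h y + h' y))) x = dz v (\<lambda>y. dzb v (\<lambda>y. of_real (h y)) y + dzb v (\<lambda>y. of_real (h' y)) y) x"
      proof (rule dz_cong[OF S xS])
        show "dzb v (\<lambda>y. complex_of_real (h y + h' y)) y = dzb v (\<lambda>y. of_real (h y)) y + dzb v (\<lambda>y. of_real (h' y)) y" if "y \<in> S" for y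
          unfolding of_real_add using Cinf_differentiable[OF Cinf_of_real[OF S h(1)] that] Cinf_differentiable[OF Cinf_of_real[OF S h(2)] that]
          by (rule dzb_add)
      qed (rule d[OF Cinf_dzb[OF S Cinf_of_real[OF S Cinf_add[OF S h]]]])
      also have "\<dots> = dz v (dzb v (\<lambda>y. of_real (h y))) x + dz v (dzb v (\<lambda>y. of_real (h' y))) x"
        by (rule dz_add) (rule d[OF Cinf_dzb[OF S Cinf_of_real[OF S h(1)]]], rule d[OF Cinf_dzb[OF S Cinf_of_real[OF S h(2)]]])
      finally show ?thesis .
    qed
    from this[OF Cab Cc] this[OF Ca Cb] show ?thesis by simp
  qed
  have a1: "dz v (\<lambda>y. of_real (?a y)) x = of_real (inverse (\<tau> x)) * dz v (\<lambda>y. of_real (\<tau> y)) x"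
    by (rule dz_compose_real[OF d[OF C\<tau>] D\<tau>[OF xS]])
  have b1: "dz v (\<lambda>y. of_real (?b y)) x = of_real (2 * B * w x) * dz v (\<lambda>y. of_real (w y)) x"
    by (rule dz_compose_real[OF d[OF w] Dw])
  have c1: "dz v (\<lambda>y. of_real (?c y)) x = of_real \<gamma>1 * dz v (\<lambda>y. of_real (u y)) x"
    unfolding \<gamma>1[symmetric] by (rule dz_compose_real[OF d[OF u] D\<gamma>[OF xS]])
  have a2: "dz v (dzb v (\<lambda>y. of_real (?a y))) x = of_real (- (1 / (\<tau> x)\<^sup>2) * (cmod (dz v (\<lambda>y. of_real (\<tau> y)) x))\<^sup>2)
     + of_real (inverse (\<tau> x)) * dz v (dzb v (\<lambda>y. of_real (\<tau> y))) x"
    by (rule dz_dzb_compose_real[OF S C\<tau> xS D\<tau> DD\<tau>])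
  have b2: "dz v (dzb v (\<lambda>y. of_real (?b y))) x = of_real (2 * B * (cmod (dz v (\<lambda>y. of_real (w y)) x))\<^sup>2)
     + of_real (2 * B * w x) * dz v (dzb v (\<lambda>y. of_real (w y))) x"
    by (rule dz_dzb_compose_real[OF S w xS Dw DDw])
  have c2: "dz v (dzb v (\<lambda>y. of_real (?c y))) x = of_real (\<gamma>2 * (cmod (dz v (\<lambda>y. of_real (u y)) x))\<^sup>2)
     + of_real \<gamma>1 * dz v (dzb v (\<lambda>y. of_real (u y))) x"
    unfolding \<gamma>1[symmetric] by (rule dz_dzb_compose_real[OF S u xS D\<gamma> DD\<gamma>])
  show "dz v (\<lambda>y. of_real (\<tau> y)) x / of_real (\<tau> x) + of_real (2 * B * w x) * dz v (\<lambda>y. of_real (w y)) x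
      + of_real \<gamma>1 * dz v (\<lambda>y. of_real (u y)) x = 0"
    using M(1)[of v] unfolding split1 a1 b1 c1 by (simp add: divide_inverse mult.commute)
  show "Re (dz v (dzb v (\<lambda>y. of_real (\<tau> y))) x) / \<tau> x - (cmod (dz v (\<lambda>y. of_real (\<tau> y)) x))\<^sup>2 / (\<tau> x)\<^sup>2
      + 2 * B * w x * Re (dz v (dzb v (\<lambda>y. of_real (w y))) x) + 2 * B * (cmod (dz v (\<lambda>y. of_real (w y)) x))\<^sup>2
      + \<gamma>1 * Re (dz v (dzb v (\<lambda>y. of_real (u y))) x) + \<gamma>2 * (cmod (dz v (\<lambda>y. of_real (u y)) x))\<^sup>2 \<le> 0"
    using M(2)[of v] unfolding split2 a2 b2 c2 plus_complex.simps Re_complex_of_real times_complex.simps Im_complex_of_real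
    by (simp add: divide_inverse mult.commute)
qed

end

lemma Cinf_deriv:
  fixes F :: "real \<Rightarrow> real"
  assumes "open S" "Cinf S F" shows "Cinf S (deriv F)"
proof (rule Cinf_cong[OF assms(1) _ Cinf_frechet[OF assms(2), of 1]])
  fix s assume "s \<in> S"
  then have "F differentiable (at s)" by (rule Cinf_differentiable[OF assms(2)])
  then have "(F has_derivative (\<lambda>v. deriv F s * v)) (at s)"
    using DERIV_deriv_iff_real_differentiable[of F s] by (simp add: has_field_derivative_def)
  from frechet_derivative_at[OF this] show "frechet_derivative F (at s) 1 = deriv F s" by (metis mult.right_neutral)
qed

text \<open>The barrier is decreasing, so at earlier times \<open>y\<close> may be replaced by
  something larger without disturbing the comparison with the maximum.\<close>

lemma barrier_mono:
  fixes y y' A :: real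
  assumes "0 \<le> y" "y \<le> y'" "A \<ge> 0"
  shows "1 / (y' + 1) - A * y' \<le> 1 / (y + 1) - A * y"
  using assms by (intro diff_mono divide_left_mono mult_left_mono) auto

context flow
begin

text \<open>Since \<open>t0 > 0\<close>, both the spatial conditions and the one-sided condition in
  time hold at the maximum; with \<open>laplace_speed\<close> they are the hypotheses of
  \<open>maximum_point_estimate\<close>. Its two alternatives are translated back, the first by
  inserting the value of \<open>\<gamma>2\<close>, the second by
  \<open>\<tau>_upper\<close>.\<close>

lemma maximum_point_bound:
  fixes K m1 m3 Kw A' B C c0 N i0 t0 :: real and \<mu> :: "'a measure"
  assumes K: "K \<ge> 1"
    and c: "c \<in> A" and bd: "bounded_data f u0 K c p"
    and dens: "\<And>t q. t \<in> I \<Longrightarrow> exp (- K) \<le> dens t q" "\<And>t q. t \<in> I \<Longrightarrow> dens t q \<le> exp K"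
    and m1: "m1 > 0" "\<And>s. \<bar>s\<bar> \<le> K \<Longrightarrow> m1 \<le> deriv F (exp s) * exp s"
    and m3: "\<And>s. \<bar>s\<bar> \<le> K \<Longrightarrow> \<bar>deriv (deriv F) (exp s) * exp s * exp s + deriv F (exp s) * exp s\<bar> \<le> m3"
    and Kw: "\<And>t q. t \<in> I \<Longrightarrow> \<bar>speed t q\<bar> \<le> Kw"
    and N: "N = real CARD('n)" and C: "C = geo_const N K" and B: "B = m3 / m1 ^ 3 + 1"
    and c0: "c0 = min 1 (exp (- (2 * K)) / (fact CARD('n))\<^sup>2)"
    and A': "A' = 4 * B * Kw\<^sup>2 * C / c0\<^sup>2 + C * (1 + 1 / c0) + 2"
    and \<mu>: "sets \<mu> = sets borel"
    and i0: "\<And>s q. s \<in> I \<Longrightarrow> i0 \<le> u s q - mean \<mu> s"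
    and t0: "t0 \<in> I" "t0 > 0"
    and max: "\<And>s q. 0 \<le> s \<Longrightarrow> s \<le> t0 \<Longrightarrow>
       ln (trh s q) + B * (speed s q)\<^sup>2 + (1 / (u s q - mean \<mu> s - i0 + 1) - A' * (u s q - mean \<mu> s - i0))
       \<le> ln (trh t0 p) + B * (speed t0 p)\<^sup>2 + (1 / (u t0 p - mean \<mu> t0 - i0 + 1) - A' * (u t0 p - mean \<mu> t0 - i0))"
    and tpos: "\<And>s q. s \<in> I \<Longrightarrow> trh s q > 0"
  shows "(trh t0 p)\<^sup>2 \<le> C * (A' + 1)\<^sup>2 * (u t0 p - mean \<mu> t0 - i0 + 1) ^ 3 \<or>
    trh t0 p \<le> N\<^sup>2 * (exp (2 * K) * (fact CARD('n) * (1 + (C / c0 + (A' + 1) * N + 2 * (A' + 1) * Kw / m1)) ^ CARD('n))\<^sup>2)"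
proof -
  have chart: "c \<in> A" "p \<in> fst c"
      "jets0 (metric_at c) (snd c p) \<le> K" "jets0 (\<lambda>y. matrix_inv (metric_at c y)) (snd c p) \<le> K"
      "jets1 (metric_at c) (snd c p) \<le> K" "jets1 (\<lambda>y. matrix_inv (metric_at c y)) (snd c p) \<le> K"
      "\<And>i j. jets2 (\<lambda>y. metric_at c y $ i $ j) (snd c p) \<le> K"
      "\<And>i j. jets2 (\<lambda>y. matrix_inv (metric_at c y) $ i $ j) (snd c p) \<le> K"
      "jets2 (\<lambda>y. of_real (\<rho> f c y)) (snd c p) \<le> K" "\<bar>f p\<bar> \<le> K"
    using c bd unfolding bounded_data_def by blast+
  note c = chart(1,2)
  let ?x = "snd c p"
  obtain e where e: "orthonormal (\<omega> c p) e" using orthonormal_exists[OF metric_posdef[OF c]] .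
  obtain fr where fr: "orthonormal (\<omega> c p + ddbar c (u t0) p) fr" using orthonormal_exists[OF posdef[OF t0(1) c]] .
  obtain S where S: "open S" "?x \<in> S" "S \<subseteq> chart_image c" "Cinf S (coord c (speed t0))"
      "((\<lambda>s. trh s p) has_real_derivative
        Re (\<Sum>k\<in>UNIV. dz (e k) (dzb (e k) (\<lambda>y. of_real (coord c (speed t0) y))) ?x)) (at t0 within I)"
      "((\<lambda>s. speed s p) has_real_derivative deriv F (dens t0 p) * dens t0 p *
        Re (\<Sum>i\<in>UNIV. dz (fr i) (dzb (fr i) (\<lambda>y. of_real (coord c (speed t0) y))) ?x)) (at t0 within I)"
    by (rule local_flow[OF t0(1) c e fr])
  let ?w = "coord c (speed t0)"
  interpret P: metric_pair S ?x "metric_at c" "coord c (u t0)" e fr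
    by (rule Cinf_metric_pair[OF t0(1) c e fr S(1-3)])
  interpret P: metric_pair_bounded S ?x "metric_at c" "coord c (u t0)" e fr K N
  proof
    show "real CARD('n) = N" by (simp add: N)
    show "K \<ge> 1" by (rule K)
    show "cmod (metric_at c ?x $ i $ j) \<le> K" for i j by (rule order_trans[OF jets_bound(1) chart(3)])
    show "cmod (matrix_inv (metric_at c ?x) $ i $ j) \<le> K" for i j
      using order_trans[OF jets_bound(1) chart(4)] by simp
    show "cmod (dz (axis a 1) (\<lambda>y. metric_at c y $ i $ j) ?x) \<le> K" for a i j
      by (rule order_trans[OF jets_bound(2) chart(5)])
    show "cmod (dz (axis a 1) (\<lambda>y. matrix_inv (metric_at c y) $ i $ j) ?x) \<le> K" for a i j
      by (rule order_trans[OF jets_bound(2) chart(6)])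
    show "cmod (dz (axis a 1) (dzb (axis b 1) (\<lambda>y. metric_at c y $ i $ j)) ?x) \<le> K" for a b i j
      by (rule order_trans[OF jets_bound(3) chart(7)])
    show "cmod (dz (axis a 1) (dzb (axis b 1) (\<lambda>y. matrix_inv (metric_at c y) $ i $ j)) ?x) \<le> K" for a b i j
      by (rule order_trans[OF jets_bound(3) chart(8)])
  qed
  have cp: "chart_inv c ?x = p" by (rule chart_inv(2)[OF c])
  have Gd: "P.G y = \<omega> c (chart_inv c y) + ddbar c (u t0) (chart_inv c y)" if "y \<in> S" for y
    using ddbar_hess[OF c(1) chart_inv(3)[OF c(1)] u_smooth[OF t0(1) c(1)]] chart_inv(4)[OF c(1)] that S(3)
    by (auto simp: P.G_def metric_at_def)
  have \<tau>: "P.\<tau> y = trh t0 (chart_inv c y)" if "y \<in> S" for y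
  proof -
    have q: "chart_inv c y \<in> fst c" using chart_inv(3)[OF c(1)] that S(3) by blast
    show ?thesis unfolding P.\<tau>_def Gd[OF that] trh_eq[OF t0(1) c(1) q] endo_eq[OF c(1) q] by (simp add: metric_at_def)
  qed
  have \<tau>x: "P.\<tau> ?x = trh t0 p" using \<tau>[OF S(2)] cp by simp
  have dform: "dens t0 (chart_inv c y) = exp (ln (Re (det (P.G y))) - \<rho> f c y)" if "y \<in> S" for y
  proof -
    have "chart_inv c y \<in> fst c" "snd c (chart_inv c y) = y" using chart_inv(3,4)[OF c(1)] that S(3) by auto
    then show ?thesis using dens_formula[OF t0(1) c(1)] Gd[OF that] by simp
  qed
  define \<psi> where "\<psi> = ln (Re (det (P.G ?x))) - \<rho> f c ?x"
  have d\<psi>: "dens t0 p = exp \<psi>" using dform[OF S(2)] cp by (simp add: \<psi>_def)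
  have \<psi>: "\<bar>\<psi>\<bar> \<le> K" using dens(1,2)[OF t0(1), of p] unfolding d\<psi> by simp
  \<comment> \<open>\<open>a\<close> and \<open>\<Phi>2\<close> are the first and second derivatives
    of \<open>F\<close> after \<open>exp\<close> at \<open>\<psi>\<close>, the logarithm of the
    density.\<close>
  define a where "a = deriv F (exp \<psi>) * exp \<psi>"
  define \<Phi>2 where "\<Phi>2 = deriv (deriv F) (exp \<psi>) * exp \<psi> * exp \<psi> + deriv F (exp \<psi>) * exp \<psi>"
  have a: "m1 \<le> a" using m1(2)[OF \<psi>] by (simp add: a_def)
  have \<Phi>2: "\<bar>\<Phi>2\<bar> \<le> m3" using m3[OF \<psi>] by (simp add: \<Phi>2_def)
  have D1: "((\<lambda>s. F (exp s)) has_real_derivative deriv F (exp s) * exp s) (at s)" for s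
    by (rule DERIV_chain2[OF F_derivative DERIV_exp]) simp
  have dF: "(deriv F has_real_derivative deriv (deriv F) s) (at s)" if "s > 0" for s
  proof -
    have "Cinf {0<..} (deriv F)" by (rule Cinf_deriv[OF _ F_smooth]) simp
    from Cinf_differentiable[OF this, of s] that show ?thesis by (simp add: DERIV_deriv_iff_real_differentiable)
  qed
  have D2: "((\<lambda>s. deriv F (exp s) * exp s) has_real_derivative \<Phi>2) (at \<psi>)"
    using DERIV_mult[OF DERIV_chain2[OF dF DERIV_exp] DERIV_exp, of \<psi>] by (simp add: \<Phi>2_def algebra_simps)
  have \<rho>C: "Cinf S (\<rho> f c)" by (rule Cinf_subset[OF \<rho>_smooth[OF f c(1)] S(3)])
  let ?Wf = "\<Sum>j\<in>UNIV. (cmod (dz (fr j) (\<lambda>y. of_real (?w y)) ?x))\<^sup>2"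
  have speed_ineq: "Re (\<Sum>k\<in>UNIV. dz (e k) (dzb (e k) (\<lambda>y. of_real (?w y))) ?x)
    \<le> \<bar>\<Phi>2\<bar> / a\<^sup>2 * P.\<tau> ?x * ?Wf
     + a * (Re (\<Sum>i\<in>UNIV. dz (fr i) (dzb (fr i) (\<lambda>y. of_real (P.\<tau> y))) ?x)
            - (\<Sum>i\<in>UNIV. (cmod (dz (fr i) (\<lambda>y. of_real (P.\<tau> y)) ?x - P.E i))\<^sup>2) / P.\<tau> ?x
            + geo_const N K * (P.\<tau> ?x + 1) * P.\<zeta> + geo_const N K)"
  proof (rule P.laplace_speed[OF \<rho>C _ _ D1 _ _ _ S(4)])
    show "cmod (dz (axis a 1) (dzb (axis b 1) (\<lambda>y. of_real (\<rho> f c y))) ?x) \<le> K" for a b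
      by (rule order_trans[OF jets_bound(3) chart(9)])
    show "?w y = F (exp (ln (Re (det (P.G y))) - \<rho> f c y))" if "y \<in> S" for y
      using dform[OF that] by (simp add: speed_def)
    show "((\<lambda>s. deriv F (exp s) * exp s) has_real_derivative \<Phi>2) (at (ln (Re (det (P.G ?x))) - \<rho> f c ?x))"
      using D2 by (simp add: \<psi>_def)
    show "a = deriv F (exp (ln (Re (det (P.G ?x))) - \<rho> f c ?x)) * exp (ln (Re (det (P.G ?x))) - \<rho> f c ?x)"
      by (simp add: a_def \<psi>_def)
    show "a > 0" using a m1 by simp
  qed
  define k where "k = mean \<mu> t0 + i0"
  define y0 where "y0 = u t0 p - k + 1"
  have y0: "y0 \<ge> 1" using i0[OF t0(1), of p] by (simp add: y0_def k_def)
  define \<gamma>1 where "\<gamma>1 = - A' - 1 / y0\<^sup>2"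
  define \<gamma>2 where "\<gamma>2 = 2 / y0 ^ 3"
  have Cpos: "C \<ge> 0" unfolding C by (rule P.geo_const_bounds(4)[of 0]) simp
  have c0pos: "c0 > 0" unfolding c0 by simp
  have Bpos: "B > 0"
  proof -
    have "m3 \<ge> 0" using \<Phi>2 by linarith
    then show ?thesis using m1(1) by (simp add: B add_nonneg_pos)
  qed
  have A'pos: "A' \<ge> 2" unfolding A' using Cpos c0pos Bpos by simp
  have max_space: "ln (P.\<tau> y) + B * (?w y)\<^sup>2 + (1 / (coord c (u t0) y - k + 1) - A' * (coord c (u t0) y - k))
        \<le> ln (P.\<tau> ?x) + B * (?w ?x)\<^sup>2 + (1 / (coord c (u t0) ?x - k + 1) - A' * (coord c (u t0) ?x - k))"
    if "y \<in> S" for y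
    using max[of t0 "chart_inv c y"] t0(2) unfolding \<tau>[OF that] \<tau>x cp k_def by (simp add: diff_diff_eq)
  have knn: "coord c (u t0) y - k \<ge> 0" for y using i0[OF t0(1)] by (simp add: k_def algebra_simps)
  note test = P.test_function_maximum[OF S(4) knn max_space, unfolded cp, folded y0_def, folded \<gamma>1_def \<gamma>2_def]
  have time: "0 \<le> Re (\<Sum>k\<in>UNIV. dz (e k) (dzb (e k) (\<lambda>y. of_real (?w y))) ?x) / trh t0 p
      + 2 * B * speed t0 p * (a * Re (\<Sum>i\<in>UNIV. dz (fr i) (dzb (fr i) (\<lambda>y. of_real (?w y))) ?x)) + \<gamma>1 * (speed t0 p - Kw)"
  proof -
    \<comment> \<open>The mean is not differentiated. For \<open>s < t0\<close> this
      \<open>y s\<close> is at least the true value, by the Lipschitz bound, and the two agree at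
      \<open>t0\<close>. As the barrier is decreasing, the maximum at \<open>t0\<close> survives,
      and the derivative of \<open>y\<close> is the speed minus \<open>Kw\<close>.\<close>
    define y where "y s = u s p - k + Kw * (t0 - s)" for s
    let ?\<phi> = "\<lambda>s. ln (trh s p) + B * (speed s p)\<^sup>2 + (1 / (y s + 1) - A' * y s)"
    have yt: "y t0 + 1 = y0" by (simp add: y_def y0_def)
    have dy: "(y has_real_derivative speed t0 p - Kw) (at t0 within I)"
      unfolding y_def by (auto intro!: derivative_eq_intros u_time_derivative[OF t0(1)])
    have "(?\<phi> has_real_derivative
        Re (\<Sum>k\<in>UNIV. dz (e k) (dzb (e k) (\<lambda>y. of_real (?w y))) ?x) / trh t0 p
      + 2 * B * speed t0 p * (a * Re (\<Sum>i\<in>UNIV. dz (fr i) (dzb (fr i) (\<lambda>y. of_real (?w y))) ?x))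
      + \<gamma>1 * (speed t0 p - Kw)) (at t0 within I)"
    proof (intro DERIV_add)
      show "((\<lambda>s. ln (trh s p)) has_real_derivative
          Re (\<Sum>k\<in>UNIV. dz (e k) (dzb (e k) (\<lambda>y. of_real (?w y))) ?x) / trh t0 p) (at t0 within I)"
        using DERIV_chain2[OF DERIV_ln[OF tpos[OF t0(1), of p]] S(5)] by (simp add: divide_inverse mult.commute)
      show "((\<lambda>s. B * (speed s p)\<^sup>2) has_real_derivative
          2 * B * speed t0 p * (a * Re (\<Sum>i\<in>UNIV. dz (fr i) (dzb (fr i) (\<lambda>y. of_real (?w y))) ?x))) (at t0 within I)"
        using DERIV_cmult[OF DERIV_power[OF S(6), of 2], of B] unfolding d\<psi> a_def[symmetric] by (simp add: mult_ac)
      have "((\<lambda>s. inverse (y s + 1) - A' * y s) has_real_derivative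
          - (inverse (y t0 + 1) * (speed t0 p - Kw) * inverse (y t0 + 1)) - A' * (speed t0 p - Kw)) (at t0 within I)"
      proof (intro DERIV_diff DERIV_cmult dy)
        have "((\<lambda>s. y s + 1) has_real_derivative speed t0 p - Kw) (at t0 within I)"
          using DERIV_add[OF dy DERIV_const[of 1]] by simp
        then show "((\<lambda>s. inverse (y s + 1)) has_real_derivative
            - (inverse (y t0 + 1) * (speed t0 p - Kw) * inverse (y t0 + 1))) (at t0 within I)"
          by (rule DERIV_inverse') (use yt y0 in simp)
      qed
      moreover have "- (inverse (y t0 + 1) * (speed t0 p - Kw) * inverse (y t0 + 1)) - A' * (speed t0 p - Kw) = \<gamma>1 * (speed t0 p - Kw)"
        unfolding yt \<gamma>1_def by (simp add: algebra_simps power2_eq_square divide_inverse)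
      ultimately show "((\<lambda>s. 1 / (y s + 1) - A' * y s) has_real_derivative \<gamma>1 * (speed t0 p - Kw)) (at t0 within I)"
        by (simp add: inverse_eq_divide)
    qed
    then show ?thesis
    proof (rule left_maximum_derivative[OF _ t0(2)])
      fix s assume s: "t0 - t0 < s" "s < t0"
      then have sI: "s \<in> I" using I_interval(1)[OF t0(1)] by simp
      have "mean \<mu> t0 - mean \<mu> s \<le> Kw * \<bar>t0 - s\<bar>" by (rule mean_lipschitz[OF \<mu> Kw sI t0(1)])
      then have "u s p - mean \<mu> s - i0 \<le> y s" using s by (simp add: y_def k_def algebra_simps)
      moreover have "0 \<le> u s p - mean \<mu> s - i0" using i0[OF sI, of p] by simp
      ultimately have "1 / (y s + 1) - A' * y s \<le> 1 / (u s p - mean \<mu> s - i0 + 1) - A' * (u s p - mean \<mu> s - i0)"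
        using A'pos by (intro barrier_mono) auto
      moreover have "y t0 = u t0 p - mean \<mu> t0 - i0" by (simp add: y_def k_def)
      ultimately show "s \<in> I \<and> ?\<phi> s \<le> ?\<phi> t0" using max[of s p] s sI by simp
    qed
  qed
  have y0sq: "1 / y0\<^sup>2 \<le> 1" "0 \<le> 1 / y0\<^sup>2" using y0 by (auto simp: one_le_power)
  have hdet: "P.hdet = dens t0 p * exp (f p)"
  proof -
    have "P.hdet = Re (det (endo \<omega> c (u t0) p))"
      unfolding P.hdet_def Gd[OF S(2)] endo_eq[OF c] by (simp add: metric_at_def cp)
    then show ?thesis unfolding dens_eq[OF t0(1) c] by (simp add: exp_minus)
  qed
  have fb: "exp (- K) \<le> exp (f p)" "exp (f p) \<le> exp K" using chart(10) by auto
  have hd_low: "exp (- (2 * K)) \<le> P.hdet"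
  proof -
    have "exp (- (2 * K)) = exp (- K) * exp (- K)" by (simp add: exp_add[symmetric])
    also have "\<dots> \<le> P.hdet" unfolding hdet using dens(1)[OF t0(1), of p] fb(1) dens_pos[OF t0(1), of p] by (intro mult_mono) auto
    finally show ?thesis .
  qed
  have hd_up: "P.hdet \<le> exp (2 * K)"
  proof -
    have "P.hdet \<le> exp K * exp K" unfolding hdet using dens(2)[OF t0(1), of p] fb(2) dens_pos[OF t0(1), of p] by (intro mult_mono) auto
    then show ?thesis by (simp add: exp_add[symmetric])
  qed
  \<comment> \<open>For a trace below 1 its power with exponent \<open>CARD('n)\<close> is at most
    the trace itself, which makes the lower bound for det h linear in the trace; hence the minimum
    with 1 in \<open>c0\<close>.\<close>
  have \<tau>low: "c0 \<le> P.\<tau> ?x"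
  proof (rule ccontr)
    assume "\<not> c0 \<le> P.\<tau> ?x"
    then have small: "P.\<tau> ?x < 1" "P.\<tau> ?x < exp (- (2 * K)) / (fact CARD('n))\<^sup>2" by (auto simp: c0)
    have "P.\<tau> ?x ^ CARD('n) \<le> P.\<tau> ?x ^ 1" using small(1) P.\<tau>_pos by (intro power_decreasing) (auto simp: Suc_leI)
    then have "(fact CARD('n))\<^sup>2 * P.\<tau> ?x ^ CARD('n) \<le> (fact CARD('n))\<^sup>2 * P.\<tau> ?x" by (intro mult_left_mono) auto
    also have "\<dots> < exp (- (2 * K))" using small(2) by (simp add: less_divide_eq mult.commute)
    finally show False using hd_low P.\<tau>_lower by linarith
  qed
  \<comment> \<open>Origin of \<open>B\<close>: the left side is at most
    \<open>m3 / m1\<^sup>2\<close>, and a factor \<open>m1 \<le> a\<close> is split off at the cost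
    of a third power of \<open>m1\<close>. The summand 1 in \<open>B\<close> makes it
    positive.\<close>
  have MB: "\<bar>\<Phi>2\<bar> / a\<^sup>2 \<le> B * a"
  proof -
    have "\<bar>\<Phi>2\<bar> / a\<^sup>2 \<le> m3 / m1\<^sup>2" using \<Phi>2 a m1(1) by (intro frac_le power_mono) auto
    also have "\<dots> = m3 / m1 ^ 3 * m1" using m1(1) by (simp add: power2_eq_square power3_eq_cube)
    also have "\<dots> \<le> B * a"
      using a m1(1) \<Phi>2 unfolding B by (intro mult_mono) auto
    finally show ?thesis .
  qed
  have space: "Re (\<Sum>i\<in>UNIV. dz (fr i) (dzb (fr i) (\<lambda>y. of_real (P.\<tau> y))) ?x) / P.\<tau> ?x
       - (\<Sum>i\<in>UNIV. (cmod (dz (fr i) (\<lambda>y. of_real (P.\<tau> y)) ?x))\<^sup>2) / (P.\<tau> ?x)\<^sup>2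
       + 2 * B * speed t0 p * Re (\<Sum>i\<in>UNIV. dz (fr i) (dzb (fr i) (\<lambda>y. of_real (?w y))) ?x)
       + 2 * B * ?Wf + \<gamma>1 * (N - P.\<zeta>) + \<gamma>2 * (\<Sum>i\<in>UNIV. (cmod (dz (fr i) (\<lambda>y. of_real (coord c (u t0) y)) ?x))\<^sup>2) \<le> 0"
  proof -
    let ?h = "\<lambda>i. Re (dz (fr i) (dzb (fr i) (\<lambda>y. of_real (P.\<tau> y))) ?x) / P.\<tau> ?x - (cmod (dz (fr i) (\<lambda>y. of_real (P.\<tau> y)) ?x))\<^sup>2 / (P.\<tau> ?x)\<^sup>2
      + 2 * B * speed t0 p * Re (dz (fr i) (dzb (fr i) (\<lambda>y. of_real (?w y))) ?x) + 2 * B * (cmod (dz (fr i) (\<lambda>y. of_real (?w y)) ?x))\<^sup>2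
      + \<gamma>1 * Re (dz (fr i) (dzb (fr i) (\<lambda>y. of_real (coord c (u t0) y))) ?x) + \<gamma>2 * (cmod (dz (fr i) (\<lambda>y. of_real (coord c (u t0) y)) ?x))\<^sup>2"
    have "(\<Sum>i\<in>UNIV. ?h i) \<le> 0" using test(2) by (intro sum_nonpos) simp
    then show ?thesis
      unfolding P.laplace_u[symmetric] Re_sum[of _ UNIV]
      by (simp only: sum.distrib sum_subtractf sum_distrib_left sum_divide_distrib)
  qed
  have grad: "dz (fr i) (\<lambda>y. of_real (P.\<tau> y)) ?x / of_real (P.\<tau> ?x) + of_real (2 * B * speed t0 p) * dz (fr i) (\<lambda>y. of_real (?w y)) ?x
      + of_real \<gamma>1 * dz (fr i) (\<lambda>y. of_real (coord c (u t0) y)) ?x = 0" for i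
      using test(1) by simp
  have time': "0 \<le> Re (\<Sum>k\<in>UNIV. dz (e k) (dzb (e k) (\<lambda>y. of_real (?w y))) ?x) / P.\<tau> ?x
      + 2 * B * speed t0 p * (a * Re (\<Sum>i\<in>UNIV. dz (fr i) (dzb (fr i) (\<lambda>y. of_real (?w y))) ?x)) + \<gamma>1 * (speed t0 p - Kw)"
      unfolding \<tau>x by (rule time)
  have speed': "Re (\<Sum>k\<in>UNIV. dz (e k) (dzb (e k) (\<lambda>y. of_real (?w y))) ?x) \<le> \<bar>\<Phi>2\<bar> / a\<^sup>2 * P.\<tau> ?x * ?Wf
       + a * (Re (\<Sum>i\<in>UNIV. dz (fr i) (dzb (fr i) (\<lambda>y. of_real (P.\<tau> y))) ?x)
            - (\<Sum>i\<in>UNIV. (cmod (dz (fr i) (\<lambda>y. of_real (P.\<tau> y)) ?x - P.E i))\<^sup>2) / P.\<tau> ?x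
            + C * (P.\<tau> ?x + 1) * P.\<zeta> + C)"
      unfolding C by (rule speed_ineq)
  have E: "(\<Sum>i\<in>UNIV. (cmod (P.E i))\<^sup>2) \<le> C * P.\<zeta>" unfolding C by (rule P.E_geo)
  have \<gamma>: "- (A' + 1) \<le> \<gamma>1" "\<gamma>1 \<le> - A'" using y0sq unfolding \<gamma>1_def by linarith+
  have \<gamma>2: "0 < \<gamma>2" using y0 unfolding \<gamma>2_def by (intro divide_pos_pos zero_less_power) linarith+
  have A'0: "0 \<le> A'" and N0: "0 \<le> N" using A'pos by (linarith, simp only: N of_nat_0_le_iff)
  have "(P.\<tau> ?x)\<^sup>2 < C * (A' + 1)\<^sup>2 / \<gamma>2 \<or> P.\<zeta> \<le> C / c0 + (A' + 1) * N + 2 * (A' + 1) * Kw / m1"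
    by (rule maximum_point_estimate[OF \<tau>low c0pos P.\<zeta>_nonneg a m1(1) N0 MB Bpos Cpos Kw[OF t0(1)]
        \<gamma> A'0 \<gamma>2 E grad space time' speed' A'])
  then show ?thesis
  proof
    assume "(P.\<tau> ?x)\<^sup>2 < C * (A' + 1)\<^sup>2 / \<gamma>2"
    also have "\<dots> = C * (A' + 1)\<^sup>2 * y0 ^ 3 / 2" by (simp add: \<gamma>2_def)
    also have "\<dots> \<le> C * (A' + 1)\<^sup>2 * y0 ^ 3" using Cpos y0 by simp
    finally show ?thesis unfolding \<tau>x y0_def k_def by (simp add: diff_diff_eq)
  next
    assume "P.\<zeta> \<le> C / c0 + (A' + 1) * N + 2 * (A' + 1) * Kw / m1"
    from P.\<tau>_upper[OF this]
    have "P.\<tau> ?x \<le> N\<^sup>2 * (P.hdet * (fact CARD('n) * (1 + (C / c0 + (A' + 1) * N + 2 * (A' + 1) * Kw / m1)) ^ CARD('n))\<^sup>2)" .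
    also have "\<dots> \<le> N\<^sup>2 * (exp (2 * K) * (fact CARD('n) * (1 + (C / c0 + (A' + 1) * N + 2 * (A' + 1) * Kw / m1)) ^ CARD('n))\<^sup>2)"
      using hd_up by (intro mult_left_mono mult_right_mono) auto
    finally show ?thesis unfolding \<tau>x by blast
  qed
qed

end

section \<open>Choice of the constants and conclusion\<close>

lemma geo_const_nonneg: "N \<ge> 0 \<Longrightarrow> K \<ge> 0 \<Longrightarrow> geo_const N K \<ge> 0"
  unfolding geo_const_def Let_def frame_const_def by auto

text \<open>With \<open>s\<close> the logarithm of the density, the speed is
  \<open>F (exp s)\<close>, and the expressions here are its first two derivatives. All are
  continuous on the compact interval to which \<open>s\<close> is confined, and the first is
  positive.\<close>

lemma speed_constants:
  fixes F :: "real \<Rightarrow> real"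
  assumes F: "smooth_on F {0<..}" and F': "\<forall>s>0. deriv F s > 0" and K: "K \<ge> 0"
  obtains m1 m3 Kw where "m1 > 0" "\<And>s. \<bar>s\<bar> \<le> K \<Longrightarrow> m1 \<le> deriv F (exp s) * exp s"
    "\<And>s. \<bar>s\<bar> \<le> K \<Longrightarrow> \<bar>deriv (deriv F) (exp s) * exp s * exp s + deriv F (exp s) * exp s\<bar> \<le> m3"
    "\<And>s. \<bar>s\<bar> \<le> K \<Longrightarrow> \<bar>F (exp s)\<bar> \<le> Kw"
proof -
  have 0: "Cinf {0<..} F" by (rule Cinf_smooth_on[OF F]) simp
  have 1: "Cinf {0<..} (deriv F)" by (rule Cinf_deriv[OF _ 0]) simp
  have 2: "Cinf {0<..} (deriv (deriv F))" by (rule Cinf_deriv[OF _ 1]) simp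
  have c: "continuous_on {-K..K} (\<lambda>s. h (exp s))" if "Cinf {0<..} h" for h :: "real \<Rightarrow> real"
    by (rule continuous_on_compose2[OF Cinf_continuous_on[OF that]]) (auto intro!: continuous_intros)
  have cpt: "compact {-K..K}" "{-K..K} \<noteq> {}" using K by auto
  have c1: "continuous_on {-K..K} (\<lambda>s. deriv F (exp s) * exp s)" by (intro continuous_intros c 1)
  obtain s1 where s1: "s1 \<in> {-K..K}" "\<And>s. s \<in> {-K..K} \<Longrightarrow> deriv F (exp s1) * exp s1 \<le> deriv F (exp s) * exp s"
    using continuous_attains_inf[OF cpt c1] by blast
  have c3: "continuous_on {-K..K} (\<lambda>s. \<bar>deriv (deriv F) (exp s) * exp s * exp s + deriv F (exp s) * exp s\<bar>)"
    by (intro continuous_intros c 1 2)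
  obtain s3 where s3: "\<And>s. s \<in> {-K..K} \<Longrightarrow> \<bar>deriv (deriv F) (exp s) * exp s * exp s + deriv F (exp s) * exp s\<bar>
      \<le> \<bar>deriv (deriv F) (exp s3) * exp s3 * exp s3 + deriv F (exp s3) * exp s3\<bar>"
    using continuous_attains_sup[OF cpt c3] by blast
  have c4: "continuous_on {-K..K} (\<lambda>s. \<bar>F (exp s)\<bar>)" by (intro continuous_intros c 0)
  obtain s4 where s4: "\<And>s. s \<in> {-K..K} \<Longrightarrow> \<bar>F (exp s)\<bar> \<le> \<bar>F (exp s4)\<bar>"
    using continuous_attains_sup[OF cpt c4] by blast
  show ?thesis
    by (rule that[of "deriv F (exp s1) * exp s1"], use F' in simp, rule s1(2), simp add: abs_le_iff, rule s3,
        simp add: abs_le_iff, rule s4, simp add: abs_le_iff)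
qed

context flow
begin

lemma trh_pos: assumes t: "t \<in> I" shows "trh t p > 0"
proof -
  note c = chart_at[of p]
  let ?c = "chart_at p" and ?x = "snd (chart_at p) p"
  obtain e where e: "orthonormal (\<omega> ?c p) e" using orthonormal_exists[OF metric_posdef[OF c]] .
  obtain fr where fr: "orthonormal (\<omega> ?c p + ddbar ?c (u t) p) fr" using orthonormal_exists[OF posdef[OF t c]] .
  interpret P: metric_pair "chart_image ?c" ?x "metric_at ?c" "coord ?c (u t)" e fr
    by (rule Cinf_metric_pair[OF t c e fr open_chart(2)[OF c(1)] chart_inv(1)[OF c] subset_refl])
  have "P.\<tau> ?x = trh t p"
    unfolding trh_def endo_eq[OF c] ddbar_hess[OF c u_smooth[OF t c(1)]] P.\<tau>_def P.G_def
    by (simp add: metric_at_def chart_inv(2)[OF c])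
  then show ?thesis using P.\<tau>_pos by simp
qed

lemma mean_continuous:
  assumes \<mu>: "sets \<mu> = sets borel" and K: "\<And>t q. t \<in> I \<Longrightarrow> \<bar>speed t q\<bar> \<le> K"
  shows "continuous_on I (mean \<mu>)"
proof -
  have "\<bar>mean \<mu> s - mean \<mu> t\<bar> \<le> K * \<bar>s - t\<bar>" if "s \<in> I" "t \<in> I" for s t
    using mean_lipschitz[OF \<mu> K that] mean_lipschitz[OF \<mu> K that(2,1)] by (simp add: abs_le_iff abs_minus_commute)
  moreover have "K \<ge> 0" using K[OF zero_I] by (meson abs_ge_zero order_trans)
  ultimately have "K-lipschitz_on I (mean \<mu>)" by (intro lipschitz_onI) (auto simp: dist_real_def)
  then show ?thesis by (rule lipschitz_on_continuous_on)
qed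

text \<open>The maximum is taken over \<open>[0,t1]\<close> for an arbitrary time \<open>t1\<close>
  in the interval, so compactness is at hand and no constant depends on \<open>T\<close>. At the
  maximum point \<open>ln (trh t0 p)\<close> is at most a constant plus \<open>A'\<close> times
  \<open>y\<close>, which the barrier subtracts again; the rest of the test function is
  bounded.\<close>

lemma trace_estimate:
  fixes K m1 m3 Kw A' B C c0 N i0 t1 :: real and \<mu> :: "'a measure"
  assumes mono: "strict_mono_on {0<..} F" and K: "K \<ge> 1"
    and bounds: "\<And>p. \<exists>c\<in>A. bounded_data f u0 K c p"
    and m1: "m1 > 0" "\<And>s. \<bar>s\<bar> \<le> K \<Longrightarrow> m1 \<le> deriv F (exp s) * exp s"
    and m3: "\<And>s. \<bar>s\<bar> \<le> K \<Longrightarrow> \<bar>deriv (deriv F) (exp s) * exp s * exp s + deriv F (exp s) * exp s\<bar> \<le> m3"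
    and Kw: "\<And>s. \<bar>s\<bar> \<le> K \<Longrightarrow> \<bar>F (exp s)\<bar> \<le> Kw"
    and N: "N = real CARD('n)" and C: "C = geo_const N K" and B: "B = m3 / m1 ^ 3 + 1"
    and c0: "c0 = min 1 (exp (- (2 * K)) / (fact CARD('n))\<^sup>2)"
    and A': "A' = 4 * B * Kw\<^sup>2 * C / c0\<^sup>2 + C * (1 + 1 / c0) + 2"
    and Z: "Z = N\<^sup>2 * (exp (2 * K) * (fact CARD('n) * (1 + (C / c0 + (A' + 1) * N + 2 * (A' + 1) * Kw / m1)) ^ CARD('n))\<^sup>2)"
    and \<mu>: "sets \<mu> = sets borel"
    and i0: "\<And>s q. s \<in> I \<Longrightarrow> i0 \<le> u s q - mean \<mu> s"
    and t1: "t1 \<in> I"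
  shows "trh t1 q \<le> exp (Z + K + C * (A' + 1)\<^sup>2 + B * Kw\<^sup>2 + 1) * exp (A' * (u t1 q - mean \<mu> t1 - i0))"
proof -
  have dens0: "exp (- K) \<le> dens 0 p" "dens 0 p \<le> exp K" for p
  proof -
    obtain c where c: "c \<in> A" "p \<in> fst c" "\<bar>ln (Re (det (\<omega> c p + ddbar c u0 p))) - \<rho> f c (snd c p)\<bar> \<le> K"
      using bounds[of p] unfolding bounded_data_def by blast
    have "dens 0 p = exp (ln (Re (det (\<omega> c p + ddbar c u0 p))) - \<rho> f c (snd c p))"
      using dens_formula[OF zero_I c(1,2)] by (simp add: u_zero)
    then show "exp (- K) \<le> dens 0 p" "dens 0 p \<le> exp K" using c(3) by (auto simp: abs_le_iff)
  qed
  have dens: "exp (- K) \<le> dens t p" "dens t p \<le> exp K" if "t \<in> I" for t p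
    by (rule dens_bounds[OF mono _ dens0 that]; simp)+
  have w: "\<bar>speed t p\<bar> \<le> Kw" if "t \<in> I" for t p
  proof -
    have "\<bar>ln (dens t p)\<bar> \<le> K"
      using dens[OF that, of p] dens_pos[OF that, of p] ln_ge_iff[of "dens t p" "-K"] ln_le_cancel_iff[of "dens t p" "exp K"]
      by (simp add: abs_le_iff minus_le_iff)
    from Kw[OF this] show ?thesis using dens_pos[OF that, of p] by (simp add: speed_def)
  qed
  have "m3 \<ge> 0" using m3[of 0] K by simp
  then have Bpos: "B > 0" using m1(1) by (simp add: B add_nonneg_pos)
  have c0pos: "c0 > 0" by (simp add: c0)
  have Cpos: "C \<ge> 0" using K by (simp add: C N geo_const_nonneg)
  have A'pos: "A' \<ge> 2" unfolding A' using Cpos c0pos Bpos by simp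
  have Zpos: "Z \<ge> 0" unfolding Z by simp
  let ?y = "\<lambda>s q. u s q - mean \<mu> s - i0"
  have ynn: "?y s q \<ge> 0" if "s \<in> I" for s q using i0[OF that, of q] by simp
  let ?G = "\<lambda>s q. ln (trh s q) + B * (speed s q)\<^sup>2 + (1 / (?y s q + 1) - A' * ?y s q)"
  let ?D = "{0..t1} \<times> (UNIV :: 'a set)"
  have sub: "?D \<subseteq> I \<times> UNIV" using I_interval(1)[OF t1] by auto
  have t1pos: "t1 \<ge> 0" by (rule I_interval(2)[OF t1])
  have cy: "continuous_on ?D (\<lambda>z. ?y (fst z) (snd z))"
    by (intro continuous_on_diff continuous_on_const continuous_on_subset[OF continuous_flow(3) sub]
        continuous_on_compose2[OF mean_continuous[OF \<mu> w] continuous_on_fst[OF continuous_on_id]]) (use sub in auto)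
  have cs: "continuous_on ?D (\<lambda>z. speed (fst z) (snd z))"
    unfolding speed_def
    by (rule continuous_on_compose2[OF Cinf_continuous_on[OF F_smooth] continuous_on_subset[OF continuous_flow(2) sub]])
      (use sub dens_pos in auto)
  have cl: "continuous_on ?D (\<lambda>z. ln (trh (fst z) (snd z)))"
    by (rule continuous_on_ln[OF continuous_on_subset[OF continuous_flow(1) sub]])
      (use sub trh_pos in \<open>force dest: less_imp_neq\<close>)
  have cont: "continuous_on ?D (\<lambda>z. ?G (fst z) (snd z))"
  proof (intro cl cs cy continuous_on_add[OF _ continuous_on_diff] continuous_on_add continuous_on_mult continuous_on_power
      continuous_on_divide continuous_on_const)
    show "\<forall>z\<in>?D. ?y (fst z) (snd z) + 1 \<noteq> 0"
    proof
      fix z assume "z \<in> ?D"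
      then have "fst z \<in> I" using sub by auto
      from ynn[OF this, of "snd z"] show "?y (fst z) (snd z) + 1 \<noteq> 0" by linarith
    qed
  qed
  have cpt: "compact ?D" using compact by (intro compact_Times) auto
  have ne: "?D \<noteq> {}" using t1pos by auto
  obtain z where z: "z \<in> ?D" "\<And>y. y \<in> ?D \<Longrightarrow> ?G (fst y) (snd y) \<le> ?G (fst z) (snd z)"
    using continuous_attains_sup[OF cpt ne cont] by blast
  obtain t0 p where zt: "z = (t0, p)" "0 \<le> t0" "t0 \<le> t1" using z(1) by (cases z) auto
  have max: "?G s q \<le> ?G t0 p" if "0 \<le> s" "s \<le> t1" for s q
    using z(2)[of "(s, q)"] that by (simp add: zt)
  have t0I: "t0 \<in> I" using I_interval(1)[OF t1 zt(2,3)] .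
  define y0 where "y0 = ?y t0 p"
  have y0: "y0 \<ge> 0" using ynn[OF t0I] by (simp add: y0_def)
  have \<tau>0: "trh t0 p > 0" by (rule trh_pos[OF t0I])
  have "ln (trh t0 p) \<le> Z + K + C * (A' + 1)\<^sup>2 + A' * y0"
  proof (cases "t0 = 0")
    case True
    obtain c where c: "c \<in> A" "p \<in> fst c" "Re (trace (endo \<omega> c u0 p)) \<le> K" using bounds[of p] unfolding bounded_data_def by blast
    have "trh t0 p \<le> K" using trh_eq[OF zero_I c(1,2)] c(3) by (simp add: True u_zero)
    moreover have "ln (trh t0 p) \<le> trh t0 p" using ln_bound[OF \<tau>0] .
    moreover have "0 \<le> C * (A' + 1)\<^sup>2" "0 \<le> A' * y0" using Cpos A'pos y0 by auto
    ultimately show ?thesis using Zpos by linarith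
  next
    case False
    then have t0: "t0 > 0" using zt by simp
    obtain c where c: "c \<in> A" "bounded_data f u0 K c p" using bounds[of p] by blast
    have max': "?G s q \<le> ?G t0 p" if "0 \<le> s" "s \<le> t0" for s q
      by (rule max) (use that zt in auto)
    have "(trh t0 p)\<^sup>2 \<le> C * (A' + 1)\<^sup>2 * (?y t0 p + 1) ^ 3 \<or> trh t0 p \<le> Z"
      unfolding Z by (rule maximum_point_bound[OF K c dens m1 m3 w N C B c0 A' \<mu> i0 t0I t0 max' trh_pos])
    then show ?thesis
    proof
      assume a: "(trh t0 p)\<^sup>2 \<le> C * (A' + 1)\<^sup>2 * (?y t0 p + 1) ^ 3"
      let ?E = "C * (A' + 1)\<^sup>2"
      \<comment> \<open>Strict positivity, needed for the logarithm, comes from the inequality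
        itself, whose left side is positive.\<close>
      have E: "?E > 0"
      proof (rule ccontr)
        assume "\<not> ?E > 0"
        then have "?E \<le> 0" by (rule leI)
        then have "?E * (?y t0 p + 1) ^ 3 \<le> 0"
          by (rule mult_nonpos_nonneg) (rule zero_le_power, use y0 in \<open>unfold y0_def, linarith\<close>)
        then show False using a zero_less_power[OF \<tau>0, of 2] by linarith
      qed
      have y1: "y0 + 1 > 0" using y0 by simp
      \<comment> \<open>A square of the trace stands against a cube of \<open>y0 + 1\<close>. By
        \<open>ln (y0 + 1) \<le> y0\<close> the cube contributes at most \<open>3 / 2 * y0\<close>
        to the logarithm of the trace, rounded up to \<open>2 * y0\<close>; since
        \<open>A' \<ge> 2\<close>, the barrier covers it.\<close>
      have "2 * ln (trh t0 p) = ln ((trh t0 p)\<^sup>2)" using \<tau>0 by (simp add: ln_realpow)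
      also have "\<dots> \<le> ln (?E * (y0 + 1) ^ 3)"
        using a \<tau>0 zero_less_power[OF \<tau>0, of 2] E y1 unfolding y0_def[symmetric] by (subst ln_le_cancel_iff) auto
      also have "\<dots> = ln ?E + 3 * ln (y0 + 1)"
          unfolding ln_mult_pos[OF E zero_less_power[OF y1, of 3]] using y1 by (simp add: ln_realpow)
      also have "\<dots> \<le> ?E + 3 * y0" using ln_bound[OF E] ln_add_one_self_le_self[OF y0] by (simp add: add.commute)
      finally have "ln (trh t0 p) \<le> ?E + 2 * y0" using E y0 by linarith
      moreover have "2 * y0 \<le> A' * y0" using A'pos y0 by (intro mult_right_mono)
      ultimately show ?thesis using Zpos K by linarith
    next
      assume "trh t0 p \<le> Z"
      moreover have "ln (trh t0 p) \<le> trh t0 p" using ln_bound[OF \<tau>0] .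
      moreover have "0 \<le> C * (A' + 1)\<^sup>2" "0 \<le> A' * y0" using Cpos A'pos y0 by auto
      ultimately show ?thesis using K by linarith
    qed
  qed
  moreover have "B * (speed t0 p)\<^sup>2 \<le> B * Kw\<^sup>2"
    using w[OF t0I, of p] Bpos by (intro mult_left_mono) (auto simp: abs_le_square_iff[symmetric])
  moreover have "1 / (y0 + 1) \<le> 1" using y0 by simp
  ultimately have "?G t0 p \<le> Z + K + C * (A' + 1)\<^sup>2 + B * Kw\<^sup>2 + 1" unfolding y0_def[symmetric] by linarith
  then have "?G t1 q \<le> Z + K + C * (A' + 1)\<^sup>2 + B * Kw\<^sup>2 + 1" using max[OF t1pos order_refl, of q] by linarith
  moreover have "0 \<le> B * (speed t1 q)\<^sup>2" using Bpos by simp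
  moreover have "0 \<le> 1 / (?y t1 q + 1)" using ynn[OF t1, of q] by simp
  ultimately have "ln (trh t1 q) \<le> Z + K + C * (A' + 1)\<^sup>2 + B * Kw\<^sup>2 + 1 + A' * ?y t1 q" by linarith
  then have "exp (ln (trh t1 q)) \<le> exp (Z + K + C * (A' + 1)\<^sup>2 + B * Kw\<^sup>2 + 1 + A' * ?y t1 q)" by simp
  then show ?thesis using trh_pos[OF t1, of q] by (simp add: exp_add)
qed

end

theorem theorem2:
  fixes A :: "('a::{t2_space,second_countable_topology}, 'n::finite) chart set"
    and \<omega> :: "('a, 'n) chart \<Rightarrow> 'a \<Rightarrow> complex^'n^'n"
    and \<mu> :: "'a measure"
    and f u0 :: "'a \<Rightarrow> real"
    and F :: "real \<Rightarrow> real"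
  assumes "compact (UNIV :: 'a set)"
    and "complex_atlas A"
    and "hermitian_metric A \<omega>"
    and "volume_measure A \<omega> \<mu>"
    and "smooth_fun A f"
    and "smooth_on F {0<..}"
    and "strict_mono_on {0<..} F"
    and "\<forall>s>0. deriv F s > 0"
    and "smooth_fun A u0"
    and "\<forall>c\<in>A. \<forall>p\<in>fst c. hermitian_posdef (\<omega> c p + ddbar c u0 p)"
  shows "\<exists>C>0. \<forall>(T::ereal) u.
           0 < T \<longrightarrow> flow_solution A \<omega> f F u0 T u \<longrightarrow>
           (\<forall>t\<in>time_interval T. \<forall>c\<in>A. \<forall>p\<in>fst c.
              ereal (Re (trace (endo \<omega> c (u t) p))) \<le>
                ereal C * ereal_exp (ereal C *
                  (ereal (normalized \<mu> u t p) -
                   (INF (s, q)\<in>time_interval T \<times> UNIV. ereal (normalized \<mu> u s q)))))"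
proof -
  interpret hermitian_manifold A \<omega> by unfold_locales (fact assms(1-3))+
  obtain K where K: "K \<ge> 1" "\<And>p. \<exists>c\<in>A. bounded_data f u0 K c p"
    using uniform_bounds[OF assms(5,9,10)] by blast
  have K0: "0 \<le> K" using K(1) by simp
  obtain m1 m3 Kw where m: "m1 > 0" "\<And>s. \<bar>s\<bar> \<le> K \<Longrightarrow> m1 \<le> deriv F (exp s) * exp s"
    "\<And>s. \<bar>s\<bar> \<le> K \<Longrightarrow> \<bar>deriv (deriv F) (exp s) * exp s * exp s + deriv F (exp s) * exp s\<bar> \<le> m3"
    "\<And>s. \<bar>s\<bar> \<le> K \<Longrightarrow> \<bar>F (exp s)\<bar> \<le> Kw"
    by (rule speed_constants[OF assms(6,8) K0]) (rule that; blast)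
  \<comment> \<open>The constants are fixed before \<open>T\<close> and \<open>u\<close> appear;
    they depend on \<open>K\<close>, on the dimension, and on \<open>F\<close> through its bounds on
    the image of \<open>[-K,K]\<close> under \<open>exp\<close>.\<close>
  define N where "N = real CARD('n)"
  define C where "C = geo_const N K"
  define B where "B = m3 / m1 ^ 3 + 1"
  define c0 where "c0 = min 1 (exp (- (2 * K)) / (fact CARD('n))\<^sup>2)"
  define A' where "A' = 4 * B * Kw\<^sup>2 * C / c0\<^sup>2 + C * (1 + 1 / c0) + 2"
  define Z where "Z = N\<^sup>2 * (exp (2 * K) * (fact CARD('n) * (1 + (C / c0 + (A' + 1) * N + 2 * (A' + 1) * Kw / m1)) ^ CARD('n))\<^sup>2)"
  define Q where "Q = exp (Z + K + C * (A' + 1)\<^sup>2 + B * Kw\<^sup>2 + 1)"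
  \<comment> \<open>One constant has to serve both as factor and in the exponent. The maximum does,
    as \<open>normalized\<close> minus its infimum is nonnegative.\<close>
  define C1 where "C1 = max Q A'"
  have Q: "Q > 0" by (simp add: Q_def)
  have C1: "C1 > 0" "Q \<le> C1" "A' \<le> C1" using Q by (auto simp: C1_def)
  show ?thesis
  proof (rule exI[of _ C1], intro conjI allI impI ballI C1(1))
    fix T :: ereal and u t c p
    assume T: "0 < T" and sol: "flow_solution A \<omega> f F u0 T u"
      and t: "t \<in> time_interval T" and c: "c \<in> A" and p: "p \<in> fst c"
    interpret flow A \<omega> f u0 F T u by unfold_locales (fact assms T sol)+
    have \<mu>: "sets \<mu> = sets borel" using assms(4) by (simp add: volume_measure_def)
    have nrm: "normalized \<mu> u s q = u s q - mean \<mu> s" for s q by (simp add: normalized_def mean_def)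
    let ?i = "INF (s, q)\<in>time_interval T \<times> UNIV. ereal (normalized \<mu> u s q)"
    have le: "?i \<le> ereal (normalized \<mu> u s q)" if "s \<in> I" for s q
      using INF_lower[of "(s, q)" "I \<times> UNIV" "\<lambda>(s, q). ereal (normalized \<mu> u s q)"] that by simp
    show "ereal (Re (trace (endo \<omega> c (u t) p))) \<le> ereal C1 * ereal_exp (ereal C1 * (ereal (normalized \<mu> u t p) - ?i))"
    proof (cases ?i)
      case (real i0)
      have i0: "i0 \<le> u s q - mean \<mu> s" if "s \<in> I" for s q using le[OF that, of q, unfolded real] by (simp add: nrm)
      have y: "0 \<le> u t p - mean \<mu> t - i0" using i0[OF t, of p] by simp
      have "Re (trace (endo \<omega> c (u t) p)) \<le> Q * exp (A' * (u t p - mean \<mu> t - i0))"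
        using trace_estimate[OF assms(7) K m N_def C_def B_def c0_def A'_def Z_def \<mu> i0 t, of p]
        unfolding Q_def trh_eq[OF t c p] .
      also have "\<dots> \<le> C1 * exp (C1 * (u t p - mean \<mu> t - i0))"
        using C1 Q y by (intro mult_mono) (auto intro: mult_right_mono)
      finally show ?thesis unfolding real by (simp add: nrm)
    next
      case PInf
      then show ?thesis using le[OF t, of p] by simp
    next
      \<comment> \<open>With infimum \<open>-\<infinity>\<close> the exponent is infinite, and so is
        the right side.\<close>
      case MInf
      have "ereal_exp \<infinity> = \<infinity>" by (simp only: infinity_ereal_def ereal_exp.simps)
      with MInf show ?thesis using C1(1) by simp
    qed
  qed
qed

end
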